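(* Let $a>0$, $q\neq 0$ and $p\in(4,6)$. Then the system $$-\Delta u+q^2\phi u=|u|^{p-2}u,\qquad -\Delta\phi+a^2\Delta^2\phi=4\pi u^2\qquad\text{in }\mathbb{R}^3$$ admits a ground state solution in $\mathcal{E}$; likewise it admits a ground state solution in $\mathcal{E}_r$.
   Context: $D^{1,2}(\mathbb{R}^3)=\{u\in L^6(\mathbb{R}^3):|\nabla u|\in L^2(\mathbb{R}^3)\}$ with norm $\|\nabla u\|_2$. For $a>0$ let $\mathcal{K}_a(x)=\frac{1-e^{-|x|/a}}{|x|}$ and, for measurable $f,g$, $V(f,g)=\int_{\mathbb{R}^3}\int_{\mathbb{R}^3}\mathcal{K}_a(x-y)f(x)g(y)\,dx\,dy$. Let $\mathcal{E}=\{u\in D^{1,2}(\mathbb{R}^3):V(u^2,u^2)<+\infty\}$ with norm $\|u\|_{\mathcal{E}}=(\|\nabla u\|_2^2+V(u^2,u^2)^{1/2})^{1/2}$, and $\mathcal{E}_r$ its subspace of radial functions. For $u\in\mathcal{E}$ put $\phi_u=\mathcal{K}_a*u^2$. The energy functional is $I_a(u)=\frac12\|\nabla u\|_2^2+\frac{q^2}{4}V(u^2,u^2)-\frac1p\|u\|_p^p$ (of class $C^1$ on $\mathcal{E}$ for $p\in[3,6]$). A weak solution in $\mathcal{E}$ is $u\in\mathcal{E}$ with $I_a'(u)=0$, i.e. $\int\nabla u\cdot\nabla v+q^2\int\phi_u uv=\int|u|^{p-2}uv$ for all $v\in\mathcal{E}$ (the pair $(u,\phi_u)$ then solves the system weakly).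 A ground state solution in $\mathcal{E}$ (resp. $\mathcal{E}_r$) is a nontrivial weak solution $u\in\mathcal{E}$ (resp. $u\in\mathcal{E}_r$) minimizing $I_a$ among all nontrivial weak solutions in $\mathcal{E}$ (resp. in $\mathcal{E}_r$). *)

theory Defs
  imports "HOL-Analysis.Analysis"
begin

type_synonym R3 = "real ^ 3"

fun Ck :: "nat \<Rightarrow> (R3 \<Rightarrow> real) \<Rightarrow> bool" where
  "Ck 0 f = continuous_on UNIV f"
| "Ck (Suc k) f = ((\<forall>x. f differentiable (at x)) \<and>
      (\<forall>i. Ck k (\<lambda>x. frechet_derivative f (at x) (axis i 1))))"

definition partial :: "3 \<Rightarrow> (R3 \<Rightarrow> real) \<Rightarrow> R3 \<Rightarrow> real" where
  "partial i f x = frechet_derivative f (at x) (axis i 1)"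

definition test_fun :: "(R3 \<Rightarrow> real) \<Rightarrow> bool" where
  "test_fun \<phi> \<longleftrightarrow> (\<forall>k. Ck k \<phi>) \<and> compact (closure {x. \<phi> x \<noteq> 0})"

definition weak_gradient :: "(R3 \<Rightarrow> real) \<Rightarrow> (R3 \<Rightarrow> R3) \<Rightarrow> bool" where
  "weak_gradient u g \<longleftrightarrow> g \<in> borel_measurable lebesgue \<and>
     (\<forall>\<phi>. test_fun \<phi> \<longrightarrow> (\<forall>i.
        integrable lebesgue (\<lambda>x. u x * partial i \<phi> x) \<and>
        integrable lebesgue (\<lambda>x. g x $ i * \<phi> x) \<and>
        (\<integral>x. u x * partial i \<phi> x \<partial>lebesgue) = - (\<integral>x. g x $ i * \<phi> x \<partial>lebesgue)))"

definition grad :: "(R3 \<Rightarrow> real) \<Rightarrow> R3 \<Rightarrow> R3" where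
  "grad u = (SOME g. weak_gradient u g)"

definition D12 :: "(R3 \<Rightarrow> real) set" where
  "D12 = {u. u \<in> borel_measurable lebesgue \<and> integrable lebesgue (\<lambda>x. \<bar>u x\<bar> ^ 6) \<and>
            (\<exists>g. weak_gradient u g \<and> integrable lebesgue (\<lambda>x. norm (g x) ^ 2))}"

definition kernel :: "real \<Rightarrow> R3 \<Rightarrow> real" where
  "kernel a x = (1 - exp (- norm x / a)) / norm x"

text \<open>V(f,g) for nonnegative f,g, as an extended nonnegative double integral.\<close>
definition Vnn :: "real \<Rightarrow> (R3 \<Rightarrow> real) \<Rightarrow> (R3 \<Rightarrow> real) \<Rightarrow> ennreal" where
  "Vnn a f g = (\<integral>\<^sup>+ x. \<integral>\<^sup>+ y. ennreal (kernel a (x - y) * f x * g y) \<partial>lebesgue \<partial>lebesgue)"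

definition V :: "real \<Rightarrow> (R3 \<Rightarrow> real) \<Rightarrow> (R3 \<Rightarrow> real) \<Rightarrow> real" where
  "V a f g = enn2real (Vnn a f g)"

definition Espace :: "real \<Rightarrow> (R3 \<Rightarrow> real) set" where
  "Espace a = {u \<in> D12. Vnn a (\<lambda>x. (u x)^2) (\<lambda>x. (u x)^2) < \<infinity>}"

definition radial :: "(R3 \<Rightarrow> real) \<Rightarrow> bool" where
  "radial u \<longleftrightarrow> (\<exists>w. (\<forall>x y. norm x = norm y \<longrightarrow> w x = w y) \<and> (AE x in lebesgue. u x = w x))"

definition Espace_r :: "real \<Rightarrow> (R3 \<Rightarrow> real) set" where
  "Espace_r a = {u \<in> Espace a. radial u}"

definition phi :: "real \<Rightarrow> (R3 \<Rightarrow> real) \<Rightarrow> R3 \<Rightarrow> real" where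
  "phi a u x = (\<integral>y. kernel a (x - y) * (u y)^2 \<partial>lebesgue)"

definition energy :: "real \<Rightarrow> real \<Rightarrow> real \<Rightarrow> (R3 \<Rightarrow> real) \<Rightarrow> real" where
  "energy a q p u = 1/2 * (\<integral>x. norm (grad u x) ^ 2 \<partial>lebesgue)
      + q^2 / 4 * V a (\<lambda>x. (u x)^2) (\<lambda>x. (u x)^2)
      - 1/p * (\<integral>x. \<bar>u x\<bar> powr p \<partial>lebesgue)"

definition weak_solution :: "real \<Rightarrow> real \<Rightarrow> real \<Rightarrow> (R3 \<Rightarrow> real) \<Rightarrow> bool" where
  "weak_solution a q p u \<longleftrightarrow> u \<in> Espace a \<and>
     (\<forall>v \<in> Espace a.
        (\<integral>x. grad u x \<bullet> grad v x \<partial>lebesgue) + q^2 * (\<integral>x. phi a u x * u x * v x \<partial>lebesgue)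
        = (\<integral>x. \<bar>u x\<bar> powr (p - 2) * u x * v x \<partial>lebesgue))"

definition nontrivial :: "(R3 \<Rightarrow> real) \<Rightarrow> bool" where
  "nontrivial u \<longleftrightarrow> \<not> (AE x in lebesgue. u x = 0)"

definition ground_state_in :: "(R3 \<Rightarrow> real) set \<Rightarrow> real \<Rightarrow> real \<Rightarrow> real \<Rightarrow> (R3 \<Rightarrow> real) \<Rightarrow> bool" where
  "ground_state_in S a q p u \<longleftrightarrow> u \<in> S \<and> nontrivial u \<and> weak_solution a q p u \<and>
     (\<forall>w \<in> S. nontrivial w \<and> weak_solution a q p w \<longrightarrow> energy a q p u \<le> energy a q p w)"

end

(*
A ground state is a minimizer of the energy on the Nehari set. Since p > 4, the energy is there a
positive combination of the Dirichlet and the V-term, so minimizing sequences are bounded, and their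
L^p norms stay away from 0. Representing 1/|x - y| as a superposition of products of indicators of
balls bounds the mass of u^2 in balls by V(u^2,u^2) and yields V(f,g) <= C (V(f,f) + V(g,g)); together
with local Sobolev inequalities the L^p norm is small once all ball masses are small. Hence, after
translations, some mass stays near the origin and a weak limit U is nontrivial; a radial function needs
no translation, as mass far out would be repeated over a large sphere. Strong convergence is not needed:
projecting u_n + t_n v back to the Nehari set, with t_n^2 of the size of the minimization error, shows
I'(U) v >= 0 in the limit for every direction v, and I(U) <= inf by lower semicontinuity. Criticality
among radial functions implies criticality because averaging over rotations preserves I'(U).

Elements of the energy space are represented by pairs of a Borel function and a Borel weak gradient.
*)

theory Submission
 imports Defs "HOL-Complex_Analysis.Great_Picard"
begin

text \<open>Two difficulties shape the proof. The functions are controlled through the quartic form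
  V and need not be square integrable, so Hilbert space methods apply only to the gradients; the
  functions themselves converge almost everywhere and in L^2 on balls. Control at infinity comes
  from ball masses, which V bounds with growth of order the square root of the radius. Secondly,
  this convergence neither yields I'(u_n) -> 0 nor carries the constraint to the limit. On the
  Nehari set the fibre map s -> I(s u) drops away from s = 1 by a definite amount, which forces the
  projection factors to tend to 1; since the perturbation costs t_n I'(u_n) v + O(t_n^2), division
  by t_n then leaves the sign of the derivative. That the limit satisfies the constraint is a
  consequence, by testing with the limit itself. The exponent 4 is the homogeneity of V: p > 4
  produces the drop of the fibre map and the surplus of degree in the L^p estimates, while p < 6
  makes their sixth-power part small.\<close>

abbreviation (input) lborel2 where "lborel2 \<equiv> lborel \<Otimes>\<^sub>M lborel"
abbreviation (input) borel2 where "borel2 \<equiv> borel \<Otimes>\<^sub>M borel"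
abbreviation (input) nn_lborel (binder "NI " 10) where "nn_lborel f \<equiv> nn_integral lborel f"
abbreviation (input) nn_lborel_real (binder "NE " 10) where "nn_lborel_real f \<equiv> nn_integral lborel (%x. ennreal (f x))"
abbreviation (input) int_lborel (binder "LI " 10) where "int_lborel f \<equiv> integral\<^sup>L lborel f"
abbreviation (input) AE_lborel (binder "AL " 10) where "AE_lborel P \<equiv> AE x in lborel. P x"
abbreviation (input) BM where "BM f \<equiv> f \<in> borel_measurable borel"
abbreviation (input) converges_to (infix "--->" 60) where "converges_to f l \<equiv> f \<longlonglongrightarrow> l"

section \<open>Test functions\<close>

text \<open>A form of Vitali's theorem: the majorant may contain a small multiple of functions bounded in \<open>L1\<close>.\<close>

lemma integral_tendsto_of_eps_domination:
 fixes f :: "nat => 'a => real"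
 assumes meas[measurable]: "!!n. f n \<in> borel_measurable M" "g \<in> borel_measurable M" "!!n. Ph n \<in> borel_measurable M"
  and lim: "AE x in M. (%n. f n x) ---> g x"
  and pos: "!!n x. Ph n x >= 0" and B: "!!n. (\<integral>\<^sup>+x. ennreal (Ph n x) \<partial>M) <= ennreal B" "B >= 0"
  and dom: "!!de. de > 0 ==> EX H. integrable M H & (ALL n x. \<bar>f n x\<bar> <= de * Ph n x + H x)"
 shows "integrable M g" "!!n. integrable M (f n)" "(%n. \<integral>x. f n x \<partial>M) ---> (\<integral>x. g x \<partial>M)"
proof -
 have intPh: "integrable M (Ph n)" for n
  using B(1)[of n] pos by (intro integrableI_nonneg) (auto intro: le_less_trans)
 have IPh: "(\<integral>x. Ph n x \<partial>M) <= B" for n using B pos by (simp add: nn_integral_eq_integral[OF intPh] ennreal_le_iff)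
 obtain H1 where H1: "integrable M H1" "!!n x. \<bar>f n x\<bar> <= 1 * Ph n x + H1 x" using dom[of 1] by auto
 show fi: "integrable M (f n)" for n by (rule Bochner_Integration.integrable_bound[of _ "%x. Ph n x + H1 x"])
   (use H1 intPh in \<open>auto intro!: AE_I2 intro: order_trans[OF _ abs_ge_self]\<close>)
 have bd: "(\<integral>\<^sup>+x. ennreal \<bar>f n x\<bar> \<partial>M) <= ennreal (B + (\<integral>x. H1 x \<partial>M))" for n
 proof -
  have "(\<integral>\<^sup>+x. ennreal \<bar>f n x\<bar> \<partial>M) = ennreal (\<integral>x. \<bar>f n x\<bar> \<partial>M)" using fi[of n] by (intro nn_integral_eq_integral) auto
  also have "... <= ennreal (\<integral>x. Ph n x + H1 x \<partial>M)"
   using fi[of n] H1 intPh[of n] by (intro ennreal_leI integral_mono) auto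
  also have "... <= ennreal (B + (\<integral>x. H1 x \<partial>M))" using intPh[of n] H1 IPh[of n] by (intro ennreal_leI) simp
  finally show ?thesis .
 qed
 show gi: "integrable M g"
 proof (rule integrableI_bounded)
  have "(\<integral>\<^sup>+x. ennreal (norm (g x)) \<partial>M) = (\<integral>\<^sup>+x. liminf (%n. ennreal \<bar>f n x\<bar>) \<partial>M)"
  proof (rule nn_integral_cong_AE, use lim in eventually_elim)
   case (elim x)
   then have "(%n. ennreal \<bar>f n x\<bar>) ---> ennreal \<bar>g x\<bar>" by (intro tendsto_ennrealI tendsto_rabs)
   from lim_imp_Liminf[OF trivial_limit_sequentially this] show ?case by simp
  qed
  also have "... <= liminf (%n. \<integral>\<^sup>+x. ennreal \<bar>f n x\<bar> \<partial>M)" by (intro nn_integral_liminf) simp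
  also have "... <= ennreal (B + (\<integral>x. H1 x \<partial>M))"
   by (rule order_trans[OF Liminf_mono[of _ "%_. ennreal (B + (\<integral>x. H1 x \<partial>M))"]]) (auto simp: bd Liminf_const)
  also have "... < \<infinity>" by simp
  finally show "(\<integral>\<^sup>+x. ennreal (norm (g x)) \<partial>M) < \<infinity>" .
 qed simp
 show "(%n. \<integral>x. f n x \<partial>M) ---> (\<integral>x. g x \<partial>M)"
 proof (rule tendstoI)
  fix e :: real assume e: "e > 0"
  define de where "de = e / (2 * (B + 1))"
  have de: "de > 0" using e B(2) by (auto simp: de_def field_simps)
  have deB: "de * B <= e / 2" using e B(2) by (auto simp: de_def field_simps)
  obtain H where H: "integrable M H" "!!n x. \<bar>f n x\<bar> <= de * Ph n x + H x" using dom[OF de(1)] by auto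
  \<comment> \<open>The excess of |f_n - g| over \<open>de * Ph n\<close> is dominated by |H| + |g|
    and tends to 0 pointwise, so ordinary dominated convergence handles it; what is left contributes
    at most \<open>de * B\<close>, that is half of \<open>e\<close>.\<close>
  define E where "E n x = max 0 (\<bar>f n x - g x\<bar> - de * Ph n x)" for n x
  have [measurable]: "E n \<in> borel_measurable M" for n unfolding E_def by measurable
  have Eb: "\<bar>E n x\<bar> <= \<bar>H x\<bar> + \<bar>g x\<bar>" for n x using H(2)[of n x] by (auto simp: E_def)
  have El: "AE x in M. (%n. E n x) ---> 0" using lim
  proof eventually_elim
   case (elim x)
   then have "(%n. \<bar>f n x - g x\<bar>) ---> 0" using LIM_zero tendsto_rabs_zero by blast
   then show ?case
    by (rule tendsto_0_le[where K=1]) (use de pos in \<open>auto simp: E_def max_def intro!: always_eventually\<close>)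
  qed
  have Ei: "integrable M (E n)" for n
   by (rule Bochner_Integration.integrable_bound[of _ "%x. \<bar>H x\<bar> + \<bar>g x\<bar>"]) (use H gi Eb in auto)
  have "(%n. \<integral>x. E n x \<partial>M) ---> (\<integral>x. 0 \<partial>M)"
   by (rule integral_dominated_convergence[where w="%x. \<bar>H x\<bar> + \<bar>g x\<bar>"]) (use H gi Eb El in auto)
  then have "eventually (%n. \<bar>\<integral>x. E n x \<partial>M\<bar> < e/2) sequentially"
   using e by (auto simp: tendsto_iff dist_real_def dest: spec[of _ "e/2"])
  then show "eventually (%n. dist (\<integral>x. f n x \<partial>M) (\<integral>x. g x \<partial>M) < e) sequentially"
  proof eventually_elim
   case (elim n)
   have "dist (\<integral>x. f n x \<partial>M) (\<integral>x. g x \<partial>M) = \<bar>\<integral>x. f n x - g x \<partial>M\<bar>" using fi gi by (simp add: dist_real_def)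
   also have "... <= (\<integral>x. \<bar>f n x - g x\<bar> \<partial>M)" by (rule integral_abs_bound)
   also have "... <= (\<integral>x. E n x + de * Ph n x \<partial>M)" using fi gi Ei intPh by (intro integral_mono) (auto simp: E_def)
   also have "... = (\<integral>x. E n x \<partial>M) + de * (\<integral>x. Ph n x \<partial>M)" using Ei intPh by simp
   also have "... <= (\<integral>x. E n x \<partial>M) + de * B" using IPh[of n] de by simp
   also have "... < e" using elim deB by linarith
   finally show ?case .
  qed
 qed
qed

text \<open>Riesz-Fischer for functions instead of classes, with distances as extended integrals:
  only the differences of the \<open>f n\<close> have to be square integrable. This is what
  mollifications of a locally square integrable function require. The measure is general because a
  weighted one appears later.\<close>

lemma L2_complete:
 fixes f :: "nat => 'a => 'b::{banach, second_countable_topology}"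
 assumes [measurable]: "!!n. f n \<in> borel_measurable M"
  and cau: "!!e. e > 0 ==> EX N. ALL m>=N. ALL n>=N. (\<integral>\<^sup>+x. ennreal ((norm (f m x - f n x))^2) \<partial>M) <= ennreal e"
 obtains g r where "g \<in> borel_measurable M" "strict_mono (r::nat=>nat)" "AE x in M. (%n. f (r n) x) ---> g x"
  "(%n. \<integral>\<^sup>+x. ennreal ((norm (f n x - g x))^2) \<partial>M) ---> 0"
proof -
 \<comment> \<open>This rate leaves room for the weights \<open>2^k\<close> below: the weighted sum
   still converges, so almost everywhere the increments are at most a constant times
   \<open>sqrt (1/2) ^ k\<close>.\<close>
 have "EX N. ALL m>=N. ALL n>=N. (\<integral>\<^sup>+x. ennreal ((norm (f m x - f n x))^2) \<partial>M) <= ennreal ((1/8)^k)" for k :: nat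
  by (rule cau) simp
 then obtain N where N: "!!k m n. m >= N k ==> n >= N k ==> (\<integral>\<^sup>+x. ennreal ((norm (f m x - f n x))^2) \<partial>M) <= ennreal ((1/8)^k)"
  by metis
 define r where "r k = k + (\<Sum>i\<le>k. N i)" for k
 have r: "strict_mono r" by (rule strict_monoI_Suc) (simp add: r_def)
 have rN: "r k >= N k" "r (Suc k) >= N k" for k
  using member_le_sum[of k "{..k}" N] member_le_sum[of k "{..Suc k}" N] unfolding r_def by (simp_all del: sum.atMost_Suc)
 define d where "d k x = (norm (f (r (Suc k)) x - f (r k) x))^2" for k x
 have [measurable]: "d k \<in> borel_measurable M" for k unfolding d_def by measurable
 have "(\<integral>\<^sup>+x. (\<Sum>k. ennreal (2^k * d k x)) \<partial>M) = (\<Sum>k. \<integral>\<^sup>+x. ennreal (2^k * d k x) \<partial>M)" by (rule nn_integral_suminf) simp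
 also have "... <= (\<Sum>k. ennreal ((1/4)^k))"
 proof (intro suminf_le)
  fix k
  have "(\<integral>\<^sup>+x. ennreal (2^k * d k x) \<partial>M) = ennreal (2^k) * (\<integral>\<^sup>+x. ennreal (d k x) \<partial>M)"
   by (simp add: ennreal_mult d_def nn_integral_cmult)
  also have "... <= ennreal (2^k) * ennreal ((1/8)^k)"
   using N[OF rN(2,1)] by (intro mult_left_mono) (auto simp: d_def)
  also have "... = ennreal ((1/4)^k)" by (simp flip: ennreal_mult power_mult_distrib)
  finally show "(\<integral>\<^sup>+x. ennreal (2^k * d k x) \<partial>M) <= ennreal ((1/4)^k)" .
 qed auto
 also have "... = ennreal (\<Sum>k. (1/4)^k)" by (rule suminf_ennreal2) (auto intro: summable_geometric)
 finally have "(\<integral>\<^sup>+x. (\<Sum>k. ennreal (2^k * d k x)) \<partial>M) ~= \<infinity>" by (auto simp: top_unique)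
 then have fin: "AE x in M. (\<Sum>k. ennreal (2^k * d k x)) ~= \<infinity>" by (intro nn_integral_PInf_AE) auto
 have conv: "AE x in M. convergent (%n. f (r n) x)" using fin
 proof eventually_elim
  case (elim x)
  define S where "S = enn2real (\<Sum>k. ennreal (2^k * d k x))"
  have S: "2^k * d k x <= S" for k
  proof -
   have "(\<Sum>i\<in>{k}. ennreal (2^i * d i x)) <= (\<Sum>k. ennreal (2^k * d k x))" by (rule sum_le_suminf) auto
   then have "ennreal (2^k * d k x) <= ennreal S" unfolding S_def using elim by (simp add: less_top)
   moreover have "S >= 0" by (simp add: S_def)
   ultimately show ?thesis by (simp add: ennreal_le_iff)
  qed
  have nb: "norm (f (r (Suc k)) x - f (r k) x) <= sqrt S * (sqrt (1/2))^k" for k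
  proof -
   have "d k x <= S * (1/2)^k" using S[of k] by (simp add: field_simps power_one_over)
   then have "sqrt (d k x) <= sqrt (S * (1/2)^k)" by simp
   then show ?thesis by (simp add: d_def real_sqrt_mult real_sqrt_power)
  qed
  have "summable (%k. f (r (Suc k)) x - f (r k) x)"
   by (rule summable_comparison_test[where g="%k. sqrt S * (sqrt (1/2))^k"])
    (use nb in \<open>auto intro!: summable_mult summable_geometric simp: real_sqrt_divide\<close>)
  then have "convergent (%n. \<Sum>k<n. (f (r (Suc k)) x - f (r k) x))" by (simp add: summable_iff_convergent)
  then have "convergent (%n. f (r n) x - f (r 0) x)" using sum_lessThan_telescope[of "%k. f (r k) x"] by simp
  then have "convergent (%n. (f (r n) x - f (r 0) x) + f (r 0) x)" by (intro convergent_add convergent_const)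
  then show ?case by simp
 qed
 define g where "g x = lim (%n. f (r n) x)" for x
 have gm[measurable]: "g \<in> borel_measurable M" unfolding g_def by (rule borel_measurable_lim_metric) simp
 have lim: "AE x in M. (%n. f (r n) x) ---> g x" using conv by eventually_elim (simp add: g_def convergent_LIMSEQ_iff)
 have main: "EX n0. ALL n>=n0. (\<integral>\<^sup>+x. ennreal ((norm (f n x - g x))^2) \<partial>M) <= ennreal e" if e: "e > 0" for e
 proof -
  obtain N0 where N0: "!!m n. m >= N0 ==> n >= N0 ==> (\<integral>\<^sup>+x. ennreal ((norm (f m x - f n x))^2) \<partial>M) <= ennreal e"
   using cau[OF e] by blast
  have "(\<integral>\<^sup>+x. ennreal ((norm (f n x - g x))^2) \<partial>M) <= ennreal e" if n: "n >= N0" for n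
  proof -
   have "(\<integral>\<^sup>+x. ennreal ((norm (f n x - g x))^2) \<partial>M) = (\<integral>\<^sup>+x. liminf (%k. ennreal ((norm (f n x - f (r k) x))^2)) \<partial>M)"
   proof (rule nn_integral_cong_AE, use lim in eventually_elim)
    case (elim x)
    then have "(%k. ennreal ((norm (f n x - f (r k) x))^2)) ---> ennreal ((norm (f n x - g x))^2)"
     by (intro tendsto_intros tendsto_ennrealI)
    from lim_imp_Liminf[OF trivial_limit_sequentially this] show ?case by simp
   qed
   also have "... <= liminf (%k. \<integral>\<^sup>+x. ennreal ((norm (f n x - f (r k) x))^2) \<partial>M)" by (intro nn_integral_liminf) simp
   also have "... <= liminf (%k. ennreal e)"
   proof (rule Liminf_mono, rule eventually_sequentiallyI[of N0])
    fix k assume "k >= N0"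
    then have "r k >= N0" using seq_suble[OF r, of k] by simp
    then show "(\<integral>\<^sup>+x. ennreal ((norm (f n x - f (r k) x))^2) \<partial>M) <= ennreal e" using n by (intro N0)
   qed
   finally show ?thesis by (simp add: Liminf_const)
  qed
  then show ?thesis by blast
 qed
 have "(%n. \<integral>\<^sup>+x. ennreal ((norm (f n x - g x))^2) \<partial>M) ---> 0"
 proof (rule tendsto_zero_ennreal)
  fix e :: real assume "e > 0"
  then obtain n0 where "ALL n>=n0. (\<integral>\<^sup>+x. ennreal ((norm (f n x - g x))^2) \<partial>M) <= ennreal (e/2)"
   using main[of "e/2"] by auto
  then show "eventually (%n. (\<integral>\<^sup>+x. ennreal ((norm (f n x - g x))^2) \<partial>M) < ennreal e) sequentially"
   using \<open>e > 0\<close> by (intro eventually_sequentiallyI[of n0]) (auto elim!: le_less_trans intro!: ennreal_lessI)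
 qed
 then show ?thesis using that gm r lim by blast
qed

section \<open>Smooth functions of one variable and their tensor products\<close>

primrec sm :: "nat => (real => real) => bool" where
 "sm 0 f = continuous_on UNIV f"
| "sm (Suc k) f = (EX f'. (ALL t. (f has_real_derivative f' t) (at t)) & sm k f')"

lemma sm_SucD: "sm (Suc k) f ==> sm k f"
proof (induction k arbitrary: f)
 case 0
 then show ?case by (auto intro!: continuous_at_imp_continuous_on intro: DERIV_isCont)
next
 case (Suc k)
 then show ?case by (metis sm.simps(2))
qed

lemma sm_const: "sm k (%_. c)"
proof (induction k arbitrary: c)
 case (Suc k)
 then show ?case by (auto intro!: exI[of _ "%_. 0"])
qed simp

lemma sm_add: "sm k f ==> sm k g ==> sm k (%t. f t + g t)"
proof (induction k arbitrary: f g)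
 case 0
 then show ?case by (auto intro: continuous_intros)
next
 case (Suc k)
 then obtain f' g' where "ALL t. (f has_real_derivative f' t) (at t)" "sm k f'"
  "ALL t. (g has_real_derivative g' t) (at t)" "sm k g'" by auto
 then show ?case using Suc.IH by (auto intro!: exI[of _ "%t. f' t + g' t"] derivative_intros)
qed

lemma sm_mult: "sm k f ==> sm k g ==> sm k (%t. f t * g t)"
proof (induction k arbitrary: f g)
 case 0
 then show ?case by (auto intro: continuous_intros)
next
 case (Suc k)
 then obtain f' g' where *: "ALL t. (f has_real_derivative f' t) (at t)" "sm k f'"
  "ALL t. (g has_real_derivative g' t) (at t)" "sm k g'" by auto
 have "sm k f" "sm k g" using Suc.prems by (blast intro: sm_SucD)+
 then have "sm k (%t. f' t * g t + g' t * f t)" using * Suc.IH by (intro sm_add) auto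
 then show ?case using * by (auto intro!: exI[of _ "%t. f' t * g t + g' t * f t"] derivative_intros)
qed

lemma sm_affine: "sm k f ==> sm k (%t. f (c * t + d))"
proof (induction k arbitrary: f)
 case 0
 then have "continuous_on UNIV f" by simp
 then show ?case by (auto intro!: continuous_intros continuous_on_compose2[of UNIV f])
next
 case (Suc k)
 then obtain f' where *: "!!t. (f has_real_derivative f' t) (at t)" "sm k f'" by auto
 have "((%t. f (c * t + d)) has_real_derivative (f' (c * t + d) * c)) (at t)" for t
  by (rule DERIV_chain2[OF *(1)]) (auto intro!: derivative_eq_intros)
 moreover have "sm k (%t. f' (c * t + d) * c)" by (intro sm_mult sm_const Suc.IH *(2))
 ultimately show ?case by (auto intro!: exI[of _ "%t. f' (c * t + d) * c"])
qed

text \<open>The power in front of exp(-1/t) makes the family closed under differentiation up to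
  linear combinations; smoothness of the flat function then is a plain induction over all
  \<open>n\<close> at once.\<close>

definition flat :: "nat => real => real" where
 "flat n t = (if t > 0 then (1/t)^n * exp (-(1/t)) else 0)"

lemma flat_deriv: "(flat n has_real_derivative (flat (n+2) t - n * flat (n+1) t)) (at t)"
proof (cases "t = 0")
 case False
 then consider "t < 0" | "t > 0" by linarith
 then show ?thesis
 proof cases
  case 1
  have "((%_. 0) has_real_derivative 0) (at t)" by simp
  moreover have "eventually (%s. s < 0) (nhds t)" using 1 by (intro order_tendstoD tendsto_ident_at) (auto simp: filterlim_def)
  then have "eventually (%s. flat n s = 0) (nhds t)" by eventually_elim (simp add: flat_def)
  ultimately have "(flat n has_real_derivative 0) (at t)" by (subst DERIV_cong_ev[where g="%_. 0"]) auto
  then show ?thesis using 1 by (simp add: flat_def)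
 next
  case 2
  have "((%s. (1/s)^n * exp (-(1/s))) has_real_derivative (flat (n+2) t - n * flat (n+1) t)) (at t)"
  proof (cases n)
   case 0
   then show ?thesis using 2 by (auto intro!: derivative_eq_intros simp: flat_def field_simps power2_eq_square)
  next
   case (Suc m)
   have "((%s. (1/s)^n * exp (-(1/s))) has_real_derivative
     (n * ((1/t) ^ (n - Suc 0) * - (1 / t^2)) * exp (-(1/t)) + exp (-(1/t)) * (1/t^2) * (1/t)^n)) (at t)"
    using 2 by (auto intro!: derivative_eq_intros simp: power2_eq_square)
   moreover have "n * ((1/t) ^ (n - Suc 0) * - (1 / t^2)) * exp (-(1/t)) + exp (-(1/t)) * (1/t^2) * (1/t)^n
     = flat (n+2) t - n * flat (n+1) t" using 2 Suc by (simp add: flat_def power2_eq_square field_simps)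
   ultimately show ?thesis by simp
  qed
  moreover have "eventually (%s. s > 0) (nhds t)" using 2 by (intro order_tendstoD) (auto simp: filterlim_def)
  then have "eventually (%s. flat n s = (1/s)^n * exp (-(1/s))) (nhds t)" by eventually_elim (simp add: flat_def)
  ultimately show ?thesis by (subst DERIV_cong_ev[where g="%s. (1/s)^n * exp (-(1/s))"]) auto
 qed
next
 case True
 have "((%h. (flat n (0 + h) - flat n 0) / h) \<longlongrightarrow> 0) (at 0)"
 proof (rule filterlim_split_at)
  show "((%h. (flat n (0 + h) - flat n 0) / h) \<longlongrightarrow> 0) (at_left 0)"
   by (rule tendsto_eventually) (auto simp: flat_def eventually_at_left_field intro!: exI[of _ "-1"])
  \<comment> \<open>With x = 1/h this is the right-hand difference quotient at 0.\<close>
  have "((%x::real. x ^ (n+1) / exp x) \<longlongrightarrow> 0) at_top" by (rule tendsto_power_div_exp_0)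
  then have "((%h::real. (inverse h) ^ (n+1) / exp (inverse h)) \<longlongrightarrow> 0) (at_right 0)"
   by (rule filterlim_compose) (rule filterlim_inverse_at_top_right)
  then show "((%h. (flat n (0 + h) - flat n 0) / h) \<longlongrightarrow> 0) (at_right 0)" by (rule Lim_transform_eventually)
    (auto simp: flat_def eventually_at_right_field exp_minus field_simps intro!: exI[of _ 1])
 qed
 then show ?thesis using True by (simp add: DERIV_def flat_def)
qed

lemma sm_flat: "sm k (flat n)"
proof (induction k arbitrary: n)
 case 0
 show ?case using flat_deriv by (auto intro!: continuous_at_imp_continuous_on DERIV_isCont)
next
 case (Suc k)
 have "sm k (%t. flat (n+2) t + (- real n) * flat (n+1) t)" by (intro sm_add sm_mult sm_const Suc.IH)
 then show ?case using flat_deriv[of n] by (auto intro!: exI[of _ "%t. flat (n+2) t - n * flat (n+1) t"])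
qed

text \<open>A partial derivative of a product over the coordinates only replaces one factor, so
  membership in all classes \<open>Ck\<close> reduces to the one-variable classes
  \<open>sm\<close>.\<close>

definition tens :: "(3 => real => real) => R3 => real" where
 "tens h x = (\<Prod>i\<in>UNIV. h i (x $ i))"

lemma tens_has_derivative:
 assumes "!!i t. (h i has_real_derivative h' i t) (at t)"
 shows "(tens h has_derivative (%v. \<Sum>i\<in>UNIV. (h' i (x $ i) * v $ i) * (\<Prod>j\<in>UNIV - {i}. h j (x $ j)))) (at x)"
proof -
 have "((%x. h i (x $ i)) has_derivative (%v. h' i (x $ i) * v $ i)) (at x)" for i
 proof -
  have "(h i has_derivative (%v. h' i (x $ i) * v)) (at (x $ i))"
   using assms[of i "x $ i"] by (simp add: has_field_derivative_def)
  then show ?thesis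
   by (rule has_derivative_compose[rotated]) (rule bounded_linear_imp_has_derivative[OF bounded_linear_vec_nth])
 qed
 then show ?thesis unfolding tens_def by (intro has_derivative_prod) auto
qed

lemma tens_frechet:
 fixes h h' :: "3 => real => real" and x :: R3
 assumes "!!i t. (h i has_real_derivative h' i t) (at t)"
 shows "frechet_derivative (tens h) (at x) (axis (j::3) 1) = tens (h(j := h' j)) x"
proof -
 have "frechet_derivative (tens h) (at x) (axis j 1) = (\<Sum>i\<in>UNIV. (h' i (x $ i) * axis j 1 $ i) * (\<Prod>j\<in>UNIV - {i}. h j (x $ j)))"
  by (rule fun_cong[OF frechet_derivative_at[OF tens_has_derivative[of h h' x, OF assms]], symmetric])
 also have "... = (\<Sum>i\<in>UNIV. if i = j then h' j (x $ j) * (\<Prod>k\<in>UNIV - {j}. h k (x $ k)) else 0)"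
  by (intro sum.cong) (auto simp: axis_def)
 also have "... = h' j (x $ j) * (\<Prod>k\<in>UNIV - {j}. h k (x $ k))" by simp
 also have "... = tens (h(j := h' j)) x" unfolding tens_def by (subst prod.remove[of UNIV j]) (auto intro!: prod.cong)
 finally show ?thesis .
qed

lemma Ck_tens: "(!!i. sm k (h i)) ==> Ck k (tens h)"
proof (induction k arbitrary: h)
 case 0
 have "continuous_on UNIV (%x::R3. h i (x $ i))" for i
  by (rule continuous_on_compose2[of UNIV "h i"]) (use 0 in \<open>auto intro: continuous_intros\<close>)
 then show ?case unfolding tens_def Ck.simps by (intro continuous_on_prod)
next
 case (Suc k)
 then have "EX f'. (ALL t. (h i has_real_derivative f' t) (at t)) & sm k f'" for i by auto
 then obtain h' where h': "!!i t. (h i has_real_derivative h' i t) (at t)" "!!i. sm k (h' i)" by metis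
 have "tens h differentiable at x" for x
  using tens_has_derivative[of h h' x, OF h'(1)] unfolding differentiable_def by blast
 moreover have "Ck k (%x. frechet_derivative (tens h) (at x) (axis i 1))" for i
 proof -
  have "Ck k (tens (h(i := h' i)))" using h'(2) sm_SucD[OF Suc.prems] by (intro Suc.IH) auto
  moreover have "(%x. frechet_derivative (tens h) (at x) (axis i 1)) = tens (h(i := h' i))"
   using tens_frechet[of h h', OF h'(1)] by blast
  ultimately show ?thesis by simp
 qed
 ultimately show ?case by simp
qed

lemma test_fun_tens:
 assumes "!!i k. sm k (h i)" "!!i t. t \<notin> {l i..u i} ==> h i t = 0" shows "test_fun (tens h)"
proof -
 have "{x. tens h x ~= 0} \<subseteq> cbox (\<chi> i. l i) (\<chi> i. u i)" using assms(2) by (force simp: tens_def mem_box_cart)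
 then have "bounded (closure {x. tens h x ~= 0})"
  using bounded_cbox bounded_subset closed_cbox closure_minimal by metis
 then have "compact (closure {x. tens h x ~= 0})" by (simp add: compact_eq_bounded_closed)
 moreover have "Ck k (tens h)" for k using assms(1) by (rule Ck_tens)
 ultimately show ?thesis unfolding test_fun_def by (intro conjI allI)
qed

section \<open>Derivatives, supports and bounds of test functions\<close>

lemma test_fun_derivative:
 assumes "test_fun vp" shows "(vp has_derivative (%v. \<Sum>i\<in>UNIV. v $ i * partial i vp x)) (at x)"
proof -
 have "Ck (Suc 0) vp" using assms unfolding test_fun_def by blast
 then have "vp differentiable (at x)" by simp
 then have d: "(vp has_derivative frechet_derivative vp (at x)) (at x)" by (rule frechet_derivative_works[THEN iffD1])
 then have lin: "linear (frechet_derivative vp (at x))" by (rule has_derivative_linear)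
 have "frechet_derivative vp (at x) v = (\<Sum>i\<in>UNIV. v $ i * partial i vp x)" for v
 proof -
  have "v = (\<Sum>i\<in>UNIV. v $ i *\<^sub>R axis i 1)" using basis_expansion[of v] by (simp only: scalar_mult_eq_scaleR)
  then have "frechet_derivative vp (at x) v = frechet_derivative vp (at x) (\<Sum>i\<in>UNIV. v $ i *\<^sub>R axis i 1)" by (rule arg_cong)
  also have "... = (\<Sum>i\<in>UNIV. v $ i * partial i vp x)" by (simp add: linear_sum[OF lin] linear_scale[OF lin] partial_def)
  finally show ?thesis .
 qed
 then have "frechet_derivative vp (at x) = (%v. \<Sum>i\<in>UNIV. v $ i * partial i vp x)" by blast
 then show ?thesis using d by simp
qed

lemma test_fun_continuous:
 assumes "test_fun vp" shows "continuous_on UNIV vp" "continuous_on UNIV (partial i vp)"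
proof -
 have "Ck 0 vp" "Ck (Suc 0) vp" using assms unfolding test_fun_def by blast+
 then show "continuous_on UNIV vp" "continuous_on UNIV (partial i vp)" by (auto simp: partial_def[abs_def])
qed

lemma continuous_compact_support_bound:
 fixes f :: "'a::euclidean_space => real"
 assumes "continuous_on UNIV f" "!!x. norm x > r ==> f x = 0" shows "EX B>=0. ALL x. \<bar>f x\<bar> <= B"
proof -
 have "compact (f ` cball 0 r)" using assms(1) by (intro compact_continuous_image) (auto intro: continuous_on_subset)
 then obtain B where B: "!!x. x \<in> cball 0 r ==> \<bar>f x\<bar> <= B"
  using compact_imp_bounded[of "f ` cball 0 r"] unfolding bounded_iff real_norm_def by blast
 have "\<bar>f x\<bar> <= max B 0" for x using B[of x] assms(2)[of x] by (cases "norm x <= r") auto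
 then show ?thesis by (metis max.cobounded2)
qed

lemma test_fun_support:
 assumes "test_fun vp"
 obtains r B where "r > 0" "B >= 0" "!!x. norm x > r ==> vp x = 0" "!!x i. norm x > r ==> partial i vp x = 0"
  "!!x. \<bar>vp x\<bar> <= B" "!!x i. \<bar>partial i vp x\<bar> <= B"
proof -
 have "bounded {x. vp x ~= 0}"
  using assms bounded_subset[OF compact_imp_bounded closure_subset] unfolding test_fun_def by blast
 then obtain r where r: "r > 0" "!!x. vp x ~= 0 ==> norm x <= r" by (auto simp: bounded_pos)
 have z: "vp x = 0" if "norm x > r" for x using r(2)[of x] that by force
 have pz: "partial i vp x = 0" if "norm x > r" for x i
 proof -
  have "((%_. 0::real) has_derivative (%_. 0)) (at x)" by simp
  then have "(vp has_derivative (%_. 0)) (at x)"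
   by (rule has_derivative_transform_within_open[where s="{y. r < norm y}"])
    (auto simp: z that intro!: open_Collect_less continuous_intros)
  then show ?thesis unfolding partial_def by (rule fun_cong[OF frechet_derivative_at, symmetric])
 qed
 obtain B0 where B0: "B0 >= 0" "!!x. \<bar>vp x\<bar> <= B0"
  using continuous_compact_support_bound[OF test_fun_continuous(1)[OF assms] z] by auto
 have "EX B>=0. ALL x. \<bar>partial i vp x\<bar> <= B" for i
  by (rule continuous_compact_support_bound[OF test_fun_continuous(2)[OF assms] pz]) auto
 then obtain B1 where B1: "!!i. B1 i >= 0" "!!i x. \<bar>partial i vp x\<bar> <= B1 i" by metis
 have "\<bar>partial i vp x\<bar> <= B0 + (\<Sum>i\<in>UNIV. B1 i)" for i x
  using B1(2)[where i=i and x=x] B0(1) member_le_sum[of i UNIV B1] B1(1) by force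
 moreover have "\<bar>vp x\<bar> <= B0 + (\<Sum>i\<in>UNIV. B1 i)" for x using B0(2)[of x] sum_nonneg[of UNIV B1, OF B1(1)] by linarith
 moreover have "B0 + (\<Sum>i\<in>UNIV. B1 i) >= 0" using B0(1) B1(1) by (simp add: sum_nonneg)
 ultimately show ?thesis using that r(1) z pz by blast
qed

section \<open>Weak gradients\<close>

text \<open>Local square integrability is enough to pair with test functions and to mollify, and it
  survives the limits taken later, for which convergence is known only in L^2 on balls.\<close>

definition loc2 :: "(R3 => real) => bool" where
 "loc2 f \<longleftrightarrow> BM f & (ALL r. (NI x. indicator (cball 0 r) x * ennreal ((f x)^2)) < \<infinity>)"

lemma ball_borel[measurable]: "ball z r \<in> sets borel" "cball z r \<in> sets borel"
 by auto

lemma loc2_measurable[measurable_dest]: "loc2 f ==> BM f"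
 by (simp add: loc2_def)

lemma loc2I_global:
 assumes "BM f" "(NE x. (f x)^2) < \<infinity>" shows "loc2 f"
proof -
 have "(NI x. indicator (cball 0 r) x * ennreal ((f x)^2)) <= (NE x. (f x)^2)" for r
  by (intro nn_integral_mono) (auto simp: indicator_def)
 then show ?thesis using assms by (auto simp: loc2_def intro: le_less_trans)
qed

lemma loc2_integrable:
 assumes f: "loc2 f" and [measurable]: "BM vp" and B: "!!x. \<bar>vp x\<bar> <= B" "!!x. norm x > r ==> vp x = 0"
 shows "integrable lborel (%x. f x * vp x)"
proof (rule Bochner_Integration.integrable_bound)
 have [measurable]: "BM f" using f by measurable
 have i1: "integrable lborel (%x. indicator (cball 0 r) x * (f x)^2)" using f unfolding loc2_def
  by (intro integrableI_nonneg) (auto simp: ennreal_mult ennreal_indicator)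
 have i2: "integrable lborel (%x::R3. indicator (cball 0 r) x :: real)"
  by (intro integrable_real_indicator) (use emeasure_bounded_finite[OF bounded_cball, of "0::R3" r] in auto)
 show "integrable lborel (%x. B * (indicator (cball 0 r) x + indicator (cball 0 r) x * (f x)^2))"
  by (intro integrable_mult_right Bochner_Integration.integrable_add i1 i2)
 have B0: "B >= 0" using B(1)[of 0] by linarith
 have ab: "\<bar>f x\<bar> <= 1 + (f x)^2" for x
 proof -
  have "0 <= (\<bar>f x\<bar> - 1)^2" by simp
  then have "2 * \<bar>f x\<bar> <= 1 + (f x)^2" by (simp add: power2_diff)
  then show ?thesis by linarith
 qed
 show "AL x. norm (f x * vp x) <= norm (B * (indicator (cball 0 r) x + indicator (cball 0 r) x * (f x)^2))"
 proof (rule AE_I2)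
  fix x
  show "norm (f x * vp x) <= norm (B * (indicator (cball 0 r) x + indicator (cball 0 r) x * (f x)^2))"
  proof (cases "norm x <= r")
   case True
   have "\<bar>f x\<bar> * \<bar>vp x\<bar> <= (1 + (f x)^2) * B" using ab B(1)[of x] by (intro mult_mono) auto
   then show ?thesis using True B0 by (simp add: abs_mult mult.commute)
  next
   case False
   then show ?thesis using B(2)[of x] by simp
  qed
 qed
qed (use f in measurable)

lemma loc2_test_integrable:
 assumes "loc2 f" "test_fun vp"
 shows "integrable lborel (%x. f x * vp x)" "integrable lborel (%x. f x * partial i vp x)"
proof -
 obtain r B where rB: "r > 0" "B >= 0" "!!x. norm x > r ==> vp x = 0" "!!x i. norm x > r ==> partial i vp x = 0"
  "!!x. \<bar>vp x\<bar> <= B" "!!x i. \<bar>partial i vp x\<bar> <= B" using test_fun_support[OF assms(2)] by blast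
 show "integrable lborel (%x. f x * vp x)" by (rule loc2_integrable[OF assms(1) _ rB(5,3)])
   (use test_fun_continuous[OF assms(2)] in \<open>auto intro: borel_measurable_continuous_onI\<close>)
 show "integrable lborel (%x. f x * partial i vp x)" by (rule loc2_integrable[OF assms(1) _ rB(6,4)])
   (use test_fun_continuous[OF assms(2)] in \<open>auto intro: borel_measurable_continuous_onI\<close>)
qed

lemma loc2_ball_integrable:
 assumes "loc2 f" "A \<in> sets borel" "bounded A" shows "integrable lborel (%x. f x * indicator A x)"
proof -
 obtain r where r: "!!x. x \<in> A ==> norm x <= r" using assms(3) by (auto simp: bounded_iff)
 show ?thesis by (rule loc2_integrable[OF assms(1), of _ 1 r]) (use assms(2) r in \<open>force simp: indicator_def\<close>)+
qed

text \<open>Inside the box each factor is exp(-1/(k (t - a))) exp(-1/(k (b - t))). As k grows the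
  products converge pointwise to the indicator of the open box while staying below it, which is all
  that dominated convergence asks for.\<close>

definition box_approx :: "R3 => R3 => nat => R3 => real" where
 "box_approx a b k = tens (%i t. flat 0 (real k * t + (- real k * a $ i)) * flat 0 ((- real k) * t + real k * b $ i))"

lemma flat0_bounds: "0 <= flat 0 t" "flat 0 t <= 1"
 by (auto simp: flat_def)

lemma test_fun_box_approx: "test_fun (box_approx a b k)"
 unfolding box_approx_def
proof (rule test_fun_tens)
 fix i :: 3 and m :: nat
 show "sm m (%t. flat 0 (real k * t + (- real k * a $ i)) * flat 0 ((- real k) * t + real k * b $ i))"
  by (intro sm_mult sm_affine sm_flat)
next
 fix i :: 3 and t :: real
 assume "t \<notin> {a $ i..b $ i}"
 then have "real k * t + (- real k * a $ i) <= 0 \<or> (- real k) * t + real k * b $ i <= 0"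
  by (auto simp: mult_left_mono not_le less_imp_le)
 then show "flat 0 (real k * t + (- real k * a $ i)) * flat 0 ((- real k) * t + real k * b $ i) = 0"
  by (auto simp: flat_def)
qed

lemma box_approx_bounds: "0 <= box_approx a b k x" "box_approx a b k x <= 1"
 unfolding box_approx_def tens_def
 by (auto intro!: prod_nonneg prod_le_1 mult_nonneg_nonneg mult_le_one simp: flat0_bounds)

lemma box_approx_outside: "x \<notin> box a b ==> box_approx a b k x = 0"
proof -
 assume "x \<notin> box a b"
 then obtain i where i: "~ (a $ i < x $ i & x $ i < b $ i)" by (auto simp: mem_box_cart)
 then have "real k * x $ i + (- real k * a $ i) <= 0 \<or> (- real k) * x $ i + real k * b $ i <= 0"
  by (auto simp: mult_left_mono not_less)
 then have "flat 0 (real k * x $ i + (- real k * a $ i)) * flat 0 ((- real k) * x $ i + real k * b $ i) = 0"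
  by (auto simp: flat_def)
 then show ?thesis unfolding box_approx_def tens_def by (intro prod_zero) auto
qed

lemma flat0_lim: assumes "s > 0" shows "(%k. flat 0 (real k * s)) ---> 1"
proof -
 have "(%k. exp (- (1 / s) * inverse (real k))) ---> exp (- (1/s) * 0)" by (intro tendsto_intros lim_inverse_n)
 then have "(%k. exp (- (1 / s) * inverse (real k))) ---> 1" by simp
 then show ?thesis by (rule Lim_transform_eventually)
   (use assms in \<open>auto intro!: eventually_sequentiallyI[of 1] simp: flat_def field_simps\<close>)
qed

lemma box_approx_lim: "(%k. box_approx a b k x) ---> indicator (box a b) x"
proof (cases "x \<in> box a b")
 case True
 have "(%k. flat 0 (real k * x $ i + (- real k * a $ i)) * flat 0 ((- real k) * x $ i + real k * b $ i)) ---> 1 * 1" for i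
 proof (rule tendsto_mult)
  have "real k * x $ i + (- real k * a $ i) = real k * (x $ i - a $ i)"
   "(- real k) * x $ i + real k * b $ i = real k * (b $ i - x $ i)" for k by (auto simp: algebra_simps)
  moreover have "x $ i - a $ i > 0" "b $ i - x $ i > 0" using True by (auto simp: mem_box_cart)
  ultimately show "(%k. flat 0 (real k * x $ i + (- real k * a $ i))) ---> 1"
   "(%k. flat 0 ((- real k) * x $ i + real k * b $ i)) ---> 1" by (simp_all only: flat0_lim)
 qed
 then have "(%k. \<Prod>i\<in>UNIV. flat 0 (real k * x $ i + (- real k * a $ i)) * flat 0 ((- real k) * x $ i + real k * b $ i))
   ---> (\<Prod>i\<in>(UNIV::3 set). 1 * 1)" by (intro tendsto_prod)
 then show ?thesis using True unfolding box_approx_def tens_def by simp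
next
 case False
 then show ?thesis by (simp add: box_approx_outside)
qed

text \<open>Testing with \<open>box_approx\<close> shows that \<open>h\<close> has integral 0 over
  every box. Boxes generate the Borel sets and are stable under intersection, so the measures with
  the positive and the negative part of \<open>h\<close> as densities agree on each cube
  \<open>Q n\<close>, where they are finite, and hence so do the densities. The hypothesis is
  integrability over boxes because uniqueness of weak gradients is needed for fields known only to
  be integrable against test functions.\<close>

lemma fundamental_lemma_L1:
 assumes hm[measurable]: "BM h" and hi: "!!a b. integrable lborel (%x. h x * indicator (box a b) x)"
  and 0: "!!vp. test_fun vp ==> (LI x. h x * vp x) = 0" shows "AL x. h x = (0::real)"
proof -
 have box0: "(LI x. h x * indicator (box a b) x) = 0" for a b
 proof -
  have "(%k. (LI x. h x * box_approx a b k x)) ---> (LI x. h x * indicator (box a b) x)"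
  proof (rule integral_dominated_convergence[where w="%x. norm (h x * indicator (box a b) x)"])
   show "integrable lborel (%x. norm (h x * indicator (box a b) x))" by (intro integrable_norm hi)
   show "(%x. h x * box_approx a b k x) \<in> borel_measurable lborel" for k
    using borel_measurable_continuous_onI[OF test_fun_continuous(1)[OF test_fun_box_approx]] by measurable
   show "AL x. (%k. h x * box_approx a b k x) ---> h x * indicator (box a b) x"
    by (intro AE_I2 tendsto_mult tendsto_const box_approx_lim)
   show "AL x. norm (h x * box_approx a b k x) <= norm (h x * indicator (box a b) x)" for k
    using box_approx_bounds[of a b k] box_approx_outside[of _ a b k]
    by (intro AE_I2) (auto simp: abs_mult indicator_def intro!: mult_left_le)
  qed auto
  moreover have "(LI x. h x * box_approx a b k x) = 0" for k by (rule 0[OF test_fun_box_approx])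
  ultimately show ?thesis by (simp add: LIMSEQ_const_iff)
 qed
 define P where "P = (%x. ennreal (max 0 (h x)))"
 define N where "N = (%x. ennreal (max 0 (- h x)))"
 have [measurable]: "BM P" "BM N" unfolding P_def N_def by measurable
 have fin: "(NI x. P x * indicator (box a b) x) < \<infinity>" and
  eq: "(NI x. P x * indicator (box a b) x) = (NI x. N x * indicator (box a b) x)" for a b
 proof -
  note i = hi[of a b]
  have i1: "integrable lborel (%x. max 0 (h x) * indicator (box a b) x)"
   by (rule Bochner_Integration.integrable_bound[OF i]) (auto simp: indicator_def)
  have i2: "integrable lborel (%x. max 0 (- h x) * indicator (box a b) x)"
   by (rule Bochner_Integration.integrable_bound[OF i]) (auto simp: indicator_def)
  have "(LI x. max 0 (h x) * indicator (box a b) x) - (LI x. max 0 (- h x) * indicator (box a b) x)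
   = (LI x. max 0 (h x) * indicator (box a b) x - max 0 (- h x) * indicator (box a b) x)" using i1 i2 by simp
  also have "... = (LI x. h x * indicator (box a b) x)"
   by (intro Bochner_Integration.integral_cong) (auto simp: indicator_def)
  also have "... = 0" by (rule box0)
  finally have e: "(LI x. max 0 (h x) * indicator (box a b) x) = (LI x. max 0 (- h x) * indicator (box a b) x)" by simp
  have p: "(NI x. P x * indicator (box a b) x) = ennreal (LI x. max 0 (h x) * indicator (box a b) x)"
   by (subst nn_integral_eq_integral[OF i1, symmetric])
    (auto simp: P_def ennreal_mult ennreal_indicator intro!: nn_integral_cong)
  have n: "(NI x. N x * indicator (box a b) x) = ennreal (LI x. max 0 (- h x) * indicator (box a b) x)"
   by (subst nn_integral_eq_integral[OF i2, symmetric])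
    (auto simp: N_def ennreal_mult ennreal_indicator intro!: nn_integral_cong)
  show "(NI x. P x * indicator (box a b) x) < \<infinity>" by (simp add: p)
  show "(NI x. P x * indicator (box a b) x) = (NI x. N x * indicator (box a b) x)" by (simp add: p n e)
 qed
 define Q :: "nat => R3 set" where "Q n = box (- (real n *\<^sub>R One)) (real n *\<^sub>R One)" for n
 have [measurable]: "Q n \<in> sets borel" for n by (simp add: Q_def)
 have "AL x. P x * indicator (Q n) x = N x * indicator (Q n) x" for n
 proof -
  have "density lborel (%x. P x * indicator (Q n) x) = density lborel (%x. N x * indicator (Q n) x)"
  proof (rule measure_eqI_generator_eq[where E="range (%(a, b). box a b)" and \<Omega>=UNIV and A=Q])
   show "Int_stable (range (%(a, b). box a b :: R3 set))" by (auto simp: Int_stable_def box_Int_box)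
   have em: "emeasure (density lborel (%x. F x * indicator (Q n) x)) (box a b) = (NI x. F x * indicator (box a b \<inter> Q n) x)"
    if [measurable]: "BM F" for a b and F :: "R3 => ennreal"
    by (subst emeasure_density) (auto intro!: nn_integral_cong simp: indicator_def)
   have bi: "EX c d. box a b \<inter> Q n = box c d" for a b :: R3 unfolding Q_def box_Int_box by blast
   show "emeasure (density lborel (%x. P x * indicator (Q n) x)) X = emeasure (density lborel (%x. N x * indicator (Q n) x)) X"
    if X0: "X \<in> range (%(a, b). box a b)" for X
   proof -
    obtain p where "X = (%(a, b). box a b) p" using X0 by blast
    then have X: "X = box (fst p) (snd p)" by (simp add: case_prod_beta)
    obtain c d where "box (fst p) (snd p) \<inter> Q n = box c d" using bi by blast
    then show ?thesis unfolding X by (simp add: em eq)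
   qed
   show "sets (density lborel (%x. P x * indicator (Q n) x)) = sigma_sets UNIV (range (%(a, b). box a b))"
    "sets (density lborel (%x. N x * indicator (Q n) x)) = sigma_sets UNIV (range (%(a, b). box a b))"
    by (auto simp: borel_eq_box)
   show "range Q \<subseteq> range (%(a, b). box a b)" unfolding Q_def by auto
   show "(\<Union>i. Q i) = UNIV" unfolding Q_def by (rule UN_box_eq_UNIV)
   show "emeasure (density lborel (%x. P x * indicator (Q n) x)) (Q i) ~= \<infinity>" for i
   proof -
    obtain c d where "Q i \<inter> Q n = box c d" using bi unfolding Q_def by blast
    then show ?thesis using em[of P, folded Q_def] fin[of c d] unfolding Q_def[of i] by auto
   qed
  qed auto
  moreover have "(NI x. P x * indicator (Q n) x) ~= \<infinity>" using fin unfolding Q_def by (simp add: less_top[symmetric])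
  ultimately show ?thesis by (subst (asm) finite_density_unique) auto
 qed
 then have "AL x. ALL n. P x * indicator (Q n) x = N x * indicator (Q n) x" by (simp add: AE_all_countable)
 then show ?thesis
 proof eventually_elim
  case (elim x)
  obtain n where "x \<in> Q n" using UN_box_eq_UNIV unfolding Q_def by blast
  then have "P x = N x" using elim[rule_format, of n] by simp
  then show ?case by (auto simp: P_def N_def max_def split: if_splits)
 qed
qed

lemma fundamental_lemma:
 assumes h: "loc2 h" and 0: "!!vp. test_fun vp ==> (LI x. h x * vp x) = 0" shows "AL x. h x = 0"
 by (rule fundamental_lemma_L1[OF _ loc2_ball_integrable[OF h] 0]) (use h in auto)

definition wpair :: "(R3 => real) => (R3 => R3) => bool" where
 "wpair u g \<longleftrightarrow> loc2 u & BM g & (NE x. (norm (g x))^2) < \<infinity> &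
  (ALL vp. test_fun vp --> (ALL i. (LI x. u x * partial i vp x) = - (LI x. g x $ i * vp x)))"

lemma wpair_measurable[measurable_dest]:
 "wpair u g ==> BM u" "wpair u g ==> BM g" by (auto simp: wpair_def loc2_def)

lemma wpair_loc2: "wpair u g ==> loc2 u"
 by (simp add: wpair_def)

lemma vec_nth_measurable[measurable]: "BM (%x::R3. x $ i)"
 by (intro borel_measurable_continuous_onI continuous_intros)

lemma loc2_component:
 fixes g :: "R3 => R3"
 assumes [measurable]: "BM g" and fin: "(NE x. (norm (g x))^2) < \<infinity>" shows "loc2 (%x. g x $ i)"
proof (rule loc2I_global)
 have "(NE x. (g x $ i)^2) <= (NE x. (norm (g x))^2)" using component_le_norm_cart[of "g _" i]
  by (intro nn_integral_mono ennreal_leI) (metis abs_le_square_iff abs_norm_cancel)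
 then show "(NE x. (g x $ i)^2) < \<infinity>" using fin by (rule le_less_trans)
qed measurable

lemma wpair_loc2_component: "wpair u g ==> loc2 (%x. g x $ i)"
 by (auto simp: wpair_def intro!: loc2_component)

lemma ennreal_le_lincomb:
 assumes "z <= a * x + b * y" "a >= 0" "b >= 0" "x >= 0" "y >= 0"
 shows "ennreal z <= ennreal a * ennreal x + ennreal b * ennreal y"
proof -
 have "ennreal z <= ennreal (a * x + b * y)" using assms(1) by (rule ennreal_leI)
 also have "... = ennreal a * ennreal x + ennreal b * ennreal y" using assms by (simp add: ennreal_mult)
 finally show ?thesis .
qed

lemma loc2_add: "loc2 f ==> loc2 g ==> loc2 (%x. f x + c * g x)"
proof -
 assume f: "loc2 f" and g: "loc2 g"
 have [measurable]: "BM f" "BM g" using f g by auto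
 have "(NI x. indicator (cball 0 r) x * ennreal ((f x + c * g x)^2)) < \<infinity>" for r
 proof -
  have "(NI x. indicator (cball 0 r) x * ennreal ((f x + c * g x)^2))
   <= (NI x. ennreal 2 * (indicator (cball 0 r) x * ennreal ((f x)^2)) + ennreal (2 * c^2) * (indicator (cball 0 r) x * ennreal ((g x)^2)))"
  proof (intro nn_integral_mono)
   fix x :: R3
   have "0 <= (f x - c * g x)^2" by simp
   then have "(f x + c * g x)^2 <= 2 * (f x)^2 + 2 * c^2 * (g x)^2"
    by (simp add: power2_sum power2_diff power_mult_distrib)
   then show "indicator (cball 0 r) x * ennreal ((f x + c * g x)^2)
    <= ennreal 2 * (indicator (cball 0 r) x * ennreal ((f x)^2)) + ennreal (2 * c^2) * (indicator (cball 0 r) x * ennreal ((g x)^2))"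
    using ennreal_le_lincomb[of "(f x + c * g x)^2" 2 "(f x)^2" "2 * c^2" "(g x)^2"] by (auto simp: indicator_def)
  qed
  also have "... = ennreal 2 * (NI x. indicator (cball 0 r) x * ennreal ((f x)^2)) + ennreal (2 * c^2) * (NI x. indicator (cball 0 r) x * ennreal ((g x)^2))"
   by (subst nn_integral_add) (auto simp: nn_integral_cmult)
  also have "... < \<infinity>" using f g by (auto simp: loc2_def ennreal_mult_less_top)
  finally show ?thesis .
 qed
 then show ?thesis by (simp add: loc2_def)
qed

lemma norm_add_scale_sq:
 fixes a b :: "'a::real_inner" shows "(norm (a + c *\<^sub>R b))^2 <= 2 * (norm a)^2 + 2 * c^2 * (norm b)^2"
proof -
 have "(norm (a + c *\<^sub>R b))^2 + (norm (a - c *\<^sub>R b))^2 = 2 * (norm a)^2 + 2 * c^2 * (norm b)^2"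
  unfolding power2_norm_eq_inner by (simp add: inner_simps inner_commute power2_eq_square[of c] algebra_simps)
 moreover have "0 <= (norm (a - c *\<^sub>R b))^2" by simp
 ultimately show ?thesis by linarith
qed

lemma wpair_add:
 assumes u: "wpair u g" and v: "wpair v h" shows "wpair (%x. u x + c * v x) (%x. g x + c *\<^sub>R h x)"
proof -
 have [measurable]: "BM u" "BM g" "BM v" "BM h" using u v by auto
 have "(NE x. (norm (g x + c *\<^sub>R h x))^2)
  <= (NI x. ennreal 2 * ennreal ((norm (g x))^2) + ennreal (2 * c^2) * ennreal ((norm (h x))^2))"
  by (intro nn_integral_mono ennreal_le_lincomb norm_add_scale_sq) auto
 also have "... = ennreal 2 * (NE x. (norm (g x))^2) + ennreal (2 * c^2) * (NE x. (norm (h x))^2)"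
  by (subst nn_integral_add) (auto simp: nn_integral_cmult)
 also have "... < \<infinity>" using u v by (auto simp: wpair_def ennreal_mult_less_top)
 finally have fin: "(NE x. (norm (g x + c *\<^sub>R h x))^2) < \<infinity>" .
 have "(LI x. (u x + c * v x) * partial i vp x) = - (LI x. (g x + c *\<^sub>R h x) $ i * vp x)"
  if vp: "test_fun vp" for vp i
 proof -
  note ints = loc2_test_integrable[OF wpair_loc2[OF u] vp] loc2_test_integrable[OF wpair_loc2[OF v] vp]
   loc2_test_integrable[OF wpair_loc2_component[OF u] vp] loc2_test_integrable[OF wpair_loc2_component[OF v] vp]
  have eqs: "(LI x. u x * partial i vp x) = - (LI x. g x $ i * vp x)"
    "(LI x. v x * partial i vp x) = - (LI x. h x $ i * vp x)" using u v vp by (auto simp: wpair_def)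
  have "(LI x. (u x + c * v x) * partial i vp x) = (LI x. u x * partial i vp x + c * (v x * partial i vp x))"
   by (intro Bochner_Integration.integral_cong) (auto simp: algebra_simps)
  also have "... = (LI x. u x * partial i vp x) + c * (LI x. v x * partial i vp x)" using ints by simp
  also have "... = - ((LI x. g x $ i * vp x) + c * (LI x. h x $ i * vp x))" by (simp add: eqs)
  also have "(LI x. g x $ i * vp x) + c * (LI x. h x $ i * vp x) = (LI x. g x $ i * vp x + c * (h x $ i * vp x))"
   using ints by simp
  also have "... = (LI x. (g x + c *\<^sub>R h x) $ i * vp x)"
   by (intro Bochner_Integration.integral_cong) (auto simp: algebra_simps)
  finally show ?thesis .
 qed
 then show ?thesis using fin wpair_loc2[OF u] wpair_loc2[OF v] by (auto simp: wpair_def intro: loc2_add)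
qed

lemma wpair_zero_grad_unique:
 assumes "wpair u g" "wpair v h" "AL x. u x = v x" shows "AL x. g x = h x"
proof -
 have [measurable]: "BM u" "BM v" using assms by auto
 have "AL x. g x $ i = h x $ i" for i
 proof -
  have "AL x. g x $ i + (- 1) * h x $ i = 0"
  proof (rule fundamental_lemma)
   show "loc2 (%x. g x $ i + (- 1) * h x $ i)"
    by (intro loc2_add wpair_loc2_component[OF assms(1)] wpair_loc2_component[OF assms(2)])
   fix vp assume vp: "test_fun vp"
   have m[measurable]: "BM (partial i vp)"
    using test_fun_continuous[OF vp] by (auto intro: borel_measurable_continuous_onI)
   have "(LI x. u x * partial i vp x) = (LI x. v x * partial i vp x)" using assms(3) by (intro integral_cong_AE) auto
   then have e: "(LI x. g x $ i * vp x) = (LI x. h x $ i * vp x)" using assms(1,2) vp by (auto simp: wpair_def)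
   have "(LI x. (g x $ i + (- 1) * h x $ i) * vp x) = (LI x. g x $ i * vp x - h x $ i * vp x)"
    by (intro Bochner_Integration.integral_cong) (auto simp: algebra_simps)
   also have "... = 0" using loc2_test_integrable[OF wpair_loc2_component[OF assms(1)] vp, of i]
     loc2_test_integrable[OF wpair_loc2_component[OF assms(2)] vp, of i] e by simp
   finally show "(LI x. (g x $ i + (- 1) * h x $ i) * vp x) = 0" .
  qed
  then show ?thesis by eventually_elim simp
 qed
 then have "AL x. ALL i. g x $ i = h x $ i" by (simp add: AE_all_countable)
 then show ?thesis by eventually_elim (simp add: vec_eq_iff)
qed

section \<open>Mollification\<close>

text \<open>The last clause allows the reflected translates of the kernel to be inserted as test
  functions into the definition of the weak gradient; this is how convolutions are differentiated in
  \<open>cv_partial\<close>.\<close>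

definition mollifier :: "real => (R3 => real) => bool" where
 "mollifier ep k \<longleftrightarrow> ep > 0 & test_fun k & (ALL x. k x >= 0) & (ALL x. norm x >= ep --> k x = 0) &
   (LI x. k x) = 1 & (ALL x. test_fun (%y. k (x - y)))"

lemma mollifier_exists:
 assumes "ep > 0" shows "EX k. mollifier ep k"
proof -
 \<comment> \<open>The support lies in the cube of half side \<open>de\<close>, whose points have
   norm at most 3 \<open>de\<close>, below \<open>ep\<close>.\<close>
 define de where "de = ep / 4"
 have de: "de > 0" using assms by (simp add: de_def)
 define h where "h t = flat 0 (1 * t + de) * flat 0 ((-1) * t + de)" for t
 have sh: "sm m h" for m unfolding h_def by (intro sm_mult sm_affine sm_flat)
 have h0: "h t = 0" if "t \<notin> {-de..de}" for t using that by (auto simp: h_def flat_def)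
 have hpos: "h t > 0" if "t \<in> {-de<..<de}" for t using that by (auto simp: h_def flat_def)
 have hnn: "h t >= 0" for t by (auto simp: h_def flat_def)
 define K where "K = tens (%_. h)"
 have tK: "test_fun K" unfolding K_def by (rule test_fun_tens[OF sh h0])
 have l1: "loc2 (%_. 1)" unfolding loc2_def using emeasure_bounded_finite[OF bounded_cball, of "0::R3"] by auto
 have iK: "integrable lborel K" using loc2_test_integrable(1)[OF l1 tK] by simp
 have Knn: "K x >= 0" for x unfolding K_def tens_def by (intro prod_nonneg) (simp add: hnn)
 have Ipos: "(LI x. K x) > 0"
 proof (rule ccontr)
  assume "~ (LI x. K x) > 0"
  moreover have "(LI x. K x) >= 0" by (intro Bochner_Integration.integral_nonneg) (simp add: Knn)
  ultimately have "(LI x. K x) = 0" by linarith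
  then have ae: "AL x. K x = 0" using integral_nonneg_eq_0_iff_AE[OF iK] Knn by auto
  define Q where "Q = box ((\<chi> i. -de)::R3) (\<chi> i. de)"
  have pos: "K x > 0" if "x \<in> Q" for x
   using that unfolding K_def tens_def Q_def by (intro prod_pos) (auto simp: mem_box_cart intro!: hpos)
  have "AL x. x \<notin> Q" using ae by eventually_elim (use pos in force)
  then have "emeasure lborel Q = 0" by (subst (asm) AE_iff_measurable[where N=Q]) (auto simp: Q_def)
  then have "negligible Q" by (simp add: negligible_iff_emeasure0 Q_def)
  moreover have "0 \<in> Q" using de by (simp add: Q_def mem_box_cart)
  moreover have "open Q" unfolding Q_def by (rule open_box)
  ultimately show False using open_not_negligible by blast
 qed
 define c where "c = 1 / (LI x. K x)"
 define k where "k x = c * K x" for x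
 have kt: "test_fun (%y. k (s *\<^sub>R y + x))" if "s ~= 0" for x s
 proof -
  \<comment> \<open>The normalizing constant is absorbed in the first coordinate factor, so affine
    changes of the variable still give tensor products of smooth functions.\<close>
  have "(%y. k (s *\<^sub>R y + x)) = tens (%i t. (if i = 1 then c else 1) * h (s * t + x $ i))"
   by (auto simp: k_def K_def tens_def prod.distrib prod.delta fun_eq_iff)
  moreover have "test_fun (tens (%i t. (if i = 1 then c else 1) * h (s * t + x $ i)))"
  proof (rule test_fun_tens)
   show "sm m (%t. (if i = 1 then c else 1) * h (s * t + x $ i))" for i :: 3 and m
    by (intro sm_mult sm_const sm_affine sh)
   show "(if i = 1 then c else 1) * h (s * t + x $ i) = 0"
    if "t \<notin> {- ((de + \<bar>x $ i\<bar>) / \<bar>s\<bar>)..(de + \<bar>x $ i\<bar>) / \<bar>s\<bar>}" for i :: 3 and t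
   proof -
    have "\<bar>t\<bar> > (de + \<bar>x $ i\<bar>) / \<bar>s\<bar>" using that by auto
    then have "\<bar>s * t\<bar> > de + \<bar>x $ i\<bar>" using \<open>s ~= 0\<close> by (simp add: field_simps abs_mult)
    then have "s * t + x $ i \<notin> {-de..de}" by auto
    then show ?thesis by (simp add: h0)
   qed
  qed
  ultimately show ?thesis by simp
 qed
 have "test_fun k" using kt[of 1 0] by simp
 moreover have "test_fun (%y. k (x - y))" for x using kt[of "-1" x] by (simp add: algebra_simps)
 moreover have "k x >= 0" for x using Knn Ipos by (simp add: k_def c_def)
 moreover have "k x = 0" if "norm x >= ep" for x
 proof -
  have "EX i. \<bar>x $ i\<bar> > de"
  proof (rule ccontr)
   assume "~ (EX i. \<bar>x $ i\<bar> > de)"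
   then have "(\<Sum>i\<in>UNIV. \<bar>x $ i\<bar>) <= (\<Sum>i\<in>(UNIV::3 set). de)" by (intro sum_mono) (auto simp: not_less)
   then have "norm x <= 3 * de" using norm_le_l1_cart[of x] by simp
   then show False using that de by (simp add: de_def)
  qed
  then obtain i where "\<bar>x $ i\<bar> > de" by blast
  then have "h (x $ i) = 0" by (intro h0) auto
  then show ?thesis unfolding k_def K_def tens_def by (auto intro!: prod_zero)
 qed
 moreover have "(LI x. k x) = 1" using Ipos by (simp add: k_def c_def)
 ultimately show ?thesis using assms unfolding mollifier_def by blast
qed

section \<open>Convolution of locally square integrable functions with test functions\<close>

definition cv :: "(R3 => real) => (R3 => real) => R3 => real" where
 "cv f k x = (LI y. f y * k (x - y))"

definition cvv :: "(R3 => R3) => (R3 => real) => R3 => R3" where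
 "cvv g k x = (\<chi> i. cv (%y. g y $ i) k x)"

lemma test_fun_measurable: "test_fun k ==> BM k"
 "test_fun k ==> BM (partial i k)" using test_fun_continuous by (auto intro: borel_measurable_continuous_onI)

lemma cv_integrable:
 assumes "loc2 f" "test_fun k" shows "integrable lborel (%y. f y * k (x - y))"
proof -
 obtain r B where rB: "!!x. norm x > r ==> k x = 0" "!!x. \<bar>k x\<bar> <= B" using test_fun_support[OF assms(2)] by metis
 note [measurable] = test_fun_measurable(1)[OF assms(2)]
 show ?thesis
 proof (rule loc2_integrable[OF assms(1), of _ B "r + norm x"])
  show "k (x - y) = 0" if "norm y > r + norm x" for y
   using that norm_triangle_ineq2[of y x] by (intro rB(1)) (simp add: norm_minus_commute)
 qed (use rB(2) in measurable)
qed

lemma compact_support_uniformly_continuous: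
 fixes f :: "'a::euclidean_space => real"
 assumes "continuous_on UNIV f" "!!x. norm x > r ==> f x = 0" "e > 0"
 shows "EX d>0. ALL x y. dist x y < d --> \<bar>f x - f y\<bar> < e"
proof -
 have "uniformly_continuous_on (cball 0 (r + 1)) f"
  using assms(1) by (intro compact_uniformly_continuous) (auto intro: continuous_on_subset)
 then obtain d where d: "d > 0" "!!x y. x \<in> cball 0 (r + 1) ==> y \<in> cball 0 (r + 1) ==> dist x y < d ==> \<bar>f x - f y\<bar> < e"
  using assms(3) unfolding uniformly_continuous_on_def dist_real_def by metis
 have "\<bar>f x - f y\<bar> < e" if "dist x y < min d 1" for x y
 proof (cases "norm x <= r \<or> norm y <= r")
  case True
  have "\<bar>norm x - norm y\<bar> <= dist x y" by (simp add: dist_norm norm_triangle_ineq3)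
  then have "norm x <= r + 1" "norm y <= r + 1" using that True by auto
  then show ?thesis using that by (intro d(2)) auto
 next
  case False
  then show ?thesis using assms(2)[of x] assms(2)[of y] assms(3) by simp
 qed
 then show ?thesis using d(1) by (intro exI[of _ "min d 1"]) auto
qed

lemma test_fun_partial:
 assumes "test_fun vp" shows "test_fun (partial i vp)"
proof -
 obtain r B where r: "!!x i. norm x > r ==> partial i vp x = 0" using test_fun_support[OF assms] by metis
 have "Ck m (partial i vp)" for m
 proof -
  have "Ck (Suc m) vp" using assms unfolding test_fun_def by blast
  then show ?thesis by (simp add: partial_def[abs_def])
 qed
 moreover have "{x. partial i vp x ~= 0} \<subseteq> cball 0 r" using r by force
 then have "bounded {x. partial i vp x ~= 0}" by (rule bounded_subset[OF bounded_cball])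
 then have "compact (closure {x. partial i vp x ~= 0})" by (simp add: compact_eq_bounded_closed bounded_closure)
 ultimately show ?thesis unfolding test_fun_def by (intro conjI allI)
qed

lemma test_fun_linearization:
 assumes "test_fun k" and d: "!!x y i. dist x y < d ==> \<bar>partial i k x - partial i k y\<bar> < e" and h: "norm h < d"
 shows "\<bar>k (z + h) - k z - (\<Sum>i\<in>UNIV. h $ i * partial i k z)\<bar> <= norm h * (3 * e)"
proof -
 have "d > 0" using h norm_ge_zero[of h] by linarith
 then have e: "e > 0" using d[where x=0 and y=0 and i=1] by simp
 have "norm (k (z + h) - k z - (\<Sum>i\<in>UNIV. ((z + h) - z) $ i * partial i k z)) <= norm ((z + h) - z) * (3 * e)"
 proof (rule differentiable_bound_linearization[where S="ball z d" and f'="%x v. \<Sum>i\<in>UNIV. v $ i * partial i k x"])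
  show "z + t *\<^sub>R (z + h - z) \<in> ball z d" if "t \<in> {0..1}" for t
  proof -
   have "\<bar>t\<bar> * norm h <= 1 * norm h" using that by (intro mult_right_mono) auto
   then show ?thesis using h by (simp add: dist_norm)
  qed
  show "(k has_derivative (%v. \<Sum>i\<in>UNIV. v $ i * partial i k x)) (at x within ball z d)" for x
   using test_fun_derivative[OF assms(1)] by (rule has_derivative_at_withinI)
  show "onorm ((%v. \<Sum>i\<in>UNIV. v $ i * partial i k x) - (%v. \<Sum>i\<in>UNIV. v $ i * partial i k z)) <= 3 * e"
   if "x \<in> ball z d" for x
  proof (rule onorm_le)
   fix v :: R3
   have "norm (((%v. \<Sum>i\<in>UNIV. v $ i * partial i k x) - (%v. \<Sum>i\<in>UNIV. v $ i * partial i k z)) v)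
    = \<bar>\<Sum>i\<in>UNIV. v $ i * (partial i k x - partial i k z)\<bar>" by (simp add: sum_subtractf algebra_simps)
   also have "... <= (\<Sum>i\<in>UNIV. \<bar>v $ i * (partial i k x - partial i k z)\<bar>)" by (rule sum_abs)
   also have "... <= (\<Sum>i\<in>(UNIV::3 set). norm v * e)"
   proof (intro sum_mono)
    fix i :: 3
    have "\<bar>partial i k x - partial i k z\<bar> < e" using that by (intro d) (simp add: dist_commute)
    then show "\<bar>v $ i * (partial i k x - partial i k z)\<bar> <= norm v * e"
     unfolding abs_mult using component_le_norm_cart[of v i] e by (intro mult_mono) auto
   qed
   also have "... = 3 * e * norm v" by simp
   finally show "norm (((%v. \<Sum>i\<in>UNIV. v $ i * partial i k x) - (%v. \<Sum>i\<in>UNIV. v $ i * partial i k z)) v) <= 3 * e * norm v" .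
  qed
  show "z \<in> ball z d" using h by (auto intro: le_less_trans[OF norm_ge_zero])
 qed
 then show ?thesis by simp
qed

lemma cv_has_derivative:
 assumes f: "loc2 f" and k: "test_fun k"
 shows "(cv f k has_derivative (%v. \<Sum>i\<in>UNIV. v $ i * cv f (partial i k) x)) (at x)" unfolding has_derivative_at_alt
proof (intro conjI allI impI)
 show "bounded_linear (%v. \<Sum>i\<in>UNIV. v $ i * cv f (partial i k) x)"
  by (intro bounded_linear_sum bounded_linear_mult_const bounded_linear_vec_nth)
next
 fix e :: real assume e: "e > 0"
 obtain r B where rB: "r > 0" "!!x. norm x > r ==> k x = 0" "!!x i. norm x > r ==> partial i k x = 0"
  using test_fun_support[OF k] by metis
 \<comment> \<open>For increments shorter than 1 only points within r + 1 of \<open>x\<close>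
   contribute, so this local L^1 norm is all that is needed of \<open>f\<close>; the rest is the
   uniform first-order remainder of \<open>k\<close>.\<close>
 define C where "C = (LI y. \<bar>f y\<bar> * indicator (cball x (r + 1)) y)"
 have Ci: "integrable lborel (%y. \<bar>f y\<bar> * indicator (cball x (r + 1)) y)"
  using integrable_abs[OF loc2_ball_integrable[OF f, of "cball x (r + 1)"]] by (simp add: abs_mult)
 have C0: "C >= 0" unfolding C_def by (intro Bochner_Integration.integral_nonneg) simp
 define e' where "e' = e / (3 * (C + 1))"
 have e': "e' > 0" using e C0 by (simp add: e'_def)
 have "EX d>0. ALL x y. dist x y < d --> \<bar>partial i k x - partial i k y\<bar> < e'" for i
  by (rule compact_support_uniformly_continuous[OF test_fun_continuous(2)[OF k] rB(3) e'])
 then obtain D where D: "!!i. D i > 0" "!!i x y. dist x y < D i ==> \<bar>partial i k x - partial i k y\<bar> < e'" by metis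
 define d where "d = min 1 (Min (range D))"
 have d: "d > 0" "d <= 1" "!!i. d <= D i" using D(1) by (auto simp: d_def intro!: min.coboundedI2)
 have dd: "\<bar>partial i k x - partial i k y\<bar> < e'" if "dist x y < d" for x y i using D(2) d(3)[of i] that by force
 show "EX d>0. ALL y. norm (y - x) < d --> norm (cv f k y - cv f k x - (\<Sum>i\<in>UNIV. (y - x) $ i * cv f (partial i k) x)) <= e * norm (y - x)"
 proof (intro exI[of _ d] conjI allI impI d(1))
  fix w assume w: "norm (w - x) < d"
  define h where "h = w - x"
  note ints = cv_integrable[OF f k] cv_integrable[OF f test_fun_partial[OF k]]
  have eq: "cv f k w - cv f k x - (\<Sum>i\<in>UNIV. (w - x) $ i * cv f (partial i k) x)
   = (LI y. f y * (k ((x - y) + h) - k (x - y) - (\<Sum>i\<in>UNIV. h $ i * partial i k (x - y))))"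
  proof -
   have "(LI y. f y * (k ((x - y) + h) - k (x - y) - (\<Sum>i\<in>UNIV. h $ i * partial i k (x - y))))
     = (LI y. f y * k (w - y) - f y * k (x - y) - (\<Sum>i\<in>UNIV. h $ i * (f y * partial i k (x - y))))"
    by (intro Bochner_Integration.integral_cong) (auto simp: h_def algebra_simps sum_distrib_left)
   also have "... = (LI y. f y * k (w - y)) - (LI y. f y * k (x - y)) - (\<Sum>i\<in>UNIV. h $ i * (LI y. f y * partial i k (x - y)))"
    using ints by (simp add: Bochner_Integration.integral_sum)
   finally show ?thesis by (simp add: cv_def h_def)
  qed
  have "norm (cv f k w - cv f k x - (\<Sum>i\<in>UNIV. (w - x) $ i * cv f (partial i k) x))
   <= (LI y. \<bar>f y * (k ((x - y) + h) - k (x - y) - (\<Sum>i\<in>UNIV. h $ i * partial i k (x - y)))\<bar>)"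
   unfolding real_norm_def eq by (rule integral_abs_bound)
  also have "... <= (LI y. (norm h * (3 * e')) * (\<bar>f y\<bar> * indicator (cball x (r + 1)) y))"
  proof (rule integral_mono')
   show "integrable lborel (%y. (norm h * (3 * e')) * (\<bar>f y\<bar> * indicator (cball x (r + 1)) y))"
    using Ci by (rule integrable_mult_right)
   fix y
   show "0 <= (norm h * (3 * e')) * (\<bar>f y\<bar> * indicator (cball x (r + 1)) y)" using e' by simp
   show "\<bar>f y * (k ((x - y) + h) - k (x - y) - (\<Sum>i\<in>UNIV. h $ i * partial i k (x - y)))\<bar>
    <= (norm h * (3 * e')) * (\<bar>f y\<bar> * indicator (cball x (r + 1)) y)"
   proof (cases "y \<in> cball x (r + 1)")
    case True
    have "\<bar>k ((x - y) + h) - k (x - y) - (\<Sum>i\<in>UNIV. h $ i * partial i k (x - y))\<bar> <= norm h * (3 * e')"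
     using w by (intro test_fun_linearization[OF k dd]) (auto simp: h_def)
    then have "\<bar>f y\<bar> * \<bar>k ((x - y) + h) - k (x - y) - (\<Sum>i\<in>UNIV. h $ i * partial i k (x - y))\<bar> <= \<bar>f y\<bar> * (norm h * (3 * e'))"
     by (intro mult_left_mono) auto
    then show ?thesis using True by (simp add: abs_mult mult.commute mult.left_commute)
   next
    case False
    then have n: "norm (x - y) > r + 1" by (simp add: dist_norm)
    moreover have "norm (x - y) <= norm (x - y + h) + norm h" using norm_triangle_ineq4[of "x - y + h" h] by simp
    ultimately have "norm (x - y + h) > r" using w d(2) by (simp add: h_def)
    then show ?thesis using n rB(2)[of "x - y + h"] rB(2)[of "x - y"] rB(3)[of "x - y"] e' by simp
   qed
  qed
  also have "... = norm h * (3 * e' * C)" by (simp add: C_def)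
  also have "... <= norm h * e" using C0 e by (intro mult_left_mono) (auto simp: e'_def field_simps)
  finally show "norm (cv f k w - cv f k x - (\<Sum>i\<in>UNIV. (w - x) $ i * cv f (partial i k) x)) <= e * norm (w - x)"
   by (simp add: h_def mult.commute)
 qed
qed

lemma cv_continuous: "loc2 f ==> test_fun k ==> continuous_on UNIV (cv f k)"
 by (intro continuous_at_imp_continuous_on ballI has_derivative_continuous[OF cv_has_derivative])

lemma cv_measurable: "loc2 f ==> test_fun k ==> BM (cv f k)"
 by (intro borel_measurable_continuous_onI cv_continuous)

lemma mollifierD:
 assumes "mollifier ep k"
 shows "ep > 0" "test_fun k" "k x >= 0" "norm x >= ep ==> k x = 0" "(LI x. k x) = 1" "test_fun (%y. k (x - y))"
 using assms by (auto simp: mollifier_def)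

lemma partial_reflect:
 assumes "test_fun k" shows "partial i (%y. k (x - y)) y = - partial i k (x - y)"
proof -
 have "((%y. x - y) has_derivative (%v. - v)) (at y)" by (auto intro!: derivative_eq_intros)
 from has_derivative_compose[OF this test_fun_derivative[OF assms, of "x - y"]]
 have "((%y. k (x - y)) has_derivative (%v. \<Sum>i\<in>UNIV. (- v) $ i * partial i k (x - y))) (at y)" .
 from fun_cong[OF frechet_derivative_at[OF this], of "axis i 1"]
 have "partial i (%y. k (x - y)) y = (\<Sum>j\<in>UNIV. - (axis i 1 $ j) * partial j k (x - y))" unfolding partial_def by simp
 also have "... = (\<Sum>j\<in>UNIV. if j = i then - partial i k (x - y) else 0)" by (intro sum.cong) (auto simp: axis_def)
 finally show ?thesis by simp
qed

text \<open>As a function of y the kernel is a reflected translate, and the sign of the reflection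
  cancels the one in the definition of the weak gradient.\<close>

lemma cv_partial:
 assumes "wpair u g" "mollifier ep k" shows "cv u (partial i k) x = cv (%y. g y $ i) k x"
proof -
 have "(LI y. u y * partial i (%y. k (x - y)) y) = - (LI y. g y $ i * k (x - y))"
  using assms(1) mollifierD(6)[OF assms(2)] unfolding wpair_def by blast
 then show ?thesis by (simp add: partial_reflect[OF mollifierD(2)[OF assms(2)]] cv_def)
qed

lemma cv_gradient:
 assumes "wpair u g" "mollifier ep k" shows "(cv u k has_derivative (%v. v \<bullet> cvv g k x)) (at x)"
proof -
 have "(cv u k has_derivative (%v. \<Sum>i\<in>UNIV. v $ i * cv u (partial i k) x)) (at x)"
  by (rule cv_has_derivative[OF wpair_loc2[OF assms(1)] mollifierD(2)[OF assms(2)]])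
 moreover have "(\<Sum>i\<in>UNIV. v $ i * cv u (partial i k) x) = v \<bullet> cvv g k x" for v
  unfolding inner_vec_def cvv_def vec_lambda_beta inner_real_def
  by (intro sum.cong refl arg_cong2[where f="(*)"] cv_partial[OF assms])
 ultimately show ?thesis by (simp only:)
qed

lemma cvv_continuous:
 assumes "wpair u g" "mollifier ep k" shows "continuous_on UNIV (cvv g k)" unfolding cvv_def
 by (intro continuous_on_vec_lambda cv_continuous wpair_loc2_component[OF assms(1)] mollifierD(2)[OF assms(2)])

section \<open>Invariance of Lebesgue measure and L^2 estimates for mollifications\<close>

lemma lborel_reflect: "lborel = distr lborel borel (%y::R3. x - y)"
proof -
 have "lborel = density (distr lborel borel (%y::R3. x + (-1) *\<^sub>R y)) (%_. 1)" using lborel_affine[of "-1" x] by simp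
 then show ?thesis by (simp add: density_1)
qed

lemma nn_integral_reflect:
 fixes f :: "R3 => ennreal"
 assumes [measurable]: "BM f" shows "(NI y. f (x - y)) = (NI y. f y)"
 by (subst (2) lborel_reflect[of x]) (simp add: nn_integral_distr)

lemma nn_integral_translate:
 fixes f :: "R3 => ennreal"
 assumes [measurable]: "BM f" shows "(NI y. f (x + y)) = (NI y. f y)"
 by (subst (2) lborel_distr_plus[of x, symmetric]) (simp add: nn_integral_distr)

lemma integral_reflect:
 fixes f :: "R3 => real"
 assumes [measurable]: "BM f" shows "(LI y. f (x - y)) = (LI y. f y)"
 by (subst (2) lborel_reflect[of x]) (simp add: integral_distr)

lemma mollifier_nn_integral:
 assumes "mollifier ep k" shows "(NE y. k (x - y)) = 1" "(NE y. k y) = 1" "integrable lborel k"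
  "(NE y. k (y - x)) = 1"
proof -
 note [measurable] = test_fun_measurable(1)[OF mollifierD(2)[OF assms]]
 show i: "integrable lborel k" using mollifierD(5)[OF assms] not_integrable_integral_eq by force
 show *: "(NE y. k y) = 1" using nn_integral_eq_integral[OF i] mollifierD(3,5)[OF assms] by simp
 show "(NE y. k (x - y)) = 1" using nn_integral_reflect[of "%y. ennreal (k y)" x] * by simp
 show "(NE y. k (y - x)) = 1" using nn_integral_translate[of "%y. ennreal (k y)" "-x"] * by simp
qed

text \<open>Jensen's inequality for the probability density k(x - y), obtained from Cauchy-Schwarz
  after writing the kernel as the product of its square roots.\<close>

lemma cv_jensen:
 assumes f: "loc2 f" and k: "mollifier ep k"
 shows "ennreal ((cv f k x)^2) <= (NI y. ennreal (k (x - y)) * ennreal ((f y)^2))"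
proof -
 note [measurable] = test_fun_measurable(1)[OF mollifierD(2)[OF k]]
 have [measurable]: "BM f" using f by measurable
 note kp = mollifierD(3)[OF k]
 have "ennreal \<bar>cv f k x\<bar> <= (NI y. ennreal \<bar>f y * k (x - y)\<bar>)"
  using integral_norm_bound_ennreal[OF cv_integrable[OF f mollifierD(2)[OF k]], of x] by (simp add: cv_def)
 also have "... = (NI y. ennreal (sqrt (k (x - y)) * \<bar>f y\<bar>) * ennreal (sqrt (k (x - y))))"
  by (intro nn_integral_cong) (simp add: ennreal_mult[symmetric] kp abs_mult mult.assoc mult.commute)
 finally have "(ennreal \<bar>cv f k x\<bar>)^2 <= (NI y. ennreal (sqrt (k (x - y)) * \<bar>f y\<bar>) * ennreal (sqrt (k (x - y))))^2"
  by (rule power_mono) simp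
 also have "... <= (NI y. (ennreal (sqrt (k (x - y)) * \<bar>f y\<bar>))^2) * (NI y. (ennreal (sqrt (k (x - y))))^2)"
  by (rule Cauchy_Schwarz_nn_integral) measurable
 also have "(NI y. (ennreal (sqrt (k (x - y))))^2) = 1"
  using mollifier_nn_integral(1)[OF k, of x] by (simp add: ennreal_power kp)
 also have "(NI y. (ennreal (sqrt (k (x - y)) * \<bar>f y\<bar>))^2) = (NI y. ennreal (k (x - y)) * ennreal ((f y)^2))"
  by (intro nn_integral_cong) (simp add: ennreal_power kp power_mult_distrib ennreal_mult)
 finally show ?thesis by (simp add: ennreal_power)
qed

lemma cv_L2_bound:
 assumes f: "loc2 f" and k: "mollifier ep k" and [measurable]: "A \<in> sets borel" "B \<in> sets borel"
  and AB: "!!x y. x \<in> A ==> dist x y < ep ==> y \<in> B"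
 shows "(NI x. indicator A x * ennreal ((cv f k x)^2)) <= (NI x. indicator B x * ennreal ((f x)^2))"
proof -
 note [measurable] = test_fun_measurable(1)[OF mollifierD(2)[OF k]]
 have [measurable]: "BM f" using f by measurable
 have "(NI x. indicator A x * ennreal ((cv f k x)^2))
  <= (NI x. NI y. indicator A x * (ennreal (k (x - y)) * ennreal ((f y)^2)))"
  by (intro nn_integral_mono) (auto simp: nn_integral_cmult intro!: mult_left_mono cv_jensen[OF f k])
 also have "... = (NI y. NI x. indicator A x * (ennreal (k (x - y)) * ennreal ((f y)^2)))"
  by (rule lborel_pair.Fubini') measurable
 also have "... <= (NI y. NI x. ennreal (k (x - y)) * (indicator B y * ennreal ((f y)^2)))"
 proof (intro nn_integral_mono)
  fix x y
  show "indicator A x * (ennreal (k (x - y)) * ennreal ((f y)^2)) <= ennreal (k (x - y)) * (indicator B y * ennreal ((f y)^2))"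
   using AB[of x y] mollifierD(4)[OF k, of "x - y"] by (force simp: indicator_def dist_norm)
 qed
 also have "... = (NI y. indicator B y * ennreal ((f y)^2))"
  by (intro nn_integral_cong) (simp add: nn_integral_multc mollifier_nn_integral(4)[OF k])
 finally show ?thesis .
qed

lemma norm_sq_vec: "(norm (v::R3))^2 = (\<Sum>i\<in>UNIV. (v $ i)^2)"
 by (simp add: norm_vec_def L2_set_def sum_nonneg)

lemma ennreal_norm_sq_vec: "ennreal ((norm (v::R3))^2) = (\<Sum>i\<in>UNIV. ennreal ((v $ i)^2))"
 by (subst sum_ennreal) (auto simp: norm_sq_vec)

lemma cvv_L2_bound:
 assumes u: "wpair u g" and k: "mollifier ep k" and [measurable]: "A \<in> sets borel" "B \<in> sets borel"
  and AB: "!!x y. x \<in> A ==> dist x y < ep ==> y \<in> B"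
 shows "(NI x. indicator A x * ennreal ((norm (cvv g k x))^2)) <= (NI x. indicator B x * ennreal ((norm (g x))^2))"
proof -
 note l = wpair_loc2_component[OF u]
 have [measurable]: "BM g" using u by measurable
 have [measurable]: "BM (%x. cv (%y. g y $ i) k x)" for i using cv_measurable[OF l mollifierD(2)[OF k]] by simp
 have "(NI x. indicator A x * ennreal ((norm (cvv g k x))^2))
   = (NI x. (\<Sum>i\<in>UNIV. indicator A x * ennreal ((cv (%y. g y $ i) k x)^2)))"
  by (intro nn_integral_cong) (simp only: ennreal_norm_sq_vec cvv_def sum_distrib_left vec_lambda_beta)
 also have "... = (\<Sum>i\<in>UNIV. (NI x. indicator A x * ennreal ((cv (%y. g y $ i) k x)^2)))"
  by (rule nn_integral_sum) measurable
 also have "... <= (\<Sum>i\<in>UNIV. (NI x. indicator B x * ennreal ((g x $ i)^2)))"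
  by (intro sum_mono cv_L2_bound[OF l k _ _ AB]) auto
 also have "... = (NI x. (\<Sum>i\<in>UNIV. indicator B x * ennreal ((g x $ i)^2)))"
  by (rule nn_integral_sum[symmetric]) measurable
 also have "... = (NI x. indicator B x * ennreal ((norm (g x))^2))"
  by (intro nn_integral_cong) (simp only: ennreal_norm_sq_vec sum_distrib_left)
 finally show ?thesis .
qed

text \<open>Along the segment from x to x + h the increment is an integral over [0,1];
  Cauchy-Schwarz there, Fubini and translation invariance give the bound. Only the gradient enters,
  so it applies to functions that are not square integrable.\<close>

lemma C1_translation_bound:
 fixes F :: "R3 => real"
 assumes F: "!!x. (F has_derivative (%v. v \<bullet> G x)) (at x)" and G: "continuous_on UNIV G"
 shows "(NE x. (F (x + h) - F x)^2) <= ennreal ((norm h)^2) * (NE x. (norm (G x))^2)"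
proof -
 have [measurable]: "BM G" using G by (rule borel_measurable_continuous_onI)
 have [measurable]: "BM F"
  by (intro borel_measurable_continuous_onI continuous_at_imp_continuous_on ballI has_derivative_continuous[OF F])
 have pt: "ennreal ((F (x + h) - F x)^2) <= (NI s. indicator {0..1} s * (ennreal ((norm h)^2) * ennreal ((norm (G (x + s *\<^sub>R h)))^2)))" for x
 proof -
  have eq: "(LI s. (h \<bullet> G (x + s *\<^sub>R h)) * indicator {0..1} s) = F (x + 1 *\<^sub>R h) - F (x + 0 *\<^sub>R h)"
  proof (rule integral_FTC_Icc_real[where F="%s. F (x + s *\<^sub>R h)"])
   fix s :: real
   have "((%s. x + s *\<^sub>R h) has_derivative (%t. t *\<^sub>R h)) (at s)" by (auto intro!: derivative_eq_intros)
   from has_derivative_compose[OF this F]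
   show "((%s. F (x + s *\<^sub>R h)) has_real_derivative h \<bullet> G (x + s *\<^sub>R h)) (at s)"
    by (simp add: has_field_derivative_def mult.commute[of _ "h \<bullet> G (x + s *\<^sub>R h)"])
   have "continuous_on UNIV (%s. h \<bullet> G (x + s *\<^sub>R h))" by (intro continuous_intros continuous_on_compose2[OF G]) auto
   then show "isCont (%s. h \<bullet> G (x + s *\<^sub>R h)) s" by (simp add: continuous_on_eq_continuous_at)
  qed simp
  have "ennreal \<bar>F (x + h) - F x\<bar> <= (NI s. ennreal \<bar>(h \<bullet> G (x + s *\<^sub>R h)) * indicator {0..1} s\<bar>)"
  proof (cases "integrable lborel (%s. (h \<bullet> G (x + s *\<^sub>R h)) * indicator {0..1} s)")
   case True
   then show ?thesis using integral_norm_bound_ennreal[OF True] eq by simp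
  next
   \<comment> \<open>The Bochner integral of a non-integrable function is 0, so by \<open>eq\<close>
     the left-hand side vanishes.\<close>
   case False
   then show ?thesis using eq by (simp add: not_integrable_integral_eq)
  qed
  also have "... <= (NI s. ennreal (indicator {0..1} s * (norm h * norm (G (x + s *\<^sub>R h)))) * indicator {0..1} s)"
   by (intro nn_integral_mono) (auto simp: indicator_def Cauchy_Schwarz_ineq2 intro!: ennreal_leI)
  finally have "(ennreal \<bar>F (x + h) - F x\<bar>)^2 <= (NI s. ennreal (indicator {0..1} s * (norm h * norm (G (x + s *\<^sub>R h)))) * indicator {0..1} s)^2"
   by (rule power_mono) simp
  also have "... <= (NI s. (ennreal (indicator {0..1} s * (norm h * norm (G (x + s *\<^sub>R h)))))^2) * (NI s. (indicator {0..1::real} s)^2)"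
   by (rule Cauchy_Schwarz_nn_integral) measurable
  also have "(NI s. (indicator {0..1::real} s)^2) = (NI s. indicator {0..1::real} s)"
   by (intro nn_integral_cong) (simp add: indicator_def)
  also have "... = 1" by simp
  also have "(NI s. (ennreal (indicator {0..1} s * (norm h * norm (G (x + s *\<^sub>R h)))))^2)
   = (NI s. indicator {0..1} s * (ennreal ((norm h)^2) * ennreal ((norm (G (x + s *\<^sub>R h)))^2)))"
   by (intro nn_integral_cong) (simp add: indicator_def ennreal_power power_mult_distrib ennreal_mult)
  finally show ?thesis by (simp add: ennreal_power)
 qed
 have "(NE x. (F (x + h) - F x)^2)
  <= (NI x. NI s. indicator {0..1} s * (ennreal ((norm h)^2) * ennreal ((norm (G (x + s *\<^sub>R h)))^2)))"
  by (intro nn_integral_mono pt)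
 also have "... = (NI s. NI x. indicator {0..1} s * (ennreal ((norm h)^2) * ennreal ((norm (G (x + s *\<^sub>R h)))^2)))"
  by (rule lborel_pair.Fubini') measurable
 also have "... = (NI s. indicator {0..1::real} s * (ennreal ((norm h)^2) * (NE x. (norm (G x))^2)))"
 proof (intro nn_integral_cong)
  fix s :: real
  have "(NE x. (norm (G (x + s *\<^sub>R h)))^2) = (NE x. (norm (G x))^2)"
   using nn_integral_translate[of "%x. ennreal ((norm (G x))^2)" "s *\<^sub>R h"] by (simp add: add.commute)
  then show "(NI x. indicator {0..1} s * (ennreal ((norm h)^2) * ennreal ((norm (G (x + s *\<^sub>R h)))^2)))
   = indicator {0..1} s * (ennreal ((norm h)^2) * (NE x. (norm (G x))^2))" by (simp add: nn_integral_cmult)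
 qed
 also have "... = ennreal ((norm h)^2) * (NE x. (norm (G x))^2)" by (simp add: nn_integral_multc)
 finally show ?thesis .
qed

lemma loc2_continuous:
 assumes "continuous_on UNIV f" shows "loc2 f"
proof -
 have [measurable]: "BM f" using assms by (rule borel_measurable_continuous_onI)
 have "(NI x. indicator (cball 0 r) x * ennreal ((f x)^2)) < \<infinity>" for r
 proof -
  have "compact (f ` cball 0 r)" using assms by (intro compact_continuous_image) (auto intro: continuous_on_subset)
  then obtain B where B: "!!x. x \<in> cball 0 r ==> \<bar>f x\<bar> <= B"
   using compact_imp_bounded[of "f ` cball 0 r"] unfolding bounded_iff real_norm_def by blast
  have "(NI x. indicator (cball 0 r) x * ennreal ((f x)^2)) <= (NI x. indicator (cball (0::R3) r) x * ennreal (B^2))"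
  proof (rule nn_integral_mono)
   fix x :: R3
   show "indicator (cball 0 r) x * ennreal ((f x)^2) <= indicator (cball 0 r) x * ennreal (B^2)"
   proof (cases "x \<in> cball 0 r")
    case True
    then have "(f x)^2 <= B^2" using B[of x] by (metis abs_ge_zero power2_abs power_mono)
    then show ?thesis by (intro mult_left_mono ennreal_leI) auto
   qed simp
  qed
  also have "... = ennreal (B^2) * emeasure lborel (cball (0::R3) r)" by (simp add: nn_integral_multc mult.commute)
  also have "... < \<infinity>" using emeasure_bounded_finite[OF bounded_cball, of "0::R3" r] by (simp add: ennreal_mult_less_top)
  finally show ?thesis .
 qed
 then show ?thesis by (simp add: loc2_def)
qed

text \<open>The difference is an average of F(x - z) - F(x) over |z| < ep; Jensen's inequality
  reduces it to the translation bound.\<close>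

lemma C1_mollify_bound:
 assumes F: "!!x. (F has_derivative (%v. v \<bullet> G x)) (at x)" and G: "continuous_on UNIV G" and k: "mollifier ep k"
 shows "(NE x. (cv F k x - F x)^2) <= ennreal (ep^2) * (NE x. (norm (G x))^2)"
proof -
 have cF: "continuous_on UNIV F" by (intro continuous_at_imp_continuous_on ballI has_derivative_continuous[OF F])
 have [measurable]: "BM F" using cF by (rule borel_measurable_continuous_onI)
 note [measurable] = test_fun_measurable(1)[OF mollifierD(2)[OF k]]
 note lF = loc2_continuous[OF cF]
 have pt: "ennreal ((cv F k x - F x)^2) <= (NI z. ennreal (k z) * ennreal ((F (x + (- z)) - F x)^2))" for x
 proof -
  have l1: "loc2 (%_. 1)" by (intro loc2_continuous continuous_intros)
  have "cv (%y. F y + (- F x) * 1) k x = (LI y. F y * k (x - y) - F x * (1 * k (x - y)))"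
   unfolding cv_def by (intro Bochner_Integration.integral_cong) (auto simp: algebra_simps)
  also have "... = cv F k x - F x * (LI y. 1 * k (x - y))"
   using cv_integrable[OF lF mollifierD(2)[OF k], of x] cv_integrable[OF l1 mollifierD(2)[OF k], of x] by (simp add: cv_def)
  also have "(LI y. 1 * k (x - y)) = 1" using integral_reflect[of k x] mollifierD(5)[OF k] by simp
  finally have "cv F k x - F x = cv (%y. F y + (- F x) * 1) k x" by simp
  then have "ennreal ((cv F k x - F x)^2) <= (NI y. ennreal (k (x - y)) * ennreal ((F y + (- F x) * 1)^2))"
   using cv_jensen[OF loc2_add[OF lF l1, of "- F x"] k, of x] by (simp only:)
  also have "... = (NI z. ennreal (k (x - (x - z))) * ennreal ((F (x - z) + (- F x) * 1)^2))"
   by (rule nn_integral_reflect[symmetric]) measurable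
  finally show ?thesis by simp
 qed
 have "(NE x. (cv F k x - F x)^2) <= (NI x. NI z. ennreal (k z) * ennreal ((F (x + (- z)) - F x)^2))"
  by (intro nn_integral_mono pt)
 also have "... = (NI z. NI x. ennreal (k z) * ennreal ((F (x + (- z)) - F x)^2))"
  by (rule lborel_pair.Fubini') measurable
 also have "... <= (NI z. ennreal (k z) * (ennreal (ep^2) * (NE x. (norm (G x))^2)))"
 proof (intro nn_integral_mono)
  fix z
  have "(NI x. ennreal (k z) * ennreal ((F (x + (- z)) - F x)^2)) = ennreal (k z) * (NE x. (F (x + (- z)) - F x)^2)"
   by (rule nn_integral_cmult) measurable
  also have "... <= ennreal (k z) * (ennreal ((norm (- z))^2) * (NE x. (norm (G x))^2))"
   by (intro mult_left_mono C1_translation_bound[OF F G]) auto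
  also have "... <= ennreal (k z) * (ennreal (ep^2) * (NE x. (norm (G x))^2))"
  proof (cases "norm z >= ep")
   case False
   then show ?thesis by (intro mult_left_mono mult_right_mono ennreal_leI power_mono) auto
  qed (simp add: mollifierD(4)[OF k])
  finally show "(NI x. ennreal (k z) * ennreal ((F (x + (- z)) - F x)^2)) <= ennreal (k z) * (ennreal (ep^2) * (NE x. (norm (G x))^2))" .
 qed
 also have "... = ennreal (ep^2) * (NE x. (norm (G x))^2)"
  by (simp add: nn_integral_multc mollifier_nn_integral(2)[OF k])
 finally show ?thesis .
qed

section \<open>Exchange of integrals in double convolutions and in pairings with test
  functions\<close>

lemma kernel_pair_integrable:
 assumes u: "loc2 u" and [measurable]: "case_prod H \<in> borel_measurable borel2"
  and B: "!!x y. \<bar>H x y\<bar> <= B" and r: "!!x y. norm (x::R3) > r \<or> norm (y::R3) > r ==> H x y = 0"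
 shows "integrable lborel2 (%(x, y). H x y * u y)"
proof (rule integrableI_bounded)
 have [measurable]: "BM u" using u by measurable
 show "(%(x, y). H x y * u y) \<in> borel_measurable lborel2" by measurable
 have "B >= 0" using B[of 0 0] by linarith
 define I where "I = (NI y. indicator (cball 0 r) y * ennreal \<bar>u y\<bar>)"
 have "integrable lborel (%y. u y * indicator (cball 0 r) y)" by (intro loc2_ball_integrable u) auto
 then have "(NE y. norm (u y * indicator (cball 0 r) y)) < \<infinity>" by (simp add: integrable_iff_bounded)
 also have "(NE y. norm (u y * indicator (cball 0 r) y)) = I"
  unfolding I_def by (intro nn_integral_cong) (auto simp: indicator_def)
 finally have I: "I < \<infinity>" .
 have "(\<integral>\<^sup>+p. ennreal (norm (case p of (x, y) => H x y * u y)) \<partial>lborel2)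
   = (NI x. NE y. norm (H x y * u y))" by (subst lborel.nn_integral_fst[symmetric]) (auto simp: case_prod_beta)
 also have "... <= (NI x. NI y. (ennreal B * indicator (cball (0::R3) r) x) * (indicator (cball 0 r) y * ennreal \<bar>u y\<bar>))"
 proof (intro nn_integral_mono)
  fix x y :: R3
  show "ennreal (norm (H x y * u y)) <= (ennreal B * indicator (cball 0 r) x) * (indicator (cball 0 r) y * ennreal \<bar>u y\<bar>)"
  proof (cases "norm x <= r & norm y <= r")
   case True
   have "norm (H x y * u y) <= B * \<bar>u y\<bar>" using B[of x y] by (simp add: abs_mult mult_right_mono)
   then have "ennreal (norm (H x y * u y)) <= ennreal B * ennreal \<bar>u y\<bar>"
    using \<open>B >= 0\<close> by (simp add: ennreal_mult[symmetric] ennreal_leI)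
   then show ?thesis using True by simp
  next
   case False
   then have "H x y = 0" by (intro r) auto
   then show ?thesis by simp
  qed
 qed
 also have "... = (NI x. (ennreal B * I) * indicator (cball (0::R3) r) x)"
  unfolding I_def by (intro nn_integral_cong) (subst nn_integral_cmult, auto simp: mult_ac)
 also have "... = ennreal B * I * emeasure lborel (cball (0::R3) r)" by (simp add: nn_integral_cmult)
 also have "... < \<infinity>" using I emeasure_bounded_finite[OF bounded_cball, of "0::R3" r] by (simp add: ennreal_mult_less_top)
 finally show "(\<integral>\<^sup>+p. ennreal (norm (case p of (x, y) => H x y * u y)) \<partial>lborel2) < \<infinity>" .
qed

lemma cv_cv:
 assumes u: "loc2 u" and k: "test_fun k" and l: "test_fun l"
 shows "cv (cv u k) l x = (LI z. u z * (LI y. k (y - z) * l (x - y)))"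
proof -
 note [measurable] = test_fun_measurable(1)[OF k] test_fun_measurable(1)[OF l]
 obtain r B where k': "r > 0" "B >= 0" "!!x. norm x > r ==> k x = 0" "!!x. \<bar>k x\<bar> <= B" using test_fun_support[OF k] by metis
 obtain s C where l': "s > 0" "C >= 0" "!!x. norm x > s ==> l x = 0" "!!x. \<bar>l x\<bar> <= C" using test_fun_support[OF l] by metis
 have "integrable lborel2 (%(y, z). (k (y - z) * l (x - y)) * u z)"
 proof (rule kernel_pair_integrable[OF u, of _ "B * C" "norm x + s + r"])
  fix y z :: R3
  show "\<bar>k (y - z) * l (x - y)\<bar> <= B * C" unfolding abs_mult using k' l' by (intro mult_mono) auto
  assume "norm x + s + r < norm y \<or> norm x + s + r < norm z"
  moreover have "norm y <= norm x + norm (x - y)" using norm_triangle_ineq2[of y x] by (simp add: norm_minus_commute)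
  moreover have "norm z <= norm y + norm (y - z)" using norm_triangle_ineq2[of z y] by (simp add: norm_minus_commute)
  ultimately have "norm (y - z) > r \<or> norm (x - y) > s" using k'(1) by linarith
  then show "k (y - z) * l (x - y) = 0" using k'(3) l'(3) by auto
 qed measurable
 from lborel_pair.Fubini_integral[OF this]
 have "(LI z. LI y. (k (y - z) * l (x - y)) * u z) = (LI y. LI z. (k (y - z) * l (x - y)) * u z)" .
 also have "... = (LI y. (LI z. u z * k (y - z)) * l (x - y))"
 proof (intro Bochner_Integration.integral_cong refl)
  fix y
  have "(LI z. (k (y - z) * l (x - y)) * u z) = (LI z. l (x - y) * (u z * k (y - z)))"
   by (intro Bochner_Integration.integral_cong) auto
  then show "(LI z. (k (y - z) * l (x - y)) * u z) = (LI z. u z * k (y - z)) * l (x - y)" by simp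
 qed
 finally have "cv (cv u k) l x = (LI z. LI y. (k (y - z) * l (x - y)) * u z)" by (simp add: cv_def)
 then show ?thesis by (simp add: mult.commute)
qed

lemma cv_commute:
 assumes u: "loc2 u" and k: "test_fun k" and l: "test_fun l" shows "cv (cv u k) l x = cv (cv u l) k x"
proof -
 note [measurable] = test_fun_measurable(1)[OF k] test_fun_measurable(1)[OF l]
 have "(LI y. k (y - z) * l (x - y)) = (LI y. l (y - z) * k (x - y))" for z
  using integral_reflect[of "%y. k (y - z) * l (x - y)" "x + z"] by (simp add: algebra_simps)
 then show ?thesis by (simp add: cv_cv[OF u k l] cv_cv[OF u l k])
qed

lemma integral_cv_test:
 assumes u: "loc2 u" and k: "mollifier ep k" and vp: "test_fun vp"
 shows "(LI x. cv u k x * vp x) = (LI y. u y * (LI x. k (x - y) * vp x))"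
proof -
 note kt = mollifierD(2)[OF k]
 note [measurable] = test_fun_measurable(1)[OF kt] test_fun_measurable(1)[OF vp]
 obtain r B where k': "r > 0" "B >= 0" "!!x. norm x > r ==> k x = 0" "!!x. \<bar>k x\<bar> <= B" using test_fun_support[OF kt] by metis
 obtain s C where l': "s > 0" "C >= 0" "!!x. norm x > s ==> vp x = 0" "!!x. \<bar>vp x\<bar> <= C" using test_fun_support[OF vp] by metis
 have "integrable lborel2 (%(y, z). (k (y - z) * vp y) * u z)"
 proof (rule kernel_pair_integrable[OF u, of _ "B * C" "s + r"])
  fix y z :: R3
  show "\<bar>k (y - z) * vp y\<bar> <= B * C" unfolding abs_mult using k' l' by (intro mult_mono) auto
  assume "s + r < norm y \<or> s + r < norm z"
  moreover have "norm z <= norm y + norm (y - z)" using norm_triangle_ineq2[of z y] by (simp add: norm_minus_commute)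
  ultimately have "norm (y - z) > r \<or> norm y > s" using k'(1) by linarith
  then show "k (y - z) * vp y = 0" using k'(3) l'(3) by auto
 qed measurable
 from lborel_pair.Fubini_integral[OF this]
 have "(LI z. LI y. (k (y - z) * vp y) * u z) = (LI y. LI z. (k (y - z) * vp y) * u z)" .
 also have "... = (LI y. (LI z. u z * k (y - z)) * vp y)"
 proof (intro Bochner_Integration.integral_cong refl)
  fix y
  have "(LI z. (k (y - z) * vp y) * u z) = (LI z. vp y * (u z * k (y - z)))"
   by (intro Bochner_Integration.integral_cong) auto
  then show "(LI z. (k (y - z) * vp y) * u z) = (LI z. u z * k (y - z)) * vp y" by simp
 qed
 finally show ?thesis by (simp add: cv_def mult.commute)
qed

text \<open>By Fubini the mollifier is moved onto the test function. The smoothed test functions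
  converge uniformly with supports in a fixed ball, on which \<open>u\<close> is integrable.\<close>

lemma integral_cv_test_tendsto:
 assumes u: "loc2 u" and k: "!!n. mollifier (ep n) (k n)" and ep: "ep ---> 0" and vp: "test_fun vp"
 shows "(%n. (LI x. cv u (k n) x * vp x)) ---> (LI x. u x * vp x)"
proof (rule tendstoI)
 fix e :: real assume e: "e > 0"
 note [measurable] = test_fun_measurable(1)[OF mollifierD(2)[OF k]] test_fun_measurable(1)[OF vp]
 obtain s where s: "s > 0" "!!x. norm x > s ==> vp x = 0" using test_fun_support[OF vp] by metis
 define C where "C = (LI y. \<bar>u y\<bar> * indicator (cball 0 (s + 1)) y)"
 have Ci: "integrable lborel (%y. \<bar>u y\<bar> * indicator (cball 0 (s + 1)) y)"
  using integrable_abs[OF loc2_ball_integrable[OF u, of "cball 0 (s + 1)"]] by (simp add: abs_mult)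
 have C0: "C >= 0" unfolding C_def by (intro Bochner_Integration.integral_nonneg) simp
 define e' where "e' = e / (2 * (C + 1))"
 have e': "e' > 0" using e C0 by (simp add: e'_def)
 obtain d where d: "d > 0" "!!x y. dist x y < d ==> \<bar>vp x - vp y\<bar> < e'"
  using compact_support_uniformly_continuous[OF test_fun_continuous(1)[OF vp] s(2) e'] by blast
 have "eventually (%n. ep n < min d 1) sequentially" using ep d(1) by (intro order_tendstoD) auto
 then show "eventually (%n. dist (LI x. cv u (k n) x * vp x) (LI x. u x * vp x) < e) sequentially"
 proof eventually_elim
  case (elim n)
  note kn = k[of n]
  have ik: "integrable lborel (%x. k n (x - y))" for y
  proof -
   have "(NE x. norm (k n (x - y))) < \<infinity>" using mollifier_nn_integral(4)[OF kn, of y] mollifierD(3)[OF kn] by simp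
   then show ?thesis by (intro integrableI_bounded) auto
  qed
  have Ik: "(LI x. k n (x - y)) = 1" for y
   using nn_integral_eq_integral[OF ik[of y]] mollifier_nn_integral(4)[OF kn, of y] mollifierD(3)[OF kn]
   by (simp add: ennreal_eq_1)
  have ikvp: "integrable lborel (%x. k n (x - y) * vp x)" for y
  proof -
   obtain C where C: "!!x. \<bar>vp x\<bar> <= C" using test_fun_support[OF vp] by metis
   show ?thesis
   proof (rule Bochner_Integration.integrable_bound[OF integrable_mult_left[OF ik[of y], of C]])
    have "norm (k n (x - y) * vp x) <= norm (k n (x - y) * C)" for x
     using C[of x] by (auto simp: abs_mult intro!: mult_left_mono)
    then show "AL x. norm (k n (x - y) * vp x) <= norm (k n (x - y) * C)" by blast
   qed measurable
  qed
  define ps where "ps y = (LI x. k n (x - y) * vp x)" for y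
  have ps: "\<bar>ps y - vp y\<bar> <= e' * indicator (cball 0 (s + 1)) y" for y
  proof -
   have "ps y - vp y = (LI x. k n (x - y) * vp x - k n (x - y) * vp y)" using ikvp ik Ik by (simp add: ps_def)
   also have "\<bar>...\<bar> <= (LI x. \<bar>k n (x - y) * vp x - k n (x - y) * vp y\<bar>)" by (rule integral_abs_bound)
   also have "... <= (LI x. k n (x - y) * (e' * indicator (cball 0 (s + 1)) y))"
   proof (rule integral_mono')
    show "integrable lborel (%x. k n (x - y) * (e' * indicator (cball 0 (s + 1)) y))"
     by (rule integrable_mult_left[OF ik])
    fix x
    show "0 <= k n (x - y) * (e' * indicator (cball 0 (s + 1)) y)" using mollifierD(3)[OF kn] e' by simp
    show "\<bar>k n (x - y) * vp x - k n (x - y) * vp y\<bar> <= k n (x - y) * (e' * indicator (cball 0 (s + 1)) y)"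
    proof (cases "norm (x - y) >= ep n")
     case True
     then show ?thesis using mollifierD(4)[OF kn] by simp
    next
     case False
     have "\<bar>vp x - vp y\<bar> <= e' * indicator (cball 0 (s + 1)) y"
     proof (cases "norm y <= s + 1")
      case True
      then show ?thesis using d(2)[of x y] False elim by (simp add: dist_norm less_imp_le)
     next
      case F: False
      have "norm y <= norm x + norm (x - y)" using norm_triangle_ineq2[of y x] by (simp add: norm_minus_commute)
      then have "norm x > s" using F False elim by linarith
      then show ?thesis using F s by simp
     qed
     then show ?thesis using mollifierD(3)[OF kn] by (simp add: abs_mult mult_left_mono flip: right_diff_distrib)
    qed
   qed
   also have "... = e' * indicator (cball 0 (s + 1)) y" using Ik by simp
   finally show ?thesis .
  qed
  have [measurable]: "BM ps" unfolding ps_def by measurable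
  have [measurable]: "BM u" using u by measurable
  have i1: "integrable lborel (%y. u y * vp y)" by (rule loc2_test_integrable[OF u vp])
  have i2: "integrable lborel (%y. u y * (ps y - vp y))"
  proof (rule Bochner_Integration.integrable_bound[OF integrable_mult_left[OF Ci, of e']])
   show "AE y in lborel. norm (u y * (ps y - vp y)) <= norm (\<bar>u y\<bar> * indicator (cball 0 (s + 1)) y * e')"
   proof (rule AE_I2)
    fix y
    have "\<bar>u y\<bar> * \<bar>ps y - vp y\<bar> <= \<bar>u y\<bar> * (e' * indicator (cball 0 (s + 1)) y)" using ps[of y] by (intro mult_left_mono) auto
    then show "norm (u y * (ps y - vp y)) <= norm (\<bar>u y\<bar> * indicator (cball 0 (s + 1)) y * e')"
     using e' by (simp add: abs_mult mult_ac)
   qed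
  qed measurable
  have "(LI x. cv u (k n) x * vp x) = (LI y. u y * ps y)" unfolding ps_def by (rule integral_cv_test[OF u kn vp])
  also have "... = (LI y. u y * vp y + u y * (ps y - vp y))"
   by (intro Bochner_Integration.integral_cong) (auto simp: algebra_simps)
  also have "... = (LI y. u y * vp y) + (LI y. u y * (ps y - vp y))" using i1 i2 by simp
  finally have "dist (LI x. cv u (k n) x * vp x) (LI x. u x * vp x) = \<bar>(LI y. u y * (ps y - vp y))\<bar>"
   by (simp add: dist_real_def)
  also have "... <= (LI y. \<bar>u y * (ps y - vp y)\<bar>)" by (rule integral_abs_bound)
  also have "... <= (LI y. \<bar>u y\<bar> * indicator (cball 0 (s + 1)) y * e')"
  proof (rule integral_mono[OF integrable_abs[OF i2] integrable_mult_left[OF Ci]])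
   fix y
   have "\<bar>u y\<bar> * \<bar>ps y - vp y\<bar> <= \<bar>u y\<bar> * (e' * indicator (cball 0 (s + 1)) y)" using ps[of y] by (intro mult_left_mono) auto
   then show "\<bar>u y * (ps y - vp y)\<bar> <= \<bar>u y\<bar> * indicator (cball 0 (s + 1)) y * e'" by (simp add: abs_mult mult_ac)
  qed
  also have "... = C * e'" by (simp add: C_def)
  also have "... < e"
  proof -
   have "C * e < (2 * (C + 1)) * e" using C0 e by (intro mult_strict_right_mono) auto
   then show ?thesis using C0 by (simp add: e'_def field_simps)
  qed
  finally show ?case .
 qed
qed

lemma sq_diff_triangle: "ennreal ((a - c)^2) <= 2 * ennreal ((a - b)^2) + 2 * ennreal ((b - c)^2)"
proof -
 have "0 <= ((a - b) - (b - c))^2" by simp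
 then have "(a - c)^2 <= 2 * (a - b)^2 + 2 * (b - c)^2" by (simp add: power2_eq_square algebra_simps)
 from ennreal_le_lincomb[OF this] show ?thesis by simp
qed

lemma nn_integral_sq_diff_triangle:
 fixes a b c :: "'a => real"
 assumes [measurable]: "a \<in> borel_measurable M" "b \<in> borel_measurable M" "c \<in> borel_measurable M"
 shows "(\<integral>\<^sup>+x. ennreal ((a x - c x)^2) \<partial>M) <= 2 * (\<integral>\<^sup>+x. ennreal ((a x - b x)^2) \<partial>M) + 2 * (\<integral>\<^sup>+x. ennreal ((b x - c x)^2) \<partial>M)"
proof -
 have "(\<integral>\<^sup>+x. ennreal ((a x - c x)^2) \<partial>M) <= (\<integral>\<^sup>+x. 2 * ennreal ((a x - b x)^2) + 2 * ennreal ((b x - c x)^2) \<partial>M)"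
  by (intro nn_integral_mono sq_diff_triangle)
 then show ?thesis by (simp add: nn_integral_add nn_integral_cmult)
qed

text \<open>Both mollifications are compared with the double one, which by \<open>cv_commute\<close>
  is a mollification of either. The inner functions are continuously differentiable with gradients
  bounded by that of \<open>u\<close>, so \<open>C1_mollify_bound\<close> applies twice; the factors
  2 come from the triangle inequality for squares.\<close>

lemma cv_diff_bound:
 assumes u: "wpair u g" and k: "mollifier ep k" and l: "mollifier de l"
 shows "(NE x. (cv u k x - cv u l x)^2) <= ennreal (2 * ep^2 + 2 * de^2) * (NE x. (norm (g x))^2)"
proof -
 note ul = wpair_loc2[OF u]
 note kt = mollifierD(2)[OF k] note lt = mollifierD(2)[OF l]
 have [measurable]: "BM (cv u k)" "BM (cv u l)" "BM (cv (cv u k) l)"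
  by (intro cv_measurable ul kt lt loc2_continuous cv_continuous)+
 define A where "A = (NE x. (norm (g x))^2)"
 have gb: "(NE x. (norm (cvv g k x))^2) <= A" if "mollifier ep k" for ep k
  using cvv_L2_bound[OF u that, of UNIV UNIV] by (simp add: A_def)
 have b1: "(NE x. (cv (cv u k) l x - cv u k x)^2) <= ennreal (de^2) * A"
  by (rule order_trans[OF C1_mollify_bound[OF cv_gradient[OF u k] cvv_continuous[OF u k] l]])
   (intro mult_left_mono gb[OF k], simp)
 have b2: "(NE x. (cv (cv u l) k x - cv u l x)^2) <= ennreal (ep^2) * A"
  by (rule order_trans[OF C1_mollify_bound[OF cv_gradient[OF u l] cvv_continuous[OF u l] k]])
   (intro mult_left_mono gb[OF l], simp)
 have c: "cv (cv u l) k = cv (cv u k) l" using cv_commute[OF ul kt lt] by (simp add: fun_eq_iff)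
 have "(NE x. (cv u k x - cv u l x)^2)
  <= 2 * (NE x. (cv u k x - cv (cv u k) l x)^2) + 2 * (NE x. (cv (cv u k) l x - cv u l x)^2)"
  by (rule nn_integral_sq_diff_triangle) measurable
 also have "... <= 2 * (ennreal (de^2) * A) + 2 * (ennreal (ep^2) * A)"
  using b1 b2 unfolding c by (intro add_mono mult_left_mono) (auto simp: power2_commute)
 also have "... = ennreal (2 * ep^2 + 2 * de^2) * A" by (simp add: ennreal_mult distrib_right mult.assoc add.commute)
 finally show ?thesis unfolding A_def .
qed

text \<open>\<open>u\<close> need not lie in L^2, but the mollifications differ from each other by
  L^2 functions and are Cauchy. Their limit is identified with \<open>u\<close> by testing: against
  every test function the sequence converges both to the limit and to \<open>u\<close>.\<close>

lemma wpair_mollify_seq: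
 assumes u: "wpair u g"
 obtains ep k where "!!n. mollifier (ep n) (k n)" "ep ---> 0" "!!n. ep n <= 1" "AL x. (%n. cv u (k n) x) ---> u x"
  "(%n. (NE x. (cv u (k n) x - u x)^2)) ---> 0"
proof -
 note ul = wpair_loc2[OF u]
 define ep where "ep n = inverse (real (Suc n))" for n
 have "EX k. mollifier (ep n) k" for n by (rule mollifier_exists) (simp add: ep_def)
 then obtain k where k: "!!n. mollifier (ep n) (k n)" by metis
 have ep: "ep ---> 0" unfolding ep_def by (rule LIMSEQ_inverse_real_of_nat)
 have ep1: "ep n <= 1" for n unfolding ep_def by (simp add: field_simps)
 have ep0: "ep n >= 0" for n unfolding ep_def by simp
 have m[measurable]: "BM (cv u (k n))" for n by (intro cv_measurable ul mollifierD(2)[OF k])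
 have [measurable]: "BM u" using u by measurable
 define A where "A = enn2real (NE x. (norm (g x))^2)"
 have A: "(NE x. (norm (g x))^2) = ennreal A" using u by (simp add: A_def wpair_def less_top)
 have A0: "A >= 0" by (simp add: A_def)
 have bd: "(NE x. (cv u (k m) x - cv u (k n) x)^2) <= ennreal ((2 * (ep m)^2 + 2 * (ep n)^2) * A)" for m n
  using cv_diff_bound[OF u k k, of m n] A0 by (simp add: A ennreal_mult)
 have "EX N. ALL m>=N. ALL n>=N. (NE x. (norm (cv u (k m) x - cv u (k n) x))^2) <= ennreal e" if "e > 0" for e
 proof -
  have "(%n. 4 * (ep n)^2 * A) ---> 4 * 0^2 * A" by (intro tendsto_intros ep)
  then have "eventually (%n. 4 * (ep n)^2 * A < e) sequentially" using that by (intro order_tendstoD(2)) auto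
  then obtain N where N: "!!n. n >= N ==> 4 * (ep n)^2 * A < e" by (auto simp: eventually_sequentially)
  have "(NE x. (norm (cv u (k m) x - cv u (k n) x))^2) <= ennreal e" if "m >= N" "n >= N" for m n
  proof -
   have "(2 * (ep m)^2 + 2 * (ep n)^2) * A <= e" using N[OF that(1)] N[OF that(2)] by (simp add: algebra_simps)
   from order_trans[OF bd ennreal_leI[OF this]] show ?thesis by (simp only: real_norm_def power2_abs)
  qed
  then show ?thesis by blast
 qed
 then obtain U r where U[measurable]: "U \<in> borel_measurable lborel" and r: "strict_mono r"
  and lim: "AL x. (%n. cv u (k (r n)) x) ---> U x" and L2: "(%n. (NE x. (norm (cv u (k n) x - U x))^2)) ---> 0"
  by (rule L2_complete[rotated]) measurable
 have L2': "(%n. (NE x. (cv u (k n) x - U x)^2)) ---> 0" using L2 by simp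
 \<comment> \<open>A late mollification differs from \<open>U\<close> by an L^2 function and is
   itself continuous, so \<open>U\<close> is locally square integrable and the fundamental lemma can
   be applied to u - U.\<close>
 have dl: "EX N. ALL n>=N. loc2 (%x. cv u (k n) x - U x)"
 proof -
  have "eventually (%n. (NE x. (cv u (k n) x - U x)^2) < 1) sequentially" using L2' by (rule order_tendstoD) simp
  then obtain N where N: "!!n. n >= N ==> (NE x. (cv u (k n) x - U x)^2) < 1" by (auto simp: eventually_sequentially)
  have "loc2 (%x. cv u (k n) x - U x)" if "n >= N" for n
   by (rule loc2I_global) (use N[OF that] in \<open>auto intro: less_trans[of _ 1]\<close>)
  then show ?thesis by blast
 qed
 then obtain N where N: "!!n. n >= N ==> loc2 (%x. cv u (k n) x - U x)" by blast
 have lcv: "loc2 (cv u (k n))" for n by (intro loc2_continuous cv_continuous ul mollifierD(2)[OF k])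
 have lU: "loc2 U" using loc2_add[OF lcv N[of N], of N "-1"] by simp
 have lD: "loc2 (%x. u x - U x)" using loc2_add[OF ul lU, of "-1"] by simp
 have "AL x. u x - U x = 0"
 proof (rule fundamental_lemma[OF lD])
  fix vp assume vp: "test_fun vp"
  note [measurable] = test_fun_measurable(1)[OF vp]
  have t1: "(%n. (LI x. cv u (k n) x * vp x)) ---> (LI x. u x * vp x)"
   by (rule integral_cv_test_tendsto[OF ul k ep vp])
  have vp2: "(NE x. (vp x)^2) < top"
  proof -
   have "integrable lborel (%x. vp x * vp x)"
    by (intro loc2_test_integrable(1)[OF loc2_continuous[OF test_fun_continuous(1)[OF vp]] vp])
   then have "integrable lborel (%x. (vp x)^2)" by (simp add: power2_eq_square)
   from nn_integral_eq_integral[OF this] show ?thesis by simp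
  qed
  have t2: "(%n. (LI x. cv u (k n) x * vp x)) ---> (LI x. U x * vp x)"
  proof -
   have z: "(%n. (NE x. (cv u (k n) x - U x)^2) * (NE x. (vp x)^2)) ---> 0"
    using ennreal_tendsto_cmult[OF vp2 L2'] by (simp add: mult.commute)
   have "(%n. ennreal ((LI x. (cv u (k n) x - U x) * vp x)^2)) ---> 0"
   proof (rule tendsto_sandwich[OF _ _ tendsto_const z])
    show "eventually (%n. ennreal ((LI x. (cv u (k n) x - U x) * vp x)^2) <= (NE x. (cv u (k n) x - U x)^2) * (NE x. (vp x)^2)) sequentially"
    proof (rule eventually_sequentiallyI[of N])
     fix n assume n: "n >= N"
     have "ennreal \<bar>(LI x. (cv u (k n) x - U x) * vp x)\<bar> <= (NI x. ennreal \<bar>cv u (k n) x - U x\<bar> * ennreal \<bar>vp x\<bar>)"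
      using integral_norm_bound_ennreal[OF loc2_test_integrable(1)[OF N[OF n] vp]] by (simp add: abs_mult ennreal_mult)
     then have "(ennreal \<bar>(LI x. (cv u (k n) x - U x) * vp x)\<bar>)^2 <= (NI x. ennreal \<bar>cv u (k n) x - U x\<bar> * ennreal \<bar>vp x\<bar>)^2"
      by (rule power_mono) simp
     also have "... <= (NI x. (ennreal \<bar>cv u (k n) x - U x\<bar>)^2) * (NI x. (ennreal \<bar>vp x\<bar>)^2)"
      by (rule Cauchy_Schwarz_nn_integral) measurable
     finally show "ennreal ((LI x. (cv u (k n) x - U x) * vp x)^2) <= (NE x. (cv u (k n) x - U x)^2) * (NE x. (vp x)^2)"
      by (simp add: ennreal_power)
    qed
   qed simp
   then have "(%n. (LI x. (cv u (k n) x - U x) * vp x)^2) ---> 0" by (subst (asm) ennreal_tendsto_0_iff) auto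
   from tendsto_real_sqrt[OF this] have "(%n. (LI x. (cv u (k n) x - U x) * vp x)) ---> 0"
    by (simp add: tendsto_rabs_zero_iff)
   then have "(%n. (LI x. (cv u (k n) x - U x) * vp x) + (LI x. U x * vp x)) ---> 0 + (LI x. U x * vp x)"
    by (intro tendsto_intros)
   moreover have "(LI x. (cv u (k n) x - U x) * vp x) + (LI x. U x * vp x) = (LI x. cv u (k n) x * vp x)" for n
    using loc2_test_integrable(1)[OF lcv vp, of n] loc2_test_integrable(1)[OF lU vp] by (simp add: left_diff_distrib)
   ultimately show ?thesis by simp
  qed
  have "(LI x. u x * vp x) = (LI x. U x * vp x)" using LIMSEQ_unique[OF t1 t2] .
  then show "(LI x. (u x - U x) * vp x) = 0"
   using loc2_test_integrable(1)[OF ul vp] loc2_test_integrable(1)[OF lU vp] by (simp add: left_diff_distrib)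
 qed
 then have eq: "AL x. U x = u x" by eventually_elim simp
 have F1: "AL x. (%n. cv u (k (r n)) x) ---> u x" using lim eq by eventually_elim simp
 have "(%n. (NE x. (cv u (k n) x - u x)^2)) ---> 0"
 proof -
  have "(NE x. (cv u (k n) x - u x)^2) = (NE x. (cv u (k n) x - U x)^2)" for n
   by (intro nn_integral_cong_AE) (use eq in eventually_elim, simp)
  then show ?thesis using L2' by simp
 qed
 from LIMSEQ_subseq_LIMSEQ[OF this r]
 have F2: "(%n. (NE x. (cv u (k (r n)) x - u x)^2)) ---> 0" by (simp add: o_def)
 have F3: "(%n. ep (r n)) ---> 0" using LIMSEQ_subseq_LIMSEQ[OF ep r] by (simp add: o_def)
 show ?thesis by (rule that[of "%n. ep (r n)" "%n. k (r n)", OF k F3 ep1 F1 F2])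
qed

text \<open>The second width in \<open>cv_diff_bound\<close> is sent to 0 by Fatou's lemma. The
  error depends on \<open>u\<close> only through its gradient, so it is uniform along sequences with
  bounded Dirichlet integral; compactness rests on this.\<close>

lemma cv_approx:
 assumes u: "wpair u g" and k: "mollifier ep k"
 shows "(NE x. (cv u k x - u x)^2) <= ennreal (2 * ep^2) * (NE x. (norm (g x))^2)"
proof -
 obtain de l where l: "!!n. mollifier (de n) (l n)" "de ---> 0" "!!n. de n <= 1" "AL x. (%n. cv u (l n) x) ---> u x"
  "(%n. (NE x. (cv u (l n) x - u x)^2)) ---> 0" by (rule wpair_mollify_seq[OF u], rule that)
 have [measurable]: "BM u" using u by measurable
 have [measurable]: "BM (cv u k)" "BM (cv u (l n))" for n
  by (intro cv_measurable wpair_loc2[OF u] mollifierD(2)[OF k] mollifierD(2)[OF l(1)])+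
 have fin: "(NE x. (norm (g x))^2) < top" using u by (simp add: wpair_def)
 have "(NE x. (cv u k x - u x)^2) = (NI x. liminf (%n. ennreal ((cv u k x - cv u (l n) x)^2)))"
 proof (rule nn_integral_cong_AE, use l(4) in eventually_elim)
  case (elim x)
  then have "(%n. ennreal ((cv u k x - cv u (l n) x)^2)) ---> ennreal ((cv u k x - u x)^2)"
   by (intro tendsto_intros tendsto_ennrealI)
  from lim_imp_Liminf[OF trivial_limit_sequentially this] show ?case by simp
 qed
 also have "... <= liminf (%n. (NE x. (cv u k x - cv u (l n) x)^2))" by (intro nn_integral_liminf) simp
 also have "... <= liminf (%n. ennreal (2 * ep^2 + 2 * (de n)^2) * (NE x. (norm (g x))^2))"
  by (intro Liminf_mono always_eventually allI cv_diff_bound[OF u k l(1)])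
 also have "... = ennreal (2 * ep^2) * (NE x. (norm (g x))^2)"
 proof (rule lim_imp_Liminf[OF trivial_limit_sequentially])
  have "(%n. ennreal (2 * ep^2 + 2 * (de n)^2)) ---> ennreal (2 * ep^2 + 2 * 0^2)"
   by (intro tendsto_intros tendsto_ennrealI l(2))
  then have "(%n. (NE x. (norm (g x))^2) * ennreal (2 * ep^2 + 2 * (de n)^2)) ---> (NE x. (norm (g x))^2) * ennreal (2 * ep^2 + 2 * 0^2)"
   by (intro ennreal_tendsto_cmult fin)
  then show "(%n. ennreal (2 * ep^2 + 2 * (de n)^2) * (NE x. (norm (g x))^2)) ---> ennreal (2 * ep^2) * (NE x. (norm (g x))^2)"
   by (simp add: mult.commute)
 qed
 finally show ?thesis .
qed

section \<open>The Sobolev inequality\<close>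

definition vec3 :: "real => real => real => R3" where
 "vec3 x y z = x *\<^sub>R axis 1 1 + y *\<^sub>R axis 2 1 + z *\<^sub>R axis 3 1"

lemma vec3_nth [simp]: "vec3 x y z $ 1 = x" "vec3 x y z $ 2 = y" "vec3 x y z $ 3 = z"
 by (simp_all add: vec3_def axis_def)

lemma vec3_measurable [measurable (raw)]:
 assumes [measurable]: "f \<in> borel_measurable N" "g \<in> borel_measurable N" "h \<in> borel_measurable N"
 shows "(%w. vec3 (f w) (g w) (h w)) \<in> borel_measurable N" unfolding vec3_def by measurable

lemma lborel_vec3:
 "lborel = distr (lborel \<Otimes>\<^sub>M lborel2) borel (%(x, y, z). vec3 x y z)"
proof (rule lborel_eqI)
 fix l u :: R3 assume lu: "!!b. b \<in> Basis ==> l \<bullet> b <= u \<bullet> b"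
 have lu': "l $ i <= u $ i" for i using lu[of "axis i 1"] by (auto simp: inner_axis)
 have [simp]: "sigma_finite_measure (lborel \<Otimes>\<^sub>M (lborel :: real measure) :: (real \<times> real) measure)"
  unfolding lborel_prod by (rule sigma_finite_lborel)
 have "(%(x, y, z). vec3 x y z) -` box l u \<inter> space (lborel \<Otimes>\<^sub>M lborel2)
   = {l $ 1<..<u $ 1} \<times> ({l $ 2<..<u $ 2} \<times> {l $ 3<..<u $ 3})"
  by (auto simp: mem_box_cart forall_3 space_pair_measure)
 then have "emeasure (distr (lborel \<Otimes>\<^sub>M lborel2) borel (%(x, y, z). vec3 x y z)) (box l u)
  = emeasure (lborel \<Otimes>\<^sub>M lborel2) ({l $ 1<..<u $ 1} \<times> ({l $ 2<..<u $ 2} \<times> {l $ 3<..<u $ 3}))"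
  by (subst emeasure_distr) auto
 also have "... = emeasure lborel {l $ 1<..<u $ 1} * (emeasure lborel {l $ 2<..<u $ 2} * emeasure lborel {l $ 3<..<u $ 3})"
  by (subst sigma_finite_measure.emeasure_pair_measure_Times) (auto simp: lborel.emeasure_pair_measure_Times)
 also have "... = ennreal ((u $ 1 - l $ 1) * ((u $ 2 - l $ 2) * (u $ 3 - l $ 3)))"
  using lu' by (simp add: ennreal_mult)
 also have "(u $ 1 - l $ 1) * ((u $ 2 - l $ 2) * (u $ 3 - l $ 3)) = (\<Prod>i\<in>UNIV. (u - l) $ i)" unfolding UNIV_3 by simp
 also have "... = (\<Prod>b\<in>Basis. (u - l) \<bullet> b)"
 proof -
  have B: "(Basis :: R3 set) = range (%i. axis i 1)" by (auto simp: Basis_vec_def)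
  show ?thesis unfolding B by (subst prod.reindex) (auto simp: inj_on_def axis_eq_axis inner_axis)
 qed
 finally show "emeasure (distr (lborel \<Otimes>\<^sub>M lborel2) borel (%(x, y, z). vec3 x y z)) (box l u) = (\<Prod>b\<in>Basis. (u - l) \<bullet> b)" .
qed simp

lemma nn_integral_vec3:
 fixes f :: "R3 => ennreal"
 assumes [measurable]: "BM f" shows "(NI v. f v) = (NI x. NI y. NI z. f (vec3 x y z))"
proof -
 have s: "sigma_finite_measure (lborel \<Otimes>\<^sub>M (lborel :: real measure) :: (real \<times> real) measure)"
  unfolding lborel_prod by (rule sigma_finite_lborel)
 have "(NI v. f v) = (\<integral>\<^sup>+p. f (case p of (x, y, z) => vec3 x y z) \<partial>(lborel \<Otimes>\<^sub>M lborel2))"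
  by (subst lborel_vec3, subst nn_integral_distr) auto
 also have "... = (NI x. \<integral>\<^sup>+q. f (case (x, q) of (x, y, z) => vec3 x y z) \<partial>lborel2)"
  by (rule sigma_finite_measure.nn_integral_fst[OF s, symmetric]) measurable
 also have "... = (NI x. NI y. NI z. f (vec3 x y z))"
  by (intro nn_integral_cong, subst lborel.nn_integral_fst[symmetric]) auto
 finally show ?thesis .
qed

text \<open>With the value infinity at infinity, squaring inverts it unconditionally; the line
  integrals whose roots are taken below may be infinite.\<close>

definition esqrt :: "ennreal => ennreal" where
 "esqrt t = (if t = \<infinity> then \<infinity> else ennreal (sqrt (enn2real t)))"

lemma esqrt_sq: "(esqrt t)^2 = t"
 by (cases t) (auto simp: esqrt_def ennreal_power)

lemma esqrt_measurable[measurable (raw)]: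
 assumes [measurable]: "f \<in> borel_measurable M" shows "(%x. esqrt (f x)) \<in> borel_measurable M"
 unfolding esqrt_def by measurable

lemma power2_le_imp_le_ennreal: "a^2 <= b^2 ==> a <= (b::ennreal)"
proof (rule ccontr)
 assume "a^2 <= b^2" "~ a <= b"
 then have "b < a" by simp
 then obtain r where r: "b = ennreal r" "r >= 0" by (cases b) auto
 have "b^2 < a^2"
 proof (cases a)
  case (real s)
  then show ?thesis using \<open>b < a\<close> r by (auto simp: ennreal_power ennreal_less_iff intro!: power_strict_mono)
 next
  case top
  then show ?thesis using r by (simp add: ennreal_power power2_eq_square[of top])
 qed
 then show False using \<open>a^2 <= b^2\<close> by simp
qed

lemma le_esqrtI: "a^2 <= b ==> a <= esqrt b"
 by (rule power2_le_imp_le_ennreal) (simp add: esqrt_sq)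

text \<open>Cauchy-Schwarz first in (y,z) for fixed x, where the factor with \<open>P\<close> does
  not depend on x, and then in x. Squares are kept on the right since the factors will be square
  roots of line integrals.\<close>

lemma Loomis_Whitney:
 fixes P Q R :: "real => real => ennreal"
 assumes [measurable]: "case_prod P \<in> borel_measurable borel2" "case_prod Q \<in> borel_measurable borel2"
  "case_prod R \<in> borel_measurable borel2" shows "(NI x. NI y. NI z. P y z * (Q x z * R x y))^2
  <= (NI y. NI z. (P y z)^2) * ((NI x. NI z. (Q x z)^2) * (NI x. NI y. (R x y)^2))"
proof -
 define A where "A = (NI y. NI z. (P y z)^2)"
 define q where "q x = (NI z. (Q x z)^2)" for x
 define r where "r x = (NI y. (R x y)^2)" for x
 have [measurable]: "BM q" "BM r" unfolding q_def r_def by measurable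
 have inner: "(NI y. NI z. P y z * (Q x z * R x y)) <= esqrt A * (esqrt (q x) * esqrt (r x))" for x
 proof (rule power2_le_imp_le_ennreal)
  have "(NI y. NI z. P y z * (Q x z * R x y)) = (\<integral>\<^sup>+p. P (fst p) (snd p) * (Q x (snd p) * R x (fst p)) \<partial>lborel2)"
   by (subst lborel.nn_integral_fst[symmetric]) auto
  also have "...^2 <= (\<integral>\<^sup>+p. (P (fst p) (snd p))^2 \<partial>lborel2) * (\<integral>\<^sup>+p. (Q x (snd p) * R x (fst p))^2 \<partial>lborel2)"
   by (rule Cauchy_Schwarz_nn_integral) measurable
  also have "(\<integral>\<^sup>+p. (P (fst p) (snd p))^2 \<partial>lborel2) = A"
   unfolding A_def by (subst lborel.nn_integral_fst[symmetric]) auto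
  also have "(\<integral>\<^sup>+p. (Q x (snd p) * R x (fst p))^2 \<partial>lborel2) = (NI y. NI z. (Q x z)^2 * (R x y)^2)"
   by (subst lborel.nn_integral_fst[symmetric]) (auto simp: power_mult_distrib)
  also have "... = q x * r x" unfolding q_def r_def by (simp add: nn_integral_multc nn_integral_cmult)
  also have "A * (q x * r x) = (esqrt A * (esqrt (q x) * esqrt (r x)))^2" by (simp add: power_mult_distrib esqrt_sq)
  finally show "(NI y. NI z. P y z * (Q x z * R x y))^2 <= (esqrt A * (esqrt (q x) * esqrt (r x)))^2" .
 qed
 have "(NI x. NI y. NI z. P y z * (Q x z * R x y)) <= (NI x. esqrt A * (esqrt (q x) * esqrt (r x)))"
  by (intro nn_integral_mono inner)
 also have "... = esqrt A * (NI x. esqrt (q x) * esqrt (r x))" by (rule nn_integral_cmult) measurable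
 finally have "(NI x. NI y. NI z. P y z * (Q x z * R x y))^2 <= (esqrt A * (NI x. esqrt (q x) * esqrt (r x)))^2"
  by (rule power_mono) simp
 also have "... = A * (NI x. esqrt (q x) * esqrt (r x))^2" by (simp add: power_mult_distrib esqrt_sq)
 also have "... <= A * ((NI x. (esqrt (q x))^2) * (NI x. (esqrt (r x))^2))"
  by (intro mult_left_mono Cauchy_Schwarz_nn_integral) auto
 finally show ?thesis by (simp add: A_def q_def r_def esqrt_sq)
qed

lemma line_bound:
 fixes W :: "R3 => real"
 assumes W: "!!x. (W has_derivative (%v. v \<bullet> D x)) (at x)" and D: "continuous_on UNIV D"
  and R: "!!x. norm x > R ==> W x = 0" and e: "norm e = 1"
 shows "ennreal \<bar>W x\<bar> <= (NI t. ennreal \<bar>e \<bullet> D (x + t *\<^sub>R e)\<bar>)"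
proof -
 have [measurable]: "BM D" using D by (rule borel_measurable_continuous_onI)
 \<comment> \<open>So large that x - T e lies outside the support; the fundamental theorem of
   calculus then starts from the value 0.\<close>
 define T where "T = norm x + \<bar>R\<bar> + 1"
 have T: "T > 0" unfolding T_def by (smt (verit) norm_ge_zero)
 have "norm (T *\<^sub>R e) <= norm (x + (-T) *\<^sub>R e) + norm x" using norm_triangle_ineq4[of "x + (-T) *\<^sub>R e" x] by simp
 then have "norm (x + (-T) *\<^sub>R e) > R" using T e by (simp add: T_def)
 then have W0: "W (x + (-T) *\<^sub>R e) = 0" by (rule R)
 have eq: "(LI s. (e \<bullet> D (x + s *\<^sub>R e)) * indicator {-T..0} s) = W (x + 0 *\<^sub>R e) - W (x + (-T) *\<^sub>R e)"
 proof (rule integral_FTC_Icc_real[where F="%s. W (x + s *\<^sub>R e)"])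
  fix s :: real
  have "((%s. x + s *\<^sub>R e) has_derivative (%t. t *\<^sub>R e)) (at s)" by (auto intro!: derivative_eq_intros)
  from has_derivative_compose[OF this W]
  show "((%s. W (x + s *\<^sub>R e)) has_real_derivative e \<bullet> D (x + s *\<^sub>R e)) (at s)"
   by (simp add: has_field_derivative_def mult.commute[of _ "e \<bullet> D (x + s *\<^sub>R e)"])
  have "continuous_on UNIV (%s. e \<bullet> D (x + s *\<^sub>R e))" by (intro continuous_intros continuous_on_compose2[OF D]) auto
  then show "isCont (%s. e \<bullet> D (x + s *\<^sub>R e)) s" by (simp add: continuous_on_eq_continuous_at)
 qed (use T in simp)
 then have eq': "W x = (LI s. (e \<bullet> D (x + s *\<^sub>R e)) * indicator {-T..0} s)" by (simp only: W0 scale_zero_left add_0_right diff_0_right)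
 have "ennreal \<bar>W x\<bar> <= (NI s. ennreal \<bar>(e \<bullet> D (x + s *\<^sub>R e)) * indicator {-T..0} s\<bar>)"
 proof (cases "integrable lborel (%s. (e \<bullet> D (x + s *\<^sub>R e)) * indicator {-T..0} s)")
  case True
  then show ?thesis unfolding eq' using integral_norm_bound_ennreal[OF True] by simp
 next
  case False
  then show ?thesis unfolding eq' by (simp add: not_integrable_integral_eq)
 qed
 also have "... <= (NI s. ennreal \<bar>e \<bullet> D (x + s *\<^sub>R e)\<bar>)"
  by (intro nn_integral_mono ennreal_leI) (auto simp: indicator_def)
 finally show ?thesis .
qed

lemma nn_integral_real_shift:
 fixes f :: "real => ennreal"
 assumes [measurable]: "BM f" shows "(NI t. f (c + t)) = (NI t. f t)"
 by (subst (2) lborel_distr_plus[of c, symmetric]) (simp add: nn_integral_distr)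

text \<open>Gagliardo's argument applied to f^4. Let X be the integral of f^6, Y that of |G|^2 and T
  that of 4 |f|^3 |G|, the gradient norm of f^4. Each of the three line integrals of this gradient
  norm bounds f^4, so f^6 is at most the product of their square roots, and Loomis-Whitney gives X^2
  <= T^3. Cauchy-Schwarz gives T^2 <= 16 X Y. Together X^4 <= (16 X Y)^3, whence 4096 =
  16^3.\<close>

lemma Gagliardo_Nirenberg_Sobolev:
 fixes f :: "R3 => real"
 assumes f: "!!x. (f has_derivative (%v. v \<bullet> G x)) (at x)" and G: "continuous_on UNIV G"
  and R: "!!x. norm x > R ==> f x = 0" shows "(NE x. (f x)^6) <= 4096 * (NE x. (norm (G x))^2)^3"
proof -
 have cf: "continuous_on UNIV f" by (intro continuous_at_imp_continuous_on ballI has_derivative_continuous[OF f])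
 have [measurable]: "BM f" "BM G" using cf G by (auto intro: borel_measurable_continuous_onI)
 define D where "D x = (4 * (f x)^3) *\<^sub>R G x" for x
 have D: "((%x. (f x)^4) has_derivative (%v. v \<bullet> D x)) (at x)" for x
  by (rule has_derivative_eq_rhs[OF has_derivative_power[OF f]]) (simp add: D_def fun_eq_iff)
 have cD: "continuous_on UNIV D" unfolding D_def by (intro continuous_intros cf G)
 have [measurable]: "BM D" using cD by (rule borel_measurable_continuous_onI)
 define N where "N v = ennreal (norm (D v))" for v
 have [measurable]: "BM N" unfolding N_def by measurable
 have lb: "ennreal ((f v)^4) <= (NI t. N (v + t *\<^sub>R e))" if e: "norm e = 1" for e v
 proof -
  have "ennreal ((f v)^4) <= (NI t. ennreal \<bar>e \<bullet> D (v + t *\<^sub>R e)\<bar>)"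
   using line_bound[where W="%x. (f x)^4", OF D cD _ e, of R v] R by simp
  also have "... <= (NI t. N (v + t *\<^sub>R e))"
   unfolding N_def using e Cauchy_Schwarz_ineq2[of e] by (intro nn_integral_mono ennreal_leI) (metis mult_1)
  finally show ?thesis .
 qed
 define P where "P y z = (NI x. N (vec3 x y z))" for y z
 define Q where "Q x z = (NI y. N (vec3 x y z))" for x z
 define S where "S x y = (NI z. N (vec3 x y z))" for x y
 have [measurable]: "case_prod P \<in> borel_measurable borel2" "case_prod Q \<in> borel_measurable borel2"
  "case_prod S \<in> borel_measurable borel2" unfolding P_def Q_def S_def by measurable
 have b: "ennreal ((f (vec3 x y z))^4) <= P y z" "ennreal ((f (vec3 x y z))^4) <= Q x z" "ennreal ((f (vec3 x y z))^4) <= S x y" for x y z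
 proof -
  have "vec3 x y z + t *\<^sub>R axis 1 1 = vec3 (x + t) y z" "vec3 x y z + t *\<^sub>R axis 2 1 = vec3 x (y + t) z"
   "vec3 x y z + t *\<^sub>R axis 3 1 = vec3 x y (z + t)" for t by (simp_all add: vec3_def algebra_simps)
  then show "ennreal ((f (vec3 x y z))^4) <= P y z" "ennreal ((f (vec3 x y z))^4) <= Q x z" "ennreal ((f (vec3 x y z))^4) <= S x y"
   using lb[of "axis 1 1" "vec3 x y z"] lb[of "axis 2 1" "vec3 x y z"] lb[of "axis 3 1" "vec3 x y z"]
    nn_integral_real_shift[of "%s. N (vec3 s y z)" x] nn_integral_real_shift[of "%s. N (vec3 x s z)" y]
    nn_integral_real_shift[of "%s. N (vec3 x y s)" z] by (simp_all add: P_def Q_def S_def)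
 qed
 have sx: "ennreal ((f v)^6) = ennreal ((f v)^2) * (ennreal ((f v)^2) * ennreal ((f v)^2))" for v
 proof -
  have "(f v)^6 = (f v)^2 * ((f v)^2 * (f v)^2)" by (simp add: power_add[symmetric])
  then show ?thesis by (simp only: ennreal_mult[OF zero_le_power2] ennreal_mult[OF zero_le_power2 mult_nonneg_nonneg[OF zero_le_power2 zero_le_power2]] zero_le_power2)
 qed
 have s4: "(ennreal ((f v)^2))^2 = ennreal ((f v)^4)" for v by (simp add: ennreal_power power_mult[symmetric])
 define X where "X = (NE v. (f v)^6)"
 define Y where "Y = (NE v. (norm (G v))^2)"
 define T where "T = (NI v. N v)"
 have TP: "(NI y. NI z. P y z) = T"
 proof -
  have "T = (NI x. NI y. NI z. N (vec3 x y z))" unfolding T_def by (rule nn_integral_vec3) measurable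
  also have "... = (NI y. NI x. NI z. N (vec3 x y z))" by (rule lborel_pair.Fubini') measurable
  also have "... = (NI y. NI z. NI x. N (vec3 x y z))" by (intro nn_integral_cong lborel_pair.Fubini') measurable
  finally show ?thesis by (simp add: P_def)
 qed
 have TQ: "(NI x. NI z. Q x z) = T"
 proof -
  have "T = (NI x. NI y. NI z. N (vec3 x y z))" unfolding T_def by (rule nn_integral_vec3) measurable
  also have "... = (NI x. NI z. NI y. N (vec3 x y z))" by (intro nn_integral_cong lborel_pair.Fubini') measurable
  finally show ?thesis by (simp add: Q_def)
 qed
 have TS: "(NI x. NI y. S x y) = T" unfolding T_def S_def by (rule nn_integral_vec3[symmetric]) measurable
 have "X = (NI x. NI y. NE z. (f (vec3 x y z))^6)" unfolding X_def by (rule nn_integral_vec3) measurable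
 also have "... <= (NI x. NI y. NI z. esqrt (P y z) * (esqrt (Q x z) * esqrt (S x y)))"
  unfolding sx by (intro nn_integral_mono mult_mono le_esqrtI) (auto simp: s4 b)
 finally have "X^2 <= (NI x. NI y. NI z. esqrt (P y z) * (esqrt (Q x z) * esqrt (S x y)))^2" by (rule power_mono) simp
 also have "... <= T * (T * T)" by (rule order_trans[OF Loomis_Whitney]) (measurable, simp add: esqrt_sq TP TQ TS)
 finally have X2: "X^2 <= T^3" by (simp add: power3_eq_cube mult.assoc)
 have T2: "T^2 <= 16 * (X * Y)"
 proof -
  have "T = 4 * (NI v. ennreal (\<bar>f v\<bar>^3) * ennreal (norm (G v)))"
  proof -
   have "T = (NI v. 4 * (ennreal (\<bar>f v\<bar>^3) * ennreal (norm (G v))))" unfolding T_def N_def D_def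
    by (intro nn_integral_cong) (simp add: abs_mult power_abs ennreal_mult mult.assoc)
   then show ?thesis by (simp add: nn_integral_cmult)
  qed
  then have "T^2 = 16 * (NI v. ennreal (\<bar>f v\<bar>^3) * ennreal (norm (G v)))^2" by (simp add: power_mult_distrib)
  also have "... <= 16 * ((NI v. (ennreal (\<bar>f v\<bar>^3))^2) * (NI v. (ennreal (norm (G v)))^2))"
   by (intro mult_left_mono Cauchy_Schwarz_nn_integral) auto
  also have "... = 16 * (X * Y)"
  proof -
   have "(ennreal (\<bar>f v\<bar>^3))^2 = ennreal ((f v)^6)" for v
    by (simp add: ennreal_power power_mult[symmetric] power_even_abs)
   then show ?thesis by (simp add: X_def Y_def ennreal_power)
  qed
  finally show ?thesis .
 qed
 \<comment> \<open>Needed to cancel X^3 at the end; here the compact support enters.\<close>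
 have Xfin: "X < \<infinity>"
 proof -
  obtain B where B: "!!x. \<bar>f x\<bar> <= B" using continuous_compact_support_bound[OF cf R] by blast
  have "X <= (NI v. ennreal (B^6) * indicator (cball (0::R3) R) v)" unfolding X_def
  proof (rule nn_integral_mono)
   fix v :: R3
   have "(f v)^6 <= B^6" using power_mono[OF B[of v], of 6] by (simp add: power_even_abs)
   then show "ennreal ((f v)^6) <= ennreal (B^6) * indicator (cball 0 R) v"
    using R[of v] by (auto simp: indicator_def intro: ennreal_leI)
  qed
  also have "... < \<infinity>"
   using emeasure_bounded_finite[OF bounded_cball, of "0::R3" R] by (simp add: nn_integral_cmult ennreal_mult_less_top)
  finally show ?thesis .
 qed
 have "X^4 <= (T^3)^2" using power_mono[OF X2, of 2] by (simp add: power_mult[symmetric])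
 also have "... = (T^2)^3" by (simp add: power_mult[symmetric])
 also have "... <= (16 * (X * Y))^3" by (rule power_mono[OF T2]) simp
 also have "... = X^3 * (4096 * Y^3)" by (simp add: power_mult_distrib mult_ac)
 finally have fin: "X^3 * X <= X^3 * (4096 * Y^3)" by (simp add: eval_nat_numeral mult_ac)
 have "X <= 4096 * Y^3"
 proof (cases "X = 0")
  case False
  have "X^3 < top" using Xfin by (cases X) (auto simp: ennreal_power)
  then show ?thesis using fin False by (subst (asm) ennreal_mult_le_mult_iff) (auto simp: less_top[symmetric])
 qed simp
 then show ?thesis by (simp add: X_def Y_def)
qed

section \<open>Cutoff functions and the local Sobolev inequality\<close>

lemma pos_part_sq_deriv: "((%s. (max 0 s)^2) has_real_derivative 2 * max 0 s) (at (s::real))"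
proof -
 consider "s < 0" | "s > 0" | "s = 0" by linarith
 then show ?thesis
 proof cases
  case 1
  have "((%_. 0::real) has_real_derivative 0) (at s)" by simp
  then have "((%s. (max 0 s)^2) has_real_derivative 0) (at s)"
   by (rule has_field_derivative_transform_within_open[where S="{..<0}"]) (use 1 in auto)
  then show ?thesis using 1 by simp
 next
  case 2
  have "((%s::real. s^2) has_real_derivative 2 * s) (at s)" by (auto intro!: derivative_eq_intros)
  then have "((%s. (max 0 s)^2) has_real_derivative 2 * s) (at s)"
   by (rule has_field_derivative_transform_within_open[where S="{0<..}"]) (use 2 in auto)
  then show ?thesis using 2 by simp
 next
  case 3
  have "((%h::real. ((max 0 (0 + h))^2 - (max 0 0)^2) / h) \<longlongrightarrow> 0) (at 0)"
   by (rule tendsto_0_le[OF tendsto_ident_at, where K=1])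
    (auto intro!: always_eventually simp: max_def power2_eq_square abs_mult)
  then show ?thesis using 3 by (simp add: DERIV_def)
 qed
qed

text \<open>The square of a positive part is continuously differentiable with an explicit gradient,
  which is all the Sobolev inequality asks for. Dividing by 4 R^2 puts the support into the ball of
  radius 2 R and makes the value at least (3/4)^2 = 9/16 on the ball of radius R.\<close>

definition cutoff :: "R3 => real => R3 => real" where
 "cutoff z R x = (max 0 (1 - (norm (x - z))^2 / (4 * R^2)))^2"

definition cutoff_grad :: "R3 => real => R3 => R3" where
 "cutoff_grad z R x = (- max 0 (1 - (norm (x - z))^2 / (4 * R^2)) / R^2) *\<^sub>R (x - z)"

lemma cutoff_derivative:
 assumes "R > 0" shows "(cutoff z R has_derivative (%v. v \<bullet> cutoff_grad z R x)) (at x)"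
proof -
 have d1: "((%x. 1 - ((x - z) \<bullet> (x - z)) / (4 * R^2)) has_derivative (%v. - (2 * (v \<bullet> (x - z))) / (4 * R^2))) (at x)"
  using assms by (auto intro!: derivative_eq_intros simp: inner_commute fun_eq_iff field_simps eval_nat_numeral)
 have "((%s. (max 0 s)^2) has_derivative (%h. 2 * max 0 s * h)) (at s)" for s :: real
  using pos_part_sq_deriv[of s] by (simp add: has_field_derivative_def)
 from has_derivative_compose[OF d1 this]
 have D: "(cutoff z R has_derivative (%v. 2 * max 0 (1 - (x - z) \<bullet> (x - z) / (4 * R^2)) * (- (2 * (v \<bullet> (x - z))) / (4 * R^2)))) (at x)"
  unfolding cutoff_def[abs_def] power2_norm_eq_inner .
 have a: "2 * m * (- (2 * w) / (4 * R^2)) = - m / R^2 * w" for m w :: real using assms by (simp add: field_simps)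
 show ?thesis
  by (rule has_derivative_eq_rhs[OF D]) (simp only: a cutoff_grad_def power2_norm_eq_inner inner_scaleR_right)
qed

lemma cutoff_grad_continuous: "R > 0 ==> continuous_on UNIV (cutoff_grad z R)"
 unfolding cutoff_grad_def[abs_def] by (intro continuous_intros) auto

lemma cutoff_facts:
 assumes "R > 0" shows "0 <= cutoff z R x" "cutoff z R x <= 1" "x \<notin> ball z (2 * R) ==> cutoff z R x = 0"
  "x \<notin> ball z (2 * R) ==> cutoff_grad z R x = 0" "norm (cutoff_grad z R x) <= 2 / R"
  "x \<in> ball z R ==> cutoff z R x >= 9/16"
proof -
 define s where "s = (norm (x - z))^2 / (4 * R^2)"
 have s0: "s >= 0" by (simp add: s_def)
 show "0 <= cutoff z R x" by (simp add: cutoff_def)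
 show "cutoff z R x <= 1" using s0 by (simp add: cutoff_def s_def[symmetric] power_le_one)
 have out: "max 0 (1 - s) = 0" if "x \<notin> ball z (2 * R)"
 proof -
  have "2 * R <= norm (x - z)" using that by (simp add: dist_norm norm_minus_commute)
  then have "(2 * R)^2 <= (norm (x - z))^2" using assms by (intro power_mono) auto
  then have "s >= 1" using assms by (simp add: s_def field_simps power_mult_distrib)
  then show ?thesis by simp
 qed
 show "x \<notin> ball z (2 * R) ==> cutoff z R x = 0" using out by (simp add: cutoff_def s_def)
 show c: "x \<notin> ball z (2 * R) ==> cutoff_grad z R x = 0" using out by (simp add: cutoff_grad_def s_def)
 show "norm (cutoff_grad z R x) <= 2 / R"
 proof (cases "x \<in> ball z (2 * R)")
  case False then show ?thesis using c assms by simp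
 next
  case True
  then have n: "norm (x - z) <= 2 * R" by (simp add: dist_norm norm_minus_commute)
  have "norm (cutoff_grad z R x) = max 0 (1 - s) / R^2 * norm (x - z)" by (simp add: cutoff_grad_def s_def)
  also have "... <= 1 / R^2 * (2 * R)" using s0 n by (intro mult_mono divide_right_mono) auto
  also have "... = 2 / R" using assms by (simp add: power2_eq_square)
  finally show ?thesis .
 qed
 show "cutoff z R x >= 9/16" if "x \<in> ball z R"
 proof -
  have "norm (x - z) <= R" using that by (simp add: dist_norm norm_minus_commute)
  then have "(norm (x - z))^2 <= R^2" by (intro power_mono) auto
  then have "s <= 1/4" using assms by (simp add: s_def field_simps)
  then have "(3/4)^2 <= (max 0 (1 - s))^2" by (intro power_mono) auto
  then show ?thesis by (simp add: cutoff_def s_def power2_eq_square)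
 qed
qed

lemma norm_add_sq_le: "(norm (a + b))^2 <= 2 * (norm a)^2 + 2 * (norm (b::'a::real_inner))^2"
 using norm_add_scale_sq[of a 1 b] by simp

text \<open>(16/9)^6 removes the cutoff on the inner ball, 4096 is the global Sobolev constant, and
  512 = 8^3 comes from the factor 8 in the gradient bound of the truncated function.\<close>

definition Csob :: ennreal where "Csob = ennreal ((16/9)^6) * 4096 * 512"

lemma Csob_finite: "Csob < \<infinity>" "Csob < top"
 unfolding Csob_def by (auto simp: ennreal_mult_less_top)

text \<open>The global inequality is applied to cutoff times mollification, which lives on the ball
  of radius 2 R; undoing a mollification of width at most R enlarges it to 3 R. The product rule
  costs 2 (2/R)^2 = 8/R^2 for the function and 2 for its gradient, both absorbed in the factor
  8.\<close>

lemma local_sobolev_mollified: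
 assumes u: "wpair u g" and R: "R > 0" and k: "mollifier ep k" and ep: "ep <= R"
 shows "(NI x. indicator (ball z R) x * ennreal ((cv u k x)^6))
  <= Csob * ((NI x. indicator (ball z (3 * R)) x * ennreal ((norm (g x))^2))
    + ennreal (1 / R^2) * (NI x. indicator (ball z (3 * R)) x * ennreal ((u x)^2))) ^ 3"
proof -
 define F where "F = cv u k"
 define H where "H = cvv g k"
 have Fd: "(F has_derivative (%v. v \<bullet> H x)) (at x)" for x unfolding F_def H_def by (rule cv_gradient[OF u k])
 have cF: "continuous_on UNIV F" unfolding F_def by (rule cv_continuous[OF wpair_loc2[OF u] mollifierD(2)[OF k]])
 have cH: "continuous_on UNIV H" unfolding H_def by (rule cvv_continuous[OF u k])
 have [measurable]: "BM F" "BM H" "BM u" "BM g" using cF cH u by (auto intro: borel_measurable_continuous_onI)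
 define f where "f x = cutoff z R x * F x" for x
 define G where "G x = F x *\<^sub>R cutoff_grad z R x + cutoff z R x *\<^sub>R H x" for x
 have fd: "(f has_derivative (%v. v \<bullet> G x)) (at x)" for x unfolding f_def
  by (rule has_derivative_eq_rhs[OF has_derivative_mult[OF cutoff_derivative[OF R] Fd]])
   (auto simp: G_def fun_eq_iff inner_simps algebra_simps)
 have ccut: "continuous_on UNIV (cutoff z R)"
  by (intro continuous_at_imp_continuous_on ballI has_derivative_continuous[OF cutoff_derivative[OF R]])
 have cG: "continuous_on UNIV G" unfolding G_def by (intro continuous_intros cF cH cutoff_grad_continuous R ccut)
 have [measurable]: "BM (cutoff z R)" "BM G" using ccut cG by (auto intro: borel_measurable_continuous_onI)
 have f0: "f x = 0" if "norm x > norm z + 2 * R" for x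
 proof -
  have "norm (x - z) > 2 * R" using that norm_triangle_ineq2[of x z] by linarith
  then have "x \<notin> ball z (2 * R)" by (simp add: dist_norm norm_minus_commute)
  then show ?thesis by (simp add: f_def cutoff_facts[OF R])
 qed
 define I where "I = (NI x. indicator (ball z (3 * R)) x * ennreal ((norm (g x))^2))"
 define J where "J = (NI x. indicator (ball z (3 * R)) x * ennreal ((u x)^2))"
 have tri: "y \<in> ball z (3 * R)" if "x \<in> ball z (2 * R)" "dist x y < ep" for x y
  using that ep dist_triangle[of z y x] by (simp add: dist_commute)
 have IH: "(NI x. indicator (ball z (2 * R)) x * ennreal ((norm (H x))^2)) <= I"
  unfolding H_def I_def by (rule cvv_L2_bound[OF u k]) (use tri in auto)
 have JF: "(NI x. indicator (ball z (2 * R)) x * ennreal ((F x)^2)) <= J"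
  unfolding F_def J_def by (rule cv_L2_bound[OF wpair_loc2[OF u] k]) (use tri in auto)
 have Gpt: "ennreal ((norm (G x))^2) <= ennreal (8 / R^2) * (indicator (ball z (2 * R)) x * ennreal ((F x)^2)) + ennreal 2 * (indicator (ball z (2 * R)) x * ennreal ((norm (H x))^2))" for x
 proof (cases "x \<in> ball z (2 * R)")
  case True
  have "(norm (G x))^2 <= 2 * (norm (F x *\<^sub>R cutoff_grad z R x))^2 + 2 * (norm (cutoff z R x *\<^sub>R H x))^2"
   unfolding G_def by (rule norm_add_sq_le)
  also have "(norm (F x *\<^sub>R cutoff_grad z R x))^2 <= (F x)^2 * (2 / R)^2"
   using cutoff_facts(5)[OF R, of z x] by (auto simp: power_mult_distrib intro!: mult_left_mono power_mono)
  also have "(norm (cutoff z R x *\<^sub>R H x))^2 <= 1 * (norm (H x))^2"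
  proof -
   have "(cutoff z R x)^2 <= 1" using cutoff_facts(1,2)[OF R, of z x] by (intro power_le_one)
   then show ?thesis using mult_right_mono[of "(cutoff z R x)^2" 1 "(norm (H x))^2"] by (simp add: power_mult_distrib)
  qed
  finally have "(norm (G x))^2 <= (8 / R^2) * (F x)^2 + 2 * (norm (H x))^2" by (simp add: power_divide)
  then show ?thesis using True ennreal_le_lincomb[of "(norm (G x))^2" "8 / R^2" "(F x)^2" 2 "(norm (H x))^2"] by simp
 next
  case False
  then show ?thesis by (simp add: G_def cutoff_facts(3,4)[OF R])
 qed
 have "(NE x. (norm (G x))^2) <= (NI x. ennreal (8 / R^2) * (indicator (ball z (2 * R)) x * ennreal ((F x)^2)) + ennreal 2 * (indicator (ball z (2 * R)) x * ennreal ((norm (H x))^2)))"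
  by (intro nn_integral_mono Gpt)
 also have "... = ennreal (8 / R^2) * (NI x. indicator (ball z (2 * R)) x * ennreal ((F x)^2)) + ennreal 2 * (NI x. indicator (ball z (2 * R)) x * ennreal ((norm (H x))^2))"
  by (subst nn_integral_add, measurable) (subst nn_integral_cmult, measurable, subst nn_integral_cmult, measurable)
 also have "... <= ennreal (8 / R^2) * J + ennreal 8 * I" by (intro add_mono mult_mono IH JF ennreal_leI) auto
 also have "... = 8 * (I + ennreal (1 / R^2) * J)"
 proof -
  have "ennreal (8 / R^2) = 8 * ennreal (1 / R^2)" using ennreal_mult[of 8 "1 / R^2"] by simp
  then show ?thesis by (simp add: distrib_left mult.assoc add.commute)
 qed
 finally have Gb: "(NE x. (norm (G x))^2) <= 8 * (I + ennreal (1 / R^2) * J)" .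
 have "(NI x. indicator (ball z R) x * ennreal ((F x)^6)) <= (NI x. ennreal ((16/9)^6) * ennreal ((f x)^6))"
 proof (rule nn_integral_mono)
  fix x
  show "indicator (ball z R) x * ennreal ((F x)^6) <= ennreal ((16/9)^6) * ennreal ((f x)^6)"
  proof (cases "x \<in> ball z R")
   case True
   have "1 <= (16/9) * cutoff z R x" using cutoff_facts(6)[OF R True] by simp
   then have "1 ^ 6 <= ((16/9) * cutoff z R x)^6" by (intro power_mono) auto
   then have "1 * (F x)^6 <= ((16/9) * cutoff z R x)^6 * (F x)^6" by (intro mult_right_mono) auto
   then have "(F x)^6 <= (16/9)^6 * (f x)^6" by (simp only: f_def power_mult_distrib mult.assoc mult_1)
   then have "ennreal ((F x)^6) <= ennreal ((16/9)^6 * (f x)^6)" by (rule ennreal_leI)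
   then show ?thesis using True by (simp add: ennreal_mult)
  qed simp
 qed
 also have "... = ennreal ((16/9)^6) * (NE x. (f x)^6)" unfolding f_def by (rule nn_integral_cmult) measurable
 also have "... <= ennreal ((16/9)^6) * (4096 * (NE x. (norm (G x))^2)^3)"
  by (intro mult_left_mono Gagliardo_Nirenberg_Sobolev[OF fd cG f0]) auto
 also have "... <= ennreal ((16/9)^6) * (4096 * (8 * (I + ennreal (1 / R^2) * J))^3)"
  by (intro mult_left_mono power_mono Gb) auto
 also have "... = Csob * (I + ennreal (1 / R^2) * J)^3"
  unfolding Csob_def power_mult_distrib[of 8] by (simp add: mult.assoc)
 finally show ?thesis by (simp add: F_def I_def J_def)
qed

lemma local_sobolev:
 assumes u: "wpair u g" and R: "R > 0" shows "(NI x. indicator (ball z R) x * ennreal ((u x)^6))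
  <= Csob * ((NI x. indicator (ball z (3 * R)) x * ennreal ((norm (g x))^2))
    + ennreal (1 / R^2) * (NI x. indicator (ball z (3 * R)) x * ennreal ((u x)^2))) ^ 3"
  (is "_ <= ?B")
proof -
 obtain de l where l: "!!n. mollifier (de n) (l n)" "de ---> 0" "!!n. de n <= 1" "AL x. (%n. cv u (l n) x) ---> u x"
  "(%n. (NE x. (cv u (l n) x - u x)^2)) ---> 0" by (rule wpair_mollify_seq[OF u], rule that)
 have [measurable]: "BM u" using u by measurable
 have [measurable]: "BM (cv u (l n))" for n by (intro cv_measurable wpair_loc2[OF u] mollifierD(2)[OF l(1)])
 have "(NI x. indicator (ball z R) x * ennreal ((u x)^6))
  = (NI x. liminf (%n. indicator (ball z R) x * ennreal ((cv u (l n) x)^6)))"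
 proof (rule nn_integral_cong_AE, use l(4) in eventually_elim)
  case (elim x)
  then have "(%n. indicator (ball z R) x * ennreal ((cv u (l n) x)^6)) ---> indicator (ball z R) x * ennreal ((u x)^6)"
   by (intro ennreal_tendsto_cmult tendsto_ennrealI tendsto_intros) (auto simp: indicator_def)
  from lim_imp_Liminf[OF trivial_limit_sequentially this] show ?case by simp
 qed
 also have "... <= liminf (%n. (NI x. indicator (ball z R) x * ennreal ((cv u (l n) x)^6)))"
  by (intro nn_integral_liminf) simp
 also have "... <= liminf (%n. ?B)"
 proof (rule Liminf_mono)
  have "eventually (%n. de n < R) sequentially" using l(2) R by (rule order_tendstoD)
  then show "eventually (%n. (NI x. indicator (ball z R) x * ennreal ((cv u (l n) x)^6)) <= ?B) sequentially"
   by eventually_elim (rule local_sobolev_mollified[OF u R l(1)], simp)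
 qed
 finally show ?thesis by (simp add: Liminf_const)
qed

section \<open>The Bopp-Podolsky kernel\<close>

text \<open>The form V on extended nonnegative functions, where Tonelli's theorem holds
  unconditionally. Its signed counterpart is \<open>Dk\<close>.\<close>

definition W :: "real => (R3 => ennreal) => (R3 => ennreal) => ennreal" where
 "W a f g = (NI x. NI y. ennreal (kernel a (x - y)) * (f x * g y))"

lemma Vnn_eq_W:
 assumes "!!x. f x >= 0" "!!x. g x >= 0" "a > 0" shows "Vnn a f g = W a (%x. ennreal (f x)) (%x. ennreal (g x))"
proof -
 have "kernel a z >= 0" for z using assms(3) by (auto simp: kernel_def)
 then show ?thesis unfolding Vnn_def W_def nn_integral_completion using assms
  by (intro nn_integral_cong) (simp add: ennreal_mult mult.assoc)
qed

lemma kernel_measurable[measurable]: "BM (kernel a)"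
 unfolding kernel_def[abs_def] by measurable

text \<open>With s = |x|/a everything follows from s/(1+s) <= 1 - exp(-s) <= min(1, s): the kernel
  is comparable with 1/(a + |x|) up to a factor 2. At the origin division by zero gives the value 0,
  so the lower bound excludes that point; below, the diagonal is discarded as a null set.\<close>

lemma kernel_bounds:
 assumes a: "a > 0"
 shows "kernel a x >= 0" "kernel a x <= 1 / a" "x ~= 0 ==> 1 / (a + norm x) <= kernel a x" "kernel a x <= 2 / (a + norm x)"
  "kernel a (- x) = kernel a x"
proof -
 define s where "s = norm x / a"
 have s0: "s >= 0" and ns: "norm x = a * s" using a by (auto simp: s_def)
 have e1: "1 - exp (- s) <= s" using exp_ge_add_one_self[of "- s"] by linarith
 have e2: "1 - exp (- s) <= 1" by simp
 have e3: "s / (1 + s) <= 1 - exp (- s)"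
 proof -
  have "(1 + s) * exp (- s) <= 1" using exp_ge_add_one_self[of s] by (simp add: exp_minus field_simps)
  then show ?thesis using s0 by (simp add: field_simps)
 qed
 have k: "kernel a x = (1 - exp (- s)) / (a * s)" by (simp add: kernel_def s_def a)
 show k0: "kernel a x >= 0" using a by (simp add: kernel_def)
 show k1: "kernel a x <= 1 / a"
 proof (cases "s = 0")
  case False
  then have "s > 0" using s0 by simp
  have "(1 - exp (- s)) / (a * s) <= s / (a * s)" using a \<open>s > 0\<close> e1 by (intro divide_right_mono) auto
  then show ?thesis unfolding k using a \<open>s > 0\<close> by simp
 qed (use a in \<open>simp add: k\<close>)
 show "1 / (a + norm x) <= kernel a x" if "x ~= 0"
 proof -
  have "s > 0" using that a by (simp add: s_def)
  have "a + norm x = a * (1 + s)" by (simp add: ns distrib_left)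
  then have "1 / (a + norm x) = (s / (1 + s)) / (a * s)" using a \<open>s > 0\<close> by simp
  also have "... <= kernel a x" unfolding k using a \<open>s > 0\<close> e3 by (intro divide_right_mono) auto
  finally show ?thesis .
 qed
 show "kernel a x <= 2 / (a + norm x)"
 proof (cases "norm x <= a")
  case True
  have "2 / (2 * a) <= 2 / (a + norm x)" using a True norm_ge_zero[of x]
   by (intro divide_left_mono) (auto intro!: mult_pos_pos add_pos_nonneg)
  then have "1 / a <= 2 / (a + norm x)" by simp
  then show ?thesis using k1 by linarith
 next
  case False
  have "kernel a x <= 1 / norm x" unfolding kernel_def by (intro divide_right_mono) auto
  also have "... = 2 / (2 * norm x)" by simp
  also have "... <= 2 / (a + norm x)" using a False by (intro divide_left_mono) (auto intro!: mult_pos_pos)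
  finally show ?thesis .
 qed
 show "kernel a (- x) = kernel a x" by (simp add: kernel_def)
qed

lemma W_commute:
 assumes [measurable]: "BM f" "BM g" and a: "a > 0" shows "W a f g = W a g f"
proof -
 have "W a f g = (NI y. NI x. ennreal (kernel a (x - y)) * (f x * g y))"
  unfolding W_def by (rule lborel_pair.Fubini') measurable
 also have "... = W a g f" unfolding W_def using kernel_bounds(5)[OF a, of "_ - _"]
  by (intro nn_integral_cong) (metis minus_diff_eq mult.commute)
 finally show ?thesis .
qed

lemma W_mono: "(!!x. f x <= f' x) ==> (!!x. g x <= g' x) ==> W a f g <= W a f' g'"
 unfolding W_def by (intro nn_integral_mono mult_mono) auto

lemma W_cong_AE:
 assumes "AL x. f x = f' x" "AL x. g x = g' x" shows "W a f g = W a f' g'" unfolding W_def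
proof (rule nn_integral_cong_AE, use assms(1) in eventually_elim)
 case (elim x)
 show ?case by (rule nn_integral_cong_AE, use assms(2) in eventually_elim) (simp add: elim)
qed

lemma nn_integral_preserving:
 fixes f :: "'a::euclidean_space => ennreal"
 assumes [measurable]: "BM f" "BM T" and T: "distr lborel borel T = lborel" shows "(NI x. f (T x)) = (NI x. f x)"
proof -
 have "(NI x. f x) = (\<integral>\<^sup>+x. f x \<partial>distr lborel borel T)" by (simp only: T)
 also have "... = (NI x. f (T x))" by (rule nn_integral_distr) measurable
 finally show ?thesis by simp
qed

lemma W_isometry:
 assumes [measurable]: "BM f" "BM g" "BM T"
  and T: "distr lborel borel T = lborel" "!!x y. norm (T x - T y) = norm (x - y)"
 shows "W a (%x. f (T x)) (%x. g (T x)) = W a f g"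
proof -
 have k: "kernel a (T x - T y) = kernel a (x - y)" for x y by (simp add: kernel_def T(2))
 have "W a (%x. f (T x)) (%x. g (T x)) = (NI x. NI y. ennreal (kernel a (T x - T y)) * (f (T x) * g (T y)))"
  unfolding W_def by (simp only: k)
 also have "... = (NI x. NI y. ennreal (kernel a (T x - y)) * (f (T x) * g y))"
  by (intro nn_integral_cong nn_integral_preserving[where f="%y. ennreal (kernel a (T _ - y)) * (f (T _) * g y)"] T) measurable
 also have "... = W a f g" unfolding W_def
  by (intro nn_integral_preserving[where f="%x. (NI y. ennreal (kernel a (x - y)) * (f x * g y))"] T) measurable
 finally show ?thesis .
qed

section \<open>Ball masses\<close>

definition bm :: "(R3 => ennreal) => R3 => real => ennreal" where
 "bm f z r = (NI x. (if dist z x < r then f x else 0))"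

lemma bm_indicator: "(NI x. indicator (ball z r) x * f x) = bm f z r"
 unfolding bm_def by (intro nn_integral_cong) (auto simp: indicator_def)

lemma bm_measurable[measurable (raw)]:
 assumes [measurable]: "BM f" "z \<in> borel_measurable N" "r \<in> borel_measurable N"
 shows "(%w. bm f (z w) (r w)) \<in> borel_measurable N" unfolding bm_def by measurable

lemma bm_mult:
 assumes [measurable]: "BM f" "BM g"
 shows "bm f z r * bm g z r = (NI x. NI y. (f x * g y) * (if dist z x < r & dist z y < r then 1 else 0))"
proof -
 have "bm f z r * bm g z r = (NI x. (if dist z x < r then f x else 0) * bm g z r)"
  unfolding bm_def[of f] by (rule nn_integral_multc[symmetric]) measurable
 also have "... = (NI x. NI y. (if dist z x < r then f x else 0) * (if dist z y < r then g y else 0))"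
  unfolding bm_def by (intro nn_integral_cong nn_integral_cmult[symmetric]) measurable
 also have "... = (NI x. NI y. (f x * g y) * (if dist z x < r & dist z y < r then 1 else 0))"
  by (intro nn_integral_cong) auto
 finally show ?thesis .
qed

lemma AE_neq: "AE y in lborel. y ~= (x::R3)"
 by (rule AE_lborel_singleton)

text \<open>Two points of a ball of radius \<open>R\<close> are at most 2 R apart, so off the
  diagonal the kernel is at least 1/(a + 2 R) there. The quantitative bounds on local L^2 norms of
  \<open>u\<close> in terms of V rest on this.\<close>

lemma ball_mass_le_W:
 assumes a: "a > 0" and R: "R > 0" and [measurable]: "BM f" shows "(bm f z R)^2 <= ennreal (a + 2 * R) * W a f f"
proof -
 have "(bm f z R)^2 = (NI x. NI y. (f x * f y) * (if dist z x < R & dist z y < R then 1 else 0))"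
  unfolding power2_eq_square by (rule bm_mult) measurable
 also have "... <= (NI x. NI y. ennreal (a + 2 * R) * (ennreal (kernel a (x - y)) * (f x * f y)))"
 proof (rule nn_integral_mono, rule nn_integral_mono_AE)
  fix x
  show "AE y in lborel. (f x * f y) * (if dist z x < R & dist z y < R then 1 else 0) <= ennreal (a + 2 * R) * (ennreal (kernel a (x - y)) * (f x * f y))"
   using AE_neq[of x]
  proof eventually_elim
   case (elim y)
   show ?case
   proof (cases "dist z x < R & dist z y < R")
    case True
    then have "norm (x - y) <= 2 * R" using dist_triangle3[of x y z] by (simp add: dist_norm dist_commute)
    then have "1 <= (a + 2 * R) * (1 / (a + norm (x - y)))" using a by (simp add: field_simps add_pos_nonneg)
    also have "... <= (a + 2 * R) * kernel a (x - y)" using a R elim by (intro mult_left_mono kernel_bounds(3)) auto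
    finally have "ennreal 1 <= ennreal ((a + 2 * R) * kernel a (x - y))" by (rule ennreal_leI)
    then have "1 <= ennreal (a + 2 * R) * ennreal (kernel a (x - y))"
     using a R kernel_bounds(1)[OF a] by (simp add: ennreal_mult)
    then have "1 * (f x * f y) <= (ennreal (a + 2 * R) * ennreal (kernel a (x - y))) * (f x * f y)"
     by (rule mult_right_mono) simp
    then show ?thesis using True by (simp add: mult.assoc)
   qed auto
  qed
 qed
 also have "... = ennreal (a + 2 * R) * W a f f"
  unfolding W_def by (subst nn_integral_cmult, measurable) (subst nn_integral_cmult, measurable)
 finally show ?thesis .
qed

section \<open>Volumes of balls and of their intersections\<close>

definition om :: real where "om = unit_ball_vol 3"

lemma om_pos: "om > 0" by (simp add: om_def)

lemma emeasure_ball3: "r >= 0 ==> emeasure lborel (ball (z::R3) r) = ennreal (om * r^3)"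
 by (simp add: emeasure_ball om_def)

definition bint :: "real => R3 => R3 => ennreal" where
 "bint r x y = (NI z. (if dist z x < r & dist z y < r then 1 else 0))"

lemma bint_measurable[measurable (raw)]:
 assumes [measurable]: "r \<in> borel_measurable N" "f \<in> borel_measurable N" "g \<in> borel_measurable N"
 shows "(%w. bint (r w) (f w) (g w)) \<in> borel_measurable N" unfolding bint_def by measurable

lemma bint_emeasure: "bint r x y = emeasure lborel (ball x r \<inter> ball y r)"
proof -
 have "bint r x y = (NI z. indicator (ball x r \<inter> ball y r) z)"
  unfolding bint_def by (intro nn_integral_cong) (auto simp: indicator_def dist_commute)
 then show ?thesis by simp
qed

lemma bint_le: "r >= 0 ==> bint r x y <= ennreal (om * r^3)"
 unfolding bint_emeasure emeasure_ball3[of r x, symmetric] by (intro emeasure_mono) auto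

lemma bint_zero: "dist x y >= 2 * r ==> bint r x y = 0"
proof -
 assume d: "dist x y >= 2 * r"
 have "ball x r \<inter> ball y r = {}"
  using d by (auto simp: dist_commute) (metis dist_commute dist_triangle_half_r dist_triangle_lt not_less add_strict_mono mult_2)
 then show ?thesis by (simp add: bint_emeasure)
qed

text \<open>The ball of half the radius about the midpoint lies in both balls.\<close>

lemma bint_ge:
 assumes "dist x y <= r" shows "bint r x y >= ennreal (om * (r/2)^3)"
proof -
 have r: "r >= 0" using assms zero_le_dist[of x y] by linarith
 define m where "m = midpoint x y"
 have m: "dist m x = dist x y / 2" "dist m y = dist x y / 2" by (simp_all add: m_def dist_midpoint)
 have "ball m (r/2) \<subseteq> ball x r \<inter> ball y r"
 proof
  fix w assume "w \<in> ball m (r/2)"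
  then have "dist m w < r/2" by simp
  then have "dist x w < r" "dist y w < r"
   using m assms dist_triangle[of x w m] dist_triangle[of y w m] by (simp_all add: dist_commute)
  then show "w \<in> ball x r \<inter> ball y r" by simp
 qed
 then have "emeasure lborel (ball m (r/2)) <= bint r x y" unfolding bint_emeasure by (intro emeasure_mono) auto
 then show ?thesis using r by (simp add: emeasure_ball3)
qed

text \<open>By Fubini the left-hand side is the double integral of f(x) f(y) against the volume of
  the intersection of the balls about x and y. This volume is at most \<open>om * R^3\<close> and
  vanishes at distance 2 R, so it is dominated by a multiple of the kernel. Thus V controls the
  squared ball masses summed over all centres.\<close>

lemma ball_mass_sq_integral:
 assumes a: "a > 0" and R: "R > 0" and [measurable]: "BM f"
 shows "(NI z. (bm f z R)^2) <= ennreal (om * R^3 * (a + 2 * R)) * W a f f"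
proof -
 have "(NI z. (bm f z R)^2) = (NI z. NI x. NI y. (f x * f y) * (if dist z x < R & dist z y < R then 1 else 0))"
  unfolding power2_eq_square by (intro nn_integral_cong bm_mult) measurable
 also have "... = (NI x. NI z. NI y. (f x * f y) * (if dist z x < R & dist z y < R then 1 else 0))"
  by (rule lborel_pair.Fubini') measurable
 also have "... = (NI x. NI y. NI z. (f x * f y) * (if dist z x < R & dist z y < R then 1 else 0))"
  by (intro nn_integral_cong lborel_pair.Fubini') measurable
 also have "... = (NI x. NI y. (f x * f y) * bint R x y)"
  unfolding bint_def by (intro nn_integral_cong nn_integral_cmult) measurable
 also have "... <= (NI x. NI y. ennreal (om * R^3 * (a + 2 * R)) * (ennreal (kernel a (x - y)) * (f x * f y)))"
 proof (rule nn_integral_mono, rule nn_integral_mono_AE)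
  fix x
  show "AE y in lborel. (f x * f y) * bint R x y <= ennreal (om * R^3 * (a + 2 * R)) * (ennreal (kernel a (x - y)) * (f x * f y))"
   using AE_neq[of x]
  proof eventually_elim
   case (elim y)
   show ?case
   proof (cases "dist x y < 2 * R")
    case True
    have "1 <= (a + 2 * R) * (1 / (a + norm (x - y)))"
     using a True by (simp add: field_simps add_pos_nonneg dist_norm)
    also have "... <= (a + 2 * R) * kernel a (x - y)" using a R elim by (intro mult_left_mono kernel_bounds(3)) auto
    finally have "om * R^3 * 1 <= om * R^3 * ((a + 2 * R) * kernel a (x - y))"
     using om_pos R by (intro mult_left_mono) auto
    then have "ennreal (om * R^3) <= ennreal (om * R^3 * (a + 2 * R) * kernel a (x - y))"
     by (intro ennreal_leI) (simp add: mult.assoc)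
    also have "... = ennreal (om * R^3 * (a + 2 * R)) * ennreal (kernel a (x - y))"
     using a R kernel_bounds(1)[OF a] om_pos by (subst ennreal_mult) auto
    finally have "bint R x y <= ennreal (om * R^3 * (a + 2 * R)) * ennreal (kernel a (x - y))"
     using bint_le[of R x y] R by simp
    then have "bint R x y * (f x * f y) <= (ennreal (om * R^3 * (a + 2 * R)) * ennreal (kernel a (x - y))) * (f x * f y)"
     by (rule mult_right_mono) simp
    then show ?thesis by (simp add: mult_ac)
   next
    case False
    then show ?thesis by (simp add: bint_zero)
   qed
  qed
 qed
 also have "... = ennreal (om * R^3 * (a + 2 * R)) * W a f f"
  unfolding W_def by (subst nn_integral_cmult, measurable) (subst nn_integral_cmult, measurable)
 finally show ?thesis .
qed

text \<open>Two balls of radius r meet in a volume of order r^3 once r exceeds the distance d of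
  their centres, so the density r^(-5) leaves the integral of r^(-2) from about max(a, d) on, which
  is of order 1/(a + d), the size of the kernel. The cut at \<open>a\<close> reproduces its bounded
  core.\<close>

definition wt :: "real => real => ennreal" where
 "wt a r = ennreal (if r >= a then 1 / r^5 else 0)"

lemma wt_measurable[measurable]: "BM (wt a)"
 unfolding wt_def[abs_def] by measurable

text \<open>A positive definite kernel comparable with the Bopp--Podolsky kernel: a superposition of
 autocorrelations of balls. It replaces the Fourier transform in all Cauchy--Schwarz arguments.\<close>
definition J :: "real => (R3 => ennreal) => (R3 => ennreal) => ennreal" where
 "J a f g = (\<integral>\<^sup>+p. wt a (fst p) * (bm f (snd p) (fst p) * bm g (snd p) (fst p)) \<partial>lborel2)"

definition Jk :: "real => R3 => R3 => ennreal" where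
 "Jk a x y = (NI r. wt a r * bint r x y)"

lemma J_eq:
 assumes [measurable]: "BM f" "BM g" shows "J a f g = (NI x. NI y. (f x * g y) * Jk a x y)"
proof -
 have "J a f g = (NI r. NI z. wt a r * (bm f z r * bm g z r))"
  unfolding J_def by (subst lborel.nn_integral_fst[symmetric]) auto
 also have "... = (NI r. NI z. NI x. NI y. wt a r * ((f x * g y) * (if dist z x < r & dist z y < r then 1 else 0)))"
 proof (intro nn_integral_cong)
  fix r z
  have "wt a r * (bm f z r * bm g z r) = wt a r * (NI x. NI y. (f x * g y) * (if dist z x < r & dist z y < r then 1 else 0))"
   by (subst bm_mult) auto
  also have "... = (NI x. wt a r * (NI y. (f x * g y) * (if dist z x < r & dist z y < r then 1 else 0)))"
   by (rule nn_integral_cmult[symmetric]) measurable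
  also have "... = (NI x. NI y. wt a r * ((f x * g y) * (if dist z x < r & dist z y < r then 1 else 0)))"
   by (intro nn_integral_cong nn_integral_cmult[symmetric]) measurable
  finally show "wt a r * (bm f z r * bm g z r) = (NI x. NI y. wt a r * ((f x * g y) * (if dist z x < r & dist z y < r then 1 else 0)))" .
 qed
 also have "... = (NI r. NI x. NI z. NI y. wt a r * ((f x * g y) * (if dist z x < r & dist z y < r then 1 else 0)))"
  by (intro nn_integral_cong lborel_pair.Fubini') measurable
 also have "... = (NI r. NI x. NI y. NI z. wt a r * ((f x * g y) * (if dist z x < r & dist z y < r then 1 else 0)))"
  by (intro nn_integral_cong lborel_pair.Fubini') measurable
 also have "... = (NI r. NI x. NI y. (f x * g y) * (wt a r * bint r x y))"
 proof (intro nn_integral_cong)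
  fix r x y
  have "(NI z. wt a r * ((f x * g y) * (if dist z x < r & dist z y < r then 1 else 0)))
   = (NI z. (wt a r * (f x * g y)) * (if dist z x < r & dist z y < r then 1 else 0))"
   by (intro nn_integral_cong) (simp add: mult.assoc)
  also have "... = (wt a r * (f x * g y)) * bint r x y" unfolding bint_def by (rule nn_integral_cmult) measurable
  finally show "(NI z. wt a r * ((f x * g y) * (if dist z x < r & dist z y < r then 1 else 0))) = (f x * g y) * (wt a r * bint r x y)"
   by (simp add: mult_ac)
 qed
 also have "... = (NI x. NI r. NI y. (f x * g y) * (wt a r * bint r x y))" by (rule lborel_pair.Fubini') measurable
 also have "... = (NI x. NI y. NI r. (f x * g y) * (wt a r * bint r x y))"
  by (intro nn_integral_cong lborel_pair.Fubini') measurable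
 also have "... = (NI x. NI y. (f x * g y) * Jk a x y)"
  unfolding Jk_def by (intro nn_integral_cong nn_integral_cmult) measurable
 finally show ?thesis .
qed

lemma integral_inverse_square:
 assumes "t > 0" shows "(NI r. ennreal (1 / r^2) * indicator {t..} r) = ennreal (1 / t)"
proof -
 have "(NI r. ennreal (1 / r^2) * indicator {t..} r) = ennreal (0 - (- 1 / t))"
 proof (rule nn_integral_FTC_atLeast[where F="%r. - 1 / r"])
  show "((%r. - 1 / r) has_real_derivative 1 / r^2) (at r)" if "t <= r" for r
   using that assms by (auto intro!: derivative_eq_intros simp: power2_eq_square field_simps)
  show "((%r::real. - 1 / r) \<longlongrightarrow> 0) at_top" by (intro tendsto_divide_0[OF tendsto_const] filterlim_at_top_imp_at_infinity filterlim_ident)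
 qed auto
 then show ?thesis by simp
qed

lemma Jk_bounds:
 assumes a: "a > 0" shows "Jk a x y <= ennreal (3 * om * (1 / (a + norm (x - y))))"
  "ennreal (1 / (a + norm (x - y))) <= ennreal (8 / om) * Jk a x y"
proof -
 define d where "d = norm (x - y)"
 have d0: "d >= 0" by (simp add: d_def)
 \<comment> \<open>For r below \<open>t\<close> either the weight or the intersection vanishes,
   which gives the upper bound; for r above \<open>T\<close> the weight is active and
   \<open>bint_ge\<close> applies, which gives the lower one.\<close>
 define t where "t = max a (d/2)"
 define T where "T = max a d"
 have t: "t > 0" "T > 0" using a by (auto simp: t_def T_def)
 have "Jk a x y <= (NI r. ennreal om * (ennreal (1 / r^2) * indicator {t..} r))" unfolding Jk_def
 proof (rule nn_integral_mono)
  fix r :: real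
  show "wt a r * bint r x y <= ennreal om * (ennreal (1 / r^2) * indicator {t..} r)"
  proof (cases "r >= t")
   case True
   then have r: "r >= a" "r > 0" using a by (auto simp: t_def)
   have "wt a r * bint r x y <= ennreal (1 / r^5) * ennreal (om * r^3)"
    unfolding wt_def using r by (intro mult_mono bint_le) auto
   also have "... = ennreal (1 / r^5 * (om * r^3))" using r om_pos by (intro ennreal_mult[symmetric]) auto
   also have "1 / r^5 * (om * r^3) = om * (1 / r^2)" using r by (simp add: field_simps eval_nat_numeral)
   also have "ennreal (om * (1 / r^2)) = ennreal om * ennreal (1 / r^2)" using om_pos by (intro ennreal_mult) auto
   finally show ?thesis using True by simp
  next
   case False
   then have "r < a \<or> d >= 2 * r" by (auto simp: t_def)
   then show ?thesis by (auto simp: wt_def d_def dist_norm bint_zero)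
  qed
 qed
 also have "... = ennreal om * ennreal (1 / t)"
  using integral_inverse_square[OF t(1)] by (simp add: nn_integral_cmult)
 also have "... = ennreal (om * (1 / t))" using om_pos t by (intro ennreal_mult[symmetric]) auto
 also have "... <= ennreal (3 * om * (1 / (a + d)))"
 proof (rule ennreal_leI)
  have "a + d <= 3 * t" by (auto simp: t_def)
  then have "1 / t <= 3 / (a + d)" using t a d0 by (simp add: field_simps)
  then have "om * (1 / t) <= om * (3 / (a + d))" using om_pos by (intro mult_left_mono) auto
  then show "om * (1 / t) <= 3 * om * (1 / (a + d))" by (simp add: mult.commute)
 qed
 finally show "Jk a x y <= ennreal (3 * om * (1 / (a + norm (x - y))))" by (simp add: d_def)
 have "ennreal (1 / (a + d)) <= ennreal (1 / T)"
  using a d0 t by (intro ennreal_leI divide_left_mono) (auto simp: T_def)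
 also have "... = ennreal (8 / om) * (ennreal (om / 8) * ennreal (1 / T))"
 proof -
  have "1 = ennreal (8 / om) * ennreal (om / 8)" using om_pos by (simp add: ennreal_mult[symmetric])
  then show ?thesis by (metis mult.assoc mult_1)
 qed
 also have "ennreal (om / 8) * ennreal (1 / T) = (NI r. ennreal (om / 8) * (ennreal (1 / r^2) * indicator {T..} r))"
  using integral_inverse_square[OF t(2)] by (simp add: nn_integral_cmult)
 also have "... <= Jk a x y" unfolding Jk_def
 proof (rule nn_integral_mono)
  fix r :: real
  show "ennreal (om / 8) * (ennreal (1 / r^2) * indicator {T..} r) <= wt a r * bint r x y"
  proof (cases "r >= T")
   case True
   then have r: "r >= a" "r > 0" "d <= r" using a by (auto simp: T_def)
   have "ennreal (om / 8) * ennreal (1 / r^2) = ennreal (om / 8 * (1 / r^2))" using om_pos by (intro ennreal_mult[symmetric]) auto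
   also have "om / 8 * (1 / r^2) = 1 / r^5 * (om * (r/2)^3)" using r by (simp add: field_simps eval_nat_numeral)
   also have "ennreal ... = ennreal (1 / r^5) * ennreal (om * (r/2)^3)" using r om_pos by (intro ennreal_mult) auto
   also have "... <= wt a r * bint r x y"
    unfolding wt_def using r by (intro mult_mono bint_ge) (auto simp: d_def dist_norm)
   finally show ?thesis using True by simp
  qed simp
 qed
 finally show "ennreal (1 / (a + norm (x - y))) <= ennreal (8 / om) * Jk a x y" by (simp add: d_def mult_left_mono)
qed

lemma W_le_J:
 assumes a: "a > 0" and [measurable]: "BM f" "BM g" shows "W a f g <= ennreal (16 / om) * J a f g"
proof -
 have "W a f g <= (NI x. NI y. ennreal (16 / om) * ((f x * g y) * Jk a x y))" unfolding W_def
 proof (intro nn_integral_mono)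
  fix x y
  have "ennreal (kernel a (x - y)) <= ennreal (2 * (1 / (a + norm (x - y))))"
   using kernel_bounds(4)[OF a, of "x - y"] by (intro ennreal_leI) simp
  also have "... = 2 * ennreal (1 / (a + norm (x - y)))" using a by (subst ennreal_mult) auto
  also have "... <= 2 * (ennreal (8 / om) * Jk a x y)" by (intro mult_left_mono Jk_bounds a) auto
  also have "... = ennreal (16 / om) * Jk a x y"
  proof -
   have "2 * ennreal (8 / om) = ennreal (16 / om)" using om_pos ennreal_mult[of 2 "8 / om"] by simp
   then show ?thesis by (metis mult.assoc)
  qed
  finally have "ennreal (kernel a (x - y)) * (f x * g y) <= (ennreal (16 / om) * Jk a x y) * (f x * g y)"
   by (rule mult_right_mono) simp
  then show "ennreal (kernel a (x - y)) * (f x * g y) <= ennreal (16 / om) * ((f x * g y) * Jk a x y)" by (simp add: mult_ac)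
 qed
 also have "... = ennreal (16 / om) * J a f g"
  unfolding J_eq[OF assms(2,3)] Jk_def by (subst nn_integral_cmult, measurable) (subst nn_integral_cmult, measurable)
 finally show ?thesis .
qed

lemma J_le_W:
 assumes a: "a > 0" and [measurable]: "BM f" "BM g" shows "J a f g <= ennreal (3 * om) * W a f g"
proof -
 have "J a f g <= (NI x. NI y. ennreal (3 * om) * (ennreal (kernel a (x - y)) * (f x * g y)))"
  unfolding J_eq[OF assms(2,3)]
 proof (rule nn_integral_mono, rule nn_integral_mono_AE)
  fix x
  show "AE y in lborel. (f x * g y) * Jk a x y <= ennreal (3 * om) * (ennreal (kernel a (x - y)) * (f x * g y))"
   using AE_neq[of x]
  proof eventually_elim
   case (elim y)
   have "Jk a x y <= ennreal (3 * om * (1 / (a + norm (x - y))))" by (rule Jk_bounds(1)[OF a])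
   also have "... <= ennreal (3 * om * kernel a (x - y))"
    using om_pos kernel_bounds(3)[OF a, of "x - y"] elim by (intro ennreal_leI mult_left_mono) auto
   also have "... = ennreal (3 * om) * ennreal (kernel a (x - y))" using om_pos kernel_bounds(1)[OF a] by (intro ennreal_mult) auto
   finally have "Jk a x y * (f x * g y) <= (ennreal (3 * om) * ennreal (kernel a (x - y))) * (f x * g y)" by (rule mult_right_mono) simp
   then show ?case by (simp add: mult_ac)
  qed
 qed
 also have "... = ennreal (3 * om) * W a f g"
  unfolding W_def by (subst nn_integral_cmult, measurable) (subst nn_integral_cmult, measurable)
 finally show ?thesis .
qed

lemma ennreal_mult_le_sum_sq: "x * y <= x * x + y * (y::ennreal)"
proof (cases "x <= y")
 case True
 then have "x * y <= y * y" by (intro mult_right_mono) auto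
 also have "... <= x * x + y * y" by simp
 finally show ?thesis .
next
 case False
 then have "x * y <= x * x" by (intro mult_left_mono) auto
 also have "... <= x * x + y * y" by simp
 finally show ?thesis .
qed

definition CW :: ennreal where "CW = ennreal (16 / om) * ennreal (3 * om)"

lemma CW_finite: "CW < top" unfolding CW_def by (simp add: ennreal_mult_less_top)

text \<open>For \<open>J\<close> the inequality holds pointwise in the ball masses; the two-sided
  comparison of the kernels transfers it to \<open>W\<close>, and \<open>CW\<close> is the product
  of the two comparison constants. This substitutes the Cauchy-Schwarz inequality for the positive
  definite form V.\<close>

lemma W_le_sum:
 assumes a: "a > 0" and [measurable]: "BM f" "BM g" shows "W a f g <= CW * (W a f f + W a g g)"
proof -
 have "J a f g <= J a f f + J a g g"
 proof -
  have "J a f g <= (\<integral>\<^sup>+p. wt a (fst p) * (bm f (snd p) (fst p) * bm f (snd p) (fst p)) + wt a (fst p) * (bm g (snd p) (fst p) * bm g (snd p) (fst p)) \<partial>lborel2)"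
   unfolding J_def by (intro nn_integral_mono) (metis distrib_left ennreal_mult_le_sum_sq mult_left_mono zero_le)
  also have "... = J a f f + J a g g" unfolding J_def by (rule nn_integral_add) measurable
  finally show ?thesis .
 qed
 also have "... <= ennreal (3 * om) * W a f f + ennreal (3 * om) * W a g g" by (intro add_mono J_le_W a) measurable
 finally have "ennreal (16 / om) * J a f g <= ennreal (16 / om) * (ennreal (3 * om) * W a f f + ennreal (3 * om) * W a g g)"
  by (rule mult_left_mono) simp
 then show ?thesis using W_le_J[OF a assms(2,3)] by (auto simp: CW_def distrib_left mult.assoc intro: order_trans)
qed

lemma bm_finite:
 assumes a: "a > 0" and [measurable]: "BM f" and fin: "W a f f < top" shows "bm f z R < top"
proof (cases "R > 0")
 case True
 have "(bm f z R)^2 <= ennreal (a + 2 * R) * W a f f" by (rule ball_mass_le_W[OF a True]) measurable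
 also have "... < top" using fin by (simp add: ennreal_mult_less_top)
 finally show ?thesis by (cases "bm f z R") (auto simp: power2_eq_square)
next
 case False
 have "~ dist z x < R" for x using False zero_le_dist[of z x] by linarith
 then have "bm f z R = (\<integral>\<^sup>+x. 0 \<partial>(lborel :: R3 measure))" unfolding bm_def by simp
 then show ?thesis by simp
qed

text \<open>In the form \<open>J\<close> both arguments appear as masses of the same ball, so their
  product splits by comparing one mass with a multiple of the other: the part quadratic in the mass
  of \<open>f n\<close> is bounded by a small multiple of \<open>M\<close>, the rest is dominated by
  a multiple of the squared mass of \<open>h\<close> and tends to 0 pointwise. It will be applied to
  the squares of u_n - U, which vanish only locally.\<close>

lemma W_tendsto_0:
 assumes a: "a > 0" and [measurable]: "!!n. BM (f n)" "BM h"
  and M: "!!n. W a (f n) (f n) <= M" "M < top" and h: "W a h h < top" and loc: "!!z R. (%n. bm (f n) z R) ---> 0"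
 shows "(%n. W a (f n) h) ---> 0"
proof -
 define F where "F n p = bm (f n) (snd p) (fst p)" for n and p :: "real \<times> R3"
 define H where "H p = bm h (snd p) (fst p)" for p :: "real \<times> R3"
 define w where "w p = wt a (fst p)" for p :: "real \<times> R3"
 have [measurable]: "F n \<in> borel_measurable lborel2" "H \<in> borel_measurable lborel2" "w \<in> borel_measurable lborel2" for n
  unfolding F_def H_def w_def by measurable
 have Hfin: "H p < top" for p unfolding H_def by (rule bm_finite[OF a _ h]) measurable
 have wfin: "w p < top" for p by (simp add: w_def wt_def)
 have JM: "(\<integral>\<^sup>+p. w p * (F n p * F n p) \<partial>lborel2) <= ennreal (3 * om) * M" for n
 proof -
  have "(\<integral>\<^sup>+p. w p * (F n p * F n p) \<partial>lborel2) = J a (f n) (f n)" by (simp add: J_def w_def F_def)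
  also have "... <= ennreal (3 * om) * W a (f n) (f n)" by (rule J_le_W[OF a]) measurable
  also have "... <= ennreal (3 * om) * M" by (intro mult_left_mono M) auto
  finally show ?thesis .
 qed
 have JH: "(\<integral>\<^sup>+p. w p * (H p * H p) \<partial>lborel2) < top"
 proof -
  have "(\<integral>\<^sup>+p. w p * (H p * H p) \<partial>lborel2) = J a h h" by (simp add: J_def w_def H_def)
  also have "... <= ennreal (3 * om) * W a h h" by (rule J_le_W[OF a]) measurable
  also have "... < top" using h by (simp add: ennreal_mult_less_top)
  finally show ?thesis .
 qed
 have J0: "(%n. J a (f n) h) ---> 0"
 proof (rule tendsto_zero_ennreal)
  fix e :: real assume e: "e > 0"
  obtain m where m: "M = ennreal m" "m >= 0" using M(2) by (cases M) auto
  define de where "de = e / (2 * (3 * om * m + 1))"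
  have de: "de > 0" using e m om_pos by (simp add: de_def add_nonneg_pos)
  have dem: "de * (3 * om * m) <= e / 2"
  proof -
   have "3 * om * m >= 0" using m om_pos by simp
   then have "e * (3 * om * m) <= e * (3 * om * m + 1)" using e by (intro mult_left_mono) auto
   then show ?thesis using \<open>3 * om * m >= 0\<close> by (simp add: de_def field_simps)
  qed
  define E where "E n p = w p * min (F n p * H p) (ennreal (1/de) * (H p * H p))" for n p
  have [measurable]: "E n \<in> borel_measurable lborel2" for n unfolding E_def by measurable
  have split: "w p * (F n p * H p) <= ennreal de * (w p * (F n p * F n p)) + E n p" for n p
  proof (cases "F n p <= ennreal (1/de) * H p")
   case True
   then have "F n p * H p <= ennreal (1/de) * H p * H p" by (intro mult_right_mono) auto
   then have "E n p = w p * (F n p * H p)" by (simp add: E_def min_def mult.assoc)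
   then show ?thesis by simp
  next
   case False
   have "H p = ennreal de * (ennreal (1/de) * H p)"
   proof -
    have "ennreal de * ennreal (1/de) = 1" using de by (simp add: ennreal_mult[symmetric])
    then show ?thesis by (metis mult.assoc mult_1)
   qed
   also have "... <= ennreal de * F n p" using False by (intro mult_left_mono) auto
   finally have "w p * (F n p * H p) <= w p * (F n p * (ennreal de * F n p))" by (intro mult_left_mono) auto
   also have "... = ennreal de * (w p * (F n p * F n p))" by (simp add: mult_ac)
   also have "... <= ennreal de * (w p * (F n p * F n p)) + E n p" by simp
   finally show ?thesis .
  qed
  have "(%n. \<integral>\<^sup>+p. E n p \<partial>lborel2) ---> (\<integral>\<^sup>+p. 0 \<partial>(lborel2 :: (real \<times> R3) measure))"
  proof (rule nn_integral_dominated_convergence[where w="%p. w p * (ennreal (1/de) * (H p * H p))"])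
   show "AE p in lborel2. E n p <= w p * (ennreal (1/de) * (H p * H p))" for n
    unfolding E_def by (intro AE_I2 mult_left_mono) auto
   have "(\<integral>\<^sup>+p. w p * (ennreal (1/de) * (H p * H p)) \<partial>lborel2) = (\<integral>\<^sup>+p. ennreal (1/de) * (w p * (H p * H p)) \<partial>lborel2)"
    by (intro nn_integral_cong) (simp add: mult_ac)
   also have "... = ennreal (1/de) * (\<integral>\<^sup>+p. w p * (H p * H p) \<partial>lborel2)" by (rule nn_integral_cmult) measurable
   also have "... < \<infinity>" using JH by (simp add: ennreal_mult_less_top)
   finally show "(\<integral>\<^sup>+p. w p * (ennreal (1/de) * (H p * H p)) \<partial>lborel2) < \<infinity>" .
   show "AE p in lborel2. (%n. E n p) ---> 0"
   proof (rule AE_I2)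
    fix p
    have "(%n. F n p) ---> 0" unfolding F_def by (rule loc)
    from ennreal_tendsto_cmult[OF wfin ennreal_tendsto_cmult[OF Hfin this], of p p]
    have "(%n. w p * (H p * F n p)) ---> 0" by simp
    then show "(%n. E n p) ---> 0" by (rule tendsto_sandwich[OF _ _ tendsto_const, rotated 2])
      (auto simp: E_def mult.commute intro!: always_eventually mult_left_mono)
   qed
  qed measurable
  then have "eventually (%n. (\<integral>\<^sup>+p. E n p \<partial>lborel2) < ennreal (e/2)) sequentially"
   using e by (intro order_tendstoD(2)[where y=0]) auto
  then show "eventually (%n. J a (f n) h < ennreal e) sequentially"
  proof eventually_elim
   case (elim n)
   have "J a (f n) h = (\<integral>\<^sup>+p. w p * (F n p * H p) \<partial>lborel2)" by (simp add: J_def w_def F_def H_def)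
   also have "... <= (\<integral>\<^sup>+p. ennreal de * (w p * (F n p * F n p)) + E n p \<partial>lborel2)" by (intro nn_integral_mono split)
   also have "... = ennreal de * (\<integral>\<^sup>+p. w p * (F n p * F n p) \<partial>lborel2) + (\<integral>\<^sup>+p. E n p \<partial>lborel2)"
    by (subst nn_integral_add, measurable) (subst nn_integral_cmult, measurable)
   also have "... <= ennreal de * (ennreal (3 * om) * M) + (\<integral>\<^sup>+p. E n p \<partial>lborel2)"
    by (intro add_mono mult_left_mono JM) auto
   also have "ennreal de * (ennreal (3 * om) * M) = ennreal (de * (3 * om * m))"
    using de m om_pos by (simp add: ennreal_mult)
   also have "ennreal (de * (3 * om * m)) + (\<integral>\<^sup>+p. E n p \<partial>lborel2) <= ennreal (e/2) + (\<integral>\<^sup>+p. E n p \<partial>lborel2)"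
    by (intro add_right_mono ennreal_leI dem)
   also have "... < ennreal (e/2) + ennreal (e/2)" using elim by (intro ennreal_add_left_cancel_less[THEN iffD2]) auto
   also have "... = ennreal e" using e by (simp flip: ennreal_plus)
   finally show ?case .
  qed
 qed
 have "(%n. ennreal (16 / om) * J a (f n) h) ---> ennreal (16 / om) * 0" by (intro ennreal_tendsto_cmult J0) simp
 then have J0': "(%n. ennreal (16 / om) * J a (f n) h) ---> 0" by simp
 show ?thesis by (rule tendsto_sandwich[OF _ _ tendsto_const J0']) (auto intro!: always_eventually W_le_J a)
qed

lemma W_Fatou:
 assumes [measurable]: "!!n. BM (u n)" "BM v" and lim: "AL x. (%n. u n x) ---> v x"
 shows "W a (%x. ennreal ((v x)^2)) (%x. ennreal ((v x)^2)) <= liminf (%n. W a (%x. ennreal ((u n x)^2)) (%x. ennreal ((u n x)^2)))"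
proof -
 define I where "I n x = (NI y. ennreal (kernel a (x - y)) * (ennreal ((u n x)^2) * ennreal ((u n y)^2)))" for n x
 have "W a (%x. ennreal ((v x)^2)) (%x. ennreal ((v x)^2)) <= (NI x. liminf (%n. I n x))" unfolding W_def
 proof (rule nn_integral_mono_AE, use lim in eventually_elim)
  case (elim x)
  have "(NI y. ennreal (kernel a (x - y)) * (ennreal ((v x)^2) * ennreal ((v y)^2)))
   = (NI y. liminf (%n. ennreal (kernel a (x - y)) * (ennreal ((u n x)^2) * ennreal ((u n y)^2))))"
  proof (rule nn_integral_cong_AE, use lim in eventually_elim)
   case (elim y)
   have "(%n. ennreal (kernel a (x - y)) * ennreal ((u n x)^2 * (u n y)^2)) ---> ennreal (kernel a (x - y)) * ennreal ((v x)^2 * (v y)^2)"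
    by (intro ennreal_tendsto_cmult tendsto_ennrealI tendsto_intros elim \<open>(%n. u n x) ---> v x\<close>) simp
   from lim_imp_Liminf[OF trivial_limit_sequentially this] show ?case by (simp add: ennreal_mult)
  qed
  also have "... <= liminf (%n. I n x)" unfolding I_def by (rule nn_integral_liminf) measurable
  finally show ?case .
 qed
 also have "... <= liminf (%n. (NI x. I n x))" unfolding I_def by (rule nn_integral_liminf) measurable
 finally show ?thesis by (simp add: I_def W_def)
qed

section \<open>Weak limits in the space of square integrable fields\<close>

definition L2v :: "(R3 => R3) => bool" where
 "L2v g \<longleftrightarrow> BM g & (NE x. (norm (g x))^2) < \<infinity>"

definition N2 :: "(R3 => R3) => real" where
 "N2 g = (LI x. (norm (g x))^2)"

definition ip :: "(R3 => R3) => (R3 => R3) => real" where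
 "ip f g = (LI x. f x \<bullet> g x)"

lemma L2v_measurable[measurable_dest]: "L2v g ==> BM g"
 by (simp add: L2v_def)

lemma L2v_sq_integrable: "L2v g ==> integrable lborel (%x. (norm (g x))^2)"
 unfolding L2v_def by (intro integrableI_nonneg) auto

lemma N2_nonneg: "N2 g >= 0"
 unfolding N2_def by (intro Bochner_Integration.integral_nonneg) simp

lemma L2v_nn_integral: "L2v g ==> (NE x. (norm (g x))^2) = ennreal (N2 g)"
 unfolding N2_def by (intro nn_integral_eq_integral L2v_sq_integrable) auto

lemma L2v_inner_integrable:
 assumes "L2v f" "L2v h" shows "integrable lborel (%x. f x \<bullet> h x)"
proof (rule Bochner_Integration.integrable_bound[OF Bochner_Integration.integrable_add[OF L2v_sq_integrable[OF assms(1)] L2v_sq_integrable[OF assms(2)]]])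
 have [measurable]: "BM f" "BM h" using assms by auto
 show "(%x. f x \<bullet> h x) \<in> borel_measurable lborel" by measurable
 have "\<bar>f x \<bullet> h x\<bar> <= (norm (f x))^2 + (norm (h x))^2" for x
 proof -
  have "0 <= (norm (f x) - norm (h x))^2" by simp
  then have "2 * (norm (f x) * norm (h x)) <= (norm (f x))^2 + (norm (h x))^2" by (simp add: power2_diff)
  moreover have "\<bar>f x \<bullet> h x\<bar> <= norm (f x) * norm (h x)" by (rule Cauchy_Schwarz_ineq2)
  moreover have "0 <= norm (f x) * norm (h x)" by simp
  ultimately show ?thesis by linarith
 qed
 then show "AL x. norm (f x \<bullet> h x) <= norm ((norm (f x))^2 + (norm (h x))^2)" by auto
qed

lemma L2v_add:
 assumes f: "L2v f" and h: "L2v h" shows "L2v (%x. f x + c *\<^sub>R h x)"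
proof -
 have [measurable]: "BM f" "BM h" using assms by auto
 have "(NE x. (norm (f x + c *\<^sub>R h x))^2)
  <= (NI x. ennreal 2 * ennreal ((norm (f x))^2) + ennreal (2 * c^2) * ennreal ((norm (h x))^2))"
  by (intro nn_integral_mono ennreal_le_lincomb norm_add_scale_sq) auto
 also have "... = ennreal 2 * (NE x. (norm (f x))^2) + ennreal (2 * c^2) * (NE x. (norm (h x))^2)"
  by (subst nn_integral_add) (auto simp: nn_integral_cmult)
 also have "... < \<infinity>" using f h by (auto simp: L2v_def ennreal_mult_less_top)
 finally show ?thesis by (simp add: L2v_def)
qed

lemma L2v_zero: "L2v (%_. 0)" by (simp add: L2v_def)

lemma L2v_scale: "L2v f ==> L2v (%x. c *\<^sub>R f x)"
 using L2v_add[OF L2v_zero, of f c] by simp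

lemma ip_commute: "ip f g = ip g f" by (simp add: ip_def inner_commute)

lemma ip_add:
 assumes "L2v f" "L2v g" "L2v h" shows "ip (%x. f x + c *\<^sub>R g x) h = ip f h + c * ip g h"
 using L2v_inner_integrable[OF assms(1,3)] L2v_inner_integrable[OF assms(2,3)] by (simp add: ip_def inner_simps)

lemma N2_ip: "N2 f = ip f f" by (simp add: N2_def ip_def power2_norm_eq_inner)

lemma N2_add:
 assumes "L2v f" "L2v g" shows "N2 (%x. f x + c *\<^sub>R g x) = N2 f + 2 * c * ip f g + c^2 * N2 g"
proof -
 have l: "L2v (%x. f x + c *\<^sub>R g x)" using assms by (rule L2v_add)
 have "N2 (%x. f x + c *\<^sub>R g x) = ip f (%x. f x + c *\<^sub>R g x) + c * ip g (%x. f x + c *\<^sub>R g x)"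
  unfolding N2_ip by (rule ip_add[OF assms l])
 also have "ip f (%x. f x + c *\<^sub>R g x) = ip f f + c * ip g f" by (subst ip_commute) (rule ip_add[OF assms assms(1)])
 also have "ip g (%x. f x + c *\<^sub>R g x) = ip f g + c * ip g g" by (subst ip_commute) (rule ip_add[OF assms assms(2)])
 finally show ?thesis by (simp add: N2_ip ip_commute[of g f] power2_eq_square algebra_simps)
qed

lemma ip_Cauchy_Schwarz:
 assumes "L2v f" "L2v g" shows "(ip f g)^2 <= N2 f * N2 g"
proof -
 have "0 <= N2 (%x. (N2 g) *\<^sub>R f x + (- ip f g) *\<^sub>R g x)" by (rule N2_nonneg)
 also have "... = N2 (%x. (N2 g) *\<^sub>R f x) + 2 * (- ip f g) * ip (%x. (N2 g) *\<^sub>R f x) g + (- ip f g)^2 * N2 g"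
  by (rule N2_add[OF L2v_scale[OF assms(1)] assms(2)])
 also have "N2 (%x. (N2 g) *\<^sub>R f x) = (N2 g)^2 * N2 f" unfolding N2_def by (simp add: power_mult_distrib)
 also have "ip (%x. (N2 g) *\<^sub>R f x) g = N2 g * ip f g" unfolding ip_def by simp
 finally have "0 <= N2 g * (N2 f * N2 g - (ip f g)^2)" by (simp add: power2_eq_square algebra_simps)
 moreover have "ip f g = 0" if "N2 g = 0"
 proof -
  have "AL x. (norm (g x))^2 = 0"
   using that integral_nonneg_eq_0_iff_AE[OF L2v_sq_integrable[OF assms(2)]] by (simp add: N2_def)
  then have "AL x. f x \<bullet> g x = 0" by eventually_elim simp
  then show ?thesis unfolding ip_def by (rule integral_eq_zero_AE)
 qed
 ultimately show ?thesis using N2_nonneg[of g] N2_nonneg[of f] by (cases "N2 g = 0") (auto simp: zero_le_mult_iff)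
qed

text \<open>As in Mazur's lemma, nearly minimal elements of the midpoint-closed hulls of the tails converge strongly.\<close>

inductive midset :: "(nat => R3 => R3) => nat => (R3 => R3) => bool" for g n where
 midset_base: "k >= n ==> midset g n (g k)"
| midset_mid: "midset g n f ==> midset g n h ==> midset g n (%x. (1/2) *\<^sub>R (f x + h x))"

lemma midset_mono: "midset g n f ==> m <= n ==> midset g m f"
 by (induction rule: midset.induct) (auto intro: midset.intros)

lemma midpoint_decomp:
 assumes "L2v f" "L2v h" shows "L2v (%x. (1/2) *\<^sub>R (f x + h x))"
  "N2 (%x. (1/2) *\<^sub>R (f x + h x)) = (1/4) * (N2 f + 2 * ip f h + N2 h)"
  "L2v k ==> ip (%x. (1/2) *\<^sub>R (f x + h x)) k = (1/2) * (ip f k + ip h k)"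
proof -
 have e: "(%x. (1/2) *\<^sub>R (f x + h x)) = (%x. (1/2) *\<^sub>R f x + (1/2) *\<^sub>R h x)" by (simp add: scaleR_add_right)
 have l: "L2v (%x. (1/2) *\<^sub>R f x)" by (rule L2v_scale[OF assms(1)])
 have s: "ip (%x. (1/2) *\<^sub>R f x) k = (1/2) * ip f k" for k unfolding ip_def by simp
 have n: "N2 (%x. (1/2) *\<^sub>R f x) = (1/4) * N2 f" unfolding N2_def by (simp add: power_divide)
 show "L2v (%x. (1/2) *\<^sub>R (f x + h x))" unfolding e by (rule L2v_add[OF l assms(2)])
 show "N2 (%x. (1/2) *\<^sub>R (f x + h x)) = (1/4) * (N2 f + 2 * ip f h + N2 h)"
  unfolding e N2_add[OF l assms(2)] s n by (simp add: power2_eq_square field_simps)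
 show "L2v k ==> ip (%x. (1/2) *\<^sub>R (f x + h x)) k = (1/2) * (ip f k + ip h k)"
  unfolding e by (subst ip_add[OF l assms(2)]) (auto simp: s)
qed

lemma parallelogram_estimate:
 fixes x y a b i D P :: real
 shows "x <= a + i ==> y <= b + i ==> D <= P ==> 2 * x + 2 * y - 4 * P <= 2 * (a + i) + 2 * (b + i) - 4 * D" by argo

text \<open>The strong limit of nearly minimal convex combinations pairs correctly with every
  \<open>h\<close> for which the pairings converge, because |ip k h - l| < e is preserved by
  midpoints. Convergence of the pairings themselves is established later, in
  \<open>weak_compactness\<close>, from the uniqueness of weak gradients.\<close>

lemma weak_limit_exists:
 assumes g: "!!n. L2v (g n)" and M: "!!n. N2 (g n) <= M"
 obtains G where "L2v G" "!!h l. L2v h ==> (%n. ip (g n) h) ---> l ==> ip G h = l"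
proof -
 have ml: "L2v f" if "midset g n f" for n f using that by induction (auto intro: g midpoint_decomp)
 define d where "d n = Inf (N2 ` {f. midset g n f})" for n
 have bdd: "bdd_below (N2 ` {f. midset g n f})" for n using N2_nonneg by (intro bdd_belowI[of _ 0]) auto
 have ne: "N2 ` {f. midset g n f} ~= {}" for n using midset_base[of n n g] by blast
 have dle: "d n <= N2 f" if "midset g n f" for n f unfolding d_def by (rule cInf_lower[OF _ bdd]) (use that in blast)
 have "EX f. midset g n f & N2 f < d n + inverse (real (Suc n))" for n
 proof -
  have "\<exists>y\<in>N2 ` {f. midset g n f}. y < d n + inverse (real (Suc n))"
   unfolding d_def by (subst cInf_less_iff[OF ne bdd, symmetric]) simp
  then show ?thesis by blast
 qed
 then obtain f where f: "!!n. midset g n (f n)" "!!n. N2 (f n) < d n + inverse (real (Suc n))" by metis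
 have fL: "L2v (f n)" for n using ml f(1) by blast
 have [measurable]: "BM (f n)" for n using fL by auto
 have dmono: "d m <= d n" if "m <= n" for m n
  unfolding d_def[of n] by (rule cInf_greatest[OF ne]) (use that in \<open>auto intro: dle midset_mono\<close>)
 have dM: "d n <= M" for n using dle[OF midset_base[of n n g]] M[of n] by auto
 have "norm (d n) <= \<bar>d 0\<bar> + \<bar>M\<bar>" for n using dmono[of 0 n] dM[of n] by simp
 then have "Bseq d" by (rule BseqI')
 then have "convergent d" by (rule Bseq_mono_convergent) (use dmono in blast)
 then have "Cauchy d" by (rule convergent_Cauchy)
 have diff: "N2 (%x. f m x - f n x) = 2 * N2 (f m) + 2 * N2 (f n) - 4 * N2 (%x. (1/2) *\<^sub>R (f m x + f n x))" for m n
  unfolding midpoint_decomp(2)[OF fL fL] using N2_add[OF fL fL, of m "-1" n] by (simp add: field_simps)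
 \<comment> \<open>The midpoint of \<open>f m\<close> and \<open>f n\<close> lies in the hull of the
   tail from min m n, so its squared norm is at least \<open>d (min m n)\<close>; with near
   minimality the parallelogram law bounds the distance. As \<open>d\<close> is monotone and
   bounded, this makes \<open>f\<close> Cauchy.\<close>
 have key: "N2 (%x. f m x - f n x) <= 2 * \<bar>d m - d n\<bar> + 4 * inverse (real (Suc K))" if "m >= K" "n >= K" for m n K
 proof -
  have i: "inverse (real (Suc m)) <= inverse (real (Suc K))" "inverse (real (Suc n)) <= inverse (real (Suc K))"
   using that by (auto simp: field_simps)
  have "midset g (min m n) (%x. (1/2) *\<^sub>R (f m x + f n x))"
   using midset_mono[OF f(1)[of m], of "min m n"] midset_mono[OF f(1)[of n], of "min m n"] by (intro midset_mid) auto
  then have "d (min m n) <= N2 (%x. (1/2) *\<^sub>R (f m x + f n x))" by (rule dle)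
  moreover define P where "P = N2 (%x. (1/2) *\<^sub>R (f m x + f n x))"
  ultimately have P: "d (min m n) <= P" by simp
  have "N2 (f m) <= d m + inverse (real (Suc K))" "N2 (f n) <= d n + inverse (real (Suc K))"
   using f(2)[of m] f(2)[of n] i by linarith+
  then have "N2 (%x. f m x - f n x) <= 2 * (d m + inverse (real (Suc K))) + 2 * (d n + inverse (real (Suc K))) - 4 * d (min m n)"
   using P unfolding diff P_def[symmetric] by (rule parallelogram_estimate)
  also have "... <= 2 * \<bar>d m - d n\<bar> + 4 * inverse (real (Suc K))"
  proof (cases "m <= n")
   case True
   then have e: "min m n = m" by simp
   have "d n - d m <= \<bar>d m - d n\<bar>" by simp
   then show ?thesis unfolding e by argo
  next
   case False
   then have e: "min m n = n" by simp
   have "d m - d n <= \<bar>d m - d n\<bar>" by simp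
   then show ?thesis unfolding e by argo
  qed
  finally show ?thesis .
 qed
 have dL: "L2v (%x. f m x - f n x)" for m n using L2v_add[OF fL fL, of m "-1" n] by simp
 have cauchy: "EX N. ALL m>=N. ALL n>=N. (NE x. (norm (f m x - f n x))^2) <= ennreal e" if e: "e > 0" for e
 proof -
  obtain N1 where N1: "!!m n. m >= N1 ==> n >= N1 ==> \<bar>d m - d n\<bar> < e/4"
   using \<open>Cauchy d\<close> e unfolding Cauchy_def dist_real_def by (metis divide_pos_pos zero_less_numeral)
  obtain N2' where N2': "inverse (real (Suc N2')) < e / 8" using reals_Archimedean[of "e/8"] e by auto
  have "N2 (%x. f m x - f n x) <= e" if "m >= max N1 N2'" "n >= max N1 N2'" for m n
   using key[of N2' m n] N1[of m n] that N2' by auto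
  then show ?thesis using dL by (intro exI[of _ "max N1 N2'"]) (auto simp: L2v_nn_integral intro!: ennreal_leI)
 qed
 have fm: "f n \<in> borel_measurable lborel" for n by measurable
 obtain G r where G[measurable]: "G \<in> borel_measurable lborel" and r: "strict_mono r"
  and ae: "AL x. (%n. f (r n) x) ---> G x" and L2: "(%n. (NE x. (norm (f n x - G x))^2)) ---> 0"
  by (rule L2_complete[of f lborel, OF fm cauchy], assumption, rule that)
 have "eventually (%n. (NE x. (norm (f n x - G x))^2) < 1) sequentially" using L2 by (rule order_tendstoD(2)) simp
 then obtain n where "(NE x. (norm (f n x - G x))^2) < 1" by (auto simp: eventually_sequentially)
 then have "L2v (%x. f n x - G x)" by (auto simp: L2v_def intro: less_trans)
 from L2v_add[OF fL this, of n "-1"] have GL: "L2v G" by simp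
 have dG: "L2v (%x. f n x - G x)" for n using L2v_add[OF fL GL, of n "-1"] by simp
 have dG0: "(%n. N2 (%x. f n x - G x)) ---> 0"
  using L2 by (simp add: L2v_nn_integral[OF dG] N2_nonneg ennreal_tendsto_0_iff)
 show ?thesis
 proof (rule that[OF GL])
  fix h l assume h: "L2v h" and l: "(%n. ip (g n) h) ---> l"
  have t1: "(%n. ip (f n) h) ---> l"
  proof (rule LIMSEQ_I)
   fix e :: real assume e: "e > 0"
   then obtain N where N: "!!n. n >= N ==> \<bar>ip (g n) h - l\<bar> < e" using LIMSEQ_D[OF l e] by auto
   have "\<bar>ip k h - l\<bar> < e" if "midset g N k" for k using that
   proof induction
    case (midset_base k)
    then show ?case by (rule N)
   next
    case (midset_mid k k')
    have "ip (%x. (1/2) *\<^sub>R (k x + k' x)) h - l = (1/2) * ((ip k h - l) + (ip k' h - l))"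
     using midpoint_decomp(3)[OF ml[OF midset_mid(1)] ml[OF midset_mid(2)] h] by (simp add: field_simps)
    then show ?case using midset_mid.IH by (simp add: abs_if split: if_splits)
   qed
   then show "EX N. ALL n>=N. norm (ip (f n) h - l) < e" using midset_mono[OF f(1)] by (intro exI[of _ N]) auto
  qed
  have t2: "(%n. ip (f n) h) ---> ip G h"
  proof -
   have "(%n. N2 (%x. f n x - G x) * N2 h) ---> 0 * N2 h" by (intro tendsto_intros dG0)
   then have z: "(%n. N2 (%x. f n x - G x) * N2 h) ---> 0" by simp
   have "(%n. (ip (%x. f n x - G x) h)^2) ---> 0"
    by (rule tendsto_sandwich[OF _ _ tendsto_const z]) (auto intro!: always_eventually ip_Cauchy_Schwarz[OF dG h])
   from tendsto_real_sqrt[OF this] have "(%n. ip (%x. f n x - G x) h) ---> 0" by (simp add: tendsto_rabs_zero_iff)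
   moreover have "ip (%x. f n x - G x) h = ip (f n) h - ip G h" for n using ip_add[OF fL GL h, of n "-1"] by simp
   ultimately have "(%n. ip (f n) h - ip G h) ---> 0" by simp
   then show ?thesis by (simp add: LIM_zero_iff)
  qed
  show "ip G h = l" using LIMSEQ_unique[OF t2 t1] .
 qed
qed

section \<open>The energy space\<close>

definition sq :: "(R3 => real) => R3 => ennreal" where "sq u x = ennreal ((u x)^2)"
definition nsq :: "(R3 => R3) => R3 => ennreal" where "nsq g x = ennreal ((norm (g x))^2)"

lemma sq_measurable[measurable (raw)]: "BM u ==> BM (sq u)"
 unfolding sq_def[abs_def] by measurable
lemma nsq_measurable[measurable (raw)]: "BM g ==> BM (nsq g)"
 unfolding nsq_def[abs_def] by measurable

text \<open>The L^6 condition of \<open>D12\<close> is encoded by finiteness of the V-term on top of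
  local square integrability: \<open>Sobolev_X\<close> recovers it, and this form is the one that
  passes to the limits below.\<close>

definition X :: "real => (R3 => real) => (R3 => R3) => bool" where
 "X a u g \<longleftrightarrow> wpair u g & W a (sq u) (sq u) < top"

lemma X_measurable[measurable_dest]: "X a u g ==> BM u" "X a u g ==> BM g"
 by (auto simp: X_def)

lemma wpair_L2v: "wpair u g ==> L2v g" by (simp add: wpair_def L2v_def)

lemma X_L2v: "X a u g ==> L2v g" by (auto simp: X_def intro: wpair_L2v)

lemma L2v_nsq: "L2v g ==> (NI x. nsq g x) = ennreal (N2 g)"
 by (simp add: nsq_def L2v_nn_integral)

lemma W_add_left:
 assumes [measurable]: "BM f" "BM g" "BM h" shows "W a (%x. f x + g x) h = W a f h + W a g h"
proof -
 have "W a (%x. f x + g x) h = (NI x. (NI y. ennreal (kernel a (x - y)) * (f x * h y)) + (NI y. ennreal (kernel a (x - y)) * (g x * h y)))"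
  unfolding W_def by (intro nn_integral_cong) (subst nn_integral_add[symmetric], measurable, simp add: distrib_left distrib_right)
 also have "... = W a f h + W a g h" unfolding W_def by (rule nn_integral_add) measurable
 finally show ?thesis .
qed

lemma W_scale:
 assumes [measurable]: "BM f" "BM g" shows "W a (%x. c * f x) (%x. d * g x) = c * (d * W a f g)"
proof -
 have "W a (%x. c * f x) (%x. d * g x) = (NI x. NI y. c * (d * (ennreal (kernel a (x - y)) * (f x * g y))))"
  unfolding W_def by (intro nn_integral_cong) (simp add: mult_ac)
 also have "... = (NI x. c * (d * (NI y. ennreal (kernel a (x - y)) * (f x * g y))))"
  by (intro nn_integral_cong) (subst nn_integral_cmult, measurable, subst nn_integral_cmult, measurable)
 also have "... = c * (d * W a f g)"
  unfolding W_def by (subst nn_integral_cmult, measurable) (subst nn_integral_cmult, measurable)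
 finally show ?thesis .
qed

lemma W_add_finite:
 assumes a: "a > 0" and [measurable]: "BM f" "BM g" and fin: "W a f f < top" "W a g g < top"
 shows "W a f g < top" "W a (%x. f x + g x) (%x. f x + g x) < top"
proof -
 have "W a f g <= CW * (W a f f + W a g g)" by (rule W_le_sum[OF a]) measurable
 also have "... < top" using fin CW_finite by (simp add: ennreal_mult_less_top)
 finally show fg: "W a f g < top" .
 have "W a (%x. f x + g x) (%x. f x + g x) = W a f (%x. f x + g x) + W a g (%x. f x + g x)" by (rule W_add_left) measurable
 also have "W a f (%x. f x + g x) = W a (%x. f x + g x) f" by (rule W_commute) (use a in measurable)
 also have "W a (%x. f x + g x) f = W a f f + W a g f" by (rule W_add_left) measurable
 also have "W a g (%x. f x + g x) = W a (%x. f x + g x) g" by (rule W_commute) (use a in measurable)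
 also have "W a (%x. f x + g x) g = W a f g + W a g g" by (rule W_add_left) measurable
 also have "W a g f = W a f g" by (rule W_commute) (use a in measurable)
 finally show "W a (%x. f x + g x) (%x. f x + g x) < top" using fin fg by simp
qed

lemma X_add:
 assumes a: "a > 0" and u: "X a u g" and v: "X a v h" shows "X a (%x. u x + c * v x) (%x. g x + c *\<^sub>R h x)"
proof -
 have [measurable]: "BM u" "BM v" using u v by auto
 have "W a (sq (%x. u x + c * v x)) (sq (%x. u x + c * v x))
  <= W a (%x. 2 * sq u x + ennreal (2 * c^2) * sq v x) (%x. 2 * sq u x + ennreal (2 * c^2) * sq v x)"
 proof -
  have "sq (%x. u x + c * v x) x <= 2 * sq u x + ennreal (2 * c^2) * sq v x" for x
  proof -
   have "0 <= (u x - c * v x)^2" by simp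
   then have "(u x + c * v x)^2 <= 2 * (u x)^2 + 2 * c^2 * (v x)^2"
    by (simp add: power2_sum power2_diff power_mult_distrib)
   from ennreal_le_lincomb[OF this] show ?thesis by (simp add: sq_def)
  qed
  then show ?thesis by (intro W_mono)
 qed
 also have "... < top"
 proof (rule W_add_finite(2)[OF a])
  show "W a (%x. 2 * sq u x) (%x. 2 * sq u x) < top" using u by (subst W_scale) (auto simp: X_def ennreal_mult_less_top)
  show "W a (%x. ennreal (2 * c^2) * sq v x) (%x. ennreal (2 * c^2) * sq v x) < top"
   using v by (subst W_scale) (auto simp: X_def ennreal_mult_less_top)
 qed measurable
 finally show ?thesis using wpair_add[of u g v h c] u v by (simp add: X_def)
qed

text \<open>In the local inequality on a ball of radius N the lower order term is N^(-2) times the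
  mass in the ball of radius 3 N, hence at most N^(-2) sqrt((a + 6 N) m), which tends to 0.
  Finiteness of V thus plays the part of decay at infinity.\<close>

lemma Sobolev_X:
 assumes a: "a > 0" and u: "X a u g" shows "(NE x. (u x)^6) <= Csob * (NI x. nsq g x)^3"
proof -
 have [measurable]: "BM u" "BM g" using u by auto
 have w: "wpair u g" using u by (simp add: X_def)
 define A where "A = N2 g"
 have A: "(NI x. nsq g x) = ennreal A" "A >= 0" using L2v_nsq[OF X_L2v[OF u]] by (auto simp: A_def N2_nonneg)
 obtain m where m: "W a (sq u) (sq u) = ennreal m" "m >= 0" using u unfolding X_def by (cases "W a (sq u) (sq u)") auto
 define c where "c n = (1 / (real (Suc n))^2) * sqrt ((a + 6 * real (Suc n)) * m)" for n
 have c0: "c n >= 0" for n unfolding c_def using a m by simp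
 have cl: "c ---> 0"
 proof -
  have b: "c n <= sqrt ((a + 6) * m) * inverse (real (Suc n))" for n
  proof -
   define N where "N = real (Suc n)"
   have N: "N >= 1" by (simp add: N_def)
   have "a + 6 * N <= (a + 6) * N^2"
   proof -
    have "N <= N^2" "1 <= N^2" using N one_le_power[OF N, of 2] by (auto simp: power2_eq_square)
    then have "a * 1 <= a * N^2" "6 * N <= 6 * N^2" using a by (auto intro!: mult_left_mono)
    then show ?thesis by (simp add: algebra_simps)
   qed
   from mult_right_mono[OF this m(2)] have "(a + 6 * N) * m <= ((a + 6) * m) * N^2" by (simp add: mult_ac)
   then have "sqrt ((a + 6 * N) * m) <= sqrt (((a + 6) * m) * N^2)" by simp
   also have "... = sqrt ((a + 6) * m) * N" using N by (simp add: real_sqrt_mult)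
   finally have "(1 / N^2) * sqrt ((a + 6 * N) * m) <= (1 / N^2) * (sqrt ((a + 6) * m) * N)" by (intro mult_left_mono) auto
   also have "... = sqrt ((a + 6) * m) * inverse N" using N by (simp add: power2_eq_square field_simps)
   finally show ?thesis by (simp add: c_def N_def)
  qed
  have "(%n. sqrt ((a + 6) * m) * inverse (real (Suc n))) ---> sqrt ((a + 6) * m) * 0"
   by (intro tendsto_intros LIMSEQ_inverse_real_of_nat)
  then have z: "(%n. sqrt ((a + 6) * m) * inverse (real (Suc n))) ---> 0" by simp
  show ?thesis by (rule tendsto_sandwich[OF _ _ tendsto_const z]) (auto intro!: always_eventually simp: c0 b simp del: of_nat_Suc)
 qed
 have est: "(NI x. indicator (ball 0 (real (Suc n))) x * ennreal ((u x)^6)) <= Csob * ennreal ((A + c n)^3)" for n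
 proof -
  define N where "N = real (Suc n)"
  have N: "N > 0" by (simp add: N_def)
  have i1: "(NI x. indicator (ball 0 (3 * N)) x * ennreal ((norm (g x))^2)) <= ennreal A"
   unfolding A(1)[symmetric] nsq_def by (intro nn_integral_mono) (auto simp: indicator_def)
  have i2: "(NI x. indicator (ball 0 (3 * N)) x * ennreal ((u x)^2)) <= ennreal (sqrt ((a + 6 * N) * m))"
  proof -
   have "(NI x. indicator (ball 0 (3 * N)) x * ennreal ((u x)^2)) = bm (sq u) 0 (3 * N)"
    using bm_indicator[of 0 "3 * N" "sq u"] by (simp add: sq_def)
   also have "... <= ennreal (sqrt ((a + 6 * N) * m))"
   proof (rule power2_le_imp_le_ennreal)
    have "(bm (sq u) 0 (3 * N))^2 <= ennreal (a + 2 * (3 * N)) * W a (sq u) (sq u)"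
     by (rule ball_mass_le_W[OF a]) (use N in auto)
    also have "... = ennreal ((a + 6 * N) * m)" using a N m by (simp add: ennreal_mult)
    finally show "(bm (sq u) 0 (3 * N))^2 <= (ennreal (sqrt ((a + 6 * N) * m)))^2" using a N m by (simp add: ennreal_power)
   qed
   finally show ?thesis .
  qed
  have "(NI x. indicator (ball 0 N) x * ennreal ((u x)^6))
   <= Csob * ((NI x. indicator (ball 0 (3 * N)) x * ennreal ((norm (g x))^2))
    + ennreal (1 / N^2) * (NI x. indicator (ball 0 (3 * N)) x * ennreal ((u x)^2))) ^ 3"
   by (rule local_sobolev[OF w N])
  also have "... <= Csob * (ennreal A + ennreal (1 / N^2) * ennreal (sqrt ((a + 6 * N) * m)))^3"
   by (intro mult_left_mono power_mono add_mono i1 i2) auto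
  also have "ennreal A + ennreal (1 / N^2) * ennreal (sqrt ((a + 6 * N) * m)) = ennreal (A + c n)"
  proof -
   have "ennreal (1 / N^2) * ennreal (sqrt ((a + 6 * N) * m)) = ennreal (c n)"
    unfolding c_def N_def[symmetric] using a N m by (intro ennreal_mult[symmetric]) auto
   then show ?thesis using A(2) c0[of n] by simp
  qed
  also have "(ennreal (A + c n))^3 = ennreal ((A + c n)^3)" using A(2) c0[of n] by (intro ennreal_power) simp
  finally show ?thesis by (simp only: N_def)
 qed
 have "(NE x. (u x)^6) = (NI x. liminf (%n. indicator (ball 0 (real (Suc n))) x * ennreal ((u x)^6)))"
 proof (rule nn_integral_cong)
  fix x :: R3
  obtain n0 :: nat where n0: "norm x < real n0" using reals_Archimedean2 by blast
  have "(%n. indicator (ball 0 (real (Suc n))) x * ennreal ((u x)^6)) ---> ennreal ((u x)^6)"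
   by (rule tendsto_eventually, rule eventually_sequentiallyI[of n0]) (use n0 in auto)
  from lim_imp_Liminf[OF trivial_limit_sequentially this]
  show "ennreal ((u x)^6) = liminf (%n. indicator (ball 0 (real (Suc n))) x * ennreal ((u x)^6))" by simp
 qed
 also have "... <= liminf (%n. (NI x. indicator (ball 0 (real (Suc n))) x * ennreal ((u x)^6)))" by (rule nn_integral_liminf) measurable
 also have "... <= liminf (%n. Csob * ennreal ((A + c n)^3))" by (intro Liminf_mono always_eventually allI est)
 also have "... = Csob * ennreal ((A + 0)^3)"
  by (intro lim_imp_Liminf trivial_limit_sequentially ennreal_tendsto_cmult Csob_finite tendsto_ennrealI tendsto_intros cl)
 finally show ?thesis using A by (simp add: ennreal_power)
qed

section \<open>L^p estimates from ball masses\<close>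

lemma powr_split:
 fixes t ta p :: real
 assumes "t >= 0" "ta > 0" "2 < p" "p < 6" shows "t powr p <= ta powr (p - 2) * t^2 + ta powr (p - 6) * t^6"
proof (cases "t = 0")
 case False
 then have t: "t > 0" using assms by simp
 have e: "t powr p = t powr (p - 2) * t^2" "t powr p = t powr (p - 6) * t^6"
  using powr_add[of t "p - 2" 2] powr_add[of t "p - 6" 6] powr_realpow[OF t, of 2] powr_realpow[OF t, of 6] by simp_all
 show ?thesis
 proof (cases "t <= ta")
  case True
  have "t powr p <= ta powr (p - 2) * t^2" unfolding e(1) using True t assms by (intro mult_right_mono powr_mono2) auto
  then show ?thesis using t by (smt (verit) powr_ge_zero zero_le_power mult_nonneg_nonneg)
 next
  case False
  have "t powr p <= ta powr (p - 6) * t^6" unfolding e(2) using False t assms by (intro mult_right_mono powr_mono2') auto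
  moreover have "0 <= ta powr (p - 2) * t^2" by simp
  ultimately show ?thesis by linarith
 qed
qed simp

lemma add_powr_le:
 fixes b h s :: real
 assumes "b >= 0" "h >= 0" "0 <= s" "s <= 3" shows "(b + h) powr s <= 8 * (b powr s + h powr s)"
proof -
 define m where "m = max b h"
 have m: "m >= 0" "b + h <= 2 * m" using assms by (auto simp: m_def)
 have "(b + h) powr s <= (2 * m) powr s" using assms m by (intro powr_mono2) auto
 also have "... = 2 powr s * m powr s" using m by (simp add: powr_mult)
 also have "... <= 2 powr 3 * m powr s" using assms by (intro mult_right_mono powr_mono) auto
 also have "(2::real) powr 3 = 8" by simp
 also have "m powr s <= b powr s + h powr s" unfolding m_def max_def by auto
 finally show ?thesis by simp
qed

lemma bm_integral:
 assumes [measurable]: "BM f" and R: "R >= 0" shows "(NI z. bm f z R) = ennreal (om * R^3) * (NI x. f x)"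
proof -
 have "(NI z. bm f z R) = (NI x. NI z. (if dist z x < R then f x else 0))"
  unfolding bm_def by (rule lborel_pair.Fubini') measurable
 also have "... = (NI x. f x * ennreal (om * R^3))"
 proof (intro nn_integral_cong)
  fix x
  have "(NI z. (if dist z x < R then f x else 0)) = (NI z. f x * indicator (ball x R) z)"
   by (intro nn_integral_cong) (auto simp: indicator_def dist_commute)
  then show "(NI z. (if dist z x < R then f x else 0)) = f x * ennreal (om * R^3)"
   by (simp add: nn_integral_cmult emeasure_ball3[OF R])
 qed
 also have "... = ennreal (om * R^3) * (NI x. f x)" by (simp add: nn_integral_multc mult.commute)
 finally show ?thesis .
qed

lemma bm_mono: "(!!x. f x <= g x) ==> r <= s ==> bm f z r <= bm g z s"
 unfolding bm_def by (intro nn_integral_mono) auto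

definition cs :: real where "cs = enn2real Csob"
lemma cs: "Csob = ennreal cs" "cs >= 0" using Csob_finite by (auto simp: cs_def)

text \<open>With b the mass and h the gradient energy of the ball of radius 3, only b^2 and h may
  appear on the right: they integrate over all centres to multiples of V and of the Dirichlet
  integral. Splitting |u|^p at a height \<open>ta\<close> gives ta^(p-2) b plus a multiple of
  ta^(p-6) H^3 with H = b + h, and ta = ka sqrt H brings both terms to total degree 2 + sg, sg = (p
  - 4)/2. The surplus degree, positive because p > 4, is spent on powers of the bounds
  \<open>bt\<close> and \<open>N\<close>.\<close>

lemma local_Lp_estimate:
 fixes p ka bt N :: real
 assumes a: "a > 0" and p: "4 < p" "p < 6" and u: "X a u g" and ka: "ka > 0" and bt: "bt >= 0" and N: "N >= 0"
  and bbt: "bm (sq u) z 3 <= ennreal bt" and bN: "bm (sq u) z 3 <= ennreal N" and hN: "bm (nsq g) z 3 <= ennreal N"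
 defines "sg \<equiv> (p - 4) / 2"
 defines "c1 \<equiv> 8 * ka powr (p - 2) * bt powr sg + 8 * cs * ka powr (p - 6) * N powr sg"
 defines "c2 \<equiv> 8 * ka powr (p - 2) * (N powr sg * bt) + 8 * cs * ka powr (p - 6) * (N powr sg * N)"
 shows "bm (%x. ennreal (\<bar>u x\<bar> powr p)) z 1 <= ennreal c1 * (bm (sq u) z 3)^2 + ennreal c2 * bm (nsq g) z 3"
proof -
 have [measurable]: "BM u" "BM g" using u by auto
 have w: "wpair u g" using u by (simp add: X_def)
 define b where "b = enn2real (bm (sq u) z 3)"
 define h where "h = enn2real (bm (nsq g) z 3)"
 have b: "bm (sq u) z 3 = ennreal b" "b >= 0" using le_less_trans[OF bN ennreal_less_top] by (auto simp: b_def)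
 have h: "bm (nsq g) z 3 = ennreal h" "h >= 0" using le_less_trans[OF hN ennreal_less_top] by (auto simp: h_def)
 have bb: "b <= bt" "b <= N" "h <= N" using bbt bN hN bt N by (auto simp: b h ennreal_le_iff)
 define H where "H = b + h"
 have H: "H >= 0" using b h by (simp add: H_def)
 have sg: "0 < sg" "sg < 1" "(p - 2) / 2 = 1 + sg" "p / 2 = 2 + sg" using p by (auto simp: sg_def field_simps)
 have six: "bm (%x. ennreal ((u x)^6)) z 1 <= ennreal (cs * H^3)"
 proof -
  have "bm (%x. ennreal ((u x)^6)) z 1 = (NI x. indicator (ball z 1) x * ennreal ((u x)^6))" by (rule bm_indicator[symmetric])
  also have "... <= Csob * ((NI x. indicator (ball z (3 * 1)) x * ennreal ((norm (g x))^2))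
    + ennreal (1 / 1^2) * (NI x. indicator (ball z (3 * 1)) x * ennreal ((u x)^2))) ^ 3"
   by (rule local_sobolev[OF w]) simp
  also have "... = Csob * (bm (nsq g) z 3 + bm (sq u) z 3)^3"
   using bm_indicator[of z 3 "nsq g"] bm_indicator[of z 3 "sq u"] by (simp add: nsq_def sq_def)
  also have "... = ennreal (cs * H^3)"
   using b h cs by (simp add: H_def add.commute ennreal_power ennreal_mult flip: ennreal_plus)
  finally show ?thesis .
 qed
 have two: "bm (sq u) z 1 <= ennreal b" unfolding b(1)[symmetric] by (rule bm_mono) auto
 have taest: "bm (%x. ennreal (\<bar>u x\<bar> powr p)) z 1 <= ennreal (ta powr (p - 2) * b + ta powr (p - 6) * (cs * H^3))" if ta: "ta > 0" for ta
 proof -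
  have "bm (%x. ennreal (\<bar>u x\<bar> powr p)) z 1 <= (NI x. ennreal (ta powr (p - 2)) * (if dist z x < 1 then sq u x else 0) + ennreal (ta powr (p - 6)) * (if dist z x < 1 then ennreal ((u x)^6) else 0))"
   unfolding bm_def
  proof (intro nn_integral_mono)
   fix x
   have "\<bar>u x\<bar> powr p <= ta powr (p - 2) * (u x)^2 + ta powr (p - 6) * (u x)^6"
    using powr_split[of "\<bar>u x\<bar>" ta p] ta p by (simp add: power_even_abs)
   from ennreal_le_lincomb[OF this]
   show "(if dist z x < 1 then ennreal (\<bar>u x\<bar> powr p) else 0) <= ennreal (ta powr (p - 2)) * (if dist z x < 1 then sq u x else 0) + ennreal (ta powr (p - 6)) * (if dist z x < 1 then ennreal ((u x)^6) else 0)"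
    by (simp add: sq_def)
  qed
  also have "... = ennreal (ta powr (p - 2)) * bm (sq u) z 1 + ennreal (ta powr (p - 6)) * bm (%x. ennreal ((u x)^6)) z 1"
   unfolding bm_def by (subst nn_integral_add, measurable) (subst nn_integral_cmult, measurable, subst nn_integral_cmult, measurable)
  also have "... <= ennreal (ta powr (p - 2)) * ennreal b + ennreal (ta powr (p - 6)) * ennreal (cs * H^3)"
   by (intro add_mono mult_left_mono six two) auto
  also have "... = ennreal (ta powr (p - 2) * b + ta powr (p - 6) * (cs * H^3))"
   using b cs H by (simp add: ennreal_mult)
  finally show ?thesis .
 qed
 have main: "bm (%x. ennreal (\<bar>u x\<bar> powr p)) z 1 <= ennreal (ka powr (p - 2) * (H powr (1 + sg) * b) + cs * ka powr (p - 6) * H powr (2 + sg))"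
 proof (cases "H = 0")
  case True
  then have "b = 0" using b h by (simp add: H_def)
  then show ?thesis using taest[of 1] True by simp
 next
  case False
  then have Hp: "H > 0" using H by simp
  \<comment> \<open>The exponents become ta^(p-2) = ka^(p-2) H^(1+sg) and ta^(p-6) H^3 = ka^(p-6)
    H^(2+sg). The height has to be positive, hence the separate case H = 0, where the height 1
    serves.\<close>
  define ta where "ta = ka * H powr (1/2)"
  have ta: "ta > 0" using ka Hp by (simp add: ta_def)
  have e: "ta powr s = ka powr s * H powr (s / 2)" for s using ka Hp by (simp add: ta_def powr_mult powr_powr)
  have e1: "ta powr (p - 2) = ka powr (p - 2) * H powr (1 + sg)" unfolding e sg(3) ..
  have e2: "ta powr (p - 6) * H^3 = ka powr (p - 6) * H powr (2 + sg)"
  proof -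
   have "H^3 = H powr 3" using Hp powr_realpow[OF Hp, of 3] by simp
   then have "ta powr (p - 6) * H^3 = ka powr (p - 6) * (H powr ((p - 6) / 2) * H powr 3)" by (simp add: e)
   also have "H powr ((p - 6) / 2) * H powr 3 = H powr ((p - 6) / 2 + 3)" by (rule powr_add[symmetric])
   also have "(p - 6) / 2 + 3 = 2 + sg" by (simp add: sg_def field_simps)
   finally show ?thesis .
  qed
  have "ta powr (p - 2) * b + ta powr (p - 6) * (cs * H^3) = ka powr (p - 2) * (H powr (1 + sg) * b) + cs * ka powr (p - 6) * H powr (2 + sg)"
   using e1 e2 by (simp add: mult_ac)
  then show ?thesis using taest[OF ta] by simp
 qed
 have q1: "b powr (1 + sg) * b <= bt powr sg * b^2"
 proof -
  have "b powr (1 + sg) = b * b powr sg" using b(2) by (cases "b = 0") (auto simp: powr_add)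
  moreover have "b powr sg <= bt powr sg" using bb b sg by (intro powr_mono2) auto
  ultimately show ?thesis using mult_right_mono[of "b powr sg" "bt powr sg" "b^2"] by (simp add: power2_eq_square mult_ac)
 qed
 have hsg: "h powr sg <= N powr sg" using bb h sg by (intro powr_mono2) auto
 have hb1: "h powr (1 + sg) <= N powr sg * h"
 proof -
  have "h powr (1 + sg) = h powr sg * h" using h(2) by (cases "h = 0") (auto simp: powr_add)
  then show ?thesis using mult_right_mono[OF hsg h(2)] by simp
 qed
 have q2: "h powr (1 + sg) * b <= (N powr sg * bt) * h"
 proof -
  have "h powr (1 + sg) * b <= (N powr sg * h) * bt" using hb1 bb b h by (intro mult_mono) auto
  then show ?thesis by (simp add: mult_ac)
 qed
 have q3: "b powr (2 + sg) <= N powr sg * b^2"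
 proof -
  have "b powr (2 + sg) = b^2 * b powr sg" using b(2) by (cases "b = 0") (auto simp: powr_add powr_numeral)
  moreover have "b powr sg <= N powr sg" using bb b sg by (intro powr_mono2) auto
  ultimately show ?thesis using mult_right_mono[of "b powr sg" "N powr sg" "b^2"] by (simp add: mult_ac)
 qed
 have q4: "h powr (2 + sg) <= (N powr sg * N) * h"
 proof -
  have "h powr (2 + sg) = h powr (1 + sg) * h" using h(2) by (cases "h = 0") (auto simp: powr_add powr_numeral power2_eq_square)
  also have "... <= (N powr sg * h) * N" using hb1 bb h by (intro mult_mono) auto
  finally show ?thesis by (simp add: mult_ac)
 qed
 have r1: "H powr (1 + sg) * b <= 8 * (bt powr sg * b^2 + (N powr sg * bt) * h)"
 proof -
  have "H powr (1 + sg) * b <= 8 * (b powr (1 + sg) + h powr (1 + sg)) * b"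
   unfolding H_def using b h sg by (intro mult_right_mono add_powr_le) auto
  also have "... = 8 * (b powr (1 + sg) * b + h powr (1 + sg) * b)" by (simp add: algebra_simps)
  also have "... <= 8 * (bt powr sg * b^2 + (N powr sg * bt) * h)" using q1 q2 by (intro mult_left_mono add_mono) auto
  finally show ?thesis .
 qed
 have r2: "H powr (2 + sg) <= 8 * (N powr sg * b^2 + (N powr sg * N) * h)"
 proof -
  have "H powr (2 + sg) <= 8 * (b powr (2 + sg) + h powr (2 + sg))"
   unfolding H_def using b h sg by (intro add_powr_le) auto
  also have "... <= 8 * (N powr sg * b^2 + (N powr sg * N) * h)" using q3 q4 by (intro mult_left_mono add_mono) auto
  finally show ?thesis .
 qed
 have "ka powr (p - 2) * (H powr (1 + sg) * b) + cs * ka powr (p - 6) * H powr (2 + sg)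
  <= ka powr (p - 2) * (8 * (bt powr sg * b^2 + (N powr sg * bt) * h)) + cs * ka powr (p - 6) * (8 * (N powr sg * b^2 + (N powr sg * N) * h))"
  using r1 r2 cs by (intro add_mono mult_left_mono) auto
 also have "... = c1 * b^2 + c2 * h" by (simp add: c1_def c2_def algebra_simps)
 finally have fin: "ka powr (p - 2) * (H powr (1 + sg) * b) + cs * ka powr (p - 6) * H powr (2 + sg) <= c1 * b^2 + c2 * h" .
 have c: "c1 >= 0" "c2 >= 0" using bt N cs by (auto simp: c1_def c2_def)
 have "bm (%x. ennreal (\<bar>u x\<bar> powr p)) z 1 <= ennreal c1 * ennreal (b^2) + ennreal c2 * ennreal h"
  by (rule order_trans[OF main ennreal_le_lincomb[OF fin c _ h(2)]]) simp
 then show ?thesis using b h by (simp add: ennreal_power)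
qed

text \<open>Integration over the centres: on the left each point is counted with weight
  \<open>om\<close>, on the right the balls of radius 3 give 27 \<open>om\<close> and, through
  \<open>ball_mass_sq_integral\<close>, the factor a + 6.\<close>

lemma Lp_estimate:
 fixes p ka bt N :: real
 assumes a: "a > 0" and p: "4 < p" "p < 6" and u: "X a u g" and ka: "ka > 0" and bt: "bt >= 0" and N: "N >= 0"
  and bbt: "!!z. bm (sq u) z 3 <= ennreal bt" and bN: "!!z. bm (sq u) z 3 <= ennreal N" and hN: "(NI x. nsq g x) <= ennreal N"
 defines "sg \<equiv> (p - 4) / 2"
 defines "c1 \<equiv> 8 * ka powr (p - 2) * bt powr sg + 8 * cs * ka powr (p - 6) * N powr sg"
 defines "c2 \<equiv> 8 * ka powr (p - 2) * (N powr sg * bt) + 8 * cs * ka powr (p - 6) * (N powr sg * N)"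
 shows "(NE x. \<bar>u x\<bar> powr p) <= ennreal (27 * (a + 6) * c1) * W a (sq u) (sq u) + ennreal (27 * c2) * (NI x. nsq g x)"
proof -
 have [measurable]: "BM u" "BM g" using u by auto
 have c: "c1 >= 0" "c2 >= 0" using bt N cs by (auto simp: c1_def c2_def)
 define C where "C = (NE x. \<bar>u x\<bar> powr p)"
 have hz: "bm (nsq g) z 3 <= ennreal N" for z
 proof -
  have "bm (nsq g) z 3 <= (NI x. nsq g x)" unfolding bm_def by (intro nn_integral_mono) auto
  then show ?thesis using hN by (rule order_trans)
 qed
 have "ennreal om * C = (NI z. bm (%x. ennreal (\<bar>u x\<bar> powr p)) z 1)" by (subst bm_integral) (auto simp: C_def)
 also have "... <= (NI z. ennreal c1 * (bm (sq u) z 3)^2 + ennreal c2 * bm (nsq g) z 3)"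
  unfolding c1_def c2_def sg_def by (intro nn_integral_mono local_Lp_estimate[OF a p u ka bt N bbt bN hz])
 also have "... = ennreal c1 * (NI z. (bm (sq u) z 3)^2) + ennreal c2 * (NI z. bm (nsq g) z 3)"
  by (subst nn_integral_add, measurable) (subst nn_integral_cmult, measurable, subst nn_integral_cmult, measurable)
 also have "... <= ennreal c1 * (ennreal (om * 3^3 * (a + 2 * 3)) * W a (sq u) (sq u)) + ennreal c2 * (ennreal (om * 3^3) * (NI x. nsq g x))"
  by (intro add_mono mult_left_mono ball_mass_sq_integral[OF a]) (auto simp: bm_integral)
 also have "... = ennreal om * (ennreal (27 * (a + 6) * c1) * W a (sq u) (sq u) + ennreal (27 * c2) * (NI x. nsq g x))"
 proof -
  have "ennreal c1 * ennreal (om * 3^3 * (a + 2 * 3)) = ennreal om * ennreal (27 * (a + 6) * c1)"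
   using c a om_pos by (simp add: ennreal_mult[symmetric] mult_ac)
  moreover have "ennreal c2 * ennreal (om * 3^3) = ennreal om * ennreal (27 * c2)"
   using c om_pos by (simp add: ennreal_mult[symmetric] mult_ac)
  ultimately show ?thesis by (simp add: distrib_left mult.assoc[symmetric])
 qed
 finally have "ennreal om * C <= ennreal om * (ennreal (27 * (a + 6) * c1) * W a (sq u) (sq u) + ennreal (27 * c2) * (NI x. nsq g x))" .
 then show ?thesis using om_pos unfolding C_def
  by (subst (asm) ennreal_mult_le_mult_iff) (auto simp: ennreal_eq_0_iff)
qed

lemma local_mass_bound:
 assumes a: "a > 0" and u: "X a u g" and M: "W a (sq u) (sq u) <= ennreal M" "M >= 0" and R: "R > 0"
 shows "bm (sq u) z R <= ennreal (sqrt ((a + 2 * R) * M))"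
proof (rule power2_le_imp_le_ennreal)
 have [measurable]: "BM u" using u by auto
 have "(bm (sq u) z R)^2 <= ennreal (a + 2 * R) * W a (sq u) (sq u)" by (rule ball_mass_le_W[OF a R]) measurable
 also have "... <= ennreal (a + 2 * R) * ennreal M" by (intro mult_left_mono M) auto
 also have "... = (ennreal (sqrt ((a + 2 * R) * M)))^2" using a R M by (simp add: ennreal_mult ennreal_power)
 finally show "(bm (sq u) z R)^2 <= (ennreal (sqrt ((a + 2 * R) * M)))^2" .
qed

text \<open>Lions' vanishing lemma with V in place of the L^2 norm. In the coefficients of
  \<open>Lp_estimate\<close> the terms free of \<open>bt\<close> carry ka^(p-6) and are made small
  first by a large \<open>ka\<close>, as p < 6; the remaining ones contain a positive power of
  \<open>bt\<close> and become small for small \<open>de\<close> once \<open>ka\<close> is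
  fixed.\<close>

lemma Lp_vanishing:
 fixes p M e :: real
 assumes a: "a > 0" and p: "4 < p" "p < 6" and M: "M >= 0" and e: "e > 0"
 shows "EX de>0. ALL u g. X a u g --> W a (sq u) (sq u) <= ennreal M --> (NI x. nsq g x) <= ennreal M -->
  (ALL z. bm (sq u) z 3 <= ennreal de) --> (NE x. \<bar>u x\<bar> powr p) <= ennreal e"
proof -
 define N where "N = max M (sqrt ((a + 6) * M))"
 define sg where "sg = (p - 4) / 2"
 have sg: "sg > 0" using p by (simp add: sg_def)
 have N: "N >= 0" "M <= N" using M by (auto simp: N_def)
 define K where "K = 27 * (a + 6) * M * (8 * cs * N powr sg) + 27 * M * (8 * cs * (N powr sg * N))"
 have "((%ka::real. K * ka powr (p - 6)) \<longlongrightarrow> K * 0) at_top"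
  using p by (intro tendsto_mult tendsto_const tendsto_neg_powr filterlim_ident) auto
 then have "eventually (%ka. K * ka powr (p - 6) < e/2) at_top" using e by (intro order_tendstoD(2)) auto
 then have "eventually (%ka::real. K * ka powr (p - 6) < e/2 & ka > 0) at_top" by (intro eventually_conj eventually_gt_at_top)
 then obtain ka where ka: "K * ka powr (p - 6) < e/2" "ka > 0" using eventually_happens'[OF trivial_limit_at_top_linorder] by blast
 define L1 where "L1 = 27 * (a + 6) * M * (8 * ka powr (p - 2))"
 define L2 where "L2 = 27 * M * (8 * ka powr (p - 2) * N powr sg)"
 have "(%n. L1 * (inverse (real (Suc n))) powr sg + L2 * inverse (real (Suc n))) ---> L1 * 0 + L2 * 0"
  using sg by (intro tendsto_intros LIMSEQ_inverse_real_of_nat tendsto_zero_powrI[OF LIMSEQ_inverse_real_of_nat tendsto_const]) auto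
 then have "eventually (%n. L1 * (inverse (real (Suc n))) powr sg + L2 * inverse (real (Suc n)) < e/2) sequentially"
  using e by (intro order_tendstoD(2)) auto
 then obtain n where n: "L1 * (inverse (real (Suc n))) powr sg + L2 * inverse (real (Suc n)) < e/2"
  by (auto simp: eventually_sequentially)
 define de where "de = inverse (real (Suc n))"
 have de: "de > 0" by (simp add: de_def)
 show ?thesis
 proof (intro exI[of _ de] conjI allI impI de)
  fix u g assume u: "X a u g" and Wm: "W a (sq u) (sq u) <= ennreal M" and Am: "(NI x. nsq g x) <= ennreal M"
   and d: "ALL z. bm (sq u) z 3 <= ennreal de"
  have bN: "bm (sq u) z 3 <= ennreal N" for z
   using local_mass_bound[OF a u Wm M, of 3 z] by (rule order_trans) (auto simp: N_def intro!: ennreal_leI)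
  have AN: "(NI x. nsq g x) <= ennreal N" using Am N(2) by (auto intro: order_trans ennreal_leI)
  define c1 where "c1 = 8 * ka powr (p - 2) * de powr sg + 8 * cs * ka powr (p - 6) * N powr sg"
  define c2 where "c2 = 8 * ka powr (p - 2) * (N powr sg * de) + 8 * cs * ka powr (p - 6) * (N powr sg * N)"
  have c: "c1 >= 0" "c2 >= 0" using de N cs by (auto simp: c1_def c2_def)
  have "(NE x. \<bar>u x\<bar> powr p) <= ennreal (27 * (a + 6) * c1) * W a (sq u) (sq u) + ennreal (27 * c2) * (NI x. nsq g x)"
   unfolding c1_def c2_def sg_def using d de by (intro Lp_estimate[OF a p u ka(2) _ N(1) _ bN AN]) auto
  also have "... <= ennreal (27 * (a + 6) * c1) * ennreal M + ennreal (27 * c2) * ennreal M"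
   by (intro add_mono mult_left_mono Wm Am) auto
  also have "... = ennreal (27 * (a + 6) * c1 * M + 27 * c2 * M)" using c a M by (simp add: ennreal_mult)
  also have "27 * (a + 6) * c1 * M + 27 * c2 * M = (L1 * de powr sg + L2 * de) + K * ka powr (p - 6)"
   by (simp add: c1_def c2_def L1_def L2_def K_def algebra_simps)
  also have "ennreal ... <= ennreal e" using n ka unfolding de_def by (intro ennreal_leI) linarith
  finally show "(NE x. \<bar>u x\<bar> powr p) <= ennreal e" .
 qed
qed

text \<open>The same estimate with \<open>ka\<close> equal to 1 and the general bound for ball
  masses in place of a small one.\<close>

lemma Lp_bounded:
 fixes p M :: real
 assumes a: "a > 0" and p: "4 < p" "p < 6" and M: "M >= 0"
 shows "EX K>=0. ALL u g. X a u g --> W a (sq u) (sq u) <= ennreal M --> (NI x. nsq g x) <= ennreal M -->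
  (NE x. \<bar>u x\<bar> powr p) <= ennreal K"
proof -
 define N where "N = max M (sqrt ((a + 6) * M))"
 define sg where "sg = (p - 4) / 2"
 have N: "N >= 0" "M <= N" using M by (auto simp: N_def)
 define c1 where "c1 = 8 * 1 powr (p - 2) * N powr sg + 8 * cs * 1 powr (p - 6) * N powr sg"
 define c2 where "c2 = 8 * 1 powr (p - 2) * (N powr sg * N) + 8 * cs * 1 powr (p - 6) * (N powr sg * N)"
 have c: "c1 >= 0" "c2 >= 0" using N cs by (auto simp: c1_def c2_def)
 show ?thesis
 proof (intro exI[of _ "27 * (a + 6) * c1 * M + 27 * c2 * M"] conjI allI impI)
  show "0 <= 27 * (a + 6) * c1 * M + 27 * c2 * M" using c M a by simp
  fix u g assume u: "X a u g" and Wm: "W a (sq u) (sq u) <= ennreal M" and Am: "(NI x. nsq g x) <= ennreal M"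
  have bN: "bm (sq u) z 3 <= ennreal N" for z
   using local_mass_bound[OF a u Wm M, of 3 z] by (rule order_trans) (auto simp: N_def intro!: ennreal_leI)
  have AN: "(NI x. nsq g x) <= ennreal N" using Am N(2) by (auto intro: order_trans ennreal_leI)
  have "(NE x. \<bar>u x\<bar> powr p) <= ennreal (27 * (a + 6) * c1) * W a (sq u) (sq u) + ennreal (27 * c2) * (NI x. nsq g x)"
   unfolding c1_def c2_def sg_def by (intro Lp_estimate[OF a p u _ N(1) N(1) bN bN AN]) auto
  also have "... <= ennreal (27 * (a + 6) * c1) * ennreal M + ennreal (27 * c2) * ennreal M"
   by (intro add_mono mult_left_mono Wm Am) auto
  also have "... = ennreal (27 * (a + 6) * c1 * M + 27 * c2 * M)" using c a M by (simp add: ennreal_mult)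
  finally show "(NE x. \<bar>u x\<bar> powr p) <= ennreal (27 * (a + 6) * c1 * M + 27 * c2 * M)" .
 qed
qed

section \<open>Compactness\<close>

lemma cv_bound:
 assumes u: "loc2 u" and k: "mollifier ep k" and ep: "ep <= 1" and B: "!!x. k x <= B"
 shows "ennreal ((cv u k x)^2) <= ennreal B * bm (sq u) x 1"
proof -
 note [measurable] = test_fun_measurable(1)[OF mollifierD(2)[OF k]]
 have [measurable]: "BM u" using u by measurable
 have "ennreal ((cv u k x)^2) <= (NI y. ennreal (k (x - y)) * ennreal ((u y)^2))" by (rule cv_jensen[OF u k])
 also have "... <= (NI y. ennreal B * (if dist x y < 1 then sq u y else 0))"
 proof (rule nn_integral_mono)
  fix y
  show "ennreal (k (x - y)) * ennreal ((u y)^2) <= ennreal B * (if dist x y < 1 then sq u y else 0)"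
  proof (cases "dist x y < 1")
   case True
   then show ?thesis using B[of "x - y"] by (auto simp: sq_def intro!: mult_right_mono ennreal_leI)
  next
   case False
   then have "k (x - y) = 0" using ep by (intro mollifierD(4)[OF k]) (simp add: dist_norm)
   then show ?thesis by simp
  qed
 qed
 also have "... = ennreal B * bm (sq u) x 1" unfolding bm_def by (rule nn_integral_cmult) measurable
 finally show ?thesis .
qed

lemma cvv_bound:
 assumes u: "wpair u g" and k: "mollifier ep k" and B: "!!x. k x <= B" shows "(norm (cvv g k x))^2 <= B * N2 g"
proof -
 note [measurable] = test_fun_measurable(1)[OF mollifierD(2)[OF k]]
 have [measurable]: "BM g" using u by measurable
 have B0: "B >= 0" using B[of 0] mollifierD(3)[OF k, of 0] by linarith
 have "ennreal ((norm (cvv g k x))^2) = (\<Sum>i\<in>UNIV. ennreal ((cv (%y. g y $ i) k x)^2))"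
  by (simp only: ennreal_norm_sq_vec cvv_def vec_lambda_beta)
 also have "... <= (\<Sum>i\<in>UNIV. (NI y. ennreal (k (x - y)) * ennreal ((g y $ i)^2)))"
  by (intro sum_mono cv_jensen[OF wpair_loc2_component[OF u] k])
 also have "... = (NI y. (\<Sum>i\<in>UNIV. ennreal (k (x - y)) * ennreal ((g y $ i)^2)))"
  by (rule nn_integral_sum[symmetric]) measurable
 also have "... = (NI y. ennreal (k (x - y)) * ennreal ((norm (g y))^2))"
  by (intro nn_integral_cong) (simp only: ennreal_norm_sq_vec sum_distrib_left)
 also have "... <= (NI y. ennreal B * ennreal ((norm (g y))^2))"
  by (intro nn_integral_mono mult_right_mono ennreal_leI B) auto
 also have "... = ennreal B * ennreal (N2 g)"
  using L2v_nn_integral[OF wpair_L2v[OF u]] by (simp add: nn_integral_cmult)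
 also have "... = ennreal (B * N2 g)" using B0 N2_nonneg by (intro ennreal_mult[symmetric])
 finally show ?thesis using B0 N2_nonneg[of g] by (simp add: ennreal_le_iff)
qed

lemma cv_Lipschitz:
 assumes u: "wpair u g" and k: "mollifier ep k" and B: "!!x. k x <= B" and M: "N2 g <= M"
 shows "\<bar>cv u k x - cv u k y\<bar> <= sqrt (B * M) * norm (x - y)"
proof -
 have B0: "B >= 0" using B[of 0] mollifierD(3)[OF k, of 0] by linarith
 have G: "norm (cvv g k x) <= sqrt (B * M)" for x
 proof -
  have "(norm (cvv g k x))^2 <= B * N2 g" by (rule cvv_bound[OF u k B])
  also have "... <= B * M" using M B0 by (intro mult_left_mono)
  finally have "sqrt ((norm (cvv g k x))^2) <= sqrt (B * M)" by (rule real_sqrt_le_mono)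
  then show ?thesis by simp
 qed
 have "norm (cv u k x - cv u k y) <= sqrt (B * M) * norm (x - y)"
 proof (rule differentiable_bound[where S=UNIV and f'="%x v. v \<bullet> cvv g k x"])
  show "(cv u k has_derivative (%v. v \<bullet> cvv g k x)) (at x within UNIV)" for x using cv_gradient[OF u k] by simp
  show "onorm (%v. v \<bullet> cvv g k x) <= sqrt (B * M)" for x
  proof (rule onorm_le)
   fix v
   have "norm (v \<bullet> cvv g k x) <= norm v * norm (cvv g k x)" by (simp add: Cauchy_Schwarz_ineq2)
   also have "... <= norm v * sqrt (B * M)" by (intro mult_left_mono G) auto
   finally show "norm (v \<bullet> cvv g k x) <= sqrt (B * M) * norm v" by (simp add: mult.commute)
  qed
 qed auto
 then show ?thesis by simp
qed

text \<open>The step from a dense set to all points in the Arzela-Ascoli theorem: a common Lipschitz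
  constant makes the Cauchy property at a nearby point of \<open>D\<close> carry over.\<close>

lemma Lipschitz_convergent_dense:
 fixes f :: "nat => R3 => real"
 assumes D: "!!U. open U ==> U ~= {} ==> \<exists>d\<in>D. d \<in> U" and L: "!!n x y. \<bar>f n x - f n y\<bar> <= L * norm (x - y)"
  and c: "!!d. d \<in> D ==> convergent (%n. f n d)" shows "convergent (%n. f n x)"
proof (rule Cauchy_convergent, rule CauchyI)
 fix e :: real assume e: "e > 0"
 define r where "r = e / (3 * (\<bar>L\<bar> + 1))"
 have r: "r > 0" using e by (simp add: r_def)
 have "\<bar>L\<bar> * e < (\<bar>L\<bar> + 1) * e" using e by (intro mult_strict_right_mono) auto
 then have rL: "\<bar>L\<bar> * r < e / 3" by (simp add: r_def field_simps add_nonneg_pos)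
 obtain d where d: "d \<in> D" "d \<in> ball x r" using D[of "ball x r"] r by auto
 have "Cauchy (%n. f n d)" using c[OF d(1)] by (rule convergent_Cauchy)
 then obtain N where N: "!!m n. m >= N ==> n >= N ==> norm (f m d - f n d) < e / 3"
  using CauchyD[of "%n. f n d" "e/3"] e by auto
 have near: "\<bar>f n x - f n d\<bar> < e / 3" for n
 proof -
  have "\<bar>f n x - f n d\<bar> <= \<bar>L\<bar> * norm (x - d)" using L[of n x d] mult_right_mono[of L "\<bar>L\<bar>" "norm (x - d)"] by force
  also have "... <= \<bar>L\<bar> * r" using d(2) by (intro mult_left_mono) (auto simp: dist_norm)
  finally show ?thesis using rL by linarith
 qed
 have "norm (f m x - f n x) < e" if "m >= N" "n >= N" for m n
  using N[OF that] near[of m] near[of n] by (auto simp: abs_if split: if_splits)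
 then show "EX N. ALL m>=N. ALL n>=N. norm (f m x - f n x) < e" by blast
qed

text \<open>A positive bounded integrable weight: local \<open>L2\<close> convergence follows from convergence in a single weighted \<open>L2\<close> space.\<close>

definition Om :: "R3 => ennreal" where
 "Om x = (\<Sum>m. ennreal ((1/2)^m / (1 + (real m)^3)) * indicator (ball 0 (real m)) x)"

lemma Om_measurable[measurable]: "BM Om"
 unfolding Om_def[abs_def] by measurable

lemma Om_le: "Om x <= 2"
proof -
 have "Om x <= (\<Sum>m. ennreal ((1/2)^m))" unfolding Om_def
 proof (intro suminf_le)
  fix m
  have "(1/2::real)^m / (1 + (real m)^3) <= (1/2)^m / 1" by (intro divide_left_mono) (auto intro!: mult_pos_pos add_pos_nonneg)
  then show "ennreal ((1/2)^m / (1 + (real m)^3)) * indicator (ball 0 (real m)) x <= ennreal ((1/2)^m)"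
   by (auto simp: indicator_def intro: ennreal_leI)
 qed auto
 also have "... = ennreal (\<Sum>m. (1/2)^m)" by (rule suminf_ennreal2) (auto intro: summable_geometric)
 also have "(\<Sum>m. (1/2::real)^m) = 2" by (subst suminf_geometric) auto
 finally show ?thesis by simp
qed

lemma Om_integral: "(NI x. Om x) < \<infinity>"
proof -
 have "(NI x. Om x) = (\<Sum>m. (NI x. ennreal ((1/2)^m / (1 + (real m)^3)) * indicator (ball (0::R3) (real m)) x))"
  unfolding Om_def by (rule nn_integral_suminf) measurable
 also have "... <= (\<Sum>m. ennreal (om * (1/2)^m))"
 proof (intro suminf_le)
  fix m
  have "(NI x. ennreal ((1/2)^m / (1 + (real m)^3)) * indicator (ball (0::R3) (real m)) x)
   = ennreal ((1/2)^m / (1 + (real m)^3)) * ennreal (om * (real m)^3)" by (simp add: nn_integral_cmult emeasure_ball3)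
  also have "... = ennreal ((1/2)^m / (1 + (real m)^3) * (om * (real m)^3))"
   using om_pos by (intro ennreal_mult[symmetric]) auto
  also have "... <= ennreal (om * (1/2)^m)"
  proof (rule ennreal_leI)
   have "(real m)^3 / (1 + (real m)^3) <= 1" by (simp add: add_pos_nonneg)
   then have "(om * (1/2)^m) * ((real m)^3 / (1 + (real m)^3)) <= (om * (1/2)^m) * 1"
    using om_pos by (intro mult_left_mono) auto
   then show "(1/2)^m / (1 + (real m)^3) * (om * (real m)^3) <= om * (1/2)^m" by (simp add: mult_ac)
  qed
  finally show "(NI x. ennreal ((1/2)^m / (1 + (real m)^3)) * indicator (ball (0::R3) (real m)) x) <= ennreal (om * (1/2)^m)" .
 qed auto
 also have "... = ennreal (\<Sum>m. om * (1/2)^m)"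
  using om_pos by (intro suminf_ennreal2) (auto intro!: summable_mult summable_geometric)
 finally show ?thesis by (auto intro: le_less_trans)
qed

lemma Om_lower: "x \<in> ball 0 (real m) ==> Om x >= ennreal ((1/2)^m / (1 + (real m)^3))"
proof -
 assume x: "x \<in> ball 0 (real m)"
 define F where "F k = ennreal ((1/2)^k / (1 + (real k)^3)) * indicator (ball 0 (real k)) x" for k
 have "(\<Sum>k\<in>{m}. F k) <= (\<Sum>k. F k)" by (rule sum_le_suminf) auto
 moreover have "sum F {m} = F m" by simp
 ultimately have "F m <= Om x" unfolding Om_def F_def[symmetric] by simp
 then show ?thesis using x by (simp add: F_def)
qed

lemma Om_pos: "Om x > 0"
proof -
 obtain m :: nat where m: "norm x < real m" using reals_Archimedean2 by blast
 then have "Om x >= ennreal ((1/2)^m / (1 + (real m)^3))" by (intro Om_lower) simp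
 moreover have "ennreal ((1/2)^m / (1 + (real m)^3)) > 0" by (simp add: add_pos_nonneg)
 ultimately show ?thesis by (rule less_le_trans[rotated])
qed

lemma bm_le_Om:
 shows "EX C. C < top & (\<forall>f\<in>borel_measurable borel. bm f z R <= C * (NI x. Om x * f x))"
proof -
 obtain m :: nat where m: "norm z + R < real m" using reals_Archimedean2 by blast
 define c where "c = (1/2)^m / (1 + (real m)^3)"
 have c: "c > 0" by (simp add: c_def add_pos_nonneg)
 have "bm f z R <= ennreal (1/c) * (NI x. Om x * f x)" if [measurable]: "BM f" for f
 proof -
  have "bm f z R <= (NI x. ennreal (1/c) * (Om x * f x))" unfolding bm_def
  proof (rule nn_integral_mono)
   fix x
   show "(if dist z x < R then f x else 0) <= ennreal (1/c) * (Om x * f x)"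
   proof (cases "dist z x < R")
    case True
    have "norm x <= norm z + dist z x" using norm_triangle_ineq2[of x z] by (simp add: dist_norm norm_minus_commute)
    then have "Om x >= ennreal c" unfolding c_def using True m by (intro Om_lower) simp
    then have "ennreal (1/c) * ennreal c <= ennreal (1/c) * Om x" by (intro mult_left_mono) auto
    then have "1 <= ennreal (1/c) * Om x" using c by (simp flip: ennreal_mult)
    then have "1 * f x <= (ennreal (1/c) * Om x) * f x" by (intro mult_right_mono) auto
    then show ?thesis using True by (simp add: mult.assoc)
   qed simp
  qed
  also have "... = ennreal (1/c) * (NI x. Om x * f x)" by (rule nn_integral_cmult) measurable
  finally show ?thesis .
 qed
 then show ?thesis by (intro exI[of _ "ennreal (1/c)"]) auto
qed

lemma loc2_iff_bm: "loc2 u \<longleftrightarrow> BM u & (ALL R. bm (sq u) 0 R < top)"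
proof -
 have 1: "(NI x. indicator (cball 0 r) x * ennreal ((u x)^2)) <= bm (sq u) 0 (r + 1)" for r
  unfolding bm_def by (intro nn_integral_mono) (auto simp: indicator_def sq_def)
 have 2: "bm (sq u) 0 r <= (NI x. indicator (cball 0 r) x * ennreal ((u x)^2))" for r
  unfolding bm_def by (intro nn_integral_mono) (auto simp: indicator_def sq_def)
 show ?thesis unfolding loc2_def infinity_ennreal_def using le_less_trans[OF 1] le_less_trans[OF 2] by blast
qed

lemma test_integral_bm:
 assumes f: "loc2 f" and vp: "BM vp" "!!x. \<bar>vp x\<bar> <= B" "!!x. norm x > r ==> vp x = 0"
 shows "ennreal ((LI x. f x * vp x)^2) <= bm (sq f) 0 (r + 1) * (NE x. (vp x)^2)"
proof -
 have [measurable]: "BM f" using f by measurable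
 note [measurable] = vp(1)
 have "ennreal \<bar>(LI x. f x * vp x)\<bar> <= (NI x. ennreal \<bar>f x * vp x\<bar>)"
  using integral_norm_bound_ennreal[OF loc2_integrable[OF f vp]] by simp
 also have "... <= (NI x. (if dist 0 x < r + 1 then ennreal \<bar>f x\<bar> else 0) * ennreal \<bar>vp x\<bar>)"
  using vp(3) by (intro nn_integral_mono) (auto simp: abs_mult ennreal_mult not_less)
 finally have "(ennreal \<bar>(LI x. f x * vp x)\<bar>)^2 <= (NI x. (if dist 0 x < r + 1 then ennreal \<bar>f x\<bar> else 0) * ennreal \<bar>vp x\<bar>)^2"
  by (rule power_mono) simp
 also have "... <= (NI x. (if dist 0 x < r + 1 then ennreal \<bar>f x\<bar> else 0)^2) * (NI x. (ennreal \<bar>vp x\<bar>)^2)"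
  by (rule Cauchy_Schwarz_nn_integral) measurable
 also have "(NI x. (if dist 0 x < r + 1 then ennreal \<bar>f x\<bar> else 0)^2) = bm (sq f) 0 (r + 1)"
  unfolding bm_def by (intro nn_integral_cong) (simp add: sq_def ennreal_power)
 finally show ?thesis by (simp add: ennreal_power)
qed

lemma test_integral_tendsto:
 assumes f: "!!n. loc2 (f n)" and U: "loc2 U" and loc: "!!R. (%n. bm (sq (%x. f n x - U x)) 0 R) ---> 0"
  and vp: "BM vp" "!!x. \<bar>vp x\<bar> <= B" "!!x. norm x > r ==> vp x = 0"
 shows "(%n. (LI x. f n x * vp x)) ---> (LI x. U x * vp x)"
proof -
 have d: "loc2 (%x. f n x - U x)" for n using loc2_add[OF f U, of n "-1"] by simp
 have l1: "loc2 vp"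
 proof -
  note [measurable] = vp(1)
  have "bm (sq vp) 0 R < top" for R
  proof -
   have "bm (sq vp) 0 R \<le> bm (%_. ennreal (B^2)) 0 R"
    using vp(2) by (intro bm_mono) (auto simp: sq_def abs_le_square_iff[symmetric] intro!: ennreal_leI intro: order_trans[OF _ abs_ge_self])
   also have "... = ennreal (B^2) * emeasure lborel (ball (0::R3) R)"
    unfolding bm_indicator[symmetric] by (simp add: nn_integral_multc mult.commute)
   also have "... < top" using emeasure_bounded_finite[OF bounded_ball, of "0::R3" R] by (simp add: ennreal_mult_less_top)
   finally show ?thesis .
  qed
  then show ?thesis using vp(1) by (simp add: loc2_iff_bm)
 qed
 have "integrable lborel (%x. vp x * vp x)" by (rule loc2_integrable[OF l1 vp])
 then have "integrable lborel (%x. (vp x)^2)" by (simp add: power2_eq_square)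
 from nn_integral_eq_integral[OF this] have fin: "(NE x. (vp x)^2) < top" by simp
 have z: "(%n. bm (sq (%x. f n x - U x)) 0 (r + 1) * (NE x. (vp x)^2)) ---> 0"
  using ennreal_tendsto_cmult[OF fin loc] by (simp add: mult.commute)
 have "(%n. ennreal ((LI x. (f n x - U x) * vp x)^2)) ---> 0"
  by (rule tendsto_sandwich[OF _ _ tendsto_const z]) (auto intro!: always_eventually test_integral_bm[OF d vp])
 then have "(%n. (LI x. (f n x - U x) * vp x)^2) ---> 0" by (subst (asm) ennreal_tendsto_0_iff) auto
 from tendsto_real_sqrt[OF this] have "(%n. (LI x. (f n x - U x) * vp x)) ---> 0" by (simp add: tendsto_rabs_zero_iff)
 moreover have "(LI x. (f n x - U x) * vp x) = (LI x. f n x * vp x) - (LI x. U x * vp x)" for n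
  using loc2_integrable[OF f vp] loc2_integrable[OF U vp] by (simp add: left_diff_distrib)
 ultimately show ?thesis by (simp add: LIM_zero_iff)
qed

lemma sq_diff_triangle_nn:
 fixes f g h :: "R3 => real"
 assumes [measurable]: "BM f" "BM g" "BM h"
 shows "(NI x. Om x * sq (%x. f x - h x) x) <= 2 * (NI x. Om x * sq (%x. f x - g x) x) + 2 * (NI x. Om x * sq (%x. g x - h x) x)"
proof -
 have "(NI x. Om x * sq (%x. f x - h x) x) <= (NI x. 2 * (Om x * sq (%x. f x - g x) x) + 2 * (Om x * sq (%x. g x - h x) x))"
 proof (rule nn_integral_mono)
  fix x
  have "Om x * sq (%x. f x - h x) x <= Om x * (2 * sq (%x. f x - g x) x + 2 * sq (%x. g x - h x) x)"
   unfolding sq_def by (intro mult_left_mono sq_diff_triangle) auto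
  then show "Om x * sq (%x. f x - h x) x <= 2 * (Om x * sq (%x. f x - g x) x) + 2 * (Om x * sq (%x. g x - h x) x)"
   by (simp only: distrib_left mult.left_commute)
 qed
 also have "... = 2 * (NI x. Om x * sq (%x. f x - g x) x) + 2 * (NI x. Om x * sq (%x. g x - h x) x)"
  by (subst nn_integral_add, measurable) (subst nn_integral_cmult, measurable, subst nn_integral_cmult, measurable)
 finally show ?thesis .
qed

text \<open>Local Rellich compactness. At each scale \<open>ep j\<close> the mollified functions are
  bounded and Lipschitz uniformly in n, so one diagonal subsequence converges pointwise at all
  scales, and by \<open>cv_approx\<close> mollifying costs at most a multiple of
  \<open>(ep j)^2 * M\<close>, uniformly in n. Hence the subsequence is Cauchy in L^2 with the
  weight \<open>Om\<close>.\<close>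

lemma L2loc_subsequence:
 assumes a: "a > 0" and X: "!!n. X a (u n) (g n)" and M: "!!n. N2 (g n) <= M" "!!n. W a (sq (u n)) (sq (u n)) <= ennreal M" "M >= 0"
 obtains r U where "strict_mono (r::nat=>nat)" "BM U" "AL x. (%n. u (r n) x) ---> U x"
  "!!z R. (%n. bm (sq (%x. u (r n) x - U x)) z R) ---> 0"
proof -
 have w: "wpair (u n) (g n)" for n using X by (simp add: X_def)
 have [measurable]: "BM (u n)" for n using X by auto
 define ep where "ep j = inverse (real (Suc j))" for j
 have ep: "ep j > 0" "ep j <= 1" for j by (auto simp: ep_def field_simps)
 have "EX k. mollifier (ep j) k" for j by (rule mollifier_exists[OF ep(1)])
 then obtain k where k: "!!j. mollifier (ep j) (k j)" by metis
 have "EX B>=0. ALL x. k j x <= B" for j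
 proof -
  obtain B where "B >= 0" "!!x. \<bar>k j x\<bar> <= B" using test_fun_support[OF mollifierD(2)[OF k]] by metis
  then show ?thesis by (auto intro!: exI[of _ B] intro: order_trans[OF abs_ge_self])
 qed
 then obtain B where B: "!!j. B j >= 0" "!!j x. k j x <= B j" by metis
 define C where "C j = sqrt (B j * sqrt ((a + 2) * M))" for j
 have C0: "C j >= 0" for j unfolding C_def using B a M by simp
 have cvb: "\<bar>cv (u n) (k j) x\<bar> <= C j" for n j x
 proof -
  have "ennreal ((cv (u n) (k j) x)^2) <= ennreal (B j) * bm (sq (u n)) x 1"
   by (rule cv_bound[OF wpair_loc2[OF w] k ep(2) B(2)])
  also have "... <= ennreal (B j) * ennreal (sqrt ((a + 2 * 1) * M))"
   by (intro mult_left_mono local_mass_bound[OF a X M(2,3)]) auto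
  also have "... = ennreal (B j * sqrt ((a + 2) * M))" using B a M by (simp add: ennreal_mult)
  finally have "(cv (u n) (k j) x)^2 <= B j * sqrt ((a + 2) * M)" using B a M by (simp add: ennreal_le_iff)
  from real_sqrt_le_mono[OF this] show ?thesis by (simp add: C_def)
 qed
 obtain D :: "R3 set" where D: "countable D" "!!U. open U ==> U ~= {} ==> \<exists>d\<in>D. d \<in> U" by (rule countable_dense_setE, rule that)
 \<comment> \<open>Division by \<open>C j + 1\<close> gives one bound for all scales and points, as
   required for extracting a diagonal subsequence over the countable set of pairs.\<close>
 define c where "c n p = cv (u n) (k (fst p)) (snd p) / (C (fst p) + 1)" for n and p :: "nat \<times> R3"
 obtain r where r: "strict_mono (r::nat=>nat)" "!!p. p \<in> UNIV \<times> D ==> EX l. (%n. c (r n) p) ---> l"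
 proof (rule function_convergent_subsequence[of "(UNIV::nat set) \<times> D" c 1])
  show "countable ((UNIV::nat set) \<times> D)" using D(1) by auto
  show "norm (c n p) <= 1" for n p using cvb[of n "fst p" "snd p"] C0[of "fst p"] by (simp add: c_def field_simps)
 qed (rule that)
 have conv: "convergent (%n. cv (u (r n)) (k j) x)" for j x
 proof (rule Lipschitz_convergent_dense[OF D(2)])
  show "\<bar>cv (u (r n)) (k j) x - cv (u (r n)) (k j) y\<bar> <= sqrt (B j * M) * norm (x - y)" for n x y
   by (rule cv_Lipschitz[OF w k B(2) M(1)])
  show "convergent (%n. cv (u (r n)) (k j) d)" if d: "d \<in> D" for d
  proof -
   obtain l where "(%n. c (r n) (j, d)) ---> l" using r(2)[of "(j, d)"] d by auto
   then have "(%n. c (r n) (j, d) * (C j + 1)) ---> l * (C j + 1)" by (intro tendsto_intros)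
   moreover have "c n (j, d) * (C j + 1) = cv (u n) (k j) d" for n using C0[of j] by (simp add: c_def)
   ultimately show ?thesis by (auto simp: convergent_def)
  qed
 qed
 define wl where "wl j x = lim (%n. cv (u (r n)) (k j) x)" for j x
 have wl: "(%n. cv (u (r n)) (k j) x) ---> wl j x" for j x using conv by (simp add: wl_def convergent_LIMSEQ_iff)
 have [measurable]: "BM (cv (u n) (k j))" for n j by (intro cv_measurable wpair_loc2[OF w] mollifierD(2)[OF k])
 have [measurable]: "BM (wl j)" for j by (rule borel_measurable_LIMSEQ_real[OF wl]) measurable
 have wlb: "\<bar>wl j x\<bar> <= C j" for j x by (rule LIMSEQ_le_const2[OF tendsto_rabs[OF wl]]) (use cvb in auto)
 have mid: "(%n. (NI x. Om x * sq (%x. cv (u (r n)) (k j) x - wl j x) x)) ---> 0" for j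
 proof -
  have "(%n. (NI x. Om x * sq (%x. cv (u (r n)) (k j) x - wl j x) x)) ---> (\<integral>\<^sup>+x. 0 \<partial>(lborel :: R3 measure))"
  proof (rule nn_integral_dominated_convergence[where w="%x. Om x * ennreal ((2 * C j)^2)"])
   show "AL x. Om x * sq (%x. cv (u (r n)) (k j) x - wl j x) x <= Om x * ennreal ((2 * C j)^2)" for n
   proof (intro AE_I2 mult_left_mono)
    fix x
    have "\<bar>cv (u (r n)) (k j) x - wl j x\<bar> <= 2 * C j" using cvb[of "r n" j x] wlb[of j x] by linarith
    then have "(cv (u (r n)) (k j) x - wl j x)^2 <= (2 * C j)^2" using power_mono[of "\<bar>cv (u (r n)) (k j) x - wl j x\<bar>" "2 * C j" 2] by simp
    then show "sq (%x. cv (u (r n)) (k j) x - wl j x) x <= ennreal ((2 * C j)^2)" unfolding sq_def by (rule ennreal_leI)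
   qed simp
   have "(NI x. Om x * ennreal ((2 * C j)^2)) = (NI x. Om x) * ennreal ((2 * C j)^2)" by (rule nn_integral_multc) measurable
   then show "(NI x. Om x * ennreal ((2 * C j)^2)) < \<infinity>" using Om_integral by (simp add: ennreal_mult_less_top)
   show "AL x. (%n. Om x * sq (%x. cv (u (r n)) (k j) x - wl j x) x) ---> 0"
   proof (rule AE_I2)
    fix x
    have "(%n. ennreal ((cv (u (r n)) (k j) x - wl j x)^2)) ---> ennreal ((wl j x - wl j x)^2)"
     by (intro tendsto_ennrealI tendsto_intros wl)
    from ennreal_tendsto_cmult[OF le_less_trans[OF Om_le[of x]] this]
    show "(%n. Om x * sq (%x. cv (u (r n)) (k j) x - wl j x) x) ---> 0" by (simp add: sq_def)
   qed
  qed measurable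
  then show ?thesis by simp
 qed
 have near: "(NI x. Om x * sq (%x. u n x - cv (u n) (k j) x) x) <= ennreal (4 * (ep j)^2 * M)" for n j
 proof -
  have "(NI x. Om x * sq (%x. u n x - cv (u n) (k j) x) x) <= (NI x. 2 * ennreal ((cv (u n) (k j) x - u n x)^2))"
   unfolding sq_def by (intro nn_integral_mono mult_mono Om_le) (auto simp: power2_commute)
  also have "... = 2 * (NE x. (cv (u n) (k j) x - u n x)^2)" by (rule nn_integral_cmult) measurable
  also have "... <= 2 * (ennreal (2 * (ep j)^2) * (NE x. (norm (g n x))^2))"
   by (intro mult_left_mono cv_approx[OF w k]) auto
  also have "... <= 2 * (ennreal (2 * (ep j)^2) * ennreal M)"
   unfolding L2v_nn_integral[OF X_L2v[OF X]] by (intro mult_left_mono ennreal_leI M) auto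
  also have "... = ennreal (4 * (ep j)^2 * M)" using M by (simp add: ennreal_mult mult.assoc)
  finally show ?thesis .
 qed
 define dd where "dd m n = (NI x. Om x * sq (%x. u (r m) x - u (r n) x) x)" for m n
 have cau: "EX N. ALL m>=N. ALL n>=N. dd m n <= ennreal e" if e: "e > 0" for e
 proof -
  \<comment> \<open>The distance is split through both mollifications and their limit
    \<open>wl j\<close>. With the factors 2 of the triangle inequality for squares, the
    mollification error, at most \<open>4 * (ep j)^2 * M\<close>, is counted six times and the
    distance to \<open>wl j\<close> sixteen times; hence 24 here and e/32 below.\<close>
  have "(%j. 24 * ((ep j)^2 * M)) ---> 24 * (0^2 * M)"
   unfolding ep_def by (intro tendsto_intros LIMSEQ_inverse_real_of_nat)
  then have "eventually (%j. 24 * ((ep j)^2 * M) < e/2) sequentially" by (rule order_tendstoD(2)) (use e in simp)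
  then obtain j where j: "24 * ((ep j)^2 * M) < e/2" by (auto simp: eventually_sequentially)
  have "eventually (%n. (NI x. Om x * sq (%x. cv (u (r n)) (k j) x - wl j x) x) < ennreal (e / 32)) sequentially"
   using mid by (rule order_tendstoD(2)) (use e in simp)
  then obtain N where N: "!!n. n >= N ==> (NI x. Om x * sq (%x. cv (u (r n)) (k j) x - wl j x) x) <= ennreal (e / 32)"
   by (auto simp: eventually_sequentially intro: less_imp_le)
  have sym: "(NI x. Om x * sq (%x. f x - h x) x) = (NI x. Om x * sq (%x. h x - f x) x)" for f h :: "R3 => real"
   by (simp add: sq_def power2_commute)
  have "dd m n <= ennreal e" if "m >= N" "n >= N" for m n
  proof -
   define um where "um = u (r m)"
   define un where "un = u (r n)"
   define vm where "vm = cv (u (r m)) (k j)"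
   define vn where "vn = cv (u (r n)) (k j)"
   have [measurable]: "BM um" "BM un" "BM vm" "BM vn" unfolding um_def un_def vm_def vn_def by measurable
   define I where "I f h = (NI x. Om x * sq (%x. f x - h x) x)" for f h
   have tri: "I f h <= 2 * I f g + 2 * I g h" if "BM f" "BM g" "BM h" for f g h
    unfolding I_def using that by (rule sq_diff_triangle_nn)
   have b1: "I um vm <= ennreal (4 * (ep j)^2 * M)" unfolding I_def um_def vm_def by (rule near)
   have b2: "I vn un <= ennreal (4 * (ep j)^2 * M)" unfolding I_def un_def vn_def by (subst sym) (rule near)
   have b3: "I vm (wl j) <= ennreal (e / 32)" unfolding I_def vm_def by (rule N[OF that(1)])
   have b4: "I (wl j) vn <= ennreal (e / 32)" unfolding I_def vn_def by (subst sym) (rule N[OF that(2)])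
   have "dd m n = I um un" by (simp add: dd_def I_def um_def un_def)
   also have "... <= 2 * I um vm + 2 * I vm un" by (rule tri) measurable
   also have "... <= 2 * I um vm + 2 * (2 * I vm vn + 2 * I vn un)" by (intro add_left_mono mult_left_mono tri) auto
   also have "... <= 2 * I um vm + 2 * (2 * (2 * I vm (wl j) + 2 * I (wl j) vn) + 2 * I vn un)"
    by (intro add_left_mono add_right_mono mult_left_mono tri) auto
   also have "... <= 2 * ennreal (4 * (ep j)^2 * M) + 2 * (2 * (2 * ennreal (e / 32) + 2 * ennreal (e / 32)) + 2 * ennreal (4 * (ep j)^2 * M))"
    by (intro add_mono mult_left_mono b1 b2 b3 b4) auto
   also have "... = ennreal (6 * (4 * (ep j)^2 * M) + 16 * (e / 32))"
   proof -
    define s where "s = 4 * (ep j)^2 * M"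
    define t where "t = e / 32"
    have st: "s >= 0" "t >= 0" using e M by (auto simp: s_def t_def)
    have "2 * ennreal s + 2 * (2 * (2 * ennreal t + 2 * ennreal t) + 2 * ennreal s) = ennreal (6 * s + 16 * t)"
     unfolding mult_2 using st by (simp flip: ennreal_plus)
    then show ?thesis unfolding s_def t_def .
   qed
   also have "... <= ennreal e" using j by (intro ennreal_leI) simp
   finally show ?thesis .
  qed
  then show ?thesis by blast
 qed
 define Q where "Q = density lborel Om"
 have dQ: "(\<integral>\<^sup>+x. ennreal ((norm (f x - h x))^2) \<partial>Q) = (NI x. Om x * sq (%x. f x - h x) x)"
  if [measurable]: "BM f" "BM h" for f h :: "R3 => real" unfolding Q_def sq_def by (subst nn_integral_density) auto
 have Qm: "(f \<in> borel_measurable Q) = (BM f)" for f :: "R3 => real" unfolding Q_def by simp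
 have um: "u (r n) \<in> borel_measurable Q" for n unfolding Qm by measurable
 have cauQ: "EX N. ALL m>=N. ALL n>=N. (\<integral>\<^sup>+x. ennreal ((norm (u (r m) x - u (r n) x))^2) \<partial>Q) <= ennreal e" if "e > 0" for e
  using cau[OF that] by (simp add: dd_def dQ del: real_norm_def)
 obtain U s where U: "U \<in> borel_measurable Q" and s: "strict_mono (s::nat=>nat)"
  and aeQ: "AE x in Q. (%n. u (r (s n)) x) ---> U x"
  and L2: "(%n. \<integral>\<^sup>+x. ennreal ((norm (u (r n) x - U x))^2) \<partial>Q) ---> 0"
  by (rule L2_complete[of "%n. u (r n)" Q, OF um cauQ], assumption, rule that)
 have Um[measurable]: "BM U" using U by (simp add: Qm)
 have ae: "AL x. (%n. u (r (s n)) x) ---> U x"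
  using aeQ unfolding Q_def by (subst (asm) AE_density) (auto simp: Om_pos)
 have L2': "(%n. (NI x. Om x * sq (%x. u (r n) x - U x) x)) ---> 0" using L2 by (simp add: dQ del: real_norm_def)
 have loc: "(%n. bm (sq (%x. u (r n) x - U x)) z R) ---> 0" for z R
 proof -
  obtain K where K: "K < top" "!!f. BM f ==> bm f z R <= K * (NI x. Om x * f x)" using bm_le_Om[of z R] by blast
  have z: "(%n. K * (NI x. Om x * sq (%x. u (r n) x - U x) x)) ---> 0" using ennreal_tendsto_cmult[OF K(1) L2'] by simp
  show ?thesis by (rule tendsto_sandwich[OF _ _ tendsto_const z]) (auto intro!: always_eventually K(2))
 qed
 show ?thesis
 proof (rule that[of "%n. r (s n)" U])
  show "strict_mono (%n. r (s n))" using r(1) s by (auto simp: strict_mono_def)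
  show "(%n. bm (sq (%x. u (r (s n)) x - U x)) z R) ---> 0" for z R
   using LIMSEQ_subseq_LIMSEQ[OF loc s] by (simp add: o_def)
 qed (use Um ae in auto)
qed

text \<open>The pairing of \<open>g n\<close> with a test field is, up to sign, that of
  \<open>u n\<close> with a derivative of the test function, which converges because
  \<open>u n\<close> does so in L^2 on balls. Thus \<open>Gw\<close> applies exactly to the fields
  that define a weak gradient.\<close>

lemma wpair_limit:
 assumes u: "!!n. wpair (u n) (g n)" and U: "loc2 U" and loc: "!!R. (%n. bm (sq (%x. u n x - U x)) 0 R) ---> 0"
  and G: "L2v G" and Gw: "!!h l. L2v h ==> (%n. ip (g n) h) ---> l ==> ip G h = l" shows "wpair U G"
proof -
 have "(LI x. U x * partial i vp x) = - (LI x. G x $ i * vp x)" if vp: "test_fun vp" for vp i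
 proof -
  obtain r B where rB: "r > 0" "B >= 0" "!!x. norm x > r ==> vp x = 0" "!!x i. norm x > r ==> partial i vp x = 0"
   "!!x. \<bar>vp x\<bar> <= B" "!!x i. \<bar>partial i vp x\<bar> <= B" using test_fun_support[OF vp] by blast
  note [measurable] = test_fun_measurable[OF vp]
  have t: "(%n. (LI x. u n x * partial i vp x)) ---> (LI x. U x * partial i vp x)"
   by (rule test_integral_tendsto[OF wpair_loc2[OF u] U loc _ rB(6,4)]) measurable
  define h where "h x = vp x *\<^sub>R axis i (1::real)" for x
  have "integrable lborel (%x. vp x * vp x)"
   by (intro loc2_test_integrable(1)[OF loc2_continuous[OF test_fun_continuous(1)[OF vp]] vp])
  then have "integrable lborel (%x. (vp x)^2)" by (simp add: power2_eq_square)
  from nn_integral_eq_integral[OF this] have hL: "L2v h" unfolding L2v_def h_def by (auto simp: norm_axis_1)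
  have iph: "ip f h = (LI x. f x $ i * vp x)" for f by (simp add: ip_def h_def inner_axis mult.commute)
  have "ip (g n) h = - (LI x. u n x * partial i vp x)" for n using u[of n] vp unfolding iph wpair_def by auto
  then have "(%n. ip (g n) h) ---> - (LI x. U x * partial i vp x)" using tendsto_minus[OF t] by simp
  from Gw[OF hL this] show ?thesis by (simp add: iph)
 qed
 then show ?thesis using U G by (simp add: wpair_def L2v_def)
qed

lemma weak_compactness:
 assumes a: "a > 0" and X: "!!n. X a (u n) (g n)" and M: "!!n. N2 (g n) <= M" "!!n. W a (sq (u n)) (sq (u n)) <= ennreal M" "M >= 0"
 obtains r U G where "strict_mono (r::nat=>nat)" "X a U G" "AL x. (%n. u (r n) x) ---> U x"
  "!!z R. (%n. bm (sq (%x. u (r n) x - U x)) z R) ---> 0"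
  "!!h. L2v h ==> (%n. ip (g (r n)) h) ---> ip G h"
proof -
 obtain r U where r: "strict_mono (r::nat=>nat)" and Um[measurable]: "BM U"
  and ae: "AL x. (%n. u (r n) x) ---> U x" and loc: "!!z R. (%n. bm (sq (%x. u (r n) x - U x)) z R) ---> 0"
  by (rule L2loc_subsequence[OF a X M], rule that)
 have w: "wpair (u n) (g n)" for n using X by (simp add: X_def)
 have [measurable]: "BM (u n)" for n using X by auto
 have U2: "loc2 U"
 proof -
  have "bm (sq U) 0 R < top" for R
  proof -
   have "eventually (%n. bm (sq (%x. u (r n) x - U x)) 0 R < 1) sequentially" using loc by (rule order_tendstoD(2)) simp
   then obtain n where n: "bm (sq (%x. u (r n) x - U x)) 0 R < 1" by (auto simp: eventually_sequentially)
   have "bm (sq U) 0 R <= (NI x. 2 * (if dist 0 x < R then sq (u (r n)) x else 0) + 2 * (if dist 0 x < R then sq (%x. u (r n) x - U x) x else 0))"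
    unfolding bm_def
   proof (intro nn_integral_mono)
    fix x
    show "(if dist 0 x < R then sq U x else 0) <= 2 * (if dist 0 x < R then sq (u (r n)) x else 0) + 2 * (if dist 0 x < R then sq (%x. u (r n) x - U x) x else 0)"
     using sq_diff_triangle[of "U x" 0 "u (r n) x"] by (auto simp: sq_def power2_commute add.commute)
   qed
   also have "... = 2 * bm (sq (u (r n))) 0 R + 2 * bm (sq (%x. u (r n) x - U x)) 0 R"
    unfolding bm_def by (subst nn_integral_add, measurable) (subst nn_integral_cmult, measurable, subst nn_integral_cmult, measurable)
   also have "... < top"
    using n less_trans[OF n ennreal_one_less_top] wpair_loc2[OF w[of "r n"]] by (simp add: loc2_iff_bm ennreal_mult_less_top)
   finally show ?thesis .
  qed
  then show ?thesis by (simp add: loc2_iff_bm)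
 qed
 have WU: "W a (sq U) (sq U) <= ennreal M"
 proof -
  have "W a (sq U) (sq U) <= liminf (%n. W a (sq (u (r n))) (sq (u (r n))))"
   using W_Fatou[OF _ Um ae, of a] by (simp add: sq_def[abs_def])
  also have "... <= liminf (%n. ennreal M)" by (intro Liminf_mono always_eventually allI M)
  finally show ?thesis by (simp add: Liminf_const)
 qed
 obtain G where G: "L2v G" "!!h l. L2v h ==> (%n. ip (g (r n)) h) ---> l ==> ip G h = l"
  by (rule weak_limit_exists[of "%n. g (r n)" M], rule X_L2v[OF X], rule M, rule that)
 have wU: "wpair U G" by (rule wpair_limit[OF w U2 loc G])
 have XU: "X a U G" using wU WU by (auto simp: X_def intro: le_less_trans)
 \<comment> \<open>If the pairings stayed away from \<open>ip G h\<close> along a subsequence, a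
   further one would make them converge to some other value. The weak limit built from it is again a
   weak gradient of \<open>U\<close>, hence equal to \<open>G\<close> almost everywhere, a
   contradiction.\<close>
 have wk: "(%n. ip (g (r n)) h) ---> ip G h" if h: "L2v h" for h
 proof (rule ccontr)
  assume "~ (%n. ip (g (r n)) h) ---> ip G h"
  then obtain e where e: "e > 0" "ALL N. EX n>=N. \<bar>ip (g (r n)) h - ip G h\<bar> >= e"
   unfolding LIMSEQ_iff by (auto simp: not_less)
  then have "infinite {n. \<bar>ip (g (r n)) h - ip G h\<bar> >= e}" unfolding infinite_nat_iff_unbounded_le by auto
  then obtain s :: "nat => nat" where s: "strict_mono s" "!!n. \<bar>ip (g (r (s n))) h - ip G h\<bar> >= e"
   using infinite_enumerate by blast
  have b: "\<bar>ip (g n) h\<bar> <= sqrt (M * N2 h)" for n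
  proof -
   have "(ip (g n) h)^2 <= N2 (g n) * N2 h" by (rule ip_Cauchy_Schwarz[OF X_L2v[OF X] h])
   also have "... <= M * N2 h" using M(1)[of n] N2_nonneg by (intro mult_right_mono)
   finally show ?thesis using real_sqrt_le_mono[of "(ip (g n) h)^2"] by simp
  qed
  have "bounded (range (%n. ip (g (r (s n))) h))" using b by (auto simp: bounded_iff)
  then obtain l t where t: "strict_mono (t::nat=>nat)" "((%n. ip (g (r (s n))) h) \<circ> t) ---> l"
   using bounded_imp_convergent_subsequence by blast
  define q where "q n = r (s (t n))" for n
  have st: "strict_mono (%n. s (t n))" using s(1) t(1) by (auto simp: strict_mono_def)
  have lq: "(%n. ip (g (q n)) h) ---> l" using t(2) by (simp add: q_def o_def)
  obtain G' where G': "L2v G'" "!!h l. L2v h ==> (%n. ip (g (q n)) h) ---> l ==> ip G' h = l"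
  proof (rule weak_limit_exists[of "%n. g (q n)" M])
   show "L2v (g (q n))" for n by (rule X_L2v[OF X])
   show "N2 (g (q n)) <= M" for n by (rule M)
  qed blast
  have "wpair U G'"
  proof (rule wpair_limit[OF w U2 _ G'])
   show "(%n. bm (sq (%x. u (q n) x - U x)) 0 R) ---> 0" for R
    using LIMSEQ_subseq_LIMSEQ[OF loc st] by (simp add: o_def q_def)
  qed
  from wpair_zero_grad_unique[OF this wU] have "AL x. G' x = G x" by simp
  then have "AL x. G' x \<bullet> h x = G x \<bullet> h x" by eventually_elim simp
  moreover have [measurable]: "BM G" "BM G'" "BM h" using G(1) G'(1) h by auto
  ultimately have "ip G' h = ip G h" unfolding ip_def by (intro integral_cong_AE) measurable
  then have "ip G h = l" using G'(2)[OF h lq] by simp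
  moreover have "\<bar>l - ip G h\<bar> >= e"
  proof (rule LIMSEQ_le_const)
   show "(%n. \<bar>ip (g (q n)) h - ip G h\<bar>) ---> \<bar>l - ip G h\<bar>" by (intro tendsto_intros lq)
   show "EX N. ALL n>=N. e <= \<bar>ip (g (q n)) h - ip G h\<bar>" using s(2) by (auto simp: q_def)
  qed
  ultimately show False using e(1) by simp
 qed
 show ?thesis by (rule that[OF r XU ae loc wk])
qed

section \<open>The terms of the energy functional\<close>

lemma Bernoulli_powr_strict:
 fixes x r :: real
 assumes "x >= 0" "x ~= 1" "r > 1" shows "x powr r > 1 + r * (x - 1)"
proof (cases "x = 0")
 case False
 then have x: "x > 0" using assms by simp
 have D: "((%t. t powr r) has_real_derivative r * t powr (r - 1)) (at t)" if "t > 0" for t :: real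
  using that by (auto intro!: derivative_eq_intros)
 show ?thesis
 proof (cases "x > 1")
  case True
  obtain z where z: "1 < z" "z < x" "x powr r - 1 powr r = (x - 1) * (r * z powr (r - 1))"
   using MVT2[OF True, of "%t. t powr r" "%t. r * t powr (r - 1)"] D by auto
  have "z powr (r - 1) > 1" using z assms by (intro gr_one_powr) auto
  then have "(x - 1) * (r * 1) < (x - 1) * (r * z powr (r - 1))"
   using True assms by (intro mult_strict_left_mono) auto
  then show ?thesis using z(3) by (simp add: mult.commute)
 next
  case False
  then have l: "x < 1" using assms by simp
  obtain z where z: "x < z" "z < 1" "1 powr r - x powr r = (1 - x) * (r * z powr (r - 1))"
   using MVT2[OF l, of "%t. t powr r" "%t. r * t powr (r - 1)"] D x by auto
  have "z powr (r - 1) < 1" using z x assms powr_less_mono2[of "r - 1" z 1] by simp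
  then have "(1 - x) * (r * z powr (r - 1)) < (1 - x) * (r * 1)" using l assms by (intro mult_strict_left_mono) auto
  then show ?thesis using z(3) by (simp add: algebra_simps)
 qed
qed (use assms in simp)

lemma Bernoulli_powr:
 fixes x r :: real
 assumes "x >= 0" "r > 1" shows "x powr r >= 1 + r * (x - 1)"
 using Bernoulli_powr_strict[of x r] assms by (cases "x = 1") auto

lemma powr_tangent:
 fixes x y p :: real
 assumes p: "p > 2" shows "\<bar>y\<bar> powr p >= \<bar>x\<bar> powr p + p * (\<bar>x\<bar> powr (p - 2) * x) * (y - x)"
proof (cases "x = 0")
 case False
 define z where "z = y / x"
 have zb: "\<bar>z\<bar> powr p >= 1 + p * (z - 1)"
 proof (cases "z >= 0")
  case True
  then show ?thesis using Bernoulli_powr[of z p] p by simp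
 next
  case False
  then have "1 + p * (z - 1) \<le> 1 + p * (0 - 1)" using p by (intro add_left_mono mult_left_mono) auto
  also have "... <= 0" using p by simp
  also have "... <= \<bar>z\<bar> powr p" by simp
  finally show ?thesis .
 qed
 have y: "y = x * z" using False by (simp add: z_def)
 have e: "\<bar>x\<bar> powr p = \<bar>x\<bar> powr (p - 2) * x^2" using powr_add[of "\<bar>x\<bar>" "p - 2" 2] False by (simp add: powr_numeral)
 have "\<bar>x\<bar> powr p * (1 + p * (z - 1)) <= \<bar>x\<bar> powr p * \<bar>z\<bar> powr p" using zb by (intro mult_left_mono) auto
 also have "... = \<bar>y\<bar> powr p" by (simp add: y abs_mult powr_mult)
 also have "\<bar>x\<bar> powr p * (1 + p * (z - 1)) = \<bar>x\<bar> powr p + p * (\<bar>x\<bar> powr (p - 2) * x) * (y - x)"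
 proof -
  have "\<bar>x\<bar> powr p * (1 + p * (z - 1)) = \<bar>x\<bar> powr p + p * (\<bar>x\<bar> powr (p - 2) * x^2) * (z - 1)" by (simp add: e algebra_simps)
  also have "p * (\<bar>x\<bar> powr (p - 2) * x^2) * (z - 1) = p * (\<bar>x\<bar> powr (p - 2) * x) * (y - x)"
   by (simp add: y power2_eq_square algebra_simps)
  finally show ?thesis .
 qed
 finally show ?thesis .
qed simp

section \<open>The L^p term and its derivative\<close>

definition Cp :: "real => (R3 => real) => real" where
 "Cp p u = (LI x. \<bar>u x\<bar> powr p)"

definition Cp' :: "real => (R3 => real) => (R3 => real) => real" where
 "Cp' p u v = (LI x. \<bar>u x\<bar> powr (p - 2) * u x * v x)"

lemma Cp_nonneg: "Cp p u >= 0"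
 unfolding Cp_def by (intro Bochner_Integration.integral_nonneg) simp

lemma X_Lp:
 assumes a: "a > 0" and p: "4 < p" "p < 6" and u: "X a u g"
 shows "integrable lborel (%x. \<bar>u x\<bar> powr p)" "(NE x. \<bar>u x\<bar> powr p) = ennreal (Cp p u)"
proof -
 have [measurable]: "BM u" using u by auto
 obtain m where m: "W a (sq u) (sq u) = ennreal m" "m >= 0" using u unfolding X_def by (cases "W a (sq u) (sq u)") auto
 have "(NE x. \<bar>u x\<bar> powr p) < \<infinity>"
 proof -
  have "max m (N2 g) >= 0" using m by simp
  then obtain K where "ALL v h. X a v h --> W a (sq v) (sq v) <= ennreal (max m (N2 g)) --> (NI x. nsq h x) <= ennreal (max m (N2 g)) -->
   (NE x. \<bar>v x\<bar> powr p) <= ennreal K" using Lp_bounded[OF a p, of "max m (N2 g)"] by blast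
  then have "(NE x. \<bar>u x\<bar> powr p) <= ennreal K" using u m L2v_nsq[OF X_L2v[OF u]] by (auto intro!: ennreal_leI)
  then show ?thesis by (auto intro: le_less_trans)
 qed
 then show i: "integrable lborel (%x. \<bar>u x\<bar> powr p)" by (intro integrableI_nonneg) auto
 show "(NE x. \<bar>u x\<bar> powr p) = ennreal (Cp p u)" unfolding Cp_def by (rule nn_integral_eq_integral[OF i]) simp
qed

lemma Cp_scale: "c >= 0 ==> Cp p (%x. c * u x) = c powr p * Cp p u"
 unfolding Cp_def by (simp add: abs_mult powr_mult)

text \<open>A crude Young inequality by comparing t with de s. What matters is that the coefficient
  of the first term can be chosen arbitrarily small.\<close>

lemma Young_powr:
 fixes s t de p :: real
 assumes "s >= 0" "t >= 0" "de > 0" "p > 2"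
 shows "s powr (p - 1) * t <= de * s powr p + (1/de) powr (p - 1) * t powr p"
proof (cases "t <= de * s")
 case True
 have "s powr (p - 1) * t <= s powr (p - 1) * (de * s)" using True by (intro mult_left_mono) auto
 also have "... = de * s powr p" using assms by (cases "s = 0") (auto simp: powr_diff)
 also have "... <= de * s powr p + (1/de) powr (p - 1) * t powr p" by simp
 finally show ?thesis .
next
 case False
 then have s: "s <= (1/de) * t" and t: "t > 0" using assms by (auto simp: field_simps not_le intro: le_less_trans[of 0 "de * s"])
 have "s powr (p - 1) * t <= ((1/de) * t) powr (p - 1) * t" using s assms by (intro mult_right_mono powr_mono2) auto
 also have "... = (1/de) powr (p - 1) * (t powr (p - 1) * t)" using powr_mult[of "1/de" t "p - 1"] assms t by simp
 also have "t powr (p - 1) * t = t powr p" using t by (simp add: powr_diff)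
 also have "(1/de) powr (p - 1) * t powr p <= de * s powr p + (1/de) powr (p - 1) * t powr p" using assms by simp
 finally show ?thesis .
qed

lemma abs_powr_mult: "\<bar>\<bar>x\<bar> powr (p - 2) * x * y\<bar> = \<bar>x\<bar> powr (p - 1) * \<bar>y\<bar>" for x y p :: real
proof (cases "x = 0")
 case False
 have "\<bar>x\<bar> powr (p - 1) = \<bar>x\<bar> powr (p - 2) * \<bar>x\<bar>" using powr_add[of "\<bar>x\<bar>" "p - 2" 1] False by simp
 then show ?thesis by (simp add: abs_mult)
qed simp

lemma Cp'_integrable:
 assumes a: "a > 0" and p: "4 < p" "p < 6" and u: "X a u g" and v: "X a v h"
 shows "integrable lborel (%x. \<bar>u x\<bar> powr (p - 2) * u x * v x)"
proof (rule Bochner_Integration.integrable_bound[OF Bochner_Integration.integrable_add[OF X_Lp(1)[OF a p u] X_Lp(1)[OF a p v]]])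
 have [measurable]: "BM u" "BM v" using u v by auto
 show "(%x. \<bar>u x\<bar> powr (p - 2) * u x * v x) \<in> borel_measurable lborel" by measurable
 have "\<bar>\<bar>u x\<bar> powr (p - 2) * u x * v x\<bar> <= \<bar>u x\<bar> powr p + \<bar>v x\<bar> powr p" for x
  using Young_powr[of "\<bar>u x\<bar>" "\<bar>v x\<bar>" 1 p] p by (simp add: abs_powr_mult)
 then show "AL x. norm (\<bar>u x\<bar> powr (p - 2) * u x * v x) <= norm (\<bar>u x\<bar> powr p + \<bar>v x\<bar> powr p)"
  by (intro AE_I2) (auto intro: order_trans[OF _ abs_ge_self])
qed

text \<open>Convexity of |t|^p gives the tangent as a lower bound without remainder. A lower bound
  is the useful direction, since the term enters the energy with a minus sign.\<close>

lemma Cp_tangent: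
 assumes a: "a > 0" and p: "4 < p" "p < 6" and u: "X a u g" and v: "X a v h"
 shows "Cp p (%x. u x + t * v x) >= Cp p u + t * (p * Cp' p u v)"
proof -
 note iu = X_Lp(1)[OF a p u]
 note iuv = Cp'_integrable[OF a p u v]
 have "Cp p u + t * (p * Cp' p u v) = (LI x. \<bar>u x\<bar> powr p + t * (p * (\<bar>u x\<bar> powr (p - 2) * u x * v x)))"
  using iu iuv by (simp add: Cp_def Cp'_def)
 also have "... <= Cp p (%x. u x + t * v x)" unfolding Cp_def
 proof (rule integral_mono)
  show "integrable lborel (%x. \<bar>u x\<bar> powr p + t * (p * (\<bar>u x\<bar> powr (p - 2) * u x * v x)))" using iu iuv by simp
  show "integrable lborel (%x. \<bar>u x + t * v x\<bar> powr p)" by (rule X_Lp(1)[OF a p X_add[OF a u v]])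
  show "\<bar>u x\<bar> powr p + t * (p * (\<bar>u x\<bar> powr (p - 2) * u x * v x)) <= \<bar>u x + t * v x\<bar> powr p" for x
   using powr_tangent[of p "u x" "u x + t * v x"] p by (simp add: algebra_simps)
 qed
 finally show ?thesis .
qed

lemma Cp'_self: "Cp' p u u = Cp p u"
proof -
 have "\<bar>u x\<bar> powr (p - 2) * u x * u x = \<bar>u x\<bar> powr p" for x
  using powr_add[of "\<bar>u x\<bar>" "p - 2" 2] by (cases "u x = 0") (auto simp: powr_numeral power2_eq_square)
 then show ?thesis by (simp add: Cp'_def Cp_def)
qed

lemma Cp'_uminus: "Cp' p u (%x. - v x) = - Cp' p u v"
 unfolding Cp'_def by simp

text \<open>The L^p norms are merely bounded and there is no common majorant; Young's inequality
  bounds the integrands by a small multiple of |u_n|^p plus a fixed integrable multiple of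
  |v|^p.\<close>

lemma Cp'_tendsto:
 assumes a: "a > 0" and p: "4 < p" "p < 6" and u: "!!n. X a (u n) (g n)" and U: "X a U G" and v: "X a v h"
  and K: "!!n. Cp p (u n) <= K" "K >= 0" and ae: "AL x. (%n. u n x) ---> U x"
 shows "(%n. Cp' p (u n) v) ---> Cp' p U v" unfolding Cp'_def
proof (rule integral_tendsto_of_eps_domination(3)[where Ph="%n x. \<bar>u n x\<bar> powr p" and B=K])
 have [measurable]: "BM (u n)" "BM U" "BM v" for n using u U v by auto
 show "(%x. \<bar>u n x\<bar> powr (p - 2) * u n x * v x) \<in> borel_measurable lborel" for n by measurable
 show "(%x. \<bar>U x\<bar> powr (p - 2) * U x * v x) \<in> borel_measurable lborel" by measurable
 show "(%x. \<bar>u n x\<bar> powr p) \<in> borel_measurable lborel" for n by measurable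
 show "AL x. (%n. \<bar>u n x\<bar> powr (p - 2) * u n x * v x) ---> \<bar>U x\<bar> powr (p - 2) * U x * v x" using ae
 proof eventually_elim
  case (elim x)
  have "(%n. \<bar>u n x\<bar> powr (p - 2) * u n x) ---> \<bar>U x\<bar> powr (p - 2) * U x"
   using p by (intro tendsto_mult tendsto_powr' tendsto_rabs elim tendsto_const) auto
  then show ?case by (rule tendsto_mult) (rule tendsto_const)
 qed
 show "(NE x. \<bar>u n x\<bar> powr p) <= ennreal K" for n unfolding X_Lp(2)[OF a p u] by (intro ennreal_leI K)
 show "EX H. integrable lborel H & (ALL n x. \<bar>\<bar>u n x\<bar> powr (p - 2) * u n x * v x\<bar> <= de * \<bar>u n x\<bar> powr p + H x)" if "de > 0" for de
 proof (intro exI[of _ "%x. (1/de) powr (p - 1) * \<bar>v x\<bar> powr p"] conjI allI)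
  show "integrable lborel (%x. (1/de) powr (p - 1) * \<bar>v x\<bar> powr p)" using X_Lp(1)[OF a p v] by simp
  show "\<bar>\<bar>u n x\<bar> powr (p - 2) * u n x * v x\<bar> <= de * \<bar>u n x\<bar> powr p + (1/de) powr (p - 1) * \<bar>v x\<bar> powr p" for n x
   unfolding abs_powr_mult using that p by (intro Young_powr) auto
 qed
qed (use K in auto)

section \<open>The nonlocal term for signed functions\<close>

definition PP :: "(R3 \<times> R3) measure" where "PP = lborel2"

lemma sets_PP[measurable_cong]: "sets PP = sets (borel2)"
 unfolding PP_def by (intro sets_pair_measure_cong) auto

text \<open>A single integral over pairs of points rather than an iterated one: expansions and
  limits then use linearity and dominated convergence for one integral, with \<open>Di\<close> as
  the integrability condition.\<close>

definition Dk :: "real => (R3 => real) => (R3 => real) => real" where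
 "Dk a f g = (\<integral>z. kernel a (fst z - snd z) * (f (fst z) * g (snd z)) \<partial>PP)"

definition Di :: "real => (R3 => real) => (R3 => real) => bool" where
 "Di a f g \<longleftrightarrow> integrable PP (%z. kernel a (fst z - snd z) * (f (fst z) * g (snd z)))"

lemma PP_nn_integral:
 assumes [measurable]: "f \<in> borel_measurable borel2" shows "(\<integral>\<^sup>+z. f z \<partial>PP) = (NI x. NI y. f (x, y))"
proof -
 have "f \<in> borel_measurable lborel2" by measurable
 then show ?thesis unfolding PP_def by (rule lborel.nn_integral_fst[symmetric])
qed

lemma W_PP:
 assumes a: "a > 0" and [measurable]: "BM f" "BM g" and nn: "!!x. f x >= 0" "!!x. g x >= 0"
 shows "(\<integral>\<^sup>+z. ennreal (kernel a (fst z - snd z) * (f (fst z) * g (snd z))) \<partial>PP) = W a (%x. ennreal (f x)) (%x. ennreal (g x))"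
 by (subst PP_nn_integral) (auto simp: W_def ennreal_mult kernel_bounds(1)[OF a] nn)

lemma Di_I:
 assumes a: "a > 0" and [measurable]: "BM f" "BM g"
   "BM F" "BM G"
  and b: "!!x. \<bar>f x\<bar> <= F x" "!!x. \<bar>g x\<bar> <= G x" and fin: "W a (%x. ennreal (F x)) (%x. ennreal (G x)) < top"
 shows "Di a f g" unfolding Di_def
proof (rule integrableI_bounded)
 have nn: "F x >= 0" "G x >= 0" for x using b[of x] by linarith+
 have "(\<integral>\<^sup>+z. ennreal (norm (kernel a (fst z - snd z) * (f (fst z) * g (snd z)))) \<partial>PP) <= (\<integral>\<^sup>+z. ennreal (kernel a (fst z - snd z) * (F (fst z) * G (snd z))) \<partial>PP)"
  by (intro nn_integral_mono ennreal_leI) (auto simp: abs_mult kernel_bounds(1)[OF a] intro!: mult_left_mono mult_mono b nn)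
 also have "... = W a (%x. ennreal (F x)) (%x. ennreal (G x))" by (rule W_PP[OF a]) (auto simp: nn)
 finally show "(\<integral>\<^sup>+z. ennreal (norm (kernel a (fst z - snd z) * (f (fst z) * g (snd z)))) \<partial>PP) < \<infinity>"
  using fin by (auto intro: le_less_trans)
qed measurable

lemma Dk_nonneg_W:
 assumes a: "a > 0" and [measurable]: "BM f" "BM g"
  and nn: "!!x. f x >= 0" "!!x. g x >= 0" and fin: "W a (%x. ennreal (f x)) (%x. ennreal (g x)) < top"
 shows "W a (%x. ennreal (f x)) (%x. ennreal (g x)) = ennreal (Dk a f g)" "Dk a f g >= 0"
proof -
 have i: "integrable PP (%z. kernel a (fst z - snd z) * (f (fst z) * g (snd z)))"
  using Di_I[OF a, of f g f g] fin nn by (simp add: Di_def)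
 show "Dk a f g >= 0" unfolding Dk_def by (intro Bochner_Integration.integral_nonneg) (auto simp: kernel_bounds(1)[OF a] nn)
 show "W a (%x. ennreal (f x)) (%x. ennreal (g x)) = ennreal (Dk a f g)"
  unfolding Dk_def W_PP[OF a assms(2,3) nn, symmetric]
  by (rule nn_integral_eq_integral[OF i]) (auto simp: kernel_bounds(1)[OF a] nn)
qed

lemma Dk_add_left: "Di a f g ==> Di a f' g ==> Dk a (%x. f x + c * f' x) g = Dk a f g + c * Dk a f' g"
 "Di a f g ==> Di a f' g ==> Di a (%x. f x + c * f' x) g"
proof -
 assume i: "Di a f g" "Di a f' g"
 have e: "kernel a (fst z - snd z) * ((f (fst z) + c * f' (fst z)) * g (snd z))
  = kernel a (fst z - snd z) * (f (fst z) * g (snd z)) + c * (kernel a (fst z - snd z) * (f' (fst z) * g (snd z)))" for z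
  by (simp add: algebra_simps)
 show "Dk a (%x. f x + c * f' x) g = Dk a f g + c * Dk a f' g" "Di a (%x. f x + c * f' x) g"
  using i unfolding Dk_def Di_def e by auto
qed

lemma Dk_add_right: "Di a f g ==> Di a f g' ==> Dk a f (%x. g x + c * g' x) = Dk a f g + c * Dk a f g'"
 "Di a f g ==> Di a f g' ==> Di a f (%x. g x + c * g' x)"
proof -
 assume i: "Di a f g" "Di a f g'"
 have e: "kernel a (fst z - snd z) * (f (fst z) * (g (snd z) + c * g' (snd z)))
  = kernel a (fst z - snd z) * (f (fst z) * g (snd z)) + c * (kernel a (fst z - snd z) * (f (fst z) * g' (snd z)))" for z
  by (simp add: algebra_simps)
 show "Dk a f (%x. g x + c * g' x) = Dk a f g + c * Dk a f g'" "Di a f (%x. g x + c * g' x)"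
  using i unfolding Dk_def Di_def e by auto
qed

lemma Dk_commute:
 assumes a: "a > 0" and [measurable]: "BM f" "BM g" shows "Dk a f g = Dk a g f"
proof -
 have k: "kernel a (x - y) = kernel a (y - x)" for x y using kernel_bounds(5)[OF a, of "y - x"] by simp
 have "Dk a f g = (\<integral>z. (%(x, y). kernel a (x - y) * (f x * g y)) z \<partial>lborel2)"
  by (simp add: Dk_def PP_def case_prod_beta)
 also have "... = (\<integral>(x, y). (%(x, y). kernel a (x - y) * (f x * g y)) (y, x) \<partial>lborel2)"
  by (rule lborel_pair.integral_product_swap[symmetric]) measurable
 also have "... = Dk a g f"
  by (auto simp: Dk_def PP_def case_prod_beta k mult.commute intro!: Bochner_Integration.integral_cong)
 finally show ?thesis .
qed

definition Bf :: "real => (R3 => real) => real" where "Bf a u = Dk a (%x. (u x)^2) (%x. (u x)^2)"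

lemma X_Bf:
 assumes a: "a > 0" and u: "X a u g" shows "W a (sq u) (sq u) = ennreal (Bf a u)" "Bf a u >= 0"
proof -
 have [measurable]: "BM u" using u by auto
 show "W a (sq u) (sq u) = ennreal (Bf a u)" "Bf a u >= 0"
  using Dk_nonneg_W[OF a, of "%x. (u x)^2" "%x. (u x)^2"] u by (auto simp: X_def sq_def[abs_def] Bf_def)
qed

lemma X_pair_W:
 assumes a: "a > 0" and u: "X a u g" and v: "X a v h" shows "W a (sq u) (sq v) < top"
proof -
 have [measurable]: "BM u" "BM v" using u v by auto
 show ?thesis using W_add_finite(1)[OF a, of "sq u" "sq v"] u v by (auto simp: X_def)
qed

lemma X_sum_W:
 assumes a: "a > 0" and u: "X a u g" and v: "X a v h"
 shows "W a (%x. ennreal ((u x)^2 + (v x)^2)) (%x. ennreal ((u x)^2 + (v x)^2)) < top"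
proof -
 have [measurable]: "BM u" "BM v" using u v by auto
 have "W a (%x. sq u x + sq v x) (%x. sq u x + sq v x) < top"
  using W_add_finite(2)[OF a, of "sq u" "sq v"] u v by (auto simp: X_def)
 then show ?thesis by (simp add: sq_def)
qed

lemma abs_mult_le_sq: "\<bar>x * y\<bar> <= x^2 + y^2" for x y :: real
proof -
 have "0 <= (\<bar>x\<bar> - \<bar>y\<bar>)^2" by simp
 then have "2 * (\<bar>x\<bar> * \<bar>y\<bar>) <= x^2 + y^2" by (simp add: power2_diff)
 moreover have "0 <= \<bar>x\<bar> * \<bar>y\<bar>" by simp
 ultimately show ?thesis unfolding abs_mult by linarith
qed

lemma Di_quad:
 assumes a: "a > 0" and u: "X a u g" and v: "X a v h" and [measurable]: "BM f" "BM k"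
  and b: "!!x. \<bar>f x\<bar> <= (u x)^2 + (v x)^2" "!!x. \<bar>k x\<bar> <= (u x)^2 + (v x)^2"
 shows "Di a f k" "\<bar>Dk a f k\<bar> <= Dk a (%x. (u x)^2 + (v x)^2) (%x. (u x)^2 + (v x)^2)"
proof -
 have [measurable]: "BM u" "BM v" using u v by auto
 show D: "Di a f k" by (rule Di_I[OF a _ _ _ _ b X_sum_W[OF a u v]]) measurable
 have D': "Di a (%x. (u x)^2 + (v x)^2) (%x. (u x)^2 + (v x)^2)"
  by (rule Di_I[OF a _ _ _ _ _ _ X_sum_W[OF a u v]]) auto
 have "\<bar>Dk a f k\<bar> <= (\<integral>z. \<bar>kernel a (fst z - snd z) * (f (fst z) * k (snd z))\<bar> \<partial>PP)"
  unfolding Dk_def by (rule integral_abs_bound)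
 also have "... <= Dk a (%x. (u x)^2 + (v x)^2) (%x. (u x)^2 + (v x)^2)"
  unfolding Dk_def using integrable_abs[OF D[unfolded Di_def]] D'[unfolded Di_def]
  by (intro integral_mono) (auto simp: abs_mult kernel_bounds(1)[OF a] intro!: mult_left_mono mult_mono b)
 finally show "\<bar>Dk a f k\<bar> <= Dk a (%x. (u x)^2 + (v x)^2) (%x. (u x)^2 + (v x)^2)" .
qed

lemma Dk_sum_bound:
 assumes a: "a > 0" and u: "X a u g" and v: "X a v h"
 shows "Dk a (%x. (u x)^2 + (v x)^2) (%x. (u x)^2 + (v x)^2) <= (1 + 2 * enn2real CW) * (Bf a u + Bf a v)"
proof -
 have [measurable]: "BM u" "BM v" using u v by auto
 define c where "c = enn2real CW"
 have c: "CW = ennreal c" "c >= 0" using CW_finite by (auto simp: c_def)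
 have "ennreal (Dk a (%x. (u x)^2 + (v x)^2) (%x. (u x)^2 + (v x)^2)) = W a (%x. ennreal ((u x)^2 + (v x)^2)) (%x. ennreal ((u x)^2 + (v x)^2))"
  by (rule Dk_nonneg_W(1)[OF a _ _ _ _ X_sum_W[OF a u v], symmetric]) auto
 also have "... = W a (%x. sq u x + sq v x) (%x. sq u x + sq v x)" by (simp add: sq_def)
 also have "... = W a (sq u) (%x. sq u x + sq v x) + W a (sq v) (%x. sq u x + sq v x)" by (rule W_add_left) measurable
 also have "W a (sq u) (%x. sq u x + sq v x) = W a (%x. sq u x + sq v x) (sq u)" by (rule W_commute) (use a in measurable)
 also have "W a (sq v) (%x. sq u x + sq v x) = W a (%x. sq u x + sq v x) (sq v)" by (rule W_commute) (use a in measurable)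
 also have "W a (%x. sq u x + sq v x) (sq u) = W a (sq u) (sq u) + W a (sq v) (sq u)" by (rule W_add_left) measurable
 also have "W a (%x. sq u x + sq v x) (sq v) = W a (sq u) (sq v) + W a (sq v) (sq v)" by (rule W_add_left) measurable
 also have "W a (sq v) (sq u) = W a (sq u) (sq v)" by (rule W_commute) (use a in measurable)
 also have "(W a (sq u) (sq u) + W a (sq u) (sq v)) + (W a (sq u) (sq v) + W a (sq v) (sq v))
  <= (W a (sq u) (sq u) + CW * (W a (sq u) (sq u) + W a (sq v) (sq v))) + (CW * (W a (sq u) (sq u) + W a (sq v) (sq v)) + W a (sq v) (sq v))"
  by (intro add_mono order_refl W_le_sum[OF a]) measurable
 also have "... = ennreal ((1 + 2 * c) * (Bf a u + Bf a v))"
 proof -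
  have "CW * (W a (sq u) (sq u) + W a (sq v) (sq v)) = ennreal (c * (Bf a u + Bf a v))"
   using X_Bf[OF a u] X_Bf[OF a v] c by (simp add: ennreal_mult)
  then show ?thesis using X_Bf[OF a u] X_Bf[OF a v] c by (simp add: algebra_simps flip: ennreal_plus)
 qed
 finally show ?thesis using c X_Bf[OF a u] X_Bf[OF a v] by (simp add: ennreal_le_iff c_def)
qed

text \<open>The square of u + t v is F + 2 t r with r = u v + (t/2) v^2, and for t in [0,1] also
  \<open>r\<close> is bounded by u^2 + v^2. The linear term is exact; the remainder collects 2 + 4 =
  6 forms of such functions and is bounded through \<open>Bf a u\<close> and \<open>Bf a v\<close>
  alone, hence uniformly along bounded sequences.\<close>

lemma Bf_expansion:
 assumes a: "a > 0" and u: "X a u g" and v: "X a v h" and t: "0 <= t" "t <= 1"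
 shows "Bf a (%x. u x + t * v x) <= Bf a u + t * (4 * Dk a (%x. u x * v x) (%x. (u x)^2)) + t^2 * (6 * ((1 + 2 * enn2real CW) * (Bf a u + Bf a v)))"
proof -
 have [measurable]: "BM u" "BM v" using u v by auto
 define F where "F x = (u x)^2" for x
 define r where "r x = u x * v x + (t / 2) * (v x)^2" for x
 define S where "S = Dk a (%x. (u x)^2 + (v x)^2) (%x. (u x)^2 + (v x)^2)"
 have [measurable]: "BM F" "BM r" unfolding F_def r_def by measurable
 have b: "\<bar>F x\<bar> <= (u x)^2 + (v x)^2" "\<bar>u x * v x\<bar> <= (u x)^2 + (v x)^2" "\<bar>(v x)^2\<bar> <= (u x)^2 + (v x)^2" for x
  using abs_mult_le_sq by (auto simp: F_def)
 have br: "\<bar>r x\<bar> <= (u x)^2 + (v x)^2" for x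
 proof -
  have "0 <= (\<bar>u x\<bar> - \<bar>v x\<bar>)^2" by simp
  then have "\<bar>u x * v x\<bar> <= (1/2) * ((u x)^2 + (v x)^2)" by (simp add: power2_diff abs_mult)
  moreover have "(t / 2) * (v x)^2 <= (1/2) * (v x)^2" "0 <= (t / 2) * (v x)^2" using t by (auto simp: mult_left_le_one_le)
  moreover have "0 <= (1/2) * (u x)^2" "0 <= (1/2) * (v x)^2" by auto
  moreover have "\<bar>r x\<bar> <= \<bar>u x * v x\<bar> + \<bar>(t / 2) * (v x)^2\<bar>" unfolding r_def by (rule abs_triangle_ineq)
  ultimately show ?thesis by argo
 qed
 note D = Di_quad(1)[OF a u v]
 note Db = Di_quad(2)[OF a u v]
 have exp: "(u x + t * v x)^2 = F x + (2 * t) * r x" for x by (simp add: F_def r_def power2_eq_square algebra_simps)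
 have DFF: "Di a F F" by (rule D) (auto intro: b)
 have DFr: "Di a F r" by (rule D) (auto intro: b br)
 have DrF: "Di a r F" by (rule D) (auto intro: b br)
 have Drr: "Di a r r" by (rule D) (auto intro: b br)
 have Duv: "Di a (%x. u x * v x) F" by (rule D) (auto intro: b)
 have Dvv: "Di a (%x. (v x)^2) F" by (rule D) (auto intro: b)
 have "Bf a (%x. u x + t * v x) = Dk a (%x. F x + (2 * t) * r x) (%x. F x + (2 * t) * r x)" by (simp add: Bf_def exp)
 also have "... = Dk a F (%x. F x + (2 * t) * r x) + (2 * t) * Dk a r (%x. F x + (2 * t) * r x)"
  by (rule Dk_add_left(1)) (intro Dk_add_right(2) DFF DFr DrF Drr)+
 also have "... = (Dk a F F + (2 * t) * Dk a F r) + (2 * t) * (Dk a r F + (2 * t) * Dk a r r)"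
  by (simp add: Dk_add_right(1)[OF DFF DFr] Dk_add_right(1)[OF DrF Drr])
 also have "Dk a F r = Dk a r F" by (rule Dk_commute[OF a]) measurable
 also have "Dk a r F = Dk a (%x. u x * v x) F + (t / 2) * Dk a (%x. (v x)^2) F"
  unfolding r_def by (rule Dk_add_left(1)[OF Duv Dvv])
 finally have "Bf a (%x. u x + t * v x) = Dk a F F + t * (4 * Dk a (%x. u x * v x) F) + t^2 * (2 * Dk a (%x. (v x)^2) F + 4 * Dk a r r)"
  by (simp add: power2_eq_square algebra_simps)
 also have "2 * Dk a (%x. (v x)^2) F + 4 * Dk a r r <= 6 * S"
 proof -
  have "\<bar>Dk a (%x. (v x)^2) F\<bar> <= S" unfolding S_def by (rule Db) (auto intro: b)
  moreover have "\<bar>Dk a r r\<bar> <= S" unfolding S_def by (rule Db) (auto intro: br)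
  ultimately show ?thesis by (simp add: abs_le_iff)
 qed
 also have "6 * S <= 6 * ((1 + 2 * enn2real CW) * (Bf a u + Bf a v))"
  unfolding S_def by (intro mult_left_mono Dk_sum_bound[OF a u v]) auto
 finally show ?thesis by (simp add: F_def Bf_def mult_left_mono)
qed

lemma AE_PP:
 assumes "AL x. P x" shows "AE z in PP. P (fst z) & P (snd z)"
proof -
 obtain N where N: "N \<in> null_sets lborel" "{x\<in>space lborel. ~ P x} \<subseteq> N" using assms unfolding eventually_ae_filter by auto
 have "N \<times> UNIV \<in> null_sets PP" "UNIV \<times> N \<in> null_sets PP"
  unfolding PP_def by (rule lborel.times_in_null_sets1 lborel.times_in_null_sets2; simp add: N(1))+
 then have "N \<times> UNIV \<union> UNIV \<times> N \<in> null_sets PP" by (rule null_sets.Un)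
 moreover have "{z\<in>space PP. ~ (P (fst z) & P (snd z))} \<subseteq> N \<times> UNIV \<union> UNIV \<times> N" using N(2) by (auto simp: prod_eq_iff)
 ultimately show ?thesis unfolding eventually_ae_filter by blast
qed

text \<open>In u_n(x) v(x) u_n(y)^2 one of the two factors u_n(y) is written as U(y) + (u_n - U)(y).
  The first part is bounded by a small multiple of u_n(x)^2 u_n(y)^2 plus a multiple of v(x)^2
  U(y)^2, so the generalized dominated convergence applies. For the second the same inequality
  leaves the interaction of (u_n - U)^2 with v^2, which tends to 0 by
  \<open>W_tendsto_0\<close>.\<close>

lemma Dk_tendsto:
 assumes a: "a > 0" and u: "!!n. X a (u n) (g n)" and U: "X a U G" and v: "X a v h"
  and M: "!!n. W a (sq (u n)) (sq (u n)) <= ennreal M" "M >= 0" and ae: "AL x. (%n. u n x) ---> U x"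
  and loc: "!!z R. (%n. bm (sq (%x. u n x - U x)) z R) ---> 0"
 shows "(%n. Dk a (%x. u n x * v x) (%x. (u n x)^2)) ---> Dk a (%x. U x * v x) (%x. (U x)^2)"
proof -
 have [measurable]: "BM (u n)" "BM U" "BM v" for n using u U v by auto
 define K where "K z = kernel a (fst z - snd z)" for z :: "R3 \<times> R3"
 have [measurable]: "K \<in> borel_measurable borel2" unfolding K_def by measurable
 have K0: "K z >= 0" for z unfolding K_def by (rule kernel_bounds(1)[OF a])
 define Ph where "Ph n z = K z * ((u n (fst z))^2 * (u n (snd z))^2)" for n z
 have [measurable]: "Ph n \<in> borel_measurable borel2" for n unfolding Ph_def by measurable
 have Ph0: "Ph n z >= 0" for n z using K0 by (simp add: Ph_def)
 have PhM: "(\<integral>\<^sup>+z. ennreal (Ph n z) \<partial>PP) <= ennreal M" for n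
 proof -
  have "(\<integral>\<^sup>+z. ennreal (Ph n z) \<partial>PP) = W a (sq (u n)) (sq (u n))"
   unfolding Ph_def K_def by (subst W_PP[OF a]) (auto simp: sq_def[abs_def])
  then show ?thesis using M by simp
 qed
 have ip_bound: "\<bar>k * (s * t * (x * y))\<bar> <= de * (k * (s^2 * t^2)) + (1/de) * (k * (y^2 * x^2))" if "de > 0" "k >= 0" for k s t x y de :: real
 proof -
  have d: "de = (sqrt de)^2" "1/de = (1 / sqrt de)^2" using that by (auto simp: power_divide)
  have "(s * t) * (x * y) = (sqrt de * (s * t)) * ((1 / sqrt de) * (x * y))" using that by simp
  then have "\<bar>(s * t) * (x * y)\<bar> <= (sqrt de * (s * t))^2 + ((1 / sqrt de) * (x * y))^2" using abs_mult_le_sq by metis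
  also have "... = de * (s^2 * t^2) + (1/de) * (y^2 * x^2)" using that by (simp add: power_mult_distrib power_divide mult.commute)
  finally have "k * \<bar>(s * t) * (x * y)\<bar> <= k * (de * (s^2 * t^2) + (1/de) * (y^2 * x^2))" using that by (intro mult_left_mono)
  then show ?thesis using that by (simp add: abs_mult algebra_simps)
 qed
 define f1 where "f1 n z = K z * (u n (fst z) * u n (snd z) * (U (snd z) * v (fst z)))" for n z
 have t1: "(%n. \<integral>z. f1 n z \<partial>PP) ---> (\<integral>z. K z * (U (fst z) * U (snd z) * (U (snd z) * v (fst z))) \<partial>PP)"
  and i1: "!!n. integrable PP (f1 n)"
 proof -
  have meas: "f1 n \<in> borel_measurable PP" "(%z. K z * (U (fst z) * U (snd z) * (U (snd z) * v (fst z)))) \<in> borel_measurable PP" "Ph n \<in> borel_measurable PP" for n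
   unfolding f1_def by measurable
  have lim: "AE z in PP. (%n. f1 n z) ---> K z * (U (fst z) * U (snd z) * (U (snd z) * v (fst z)))"
   using AE_PP[OF ae] unfolding f1_def by eventually_elim (intro tendsto_intros, auto)
  have dom: "EX H. integrable PP H & (ALL n z. \<bar>f1 n z\<bar> <= de * Ph n z + H z)" if "de > 0" for de
  proof (intro exI[of _ "%z. (1/de) * (K z * ((v (fst z))^2 * (U (snd z))^2))"] conjI allI)
   have "Di a (%x. (v x)^2) (%x. (U x)^2)"
    by (rule Di_I[OF a, of _ _ "%x. (v x)^2" "%x. (U x)^2"]) (use X_pair_W[OF a v U] in \<open>auto simp: sq_def[abs_def]\<close>)
   then show "integrable PP (%z. (1/de) * (K z * ((v (fst z))^2 * (U (snd z))^2)))" unfolding Di_def K_def by simp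
   show "\<bar>f1 n z\<bar> <= de * Ph n z + (1/de) * (K z * ((v (fst z))^2 * (U (snd z))^2))" for n z
    unfolding f1_def Ph_def by (rule ip_bound[OF that K0])
  qed
  show "(%n. \<integral>z. f1 n z \<partial>PP) ---> (\<integral>z. K z * (U (fst z) * U (snd z) * (U (snd z) * v (fst z))) \<partial>PP)" "!!n. integrable PP (f1 n)"
   using integral_tendsto_of_eps_domination[OF meas(1,2,3) lim Ph0 PhM M(2) dom] by auto
 qed
 define w where "w n x = u n x - U x" for n x
 have Xw: "X a (w n) (%x. g n x + (-1) *\<^sub>R G x)" for n using X_add[OF a u U, of n "-1"] by (simp add: w_def[abs_def])
 have [measurable]: "BM (w n)" for n unfolding w_def by measurable
 have Ww: "(%n. W a (sq (w n)) (sq v)) ---> 0"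
 proof (rule W_tendsto_0[OF a])
  define bU where "bU = Bf a U"
  define MM where "MM = 4 * (ennreal ((1 + 2 * enn2real CW) * (M + bU)))"
  show "W a (sq (w n)) (sq (w n)) <= MM" for n
  proof -
   have "W a (sq (w n)) (sq (w n)) <= W a (%x. 2 * ennreal ((u n x)^2 + (U x)^2)) (%x. 2 * ennreal ((u n x)^2 + (U x)^2))"
   proof -
    have "sq (w n) x <= 2 * ennreal ((u n x)^2 + (U x)^2)" for x
     using sq_diff_triangle[of "u n x" "U x" 0] by (simp add: sq_def w_def distrib_left)
    then show ?thesis by (intro W_mono)
   qed
   also have "... = 2 * (2 * W a (%x. ennreal ((u n x)^2 + (U x)^2)) (%x. ennreal ((u n x)^2 + (U x)^2)))" by (rule W_scale) measurable
   also have "W a (%x. ennreal ((u n x)^2 + (U x)^2)) (%x. ennreal ((u n x)^2 + (U x)^2)) = ennreal (Dk a (%x. (u n x)^2 + (U x)^2) (%x. (u n x)^2 + (U x)^2))"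
    by (rule Dk_nonneg_W(1)[OF a _ _ _ _ X_sum_W[OF a u U]]) auto
   also have "... <= ennreal ((1 + 2 * enn2real CW) * (M + bU))"
   proof (rule ennreal_leI)
    have "Bf a (u n) <= M" using M(1)[of n] M(2) X_Bf[OF a u, of n] by (simp add: ennreal_le_iff)
    then have "(1 + 2 * enn2real CW) * (Bf a (u n) + Bf a U) <= (1 + 2 * enn2real CW) * (M + bU)"
     unfolding bU_def by (intro mult_left_mono) auto
    then show "Dk a (%x. (u n x)^2 + (U x)^2) (%x. (u n x)^2 + (U x)^2) <= (1 + 2 * enn2real CW) * (M + bU)"
     using Dk_sum_bound[OF a u U, of n] by linarith
   qed
   finally show ?thesis unfolding MM_def by (simp add: mult.assoc[symmetric] mult_left_mono)
  qed
  show "MM < top" unfolding MM_def by (simp add: ennreal_mult_less_top)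
  show "W a (sq v) (sq v) < top" using v by (simp add: X_def)
  show "(%n. bm (sq (w n)) z R) ---> 0" for z R using loc[of z R] by (simp add: w_def[abs_def])
 qed measurable
 define f2 where "f2 n z = K z * (u n (fst z) * u n (snd z) * (w n (snd z) * v (fst z)))" for n z
 have f2m[measurable]: "f2 n \<in> borel_measurable borel2" for n unfolding f2_def by measurable
 have f2b: "(\<integral>\<^sup>+z. ennreal \<bar>f2 n z\<bar> \<partial>PP) <= ennreal (de * M) + ennreal (1/de) * W a (sq (w n)) (sq v)" if de: "de > 0" for de n
 proof -
  have "(\<integral>\<^sup>+z. ennreal \<bar>f2 n z\<bar> \<partial>PP) <= (\<integral>\<^sup>+z. ennreal de * ennreal (Ph n z) + ennreal (1/de) * ennreal (K z * ((v (fst z))^2 * (w n (snd z))^2)) \<partial>PP)"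
   using de unfolding f2_def Ph_def by (intro nn_integral_mono ennreal_le_lincomb ip_bound K0) (auto simp: K0)
  also have "... = ennreal de * (\<integral>\<^sup>+z. ennreal (Ph n z) \<partial>PP) + ennreal (1/de) * (\<integral>\<^sup>+z. ennreal (K z * ((v (fst z))^2 * (w n (snd z))^2)) \<partial>PP)"
   by (subst nn_integral_add, measurable) (subst nn_integral_cmult, measurable, subst nn_integral_cmult, measurable)
  also have "(\<integral>\<^sup>+z. ennreal (K z * ((v (fst z))^2 * (w n (snd z))^2)) \<partial>PP) = W a (sq v) (sq (w n))"
   unfolding K_def by (subst W_PP[OF a]) (auto simp: sq_def[abs_def])
  also have "W a (sq v) (sq (w n)) = W a (sq (w n)) (sq v)" by (rule W_commute) (use a in measurable)
  also have "ennreal de * (\<integral>\<^sup>+z. ennreal (Ph n z) \<partial>PP) <= ennreal de * ennreal M" by (intro mult_left_mono PhM) auto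
  also have "ennreal de * ennreal M = ennreal (de * M)" using de M by (simp add: ennreal_mult)
  finally show ?thesis by (simp add: add_right_mono)
 qed
 have i2: "integrable PP (f2 n)" for n
 proof (rule integrableI_bounded)
  have "W a (sq (w n)) (sq v) < top" by (rule X_pair_W[OF a Xw v])
  then show "(\<integral>\<^sup>+z. ennreal (norm (f2 n z)) \<partial>PP) < \<infinity>" using le_less_trans[OF f2b[of 1 n]] by simp
 qed measurable
 have t2: "(%n. \<integral>z. f2 n z \<partial>PP) ---> 0"
 proof (rule LIMSEQ_I)
  fix e :: real assume e: "e > 0"
  define de where "de = e / (2 * (M + 1))"
  have de: "de > 0" using e M by (simp add: de_def)
  have deM: "de * M < e / 2"
  proof -
   have "e * M < e * (M + 1)" using e by simp
   then show ?thesis using M(2) by (simp add: de_def field_simps)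
  qed
  have "(%n. ennreal (1/de) * W a (sq (w n)) (sq v)) ---> ennreal (1/de) * 0" by (intro ennreal_tendsto_cmult Ww) simp
  then have "eventually (%n. ennreal (1/de) * W a (sq (w n)) (sq v) < ennreal (e/2)) sequentially"
   by (rule order_tendstoD(2)) (use e in simp)
  then obtain N where N: "!!n. n >= N ==> ennreal (1/de) * W a (sq (w n)) (sq v) < ennreal (e/2)" by (auto simp: eventually_sequentially)
  have "norm ((\<integral>z. f2 n z \<partial>PP) - 0) < e" if "n >= N" for n
  proof -
   have "ennreal \<bar>\<integral>z. f2 n z \<partial>PP\<bar> <= (\<integral>\<^sup>+z. ennreal \<bar>f2 n z\<bar> \<partial>PP)" using integral_norm_bound_ennreal[OF i2[of n]] by simp
   also have "... <= ennreal (de * M) + ennreal (1/de) * W a (sq (w n)) (sq v)" by (rule f2b[OF de])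
   also have "... < ennreal (e/2) + ennreal (e/2)"
    using N[OF that] deM e by (intro add_strict_mono) (auto intro: ennreal_lessI)
   also have "... = ennreal e" using e by (simp flip: ennreal_plus)
   finally show ?thesis using e by (simp add: ennreal_less_iff)
  qed
  then show "EX N. ALL n>=N. norm ((\<integral>z. f2 n z \<partial>PP) - 0) < e" by blast
 qed
 have "Dk a (%x. u n x * v x) (%x. (u n x)^2) = (\<integral>z. f1 n z \<partial>PP) + (\<integral>z. f2 n z \<partial>PP)" for n
 proof -
  have "Dk a (%x. u n x * v x) (%x. (u n x)^2) = (\<integral>z. f1 n z + f2 n z \<partial>PP)" unfolding Dk_def f1_def f2_def K_def w_def
   by (intro Bochner_Integration.integral_cong) (auto simp: power2_eq_square algebra_simps)
  then show ?thesis using i1 i2 by simp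
 qed
 moreover have "(\<integral>z. K z * (U (fst z) * U (snd z) * (U (snd z) * v (fst z))) \<partial>PP) = Dk a (%x. U x * v x) (%x. (U x)^2)"
  unfolding Dk_def K_def by (intro Bochner_Integration.integral_cong) (auto simp: power2_eq_square algebra_simps)
 ultimately show ?thesis using tendsto_add[OF t1 t2] by simp
qed

section \<open>Minimization on the Nehari set\<close>

lemma powr_four:
 fixes s p :: real
 assumes "s >= 0" shows "(s^4) powr (p/4) = s powr p"
 using assms by (cases "s = 0") (auto simp: powr_powr simp flip: powr_numeral)

text \<open>The Nehari deficit: for \<open>A + b = C\<close> the fibre map is largest at \<open>s = 1\<close>, with this quantitative gap.\<close>

definition gap :: "real => real => real" where "gap p s = (s powr p - 1) / p - (s^4 - 1) / 4"

lemma gap_pos: "s >= 0 ==> s ~= 1 ==> p > 4 ==> gap p s > 0"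
proof -
 assume s: "s >= 0" "s ~= 1" and p: "p > 4"
 have "s^4 ~= 1" using s power_eq_1_iff[of s 4] by auto
 then have "s powr p > 1 + (p/4) * (s^4 - 1)"
  using Bernoulli_powr_strict[of "s^4" "p/4"] s p powr_four[of s p] by simp
 then show ?thesis using p by (simp add: gap_def field_simps)
qed

lemma gap_nonneg: "s >= 0 ==> p > 4 ==> gap p s >= 0"
 using gap_pos[of s p] by (cases "s = 1") (auto simp: gap_def)

text \<open>After the constraint is used, the right-hand side exceeds the left by exactly A (s^2 -
  1)^2 / 4.\<close>

lemma Nehari_gap:
 fixes s p A b C :: real
 assumes "A >= 0" "A + b = C" "p > 4"
 shows "s^2 * A / 2 + s^4 * b / 4 - s powr p * C / p <= A / 2 + b / 4 - C / p - C * gap p s"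
proof -
 have "A / 2 + b / 4 - C / p - C * gap p s - (s^2 * A / 2 + s^4 * b / 4 - s powr p * C / p) = A * (s^2 - 1)^2 / 4"
  using assms by (simp add: gap_def field_simps power2_eq_square power4_eq_xxxx) (simp add: assms(2)[symmetric] algebra_simps)
 also have "... >= 0" using assms by simp
 finally show ?thesis by simp
qed

text \<open>Dividing the equation by s^2 leaves s^(p-2) C = A + s^2 b, solved by the intermediate
  value theorem up to \<open>T\<close>, where p > 4 makes the left-hand side win. The last clause
  bounds the factor by the ratio of A + b to C alone, which keeps the factors bounded along a
  sequence.\<close>

lemma Nehari_scale:
 fixes p A b C :: real
 assumes "A > 0" "b >= 0" "C > 0" "p > 4"
 obtains s where "s > 0" "s^2 * A + s^4 * b = s powr p * C"
  "!!K. A + b <= K * C ==> s <= max 1 (K powr (1 / (p - 4)))"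
proof -
 define f where "f s = s powr (p - 2) * C - A - s^2 * b" for s
 define T where "T = max 1 (((A + b) / C) powr (1 / (p - 4)))"
 have T: "T >= 1" by (simp add: T_def)
 have "((A + b) / C) = (((A + b) / C) powr (1 / (p - 4))) powr (p - 4)" using assms by (simp add: powr_powr)
 also have "... <= T powr (p - 4)" using assms by (intro powr_mono2) (auto simp: T_def)
 finally have "A + b <= T powr (p - 4) * C" using assms by (simp add: field_simps)
 then have "T^2 * (A + b) <= T^2 * (T powr (p - 4) * C)" by (intro mult_left_mono) auto
 also have "... = T powr (p - 2) * C" using T powr_add[of T 2 "p - 4"] by (simp add: powr_numeral)
 finally have "T^2 * A + T^2 * b <= T powr (p - 2) * C" by (simp add: distrib_left)
 moreover have "1 * A <= T^2 * A" using T assms by (intro mult_right_mono) (auto simp: one_le_power)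
 ultimately have "f T >= 0" by (simp add: f_def)
 moreover have "f 0 <= 0" using assms by (simp add: f_def)
 moreover have "continuous_on {0..T} (%s. s powr (p - 2))" using assms by (intro continuous_on_powr' continuous_intros) auto
 then have "continuous_on {0..T} f" unfolding f_def
  by (intro continuous_on_diff continuous_on_mult continuous_on_const continuous_on_power continuous_on_id)
 ultimately obtain s where s: "0 <= s" "s <= T" "f s = 0" using IVT'[of f 0 0 T] T by auto
 have s0: "s > 0" using s assms by (cases "s = 0") (auto simp: f_def)
 have e: "s^2 * A + s^4 * b = s powr p * C"
 proof -
  have "s^2 * (A + s^2 * b) = s^2 * (s powr (p - 2) * C)" using s by (simp add: f_def)
  also have "... = s powr p * C" using s0 powr_add[of s 2 "p - 2"] by (simp add: powr_numeral)
  finally show ?thesis by (simp add: power2_eq_square power4_eq_xxxx algebra_simps)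
 qed
 show ?thesis
 proof (rule that[OF s0 e])
  fix K assume "A + b <= K * C"
  then have "(A + b) / C <= K" using assms by (simp add: field_simps)
  then have "((A + b) / C) powr (1 / (p - 4)) <= K powr (1 / (p - 4))" using assms by (intro powr_mono2) auto
  then show "s <= max 1 (K powr (1 / (p - 4)))" using s by (auto simp: T_def)
 qed
qed

lemma X_nontrivial:
 assumes a: "a > 0" and p: "4 < p" "p < 6" and u: "X a u g" and nt: "~ (AL x. u x = 0)" shows "N2 g > 0" "Cp p u > 0"
proof -
 have [measurable]: "BM u" using u by auto
 show "N2 g > 0"
 proof (rule ccontr)
  assume "~ N2 g > 0"
  then have "N2 g = 0" using N2_nonneg[of g] by simp
  then have "(NE x. (u x)^6) <= 0" using Sobolev_X[OF a u] L2v_nsq[OF X_L2v[OF u]] by simp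
  then have "AL x. ennreal ((u x)^6) = 0" by (subst nn_integral_0_iff_AE[symmetric]) auto
  moreover have "u x = 0" if "ennreal ((u x)^6) = 0" for x using that by (simp add: ennreal_eq_0_iff)
  ultimately show False using nt by auto
 qed
 show "Cp p u > 0"
 proof (rule ccontr)
  assume "~ Cp p u > 0"
  then have "Cp p u = 0" using Cp_nonneg[of p u] by simp
  then have "(NE x. \<bar>u x\<bar> powr p) = 0" using X_Lp(2)[OF a p u] by simp
  then have "AL x. ennreal (\<bar>u x\<bar> powr p) = 0" by (subst nn_integral_0_iff_AE[symmetric]) auto
  moreover have "u x = 0" if "ennreal (\<bar>u x\<bar> powr p) = 0" for x using that by (simp add: ennreal_eq_0_iff)
  ultimately show False using nt by auto
 qed
qed

lemma Cp_pos_nontrivial: "Cp p u > 0 ==> BM u ==> ~ (AL x. u x = 0)"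
proof
 assume C: "Cp p u > 0" and [measurable]: "BM u" and ae: "AL x. u x = 0"
 have "Cp p u = (\<integral>x. 0 \<partial>(lborel::R3 measure))" unfolding Cp_def using ae by (intro integral_cong_AE) auto
 then show False using C by simp
qed

lemma Bf_scale: "Bf a (%x. c * u x) = c^4 * Bf a u"
proof -
 have "kernel a (fst z - snd z) * ((c * u (fst z))^2 * (c * u (snd z))^2) = c^4 * (kernel a (fst z - snd z) * ((u (fst z))^2 * (u (snd z))^2))" for z
  by (simp add: power2_eq_square power4_eq_xxxx)
 then show ?thesis unfolding Bf_def Dk_def by (simp only: integral_mult_right_zero)
qed

lemma N2_scale: "N2 (%x. c *\<^sub>R g x) = c^2 * N2 g"
 unfolding N2_def by (simp add: power_mult_distrib)

text \<open>\<open>S\<close> is the class in which one minimizes: all pairs, or the radial ones. The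
  two cases differ only in \<open>S_nv\<close>, by which mass can be brought to a fixed ball about
  the origin without changing the three terms of the energy: by a translation in the first case,
  with no change of the function in the second.\<close>

locale variational =
 fixes a q p :: real and S :: "(R3 => real) => (R3 => R3) => bool"
 assumes a: "a > 0" and q: "q ~= 0" and p: "4 < p" "p < 6" and S_X: "S u g ==> X a u g"
  and S_add: "S u g ==> S v h ==> S (%x. u x + c * v x) (%x. g x + c *\<^sub>R h x)"
  and S_lim: "(!!n. S (un n) (gn n)) ==> AL x. (%n. un n x) ---> U x ==> X a U G ==> S U G"
  and S_ex: "EX u g. S u g & ~ (AL x. u x = 0)"
  and S_nv: "c > 0 ==> M >= 0 ==> EX rh de. de > 0 & (ALL u g. S u g --> N2 g <= M --> Bf a u <= M --> Cp p u >= c -->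
   (EX u' g'. S u' g' & N2 g' = N2 g & Bf a u' = Bf a u & Cp p u' = Cp p u & bm (sq u') 0 rh >= ennreal de))"
begin

definition E :: "(R3 => real) => (R3 => R3) => real" where
 "E u g = N2 g / 2 + q^2 * Bf a u / 4 - Cp p u / p"

definition Neh :: "(R3 => real) => (R3 => R3) => bool" where
 "Neh u g \<longleftrightarrow> S u g & Cp p u > 0 & N2 g + q^2 * Bf a u = Cp p u"

lemma Q: "q^2 > 0" using q by simp

lemma S_scale: "S u g ==> S (%x. c * u x) (%x. c *\<^sub>R g x)"
 using S_add[of u g u g "c - 1"] by (simp add: algebra_simps)

lemma S_Cp_pos: "S u g ==> Cp p u > 0 ==> N2 g > 0"
proof -
 assume u: "S u g" "Cp p u > 0"
 have "BM u" using S_X[OF u(1)] by auto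
 then show ?thesis using X_nontrivial(1)[OF a p S_X[OF u(1)]] Cp_pos_nontrivial[OF u(2)] by blast
qed

lemma S_Bf: "S u g ==> Bf a u >= 0" using X_Bf(2)[OF a S_X] .

lemma E_scale: "s >= 0 ==> E (%x. s * u x) (%x. s *\<^sub>R g x) = s^2 * N2 g / 2 + s^4 * (q^2 * Bf a u) / 4 - s powr p * Cp p u / p"
 by (simp add: E_def N2_scale Bf_scale Cp_scale algebra_simps)

lemma Nehari_projection:
 assumes u: "S u g" and C: "Cp p u > 0"
 obtains s where "s > 0" "Neh (%x. s * u x) (%x. s *\<^sub>R g x)"
  "!!K. N2 g + q^2 * Bf a u <= K * Cp p u ==> s <= max 1 (K powr (1 / (p - 4)))"
proof -
 obtain s where s: "s > 0" "s^2 * N2 g + s^4 * (q^2 * Bf a u) = s powr p * Cp p u"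
  "!!K. N2 g + q^2 * Bf a u <= K * Cp p u ==> s <= max 1 (K powr (1 / (p - 4)))"
  using Nehari_scale[OF S_Cp_pos[OF u C] _ C p(1), of "q^2 * Bf a u"] S_Bf[OF u] by auto
 have "Neh (%x. s * u x) (%x. s *\<^sub>R g x)"
  using s(1,2) C S_scale[OF u, of s] by (simp add: Neh_def N2_scale Bf_scale Cp_scale algebra_simps)
 then show ?thesis using that s by blast
qed

lemma E_Nehari: "Neh u g ==> E u g = (1/2 - 1/p) * N2 g + (1/4 - 1/p) * (q^2 * Bf a u)"
proof -
 assume "Neh u g"
 then have "Cp p u = N2 g + q^2 * Bf a u" by (simp add: Neh_def)
 then show ?thesis using p by (simp add: E_def field_simps)
qed

lemma coef: "1/2 - 1/p > 0" "1/4 - 1/p > 0" using p by (auto simp: field_simps)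

lemma Nehari_parts:
 assumes "Neh u g" shows "0 <= (1/2 - 1/p) * N2 g" "0 <= (1/4 - 1/p) * (q^2 * Bf a u)"
  "(1/2 - 1/p) * N2 g <= E u g" "(1/4 - 1/p) * (q^2 * Bf a u) <= E u g"
proof -
 have "Bf a u >= 0" using assms S_Bf by (auto simp: Neh_def)
 then show "0 <= (1/2 - 1/p) * N2 g" "0 <= (1/4 - 1/p) * (q^2 * Bf a u)"
  using coef N2_nonneg[of g] by (auto intro!: mult_nonneg_nonneg simp del: diff_ge_0_iff_ge)
 then show "(1/2 - 1/p) * N2 g <= E u g" "(1/4 - 1/p) * (q^2 * Bf a u) <= E u g"
  unfolding E_Nehari[OF assms] by simp_all
qed

text \<open>Suppose C = Cp p u is below 1. Scaling by s with s^4 = sg / C brings the Dirichlet and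
  the V-term below 1, by the constraint and the choice sg = min(1, q^2). Then
  \<open>Lp_bounded\<close> bounds s^p C = s^(p-4) sg; as p > 4 this bounds s, that is, C from
  below.\<close>

lemma Nehari_lower: "EX c>0. ALL u g. Neh u g --> Cp p u >= c"
proof -
 obtain K where K: "K >= 0" "ALL u g. X a u g --> W a (sq u) (sq u) <= ennreal 1 --> (NI x. nsq g x) <= ennreal 1 -->
  (NE x. \<bar>u x\<bar> powr p) <= ennreal K" using Lp_bounded[OF a p, of 1] by auto
 define sg where "sg = min 1 (q^2)"
 have sg: "sg > 0" "sg <= 1" "sg <= q^2" using Q by (auto simp: sg_def)
 define T where "T = ((K + 1) / sg) powr (1 / (p - 4))"
 have T: "T > 0" using K sg by (simp add: T_def)
 have "Cp p u >= min 1 (sg / T^4)" if N: "Neh u g" for u g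
 proof (rule ccontr)
  assume "~ Cp p u >= min 1 (sg / T^4)"
  then have C: "Cp p u < 1" "Cp p u < sg / T^4" by auto
  have u: "S u g" "Cp p u > 0" "N2 g + q^2 * Bf a u = Cp p u" using N by (auto simp: Neh_def)
  define s where "s = (sg / Cp p u) powr (1/4)"
  have s: "s > 0" using sg u by (simp add: s_def)
  have s4: "s^4 = sg / Cp p u" using sg u by (simp add: s_def powr_powr flip: powr_numeral)
  have "N2 g <= Cp p u" "q^2 * Bf a u <= Cp p u" using u N2_nonneg[of g] S_Bf[OF u(1)] Q mult_nonneg_nonneg[of "q^2" "Bf a u"] by linarith+
  note AB = this
  have "(s^2 * N2 g)^2 <= (s^2 * Cp p u)^2" using AB N2_nonneg[of g] by (intro power_mono mult_left_mono) auto
  also have "... = s^4 * (Cp p u)^2" by (simp add: power2_eq_square power4_eq_xxxx)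
  also have "... = sg * Cp p u" using s4 u by (simp add: power2_eq_square)
  also have "... <= 1^2" using sg C u mult_mono[of sg 1 "Cp p u" 1] by simp
  finally have A1: "s^2 * N2 g <= 1" by (rule power2_le_imp_le) simp
  have "s^4 * (q^2 * Bf a u) <= s^4 * Cp p u" using AB by (intro mult_left_mono) auto
  also have "... = sg" using s4 u by simp
  also have "... <= q^2" by (rule sg)
  finally have "q^2 * (s^4 * Bf a u) <= q^2 * 1" by (simp add: mult.left_commute)
  then have B1: "s^4 * Bf a u <= 1" using Q by simp
  have Xs: "X a (%x. s * u x) (%x. s *\<^sub>R g x)" by (rule S_X[OF S_scale[OF u(1)]])
  have "W a (sq (%x. s * u x)) (sq (%x. s * u x)) <= ennreal 1"
   unfolding X_Bf(1)[OF a Xs] Bf_scale using B1 by (rule ennreal_leI)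
  moreover have "(NI x. nsq (%x. s *\<^sub>R g x) x) <= ennreal 1"
   unfolding L2v_nsq[OF X_L2v[OF Xs]] N2_scale using A1 by (rule ennreal_leI)
  ultimately have "ennreal (Cp p (%x. s * u x)) <= ennreal K" using K(2) Xs X_Lp(2)[OF a p Xs] by metis
  then have "s powr p * Cp p u <= K" using K(1) Cp_scale[of s p u] s by (simp add: ennreal_le_iff)
  moreover have "s powr p * Cp p u = s powr (p - 4) * sg"
  proof -
   have "s powr p = s powr (p - 4) * s^4" using s powr_add[of s "p - 4" 4] by (simp add: powr_numeral)
   then show ?thesis using s4 u by simp
  qed
  ultimately have "s powr (p - 4) < (K + 1) / sg" using sg by (simp add: field_simps)
  then have "(s powr (p - 4)) powr (1 / (p - 4)) < T" unfolding T_def using p by (intro powr_less_mono2) auto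
  then have "s < T" using s p by (simp add: powr_powr)
  then have "s^4 < T^4" using s by (intro power_strict_mono) auto
  then have "sg < T^4 * Cp p u" using s4 u by (simp add: field_simps)
  moreover have "T^4 * Cp p u < sg" using C(2) T by (simp add: field_simps)
  ultimately show False by simp
 qed
 then show ?thesis using sg T by (intro exI[of _ "min 1 (sg / T^4)"]) auto
qed

lemma Nehari_nonempty: "EX u g. Neh u g"
proof -
 obtain u g where u: "S u g" "~ (AL x. u x = 0)" using S_ex by auto
 have "Cp p u > 0" by (rule X_nontrivial(2)[OF a p S_X[OF u(1)] u(2)])
 then show ?thesis using Nehari_projection[OF u(1)] by metis
qed

text \<open>The derivative of the energy is shown to be nonnegative in a direction \<open>v\<close> by projecting \<open>u n + t n * v\<close>
 back to the Nehari set, with \<open>(t n)^2\<close> of the order of the error in the minimisation.\<close>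

lemma derivative_nonneg:
 assumes N: "!!n. Neh (u n) (g n)" and low: "!!u g. Neh u g ==> m <= E u g" and E: "!!n. E (u n) (g n) <= m + 1 / real (Suc n)"
  and M: "!!n. N2 (g n) <= M" "!!n. Bf a (u n) <= M" and c: "c > 0" "!!n. Cp p (u n) >= c" and v: "S v h"
  and lim: "(%n. ip (g n) h) ---> i" "(%n. Dk a (%x. u n x * v x) (%x. (u n x)^2)) ---> d" "(%n. Cp' p (u n) v) ---> k"
 shows "i + q^2 * d - k >= 0"
proof -
 define t where "t n = sqrt (1 / real (Suc n))" for n
 have t0: "t n > 0" "t n <= 1" "(t n)^2 = 1 / real (Suc n)" for n by (auto simp: t_def)
 have tl: "t ---> 0" unfolding t_def using tendsto_real_sqrt[OF LIMSEQ_inverse_real_of_nat] by (simp add: inverse_eq_divide)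
 have Su: "S (u n) (g n)" for n using N by (auto simp: Neh_def)
 define w where "w n x = u n x + t n * v x" for n x
 define wg where "wg n x = g n x + t n *\<^sub>R h x" for n x
 have Sw: "S (w n) (wg n)" for n unfolding w_def wg_def by (rule S_add[OF Su v])
 define ii dd kk where "ii n = ip (g n) h" and "dd n = Dk a (%x. u n x * v x) (%x. (u n x)^2)" and "kk n = Cp' p (u n) v" for n
 have lim': "ii ---> i" "dd ---> d" "kk ---> k" using lim by (auto simp: ii_def[abs_def] dd_def[abs_def] kk_def[abs_def])
 obtain Kd where Kd: "!!n. \<bar>dd n\<bar> <= Kd" using convergent_imp_Bseq[OF convergentI[OF lim'(2)]] unfolding Bseq_def by auto
 define K2 where "K2 = 6 * ((1 + 2 * enn2real CW) * (M + Bf a v))"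
 have L: "L2v (g n)" "L2v h" for n using Su v S_X X_L2v by blast+
 have A': "N2 (wg n) = N2 (g n) + 2 * t n * ii n + (t n)^2 * N2 h" for n
  unfolding wg_def ii_def by (rule N2_add[OF L])
 have A'b: "N2 (wg n) <= 2 * M + 2 * N2 h" for n
 proof -
  have "0 <= N2 (%x. g n x + (- t n) *\<^sub>R h x)" by (rule N2_nonneg)
  then have "0 <= N2 (g n) - 2 * t n * ii n + (t n)^2 * N2 h" using N2_add[OF L, of n "- t n"] by (simp add: ii_def)
  moreover have "(t n)^2 * N2 h <= 1 * N2 h" using t0[of n] N2_nonneg by (intro mult_right_mono) auto
  ultimately show ?thesis using A'[of n] M(1)[of n] by simp
 qed
 have B': "Bf a (w n) <= Bf a (u n) + t n * (4 * dd n) + (t n)^2 * K2" for n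
 proof -
  have "Bf a (w n) <= Bf a (u n) + t n * (4 * dd n) + (t n)^2 * (6 * ((1 + 2 * enn2real CW) * (Bf a (u n) + Bf a v)))"
   using t0[of n] unfolding w_def dd_def by (intro Bf_expansion[OF a S_X[OF Su] S_X[OF v]]) auto
  also have "... <= Bf a (u n) + t n * (4 * dd n) + (t n)^2 * K2"
   unfolding K2_def using M(2)[of n] by (intro add_left_mono mult_left_mono add_right_mono) auto
  finally show ?thesis .
 qed
 have K2: "K2 >= 0" unfolding K2_def using S_Bf[OF v] S_Bf[OF Su[of 0]] M(2)[of 0] by simp
 have B'b: "Bf a (w n) <= M + 4 * Kd + K2" for n
 proof -
  have "t n * (4 * dd n) <= t n * (4 * Kd)" using t0[of n] Kd[of n] by (intro mult_left_mono) auto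
  also have "... <= 1 * (4 * Kd)" using t0[of n] Kd[of n] by (intro mult_right_mono) auto
  finally have "t n * (4 * dd n) <= 4 * Kd" by simp
  moreover have "(t n)^2 * K2 <= 1 * K2" using t0[of n] K2 by (intro mult_right_mono) auto
  ultimately show ?thesis using B'[of n] M(2)[of n] by linarith
 qed
 have C': "Cp p (w n) >= Cp p (u n) + t n * (p * kk n)" for n
  unfolding w_def kk_def by (rule Cp_tangent[OF a p S_X[OF Su] S_X[OF v]])
 have "(%n. t n * (p * kk n)) ---> 0 * (p * k)" by (intro tendsto_intros tl lim')
 then have "eventually (%n. t n * (p * kk n) > - (c/2)) sequentially" using c by (intro order_tendstoD(1)) auto
 then obtain n0 where n0: "!!n. n >= n0 ==> t n * (p * kk n) > - (c/2)" by (auto simp: eventually_sequentially)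
 have C'c: "Cp p (w n) >= c / 2" if "n >= n0" for n using C'[of n] n0[OF that] c(2)[of n] by linarith
 \<comment> \<open>A common bound for all projection factors: the perturbed Dirichlet and V-terms
   are bounded and the perturbed L^p term is at least c/2.\<close>
 define Kb where "Kb = max 1 ((((2 * M + 2 * N2 h) + q^2 * (M + 4 * Kd + K2)) / (c/2)) powr (1 / (p - 4)))"
 have "EX s. n >= n0 --> s > 0 & s <= Kb & Neh (%x. s * w n x) (%x. s *\<^sub>R wg n x)" for n
 proof (cases "n >= n0")
  case True
  then have C: "Cp p (w n) >= c/2" "Cp p (w n) > 0" using C'c[of n] c by linarith+
  define H where "H = (2 * M + 2 * N2 h) + q^2 * (M + 4 * Kd + K2)"
  have H: "N2 (wg n) + q^2 * Bf a (w n) <= H" unfolding H_def using A'b B'b by (intro add_mono mult_left_mono) auto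
  have "0 <= q^2 * Bf a (w n)" using S_Bf[OF Sw[of n]] by simp
  then have H0: "0 <= H" using H N2_nonneg[of "wg n"] by linarith
  have "H = H / (c/2) * (c/2)" using c by simp
  also have "... <= H / (c/2) * Cp p (w n)" using H0 c C by (intro mult_left_mono) auto
  finally have "N2 (wg n) + q^2 * Bf a (w n) <= H / (c/2) * Cp p (w n)" using H by linarith
  then show ?thesis using Nehari_projection[OF Sw C(2)] unfolding Kb_def H_def[symmetric] by metis
 qed auto
 then obtain s where s: "!!n. n >= n0 ==> s n > 0 & s n <= Kb & Neh (%x. s n * w n x) (%x. s n *\<^sub>R wg n x)" by metis
 \<comment> \<open>The summand 1 pays for the minimization error, which equals
   \<open>(t n)^2\<close>; the others bound the quadratic remainders for projection factors up to
   \<open>Kb\<close>.\<close>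
 define K3 where "K3 = 1 + Kb^2 * N2 h / 2 + Kb^4 * (q^2 * K2) / 4"
 define F where "F n = (s n)^2 * ii n + (s n)^4 * (q^2 * dd n) - s n powr p * kk n" for n
 \<comment> \<open>The minimum is compared with the energy at the projected point. The unperturbed
   fibre map contributes the loss through \<open>gap\<close>, the first-order terms collect to
   \<open>t n * F n\<close>, and the rest is of order \<open>(t n)^2\<close>. Dropping the
   nonnegative gap bounds \<open>F n\<close> from below; keeping it forces the projection factors
   towards 1.\<close>
 have main: "c * gap p (s n) <= t n * F n + (t n)^2 * K3" if n: "n >= n0" for n
 proof -
  have sn: "s n > 0" "s n <= Kb" "Neh (%x. s n * w n x) (%x. s n *\<^sub>R wg n x)" using s[OF n] by auto
  define sg where "sg = s n"
  define ta where "ta = t n"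
  note sg = sn[folded sg_def]
  have "m <= E (%x. sg * w n x) (%x. sg *\<^sub>R wg n x)" by (rule low[OF sg(3)])
  also have "... = sg^2 * N2 (wg n) / 2 + sg^4 * (q^2 * Bf a (w n)) / 4 - sg powr p * Cp p (w n) / p" using sg by (intro E_scale) auto
  also have "... <= sg^2 * (N2 (g n) + 2 * ta * ii n + ta^2 * N2 h) / 2 + sg^4 * (q^2 * (Bf a (u n) + ta * (4 * dd n) + ta^2 * K2)) / 4
    - sg powr p * (Cp p (u n) + ta * (p * kk n)) / p" using A'[of n] B'[of n] C'[of n] p unfolding ta_def
   by (intro diff_mono add_mono divide_right_mono mult_left_mono) auto
  also have "... = (sg^2 * N2 (g n) / 2 + sg^4 * (q^2 * Bf a (u n)) / 4 - sg powr p * Cp p (u n) / p)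
    + ta * F n + ta^2 * (sg^2 * N2 h / 2 + sg^4 * (q^2 * K2) / 4)"
   using p by (simp add: F_def sg_def[symmetric] field_simps)
  also have "sg^2 * N2 (g n) / 2 + sg^4 * (q^2 * Bf a (u n)) / 4 - sg powr p * Cp p (u n) / p
   <= N2 (g n) / 2 + q^2 * Bf a (u n) / 4 - Cp p (u n) / p - Cp p (u n) * gap p sg"
   using N[of n] p by (intro Nehari_gap N2_nonneg) (auto simp: Neh_def)
  also have "N2 (g n) / 2 + q^2 * Bf a (u n) / 4 - Cp p (u n) / p = E (u n) (g n)" by (simp add: E_def)
  also have "E (u n) (g n) <= m + ta^2" using E[of n] t0(3)[of n] by (simp add: ta_def)
  also have "sg^2 * N2 h / 2 + sg^4 * (q^2 * K2) / 4 <= Kb^2 * N2 h / 2 + Kb^4 * (q^2 * K2) / 4"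
   using sg K2 N2_nonneg[of h] Q by (intro add_mono divide_right_mono mult_right_mono power_mono) auto
  finally have "m <= m + ta^2 - Cp p (u n) * gap p sg + ta * F n + ta^2 * (Kb^2 * N2 h / 2 + Kb^4 * (q^2 * K2) / 4)"
   by (simp add: mult_left_mono)
  moreover have "c * gap p sg <= Cp p (u n) * gap p sg" using c gap_nonneg[of sg p] sg p by (intro mult_right_mono) auto
  ultimately show ?thesis unfolding sg_def[symmetric] ta_def[symmetric] K3_def by (simp add: algebra_simps)
 qed
 have Flow: "F n >= - (t n * K3)" if n: "n >= n0" for n
 proof -
  have "0 <= c * gap p (s n)" using c gap_nonneg[of "s n" p] s[OF n] p by simp
  then have "0 <= t n * (F n + t n * K3)" using main[OF n] by (simp add: power2_eq_square algebra_simps)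
  then have "0 <= F n + t n * K3" using t0(1)[of n] by (simp add: zero_le_mult_iff)
  then show ?thesis by simp
 qed
 \<comment> \<open>A convergent subsequence of the projection factors is enough: its limit
   \<open>l\<close> satisfies \<open>gap p l <= 0\<close>, hence is 1, and along it \<open>F\<close>
   tends to the derivative in question.\<close>
 have "ALL n. s (n + n0) \<in> {0..Kb}" using s by (auto intro!: less_imp_le)
 then obtain l r where r: "l \<in> {0..Kb}" "strict_mono (r::nat=>nat)" "((%n. s (n + n0)) \<circ> r) ---> l"
  by (rule seq_compactE[OF compact_imp_seq_compact[OF compact_Icc]])
 define R where "R n = r n + n0" for n
 have R: "strict_mono R" "R n >= n0" for n using r(2) by (auto simp: R_def strict_mono_def)
 have sl: "(%n. s (R n)) ---> l" using r(3) by (simp add: o_def R_def)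
 have l0: "l >= 0" using r by simp
 note sub = LIMSEQ_subseq_LIMSEQ[OF _ R(1), unfolded o_def]
 have sp: "(%n. s (R n) powr p) ---> l powr p"
  using p s[OF R(2)] by (intro tendsto_powr' sl tendsto_const) (auto intro!: always_eventually less_imp_le)
 have Fl: "(%n. F (R n)) ---> l^2 * i + l^4 * (q^2 * d) - l powr p * k"
  unfolding F_def by (intro tendsto_intros sl sp sub[OF lim'(1)] sub[OF lim'(2)] sub[OF lim'(3)])
 have "(%n. t (R n) * F (R n) + (t (R n))^2 * K3) ---> 0 * (l^2 * i + l^4 * (q^2 * d) - l powr p * k) + 0^2 * K3"
  by (intro tendsto_intros Fl sub[OF tl])
 then have "(%n. t (R n) * F (R n) + (t (R n))^2 * K3) ---> 0" by simp
 moreover have "(%n. c * gap p (s (R n))) ---> c * gap p l"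
  unfolding gap_def using p by (intro tendsto_intros sl sp) auto
 ultimately have "c * gap p l <= 0" using main[OF R(2)] by (intro LIMSEQ_le) auto
 then have "l = 1" using gap_pos[OF l0 _ p(1)] c by (force simp: mult_le_0_iff)
 then have "(%n. F (R n)) ---> i + q^2 * d - k" using Fl by simp
 moreover have "(%n. - (t (R n) * K3)) ---> - (0 * K3)" by (intro tendsto_intros sub[OF tl])
 ultimately show ?thesis using Flow[OF R(2)] by (intro LIMSEQ_le[of "%n. - (t (R n) * K3)" 0]) auto
qed

theorem minimizer_exists:
 obtains U G where "S U G" "~ (AL x. U x = 0)"
  "!!v h. S v h ==> ip G h + q^2 * Dk a (%x. U x * v x) (%x. (U x)^2) = Cp' p U v"
  "!!u g. S u g ==> ~ (AL x. u x = 0) ==> N2 g + q^2 * Bf a u = Cp p u ==> E U G <= E u g"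
proof -
 define NS where "NS = {E u g |u g. Neh u g}"
 define m where "m = Inf NS"
 have NS0: "NS ~= {}" using Nehari_nonempty by (auto simp: NS_def)
 have E0: "0 <= E u g" if "Neh u g" for u g using Nehari_parts(1,3)[OF that] by linarith
 have bdd: "bdd_below NS" by (rule bdd_belowI[of _ 0]) (auto simp: NS_def E0)
 have low: "m <= E u g" if "Neh u g" for u g unfolding m_def using that by (intro cInf_lower bdd) (auto simp: NS_def)
 obtain c where c: "c > 0" "!!u g. Neh u g ==> Cp p u >= c" using Nehari_lower by auto
 have m0: "m >= 0" unfolding m_def by (rule cInf_greatest[OF NS0]) (auto simp: NS_def E0)
 define M where "M = max ((m + 1) / (1/2 - 1/p)) ((m + 1) / ((1/4 - 1/p) * q^2))"
 have M0: "M >= 0" using m0 coef(1) by (simp add: M_def le_max_iff_disj)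
 obtain rh de where nv: "de > 0" "!!u g. S u g ==> N2 g <= M ==> Bf a u <= M ==> Cp p u >= c ==>
   EX u' g'. S u' g' & N2 g' = N2 g & Bf a u' = Bf a u & Cp p u' = Cp p u & bm (sq u') 0 rh >= ennreal de"
  using S_nv[OF c(1) M0] by blast
 have bds: "N2 g <= M" "Bf a u <= M" if "Neh u g" "E u g <= m + 1" for u g
 proof -
  have "(1/2 - 1/p) * N2 g <= m + 1" using Nehari_parts(3)[OF that(1)] that(2) by linarith
  then have "N2 g <= (m + 1) / (1/2 - 1/p)" using coef(1) by (simp add: pos_le_divide_eq mult.commute)
  then show "N2 g <= M" by (simp add: M_def)
  have "((1/4 - 1/p) * q^2) * Bf a u <= m + 1" using Nehari_parts(4)[OF that(1)] that(2) by (simp add: mult.assoc)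
  then have "Bf a u <= (m + 1) / ((1/4 - 1/p) * q^2)" using mult_pos_pos[OF coef(2) Q] by (simp add: pos_le_divide_eq mult.commute)
  then show "Bf a u <= M" by (simp add: M_def)
 qed
 \<comment> \<open>By \<open>S_nv\<close> a nearly minimal element is replaced by one with mass near
   the origin; as the three terms are unchanged, it remains on the Nehari set with the same
   energy.\<close>
 have "EX u g. Neh u g & E u g <= m + 1 / real (Suc n) & bm (sq u) 0 rh >= ennreal de" for n
 proof -
  have "Inf NS < m + 1 / real (Suc n)" by (simp add: m_def)
  then obtain u g where u: "Neh u g" "E u g < m + 1 / real (Suc n)"
   using cInf_less_iff[OF NS0 bdd] by (auto simp: NS_def)
  have "1 / real (Suc n) <= 1" by simp
  then have "E u g <= m + 1" using u(2) by linarith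
  then obtain u' g' where "S u' g'" "N2 g' = N2 g" "Bf a u' = Bf a u" "Cp p u' = Cp p u" "bm (sq u') 0 rh >= ennreal de"
   using nv(2)[of u g] bds[OF u(1)] c(2)[OF u(1)] u(1) by (auto simp: Neh_def)
  then show ?thesis using u by (intro exI[of _ u'] exI[of _ g']) (auto simp: Neh_def E_def)
 qed
 then obtain u g where u: "!!n. Neh (u n) (g n)" "!!n. E (u n) (g n) <= m + 1 / real (Suc n)" "!!n. bm (sq (u n)) 0 rh >= ennreal de"
  by metis
 have Su: "S (u n) (g n)" for n using u(1) by (auto simp: Neh_def)
 have E1: "E (u n) (g n) <= m + 1" for n
 proof -
  have "1 / real (Suc n) <= 1" by simp
  then show ?thesis using u(2)[of n] by linarith
 qed
 note bd = bds[OF u(1) E1]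
 have WM: "W a (sq (u n)) (sq (u n)) <= ennreal M" for n
  unfolding X_Bf(1)[OF a S_X[OF Su]] by (rule ennreal_leI[OF bd(2)])
 obtain r U G where r: "strict_mono (r::nat=>nat)" and XU: "X a U G" and ae: "AL x. (%n. u (r n) x) ---> U x"
  and loc: "!!z R. (%n. bm (sq (%x. u (r n) x - U x)) z R) ---> 0"
  and wk: "!!h. L2v h ==> (%n. ip (g (r n)) h) ---> ip G h"
  by (rule weak_compactness[of a u g M, OF a S_X[OF Su] bd(1) WM M0]) blast
 have SU: "S U G" by (rule S_lim[OF Su ae XU])
 have [measurable]: "BM (u n)" "BM U" for n using S_X[OF Su[of n]] XU by auto
 \<comment> \<open>The mass in the ball of radius \<open>rh\<close> survives the limit because
   convergence in L^2 on balls is strong.\<close>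
 have nt: "~ (AL x. U x = 0)"
 proof
  assume "AL x. U x = 0"
  then have "bm (sq (%x. u (r n) x - U x)) 0 rh = bm (sq (u (r n))) 0 rh" for n
   unfolding bm_def by (intro nn_integral_cong_AE) (auto simp: sq_def elim!: eventually_mono)
  then have "(%n. bm (sq (u (r n))) 0 rh) ---> 0" using loc[of 0 rh] by simp
  then have "ennreal de <= 0" by (rule LIMSEQ_le_const) (use u(3) in auto)
  then show False using nv(1) by simp
 qed
 have rn: "E (u (r n)) (g (r n)) <= m + 1 / real (Suc n)" for n
 proof -
  have "1 / real (Suc (r n)) <= 1 / real (Suc n)" using seq_suble[OF r, of n] by (intro divide_left_mono) auto
  then show ?thesis using u(2)[of "r n"] by linarith
 qed
 have CM: "Cp p (u n) <= M + q^2 * M" for n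
  using u(1)[of n] bd[of n] mult_left_mono[OF bd(2)[of n], of "q^2"] by (simp add: Neh_def)
 have ge: "ip G h + q^2 * Dk a (%x. U x * v x) (%x. (U x)^2) - Cp' p U v >= 0" if v: "S v h" for v h
  using derivative_nonneg[OF u(1) low rn bd(1) bd(2) c(1) c(2)[OF u(1)] v wk[OF X_L2v[OF S_X[OF v]]]
   Dk_tendsto[OF a S_X[OF Su] XU S_X[OF v] WM M0 ae loc]
   Cp'_tendsto[OF a p S_X[OF Su] XU S_X[OF v] CM _ ae]] M0 by simp
 have crit: "ip G h + q^2 * Dk a (%x. U x * v x) (%x. (U x)^2) = Cp' p U v" if v: "S v h" for v h
 proof -
  have n: "ip G (%x. (-1) *\<^sub>R h x) = - ip G h" "Dk a (%x. U x * (-1 * v x)) (%x. (U x)^2) = - Dk a (%x. U x * v x) (%x. (U x)^2)"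
   by (simp_all add: ip_def Dk_def)
  have "ip G (%x. (-1) *\<^sub>R h x) + q^2 * Dk a (%x. U x * (-1 * v x)) (%x. (U x)^2) - Cp' p U (%x. -1 * v x) >= 0"
   by (rule ge[OF S_scale[OF v]])
  then show ?thesis using ge[OF v] Cp'_uminus[of p U v] unfolding n by simp
 qed
 \<comment> \<open>Criticality tested with \<open>U\<close> itself is the Nehari identity.\<close>
 have NU: "Neh U G" using crit[OF SU] X_nontrivial(2)[OF a p XU nt] SU
  by (simp add: Neh_def Cp'_self N2_ip Bf_def power2_eq_square[of "U _"])
 \<comment> \<open>On the Nehari set the energy is a positive combination of two terms. The
   Dirichlet term is at least 2 ip(g_n, G) - N2 G, which converges, so the V-term lies below the
   convergent sequence \<open>y\<close> and Fatou's lemma is applied to it alone.\<close>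
 have Em: "E U G <= m"
 proof -
  define al where "al = 1/2 - 1/p"
  define bt where "bt = (1/4 - 1/p) * q^2"
  have albt: "al > 0" "bt > 0" using coef Q by (auto simp: al_def bt_def)
  define y where "y n = (m + 1 / real (Suc n) - al * (2 * ip (g (r n)) G - N2 G)) / bt" for n
  have "y ---> (m + 0 - al * (2 * ip G G - N2 G)) / bt" unfolding y_def using albt LIMSEQ_inverse_real_of_nat
   by (intro tendsto_intros wk X_L2v[OF XU]) (auto simp: inverse_eq_divide)
  then have yl: "y ---> (m - al * N2 G) / bt" by (simp add: N2_ip)
  have By: "Bf a (u (r n)) <= y n" for n
  proof -
   have "0 <= N2 (%x. g (r n) x + (-1) *\<^sub>R G x)" by (rule N2_nonneg)
   then have "2 * ip (g (r n)) G - N2 G <= N2 (g (r n))"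
    using N2_add[OF X_L2v[OF S_X[OF Su]] X_L2v[OF XU], of "r n" "-1"] by simp
   then have "al * (2 * ip (g (r n)) G - N2 G) <= al * N2 (g (r n))" using albt by (intro mult_left_mono) auto
   moreover have "al * N2 (g (r n)) + bt * Bf a (u (r n)) <= m + 1 / real (Suc n)"
    using rn[of n] unfolding E_Nehari[OF u(1)] by (simp add: al_def bt_def mult.assoc)
   ultimately have "bt * Bf a (u (r n)) <= m + 1 / real (Suc n) - al * (2 * ip (g (r n)) G - N2 G)" by linarith
   then show ?thesis using albt by (simp add: y_def pos_le_divide_eq mult.commute)
  qed
  have "ennreal (Bf a U) = W a (sq U) (sq U)" by (rule X_Bf(1)[OF a XU, symmetric])
  also have "... <= liminf (%n. W a (sq (u (r n))) (sq (u (r n))))"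
   unfolding sq_def[abs_def] by (rule W_Fatou[OF _ _ ae]) measurable
  also have "... <= liminf (%n. ennreal (y n))"
   using By by (intro Liminf_mono always_eventually allI) (simp add: X_Bf(1)[OF a S_X[OF Su]] ennreal_leI)
  also have "... = ennreal ((m - al * N2 G) / bt)" using yl by (intro lim_imp_Liminf) (auto intro!: tendsto_ennrealI)
  finally have "Bf a U <= (m - al * N2 G) / bt"
  proof -
   assume *: "ennreal (Bf a U) <= ennreal ((m - al * N2 G) / bt)"
   have "(m - al * N2 G) / bt >= 0" by (rule LIMSEQ_le_const[OF yl]) (blast intro: order_trans[OF S_Bf[OF Su] By])
   then show ?thesis using * by (simp add: ennreal_le_iff)
  qed
  then have "al * N2 G + bt * Bf a U <= m" using albt by (simp add: pos_le_divide_eq mult.commute)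
  then show ?thesis unfolding E_Nehari[OF NU] by (simp add: al_def bt_def mult.assoc)
 qed
 have low': "m <= E u g" if "S u g" "~ (AL x. u x = 0)" "N2 g + q^2 * Bf a u = Cp p u" for u g
  using that X_nontrivial(2)[OF a p S_X[OF that(1)] that(2)] by (intro low) (simp add: Neh_def)
 show ?thesis by (rule that[OF SU nt crit order_trans[OF Em low']])
qed

end

section \<open>Isometries and nonvanishing\<close>

lemma orthogonal_measurable: "orthogonal_transformation (R::R3=>R3) ==> BM R"
 by (intro borel_measurable_continuous_onI linear_continuous_on)
  (simp add: orthogonal_transformation_linear flip: linear_conv_bounded_linear)

lemma lborel_distr_orthogonal:
 assumes R: "orthogonal_transformation (R::R3=>R3)" shows "distr lborel borel R = lborel"
proof (rule lborel_eqI[symmetric])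
 note [measurable] = orthogonal_measurable[OF R]
 fix l u :: R3 assume lu: "!!b. b \<in> Basis ==> l \<bullet> b <= u \<bullet> b"
 have b: "bij R" by (rule orthogonal_transformation_bij[OF R])
 have i: "orthogonal_transformation (inv R)" by (rule orthogonal_transformation_inv[OF R])
 have e: "R -` box l u = inv R ` box l u" by (rule bij_vimage_eq_inv_image[OF b])
 have m: "inv R ` box l u \<in> sets borel" unfolding e[symmetric] using measurable_sets[of R borel borel "box l u"] by simp
 have "emeasure (distr lborel borel R) (box l u) = emeasure lebesgue (inv R ` box l u)"
  using m by (simp add: emeasure_distr e)
 also have "... = ennreal (measure lebesgue (inv R ` box l u))"
  by (intro emeasure_eq_measure2 measurable_orthogonal_image[OF i]) simp
 also have "measure lebesgue (inv R ` box l u) = measure lebesgue (box l u)"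
  by (rule measure_orthogonal_image[OF i]) simp
 also have "ennreal (measure lebesgue (box l u)) = ennreal (\<Prod>b\<in>Basis. (u - l) \<bullet> b)"
  using lu by (simp add: measure_def emeasure_lborel_box[OF lu] prod_nonneg inner_diff_left)
 finally show "emeasure (distr lborel borel R) (box l u) = ennreal (\<Prod>b\<in>Basis. (u - l) \<bullet> b)" .
qed simp

text \<open>The linear part is carried along because gradients transform by its transpose, see
  \<open>pb\<close>.\<close>

definition iso :: "(R3 => R3) => (R3 => R3) => bool" where
 "iso T R \<longleftrightarrow> orthogonal_transformation R & (EX c. ALL x. T x = c + R x)"

lemma iso_orthogonal: "orthogonal_transformation R ==> iso R R"
 unfolding iso_def by (auto intro: exI[of _ 0])

lemma iso_translation: "iso (%x. c + x) (%x. x)"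
 unfolding iso_def by (auto simp: orthogonal_transformation_def linear_iff)

lemma iso_measurable[measurable_dest]: "iso T R ==> BM T"
proof -
 assume "iso T R"
 then obtain c where R: "orthogonal_transformation R" "T = (%x. c + R x)" by (auto simp: iso_def)
 note [measurable] = orthogonal_measurable[OF R(1)]
 show ?thesis unfolding R(2) by measurable
qed

lemma iso_distr: "iso T R ==> distr lborel borel T = lborel"
proof -
 assume "iso T R"
 then obtain c where R: "orthogonal_transformation R" "T = (+) c \<circ> R" by (auto simp: iso_def fun_eq_iff)
 note [measurable] = orthogonal_measurable[OF R(1)]
 have "distr lborel borel T = distr (distr lborel borel R) borel ((+) c)" unfolding R(2) by (subst distr_distr) auto
 then show ?thesis by (simp add: lborel_distr_orthogonal[OF R(1)] lborel_distr_plus)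
qed

lemma iso_norm: "iso T R ==> norm (T x - T y) = norm (x - y)"
proof -
 assume "iso T R"
 then obtain c where R: "orthogonal_transformation R" "!!x. T x = c + R x" by (auto simp: iso_def)
 have "T x - T y = R (x - y)" using linear_diff[OF orthogonal_transformation_linear[OF R(1)]] by (simp add: R(2))
 then show ?thesis using orthogonal_transformation_norm[OF R(1)] by simp
qed

lemma iso_inverse:
 assumes "iso T R"
 obtains T' R' where "iso T' R'" "!!x. T' (T x) = x"
proof -
 obtain c where R: "orthogonal_transformation R" "!!x. T x = c + R x" using assms by (auto simp: iso_def)
 have i: "orthogonal_transformation (inv R)" by (rule orthogonal_transformation_inv[OF R(1)])
 have "iso (%x. - inv R c + inv R x) (inv R)" using i by (auto simp: iso_def)
 moreover have "- inv R c + inv R (T x) = x" for x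
  using linear_add[OF orthogonal_transformation_linear[OF i]] orthogonal_transformation_inj[OF R(1)] by (simp add: R(2))
 ultimately show ?thesis using that by blast
qed

section \<open>Test functions and weak gradients under isometries\<close>

lemma iso_integral:
 fixes f :: "R3 => real"
 assumes T: "iso T R" and f: "BM f" shows "(LI x. f (T x)) = (LI x. f x)"
 using integral_distr[of T lborel borel f] T f iso_distr[OF T] by simp

lemma Ck_lin: "Ck k f ==> Ck k g ==> Ck k (%x. b * f x + c * g x)"
proof (induction k arbitrary: f g)
 case (Suc k)
 have d: "f differentiable at x" "g differentiable at x" for x using Suc.prems by auto
 have D: "((%x. b * f x + c * g x) has_derivative (%v. b * frechet_derivative f (at x) v + c * frechet_derivative g (at x) v)) (at x)" for x
  using d[of x] by (auto intro!: derivative_eq_intros simp: frechet_derivative_works)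
 have "Ck k (%x. b * frechet_derivative f (at x) (axis i 1) + c * frechet_derivative g (at x) (axis i 1))" for i
  using Suc.prems by (intro Suc.IH) auto
 then show ?case using D by (auto simp: frechet_derivative_at[OF D, symmetric] differentiable_def)
qed (auto intro!: continuous_intros)

lemma frechet_partials:
 assumes "(f::R3=>real) differentiable at x"
 shows "frechet_derivative f (at x) v = (\<Sum>j\<in>UNIV. v $ j * frechet_derivative f (at x) (axis j 1))"
proof -
 have l: "linear (frechet_derivative f (at x))" by (rule linear_frechet_derivative[OF assms])
 have "v = (\<Sum>j\<in>UNIV. v $ j *\<^sub>R axis j 1)" using basis_expansion[of v] by (simp add: scalar_mult_eq_scaleR)
 then have "frechet_derivative f (at x) v = frechet_derivative f (at x) (\<Sum>j\<in>UNIV. v $ j *\<^sub>R axis j 1)" by simp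
 then show ?thesis by (simp add: linear_sum[OF l] linear_scale[OF l])
qed

lemma iso_derivative:
 assumes "iso T R" "(vp::R3=>real) differentiable at (T x)"
 shows "((%x. vp (T x)) has_derivative (%v. frechet_derivative vp (at (T x)) (R v))) (at x)"
proof -
 obtain c where R: "orthogonal_transformation R" "T = (%x. c + R x)" using assms by (auto simp: iso_def)
 have "bounded_linear R" using orthogonal_transformation_linear[OF R(1)] by (simp add: linear_conv_bounded_linear)
 then have D: "(T has_derivative R) (at x)" unfolding R(2)
  using has_derivative_add[OF has_derivative_const[of c "at x"] bounded_linear_imp_has_derivative[of R "at x"]] by simp
 show ?thesis using assms(2) by (intro has_derivative_compose[OF D]) (simp add: frechet_derivative_works)
qed

lemma Ck_iso: "iso T R ==> Ck k vp ==> Ck k (%x. vp (T x))"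
proof (induction k arbitrary: vp)
 case 0
 then obtain c where R: "orthogonal_transformation R" "T = (%x. c + R x)" by (auto simp: iso_def)
 have "continuous_on UNIV T" unfolding R(2)
  using orthogonal_transformation_linear[OF R(1)] by (intro continuous_intros linear_continuous_on) (simp add: linear_conv_bounded_linear)
 then show ?case using 0 by (auto intro: continuous_on_compose2)
next
 case (Suc k)
 have d: "vp differentiable at x" for x using Suc.prems by auto
 note D = iso_derivative[OF Suc.prems(1) d]
 have "Ck k (%x. vp' (T x))" if "vp' = (%x. frechet_derivative vp (at x) (axis j 1))" for j vp'
  using Suc.prems unfolding that by (intro Suc.IH) auto
 then have j: "Ck k (%x. frechet_derivative vp (at (T x)) (axis j 1))" for j by blast
 have "Ck k (%x. 1 * (R (axis i 1) $ 1 * frechet_derivative vp (at (T x)) (axis 1 1) + R (axis i 1) $ 2 * frechet_derivative vp (at (T x)) (axis 2 1))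
   + R (axis i 1) $ 3 * frechet_derivative vp (at (T x)) (axis 3 1))" for i by (intro Ck_lin j)
 then have "Ck k (%x. frechet_derivative vp (at (T x)) (R (axis i 1)))" for i
  by (simp add: frechet_partials[OF d, of _ "R _"] sum_3)
 then show ?case using D by (auto simp: frechet_derivative_at[OF D, symmetric] differentiable_def)
qed

lemma test_fun_iso:
 assumes T: "iso T R" and vp: "test_fun vp"
 shows "test_fun (%x. vp (T x))" "partial i (%x. vp (T x)) x = (\<Sum>j\<in>UNIV. R (axis i 1) $ j * partial j vp (T x))"
proof -
 obtain r B where r: "!!x. norm x > r ==> vp x = 0" using test_fun_support[OF vp] by metis
 have "norm x <= r + norm (T 0)" if "vp (T x) ~= 0" for x
  using r[of "T x"] that iso_norm[OF T, of x 0] norm_triangle_ineq4[of "T x" "T 0"] by fastforce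
 then have "bounded {x. vp (T x) ~= 0}" unfolding bounded_iff by blast
 then show "test_fun (%x. vp (T x))" using Ck_iso[OF T] vp by (auto simp: test_fun_def compact_eq_bounded_closed bounded_closure)
 have "Ck 1 vp" using vp by (simp add: test_fun_def)
 then have d: "vp differentiable at (T x)" by simp
 show "partial i (%x. vp (T x)) x = (\<Sum>j\<in>UNIV. R (axis i 1) $ j * partial j vp (T x))"
  unfolding partial_def frechet_derivative_at[OF iso_derivative[OF T d], symmetric] by (rule frechet_partials[OF d])
qed

text \<open>The transpose, which is the inverse for an orthogonal \<open>R\<close>. Written through
  the images of the unit vectors it is visibly measurable also when \<open>R\<close> varies with a
  parameter, as in the averages over rotations.\<close>

definition pb :: "(R3 => R3) => R3 => R3" where "pb R w = (\<chi> i. w \<bullet> R (axis i 1))"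

lemma pb_orthogonal:
 assumes R: "orthogonal_transformation R" shows "pb R = inv R" "norm (pb R w) = norm w" "pb R v \<bullet> pb R w = v \<bullet> w"
proof -
 have i: "orthogonal_transformation (inv R)" by (rule orthogonal_transformation_inv[OF R])
 have "inv R w $ i = w \<bullet> R (axis i 1)" for w i
 proof -
  have "inv R w $ i = inv R w \<bullet> axis i 1" by (simp add: inner_axis)
  also have "... = R (inv R w) \<bullet> R (axis i 1)" using R by (simp add: orthogonal_transformation_def)
  also have "R (inv R w) = w" by (rule surj_f_inv_f[OF orthogonal_transformation_surj[OF R]])
  finally show ?thesis .
 qed
 then show e: "pb R = inv R" by (simp add: pb_def fun_eq_iff vec_eq_iff)
 show "norm (pb R w) = norm w" "pb R v \<bullet> pb R w = v \<bullet> w"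
  unfolding e using i orthogonal_transformation_norm[OF i] by (auto simp: orthogonal_transformation_def)
qed

lemma pb_measurable: "orthogonal_transformation R ==> BM (pb R)"
 unfolding pb_orthogonal by (intro orthogonal_measurable orthogonal_transformation_inv)

lemma bm_iso:
 assumes T: "iso T R" and [measurable]: "BM f" shows "bm (%x. f (T x)) z r = bm f (T z) r"
proof -
 have d: "dist z x = dist (T z) (T x)" for x using iso_norm[OF T] by (simp add: dist_norm)
 have [measurable]: "BM T" using T by auto
 show ?thesis unfolding bm_def d
  by (rule nn_integral_preserving[where f="%x. if dist (T z) x < r then f x else 0"]) (auto simp: iso_distr[OF T])
qed

lemma bm_ball_mono:
 assumes "dist z' z + r <= r'" shows "bm f z r <= bm f z' r'"
proof -
 have "dist z' x < r'" if "dist z x < r" for x using that assms dist_triangle[of z' x z] by linarith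
 then show ?thesis unfolding bm_def by (auto intro!: nn_integral_mono)
qed

lemma iso_wpair:
 assumes T: "iso T R" and u: "wpair u g" shows "wpair (%x. u (T x)) (%x. pb R (g (T x)))"
proof -
 have R: "orthogonal_transformation R" using T by (simp add: iso_def)
 have [measurable]: "BM T" "BM (pb R)" "BM u" "BM g" using T pb_measurable[OF R] u by auto
 have l: "loc2 u" using u by (rule wpair_loc2)
 have L: "loc2 (%x. u (T x))"
 proof -
  have "bm (sq (%x. u (T x))) 0 r < top" for r
  proof -
   have "bm (sq (%x. u (T x))) 0 r = bm (sq u) (T 0) r" using bm_iso[OF T, of "sq u"] by (simp add: sq_def[abs_def])
   also have "... <= bm (sq u) 0 (norm (T 0) + r)" by (rule bm_ball_mono) simp
   finally show ?thesis using l le_less_trans unfolding loc2_iff_bm by blast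
  qed
  then show ?thesis unfolding loc2_iff_bm by simp
 qed
 have N: "(NE x. (norm (pb R (g (T x))))^2) < \<infinity>"
  using nn_integral_preserving[of "%x. ennreal ((norm (g x))^2)" T] iso_distr[OF T] u by (simp add: pb_orthogonal(2)[OF R] wpair_def)
 have "(LI x. u (T x) * partial i vp x) = - (LI x. pb R (g (T x)) $ i * vp x)" if vp: "test_fun vp" for vp i
 proof -
  obtain T' R' where T': "iso T' R'" "!!x. T' (T x) = x" using iso_inverse[OF T] by blast
  \<comment> \<open>Every test function is the pullback of another one under \<open>T\<close>, so
    both sides are integrals of pullbacks, and the change of variables removes \<open>T\<close> from
    them.\<close>
  define ps where "ps x = vp (T' x)" for x
  have ps: "test_fun ps" unfolding ps_def by (rule test_fun_iso(1)[OF T'(1) vp])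
  have vpps: "vp = (%x. ps (T x))" by (simp add: ps_def T'(2))
  note [measurable] = test_fun_measurable[OF ps]
  have "(LI x. u (T x) * partial i vp x) = (LI x. u (T x) * (\<Sum>j\<in>UNIV. R (axis i 1) $ j * partial j ps (T x)))"
   unfolding vpps test_fun_iso(2)[OF T ps] ..
  also have "... = (LI x. u x * (\<Sum>j\<in>UNIV. R (axis i 1) $ j * partial j ps x))"
   by (rule iso_integral[OF T, of "%x. u x * (\<Sum>j\<in>UNIV. R (axis i 1) $ j * partial j ps x)"]) measurable
  also have "... = (LI x. (\<Sum>j\<in>UNIV. R (axis i 1) $ j * (u x * partial j ps x)))"
   by (simp add: sum_distrib_left mult.left_commute)
  also have "... = (\<Sum>j\<in>UNIV. R (axis i 1) $ j * (LI x. u x * partial j ps x))"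
   using loc2_test_integrable(2)[OF l ps] by (subst Bochner_Integration.integral_sum) auto
  also have "... = - (\<Sum>j\<in>UNIV. R (axis i 1) $ j * (LI x. g x $ j * ps x))"
   using u ps by (simp add: wpair_def sum_negf)
  also have "(\<Sum>j\<in>UNIV. R (axis i 1) $ j * (LI x. g x $ j * ps x)) = (LI x. (\<Sum>j\<in>UNIV. R (axis i 1) $ j * (g x $ j * ps x)))"
   using loc2_test_integrable(1)[OF wpair_loc2_component[OF u] ps] by (subst Bochner_Integration.integral_sum) auto
  also have "... = (LI x. pb R (g x) $ i * ps x)" by (simp add: pb_def inner_vec_def sum_distrib_left mult_ac)
  also have "... = (LI x. pb R (g (T x)) $ i * vp x)"
   unfolding vpps by (rule iso_integral[OF T, of "%x. pb R (g x) $ i * ps x", symmetric]) measurable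
  finally show ?thesis .
 qed
 then show ?thesis using L N by (simp add: wpair_def)
qed

lemma iso_X:
 assumes T: "iso T R" and u: "X a u g" shows "X a (%x. u (T x)) (%x. pb R (g (T x)))"
proof -
 have [measurable]: "BM T" "BM u" using T u by auto
 have "W a (sq (%x. u (T x))) (sq (%x. u (T x))) = W a (sq u) (sq u)"
  using W_isometry[of "sq u" "sq u" T a] iso_distr[OF T] iso_norm[OF T] by (simp add: sq_def[abs_def])
 then show ?thesis using u iso_wpair[OF T] by (simp add: X_def)
qed

lemma iso_N2: "iso T R ==> BM g ==> N2 (%x. pb R (g (T x))) = N2 g"
 unfolding N2_def using iso_integral[of T R "%x. (norm (g x))^2"] by (simp add: pb_orthogonal(2) iso_def)

lemma iso_Cp: "iso T R ==> BM u ==> Cp p (%x. u (T x)) = Cp p u"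
 unfolding Cp_def using iso_integral[of T R "%x. \<bar>u x\<bar> powr p"] by simp

lemma iso_Dk:
 assumes T: "iso T R" and [measurable]: "BM f" "BM g" shows "Dk a (%x. f (T x)) (%x. g (T x)) = Dk a f g"
proof -
 have [measurable]: "BM T" using T by auto
 have k: "kernel a (T x - T y) = kernel a (x - y)" for x y using iso_norm[OF T] by (simp add: kernel_def)
 have "PP = distr lborel borel T \<Otimes>\<^sub>M distr lborel borel T" by (simp add: PP_def iso_distr[OF T])
 also have "... = distr PP (borel2) (%(x, y). (T x, T y))"
  unfolding PP_def by (rule pair_measure_distr) (auto simp: iso_distr[OF T] lborel.sigma_finite_measure_axioms)
 finally have "Dk a f g = (\<integral>z. kernel a (fst z - snd z) * (f (fst z) * g (snd z)) \<partial>distr PP (borel2) (%(x, y). (T x, T y)))"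
  by (simp add: Dk_def)
 also have "... = Dk a (%x. f (T x)) (%x. g (T x))" by (subst integral_distr) (auto simp: Dk_def k case_prod_beta)
 finally show ?thesis by simp
qed

section \<open>Concentration of mass and a nonzero element of the space\<close>

lemma mass_somewhere:
 assumes a: "a > 0" and p: "4 < p" "p < 6" and c: "c > 0" and M: "M >= 0"
 shows "EX de>0. ALL u g. X a u g --> N2 g <= M --> Bf a u <= M --> Cp p u >= c --> (EX z. bm (sq u) z 3 >= ennreal de)"
proof -
 have c2: "c/2 > 0" using c by simp
 obtain de where de: "de > 0" "ALL u g. X a u g --> W a (sq u) (sq u) <= ennreal M --> (NI x. nsq g x) <= ennreal M -->
  (ALL z. bm (sq u) z 3 <= ennreal de) --> (NE x. \<bar>u x\<bar> powr p) <= ennreal (c/2)"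
  using Lp_vanishing[OF a p M c2] by blast
 have "EX z. bm (sq u) z 3 >= ennreal de" if u: "X a u g" "N2 g <= M" "Bf a u <= M" "Cp p u >= c" for u g
 proof (rule ccontr)
  assume n: "~ ?thesis"
  have "bm (sq u) z 3 <= ennreal de" for z using n by (meson linear)
  moreover have "W a (sq u) (sq u) <= ennreal M" "(NI x. nsq g x) <= ennreal M"
   using u X_Bf(1)[OF a u(1)] L2v_nsq[OF X_L2v[OF u(1)]] by (auto intro: ennreal_leI)
  ultimately have "ennreal (Cp p u) <= ennreal (c/2)" using de(2) u(1) X_Lp(2)[OF a p u(1)] by metis
  then show False using u(4) c by (simp add: ennreal_le_iff)
 qed
 then show ?thesis using de(1) by blast
qed

text \<open>Difference quotients of \<open>f\<close> integrate to 0 by translation invariance. They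
  are bounded with supports in a fixed ball and converge to the directional derivative, so dominated
  convergence yields this case of the divergence theorem.\<close>

lemma integral_derivative_zero:
 fixes f :: "R3 => real"
 assumes f: "!!x. (f has_derivative (%v. v \<bullet> G x)) (at x)" and G: "continuous_on UNIV G" and R: "!!x. norm x > R ==> f x = 0"
 shows "(LI x. G x \<bullet> e) = 0"
proof -
 have c: "continuous_on UNIV f" using f has_derivative_continuous by (blast intro: continuous_at_imp_continuous_on)
 have [measurable]: "BM f" "BM G" using c G by (auto intro: borel_measurable_continuous_onI)
 define t where "t n = 1 / real (Suc n)" for n
 have t: "t n > 0" "t n <= 1" "t n ~= 0" for n by (auto simp: t_def)
 have t0: "t ---> 0" unfolding t_def using LIMSEQ_inverse_real_of_nat by (simp add: inverse_eq_divide)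
 define s where "s n x = (f (x + t n *\<^sub>R e) - f x) / t n" for n x
 have [measurable]: "BM (s n)" for n unfolding s_def by measurable
 define r where "r = R + norm e"
 have "bounded (G ` cball 0 (r + norm e))"
  by (intro compact_imp_bounded compact_continuous_image continuous_on_subset[OF G]) auto
 then obtain B where B: "!!x. x \<in> cball 0 (r + norm e) ==> norm (G x) <= B" "B >= 0"
  unfolding bounded_pos using less_imp_le by blast
 have lim: "(%n. s n x) ---> G x \<bullet> e" for x
 proof -
  have "(f has_derivative (%v. v \<bullet> G x)) (at (x + 0 *\<^sub>R e))" using f[of x] by simp
  moreover have "((%h. x + h *\<^sub>R e) has_derivative (%h. h *\<^sub>R e)) (at 0)" by (auto intro!: derivative_eq_intros)
  ultimately have "((%h. f (x + h *\<^sub>R e)) has_derivative (%h. (h *\<^sub>R e) \<bullet> G x)) (at 0)" by (rule has_derivative_compose[rotated])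
  then have "((%h. f (x + h *\<^sub>R e)) has_real_derivative (G x \<bullet> e)) (at 0)"
   by (simp add: has_field_derivative_def inner_commute mult_commute_abs)
  then have "(%h. (f (x + h *\<^sub>R e) - f x) / h) \<midarrow>0\<rightarrow> G x \<bullet> e" by (simp add: DERIV_def)
  then have "(%n. (f (x + t n *\<^sub>R e) - f x) / t n) ---> G x \<bullet> e" unfolding tendsto_at_iff_sequentially comp_def using t0 t(3) by blast
  then show ?thesis unfolding s_def .
 qed
 have bd: "norm (s n x) <= (B * norm e) * indicator (cball 0 r) x" for n x
 proof (cases "norm x <= r")
  case True
  have "norm (f (x + t n *\<^sub>R e) - f x) <= B * norm (x + t n *\<^sub>R e - x)"
  proof (rule differentiable_bound[of "cball 0 (r + norm e)" f "%x v. v \<bullet> G x"])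
   show "(f has_derivative (%v. v \<bullet> G y)) (at y within cball 0 (r + norm e))" for y by (rule has_derivative_at_withinI[OF f])
   show "onorm (%v. v \<bullet> G y) <= B" if "y \<in> cball 0 (r + norm e)" for y
   proof (rule onorm_le)
    show "norm (v \<bullet> G y) <= B * norm v" for v
     using Cauchy_Schwarz_ineq2[of v "G y"] mult_left_mono[OF B(1)[OF that], of "norm v"] by (simp add: mult.commute)
   qed
   have "norm (t n *\<^sub>R e) <= 1 * norm e" using t[of n] by (simp add: mult_left_le_one_le)
   then show "x + t n *\<^sub>R e \<in> cball 0 (r + norm e)" "x \<in> cball 0 (r + norm e)"
    using True norm_triangle_ineq[of x "t n *\<^sub>R e"] norm_ge_zero[of e] by (auto simp del: norm_ge_zero)
  qed simp
  also have "... = t n * (B * norm e)" using t[of n] by simp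
  finally show ?thesis using True t[of n] by (simp add: s_def divide_le_eq mult.commute)
 next
  case False
  have "norm (t n *\<^sub>R e) <= norm e" using t[of n] by (simp add: mult_left_le_one_le)
  then have "norm (x + t n *\<^sub>R e) > R" using False norm_diff_ineq[of x "t n *\<^sub>R e"] by (simp add: r_def)
  moreover have "norm x > R" using False norm_ge_zero[of e] unfolding r_def by linarith
  ultimately show ?thesis using False R by (simp add: s_def)
 qed
 have i: "integrable lborel (%x. (B * norm e) * indicator (cball (0::R3) r) x :: real)"
  by (intro integrable_mult_right integrable_real_indicator) (use emeasure_lborel_cball_finite in auto)
 obtain K where K: "ALL x. \<bar>f x\<bar> <= K" using continuous_compact_support_bound[OF c R] by blast
 have fi: "integrable lborel f"
 proof (rule Bochner_Integration.integrable_bound)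
  show "AL x. norm (f x) <= norm (K * indicator (cball 0 R) x :: real)" using R K
   by (intro AE_I2) (auto simp: indicator_def intro: order_trans[OF _ abs_ge_self])
  show "integrable lborel (%x. K * indicator (cball (0::R3) R) x :: real)"
   by (intro integrable_mult_right integrable_real_indicator) (use emeasure_lborel_cball_finite in auto)
 qed simp
 have "(LI x. s n x) = 0" for n
 proof -
  have tr: "(LI x. f (x + t n *\<^sub>R e)) = (LI x. f x)"
   using iso_integral[OF iso_translation, of f "t n *\<^sub>R e"] by (simp add: add.commute)
  have "integrable (distr lborel borel ((+) (t n *\<^sub>R e))) f" using fi by (simp add: lborel_distr_plus)
  then have "integrable lborel (%x. f (t n *\<^sub>R e + x))" by (subst (asm) integrable_distr_eq) auto
  then have "integrable lborel (%x. f (x + t n *\<^sub>R e))" by (simp add: add.commute)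
  then show ?thesis unfolding s_def using fi tr by simp
 qed
 moreover have "(%n. (LI x. s n x)) ---> (LI x. G x \<bullet> e)"
  by (rule integral_dominated_convergence[OF _ _ i]) (use lim bd in auto)
 ultimately show ?thesis by (simp add: LIMSEQ_const_iff)
qed

lemma C1_wpair:
 assumes f: "!!x. (f has_derivative (%v. v \<bullet> G x)) (at x)" and G: "continuous_on UNIV G"
  and R: "!!x. norm x > R ==> f x = 0" "!!x. norm x > R ==> G x = 0" shows "wpair f G"
proof -
 have c: "continuous_on UNIV f" using f has_derivative_continuous by (blast intro: continuous_at_imp_continuous_on)
 have [measurable]: "BM G" using G by (rule borel_measurable_continuous_onI)
 have gi: "continuous_on UNIV (%x. G x $ i)" for i using G by (intro continuous_intros)
 have "(NE x. (norm (G x))^2) < \<infinity>"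
 proof -
  obtain B where B: "B >= 0" "ALL x. \<bar>norm (G x)\<bar> <= B"
   using continuous_compact_support_bound[of "%x. norm (G x)" R] G R by (auto intro: continuous_intros)
  have "(NE x. (norm (G x))^2) <= (NI x. ennreal (B^2) * indicator (cball (0::R3) R) x)"
   using B R by (intro nn_integral_mono) (auto simp: indicator_def intro!: ennreal_leI power_mono)
  also have "... < \<infinity>" using emeasure_lborel_cball_finite[of "0::R3" R] by (simp add: nn_integral_cmult ennreal_mult_less_top)
  finally show ?thesis .
 qed
 moreover have "(LI x. f x * partial i vp x) = - (LI x. G x $ i * vp x)" if vp: "test_fun vp" for vp i
 proof -
  define H where "H x = f x *\<^sub>R (\<chi> j. partial j vp x) + vp x *\<^sub>R G x" for x
  have D: "((%x. f x * vp x) has_derivative (%v. v \<bullet> H x)) (at x)" for x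
  proof -
   have "((%x. f x * vp x) has_derivative (%v. f x * (\<Sum>i\<in>UNIV. v $ i * partial i vp x) + (v \<bullet> G x) * vp x)) (at x)"
    by (rule has_derivative_mult[OF f test_fun_derivative[OF vp]])
   moreover have "(\<Sum>i\<in>UNIV. v $ i * partial i vp x) = v \<bullet> (\<chi> j. partial j vp x)" for v by (simp add: inner_vec_def)
   ultimately show ?thesis by (simp add: H_def inner_add_right mult.commute)
  qed
  have "continuous_on UNIV H" unfolding H_def by (intro continuous_intros c G test_fun_continuous[OF vp])
  then have "(LI x. H x \<bullet> axis i 1) = 0" by (intro integral_derivative_zero[OF D, of R]) (use R in auto)
  moreover have "(LI x. H x \<bullet> axis i 1) = (LI x. f x * partial i vp x + G x $ i * vp x)"
   by (simp add: H_def inner_axis mult.commute)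
  moreover have "... = (LI x. f x * partial i vp x) + (LI x. G x $ i * vp x)"
   by (intro Bochner_Integration.integral_add loc2_test_integrable loc2_continuous c gi vp)
  ultimately show ?thesis by simp
 qed
 ultimately show ?thesis using loc2_continuous[OF c] by (simp add: wpair_def)
qed

text \<open>A nonzero radial element of the space, so that both Nehari sets are nonempty.\<close>

lemma cutoff_X:
 assumes a: "a > 0" shows "X a (cutoff 0 1) (cutoff_grad 0 1)" "radial (cutoff 0 1)" "~ (AL x. cutoff 0 1 x = 0)"
proof -
 have wp: "wpair (cutoff 0 1) (cutoff_grad 0 1)"
  by (rule C1_wpair[where R=2]) (auto intro!: cutoff_derivative cutoff_grad_continuous cutoff_facts)
 have "W a (sq (cutoff 0 1)) (sq (cutoff 0 1)) <= (NI x. NI y. ennreal (1/a) * (indicator (ball (0::R3) 2) x * indicator (ball (0::R3) 2) y))"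
  unfolding W_def
 proof (intro nn_integral_mono mult_mono)
  show "ennreal (kernel a (x - y)) <= ennreal (1/a)" for x y by (intro ennreal_leI kernel_bounds a)
  show "sq (cutoff 0 1) x <= indicator (ball 0 2) x" for x
   using cutoff_facts(1,2)[of 1 0 x] cutoff_facts(3)[of 1 x 0] power_le_one[of "cutoff 0 1 x" 2] by (auto simp: sq_def indicator_def ennreal_leI[of _ 1, simplified])
  then show "sq (cutoff 0 1) x <= indicator (ball 0 2) x" for x .
 qed auto
 also have "... = ennreal (1/a) * (emeasure lborel (ball (0::R3) 2) * emeasure lborel (ball (0::R3) 2))"
  by (simp add: nn_integral_cmult nn_integral_multc)
 also have "... < top" by (simp add: ennreal_mult_less_top emeasure_ball3)
 finally show "X a (cutoff 0 1) (cutoff_grad 0 1)" using wp by (simp add: X_def)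
 show "radial (cutoff 0 1)" unfolding radial_def by (rule exI[of _ "cutoff 0 1"]) (auto simp: cutoff_def)
 show "~ (AL x. cutoff 0 1 x = 0)"
 proof
  assume "AL x. cutoff 0 1 x = 0"
  then have "AL x. x \<notin> ball (0::R3) 1" by eventually_elim (use cutoff_facts(6)[of 1 _ 0] in force)
  then have "ball (0::R3) 1 \<in> null_sets lborel" by (subst AE_iff_null_sets) simp_all
  then have "emeasure lborel (ball (0::R3) 1) = 0" by auto
  then show False using emeasure_ball3[of 1 0] om_pos by simp
 qed
qed

section \<open>Radial functions\<close>

lemma radial_AE: "radial u \<longleftrightarrow> (EX w. (ALL x y. norm x = norm y --> w x = w y) & (AL x. u x = w x))"
 unfolding radial_def by (simp add: AE_completion_iff)

lemma radial_orthogonal: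
 assumes u: "radial u" and R: "orthogonal_transformation R" shows "AL x. u (R x) = u x"
proof -
 obtain w where w: "!!x y. norm x = norm y ==> w x = w y" "AL x. u x = w x" using u unfolding radial_AE by blast
 have "AE x in distr lborel borel R. u x = w x" unfolding lborel_distr_orthogonal[OF R] by (rule w)
 then have "AL x. u (R x) = w (R x)" by (rule AE_distrD[rotated]) (simp add: orthogonal_measurable[OF R])
 then show ?thesis using w(2) by eventually_elim (simp add: w(1)[OF orthogonal_transformation_norm[OF R]])
qed

lemma radial_add: "radial u ==> radial v ==> radial (%x. u x + c * v x)"
proof -
 assume "radial u" "radial v"
 then obtain w z where w: "ALL x y. norm x = norm y --> w x = w y" "AL x. u x = w x"
  and z: "ALL x y. norm x = norm y --> z x = z y" "AL x. v x = z x" unfolding radial_AE by blast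
 have "AL x. u x + c * v x = w x + c * z x" using w(2) z(2) by eventually_elim simp
 then show ?thesis unfolding radial_AE using w(1) z(1) by (intro exI[of _ "%x. w x + c * z x"]) metis
qed

text \<open>\<open>lim\<close> depends only on the sequence of values, also where that sequence
  diverges, so the limit of exactly radial representatives is exactly radial.\<close>

lemma radial_limit:
 assumes u: "!!n. radial (u n)" and lim: "AL x. (%n. u n x) ---> U x" shows "radial U"
proof -
 obtain w where w: "!!n x y. norm x = norm y ==> w n x = w n y" "!!n. AL x. u n x = w n x"
  using u unfolding radial_AE by metis
 have "AL x. ALL n. u n x = w n x" using w(2) by (simp add: AE_all_countable)
 then have "AL x. U x = lim (%n. w n x)" using lim by eventually_elim (simp add: limI)
 moreover have "lim (%n. w n x) = lim (%n. w n y)" if "norm x = norm y" for x y using w(1)[OF that] by simp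
 ultimately show ?thesis unfolding radial_AE by (intro exI[of _ "%x. lim (%n. w n x)"] conjI allI impI)
qed

text \<open>By radiality the mass at \<open>z\<close> reappears at every rotated centre, so every
  ball of radius 4 with centre in the shell between |z| and |z| + 1 has mass at least
  \<open>de\<close>. The shell has volume at least om (|z| + 1), and
  \<open>ball_mass_sq_integral\<close> bounds the integral of the squared masses; 64 = 4^3 and a + 8
  come from the radius 4.\<close>

lemma radial_mass_centre:
 assumes a: "a > 0" and u: "X a u g" "radial u" and W: "W a (sq u) (sq u) <= ennreal M" "M >= 0" and de: "de > 0" and z: "bm (sq u) z 3 >= ennreal de"
 shows "om * (norm z + 1) * de^2 <= om * 64 * (a + 8) * M \<or> norm z < 1"
proof (cases "norm z < 1")
 case False
 have [measurable]: "BM u" using u by auto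
 define A where "A = ball (0::R3) (norm z + 1) - ball 0 (norm z)"
 have rot: "bm (sq u) z' 3 >= ennreal de" if "norm z' = norm z" for z'
 proof -
  have "norm z = norm z'" using that by simp
  then obtain R where R: "orthogonal_transformation R" "R z = z'" using rotation_exists[of z z'] by auto
  have [measurable]: "BM R" by (rule orthogonal_measurable[OF R(1)])
  have "bm (sq u) z' 3 = bm (%x. sq u (R x)) z 3" using bm_iso[OF iso_orthogonal[OF R(1)], of "sq u" z 3] R by simp
  also have "... = bm (sq u) z 3" unfolding bm_def
   by (intro nn_integral_cong_AE) (use radial_orthogonal[OF u(2) R(1)] in \<open>auto simp: sq_def elim!: eventually_mono\<close>)
  finally show ?thesis using z by simp
 qed
 have "(ennreal de)^2 * indicator A y <= (bm (sq u) y 4)^2" for y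
 proof (cases "y \<in> A")
  case True
  then have y: "norm z <= norm y" "norm y < norm z + 1" by (auto simp: A_def)
  then have y0: "norm y > 0" using False by linarith
  define z' where "z' = (norm z / norm y) *\<^sub>R y"
  have "norm z' = norm z" using y0 by (simp add: z'_def)
  note r = rot[OF this]
  have "y - z' = (1 - norm z / norm y) *\<^sub>R y" by (simp add: z'_def algebra_simps)
  then have "norm (y - z') = \<bar>1 - norm z / norm y\<bar> * norm y" by simp
  also have "... = norm y - norm z" using y y0 by (simp add: field_simps abs_if)
  finally have "dist y z' < 1" using y by (simp add: dist_norm)
  then have "bm (sq u) z' 3 <= bm (sq u) y 4" by (intro bm_ball_mono) simp
  then have "ennreal de <= bm (sq u) y 4" using r by simp
  then show ?thesis using True by (simp add: power_mono)
 qed simp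
 then have "(NI y. (ennreal de)^2 * indicator A y) <= (NI y. (bm (sq u) y 4)^2)" by (intro nn_integral_mono)
 also have "... <= ennreal (om * 4^3 * (a + 2 * 4)) * W a (sq u) (sq u)" by (rule ball_mass_sq_integral[OF a]) auto
 also have "... <= ennreal (om * 4^3 * (a + 2 * 4)) * ennreal M" using W by (intro mult_left_mono) auto
 also have "... = ennreal (om * 64 * (a + 8) * M)" using a W om_pos by (simp add: ennreal_mult[symmetric])
 also have "(NI y. (ennreal de)^2 * indicator A y) = (ennreal de)^2 * emeasure lborel A"
  by (subst nn_integral_cmult_indicator) (auto simp: A_def)
 also have "emeasure lborel A = ennreal (om * (norm z + 1)^3 - om * (norm z)^3)"
  unfolding A_def using om_pos by (subst emeasure_Diff) (auto simp: emeasure_ball3 ennreal_minus)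
 also have "(ennreal de)^2 * ennreal (om * (norm z + 1)^3 - om * (norm z)^3) = ennreal (de^2 * (om * (norm z + 1)^3 - om * (norm z)^3))"
  using de by (simp add: ennreal_mult' ennreal_power)
 finally have *: "de^2 * (om * (norm z + 1)^3 - om * (norm z)^3) <= om * 64 * (a + 8) * M"
  using a W om_pos by (subst (asm) ennreal_le_iff) auto
 have "om * (norm z + 1)^3 - om * (norm z)^3 = om * (3 * (norm z)^2 + 3 * norm z + 1)"
  by (simp add: power3_eq_cube power2_eq_square algebra_simps)
 also have "... >= om * (norm z + 1)" using om_pos norm_ge_zero[of z] zero_le_power2[of "norm z"] by (intro mult_left_mono) linarith+
 finally have "de^2 * (om * (norm z + 1)) <= de^2 * (om * (norm z + 1)^3 - om * (norm z)^3)" by (intro mult_left_mono) auto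
 then show ?thesis using * by (simp add: mult_ac)
qed simp

lemma variational_X:
 assumes a: "a > 0" and q: "q ~= 0" and p: "4 < p" "p < 6" shows "variational a q p (X a)"
proof
 show "EX rh de. de > 0 & (ALL u g. X a u g --> N2 g <= M --> Bf a u <= M --> Cp p u >= c -->
   (EX u' g'. X a u' g' & N2 g' = N2 g & Bf a u' = Bf a u & Cp p u' = Cp p u & bm (sq u') 0 rh >= ennreal de))"
  if "c > 0" "M >= 0" for c M
 proof -
  obtain de where de: "de > 0" "ALL u g. X a u g --> N2 g <= M --> Bf a u <= M --> Cp p u >= c --> (EX z. bm (sq u) z 3 >= ennreal de)"
   using mass_somewhere[OF a p \<open>c > 0\<close> \<open>M >= 0\<close>] by blast
  have "EX u' g'. X a u' g' & N2 g' = N2 g & Bf a u' = Bf a u & Cp p u' = Cp p u & bm (sq u') 0 3 >= ennreal de"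
   if u: "X a u g" "N2 g <= M" "Bf a u <= M" "Cp p u >= c" for u g
  proof -
   obtain z where z: "bm (sq u) z 3 >= ennreal de" using de(2) u by blast
   have [measurable]: "BM u" "BM g" using u by auto
   note T = iso_translation[of z]
   have "bm (sq (%x. u (z + x))) 0 3 >= ennreal de" using bm_iso[OF T, of "sq u" 0 3] z by (simp add: sq_def[abs_def])
   moreover have "Bf a (%x. u (z + x)) = Bf a u" using iso_Dk[OF T, of "%x. (u x)^2" "%x. (u x)^2" a] by (simp add: Bf_def)
   ultimately show ?thesis using iso_X[OF T u(1)] iso_N2[OF T, of g] iso_Cp[OF T, of u p]
    by (intro exI[of _ "%x. u (z + x)"] exI[of _ "%x. pb (%x. x) (g (z + x))"]) simp
  qed
  then show ?thesis using de(1) by blast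
 qed
 show "EX u g. X a u g & ~ (AL x. u x = 0)" using cutoff_X[OF a] by blast
qed (use assms X_add in auto)

lemma variational_radial:
 assumes a: "a > 0" and q: "q ~= 0" and p: "4 < p" "p < 6" shows "variational a q p (%u g. X a u g & radial u)"
proof
 show "EX rh de. de > 0 & (ALL u g. X a u g & radial u --> N2 g <= M --> Bf a u <= M --> Cp p u >= c -->
   (EX u' g'. (X a u' g' & radial u') & N2 g' = N2 g & Bf a u' = Bf a u & Cp p u' = Cp p u & bm (sq u') 0 rh >= ennreal de))"
  if M: "c > 0" "M >= 0" for c M
 proof -
  obtain de where de: "de > 0" "ALL u g. X a u g --> N2 g <= M --> Bf a u <= M --> Cp p u >= c --> (EX z. bm (sq u) z 3 >= ennreal de)"
   using mass_somewhere[OF a p M] by blast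
  \<comment> \<open>The inequality of \<open>radial_mass_centre\<close> solved for the norm of the
    centre; the summand 1 covers its alternative, centres of norm below 1.\<close>
  define rh where "rh = 64 * (a + 8) * M / de^2 + 1"
  have "bm (sq u) 0 (rh + 3) >= ennreal de" if u: "X a u g" "radial u" "N2 g <= M" "Bf a u <= M" "Cp p u >= c" for u g
  proof -
   obtain z where z: "bm (sq u) z 3 >= ennreal de" using de(2) u by blast
   have "W a (sq u) (sq u) <= ennreal M" using u(4) X_Bf(1)[OF a u(1)] by (simp add: ennreal_leI)
   from radial_mass_centre[OF a u(1,2) this M(2) de(1) z]
   have "norm z <= rh"
   proof
    assume "om * (norm z + 1) * de^2 <= om * 64 * (a + 8) * M"
    then have "om * ((norm z + 1) * de^2) <= om * (64 * (a + 8) * M)" by (simp only: mult.assoc)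
    then have "(norm z + 1) * de^2 <= 64 * (a + 8) * M" using om_pos by simp
    then have "norm z + 1 <= 64 * (a + 8) * M / de^2" using de(1) by (simp add: pos_le_divide_eq)
    then show ?thesis by (simp add: rh_def)
   next
    assume "norm z < 1"
    moreover have "64 * (a + 8) * M / de^2 >= 0" using a M by simp
    ultimately show ?thesis by (simp add: rh_def)
   qed
   then have "bm (sq u) z 3 <= bm (sq u) 0 (rh + 3)" by (intro bm_ball_mono) simp
   then show ?thesis using z by simp
  qed
  then show ?thesis using de(1) by blast
 qed
 show "EX u g. (X a u g & radial u) & ~ (AL x. u x = 0)" using cutoff_X[OF a] by blast
 show "X a U G & radial U" if "!!n. X a (un n) (gn n) & radial (un n)" "AL x. (%n. un n x) ---> U x" "X a U G" for un gn U G
  using that radial_limit[of un U] by blast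
qed (use assms X_add radial_add in auto)

section \<open>Averaging over rotations\<close>

text \<open>Orthonormal frames are obtained from pairs of vectors by Gram-Schmidt and the cross product; the
 uniform distribution on a rotation invariant set of pairs replaces the Haar measure of the rotation group.\<close>

definition fr1 :: "R3 \<times> R3 => R3" where "fr1 y = sgn (fst y)"
definition fr2 :: "R3 \<times> R3 => R3" where "fr2 y = sgn (snd y - (snd y \<bullet> fr1 y) *\<^sub>R fr1 y)"
definition fr3 :: "R3 \<times> R3 => R3" where "fr3 y = cross3 (fr1 y) (fr2 y)"
definition Rt :: "R3 \<times> R3 => R3 => R3" where "Rt y x = vec3 (fr1 y \<bullet> x) (fr2 y \<bullet> x) (fr3 y \<bullet> x)"

lemma cross3_vec3: "cross3 a b = vec3 (a$2 * b$3 - a$3 * b$2) (a$3 * b$1 - a$1 * b$3) (a$1 * b$2 - a$2 * b$1)"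
 by (simp add: cross3_def vec_eq_iff forall_3)

lemma fst_snd_borel[measurable]: "BM (fst :: R3 \<times> R3 => R3)" "BM (snd :: R3 \<times> R3 => R3)"
 by (auto intro!: borel_measurable_continuous_onI continuous_intros)

lemma fr_measurable[measurable]: "BM fr1" "BM fr2" "BM fr3"
proof -
 show 1[measurable]: "BM fr1" unfolding fr1_def[abs_def] sgn_div_norm by measurable
 show 2[measurable]: "BM fr2" unfolding fr2_def[abs_def] sgn_div_norm by measurable
 show "BM fr3" unfolding fr3_def[abs_def] cross3_vec3 by measurable
qed

lemma Rt_measurable[measurable (raw)]:
 assumes [measurable]: "f \<in> borel_measurable N" "g \<in> borel_measurable N"
 shows "(%w. Rt (f w) (g w)) \<in> borel_measurable N" unfolding Rt_def by measurable

text \<open>A nonzero cross product means linear independence, so Gram-Schmidt yields a genuine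
  frame on this set. It is open, nonempty and bounded, hence of positive finite measure.\<close>

definition Om2 :: "(R3 \<times> R3) set" where "Om2 = {y. norm (fst y) < 1 & norm (snd y) < 1 & cross3 (fst y) (snd y) ~= 0}"
definition hr :: "(R3 \<times> R3) measure" where "hr = uniform_measure lborel Om2"

lemma Om2_sets[measurable]: "Om2 \<in> sets borel"
 and Om2_emeasure: "emeasure lborel Om2 ~= 0" "emeasure lborel Om2 ~= \<infinity>"
proof -
 have c: "continuous_on UNIV (%y::R3\<times>R3. cross3 (fst y) (snd y))" by (intro continuous_on_cross continuous_intros)
 have o: "open Om2" unfolding Om2_def
  by (intro open_Collect_conj open_Collect_less open_Collect_neq c continuous_intros)
 then show s: "Om2 \<in> sets borel" by simp
 have "cross3 (axis 1 (1/2)) (axis 2 (1/2)) $ 3 ~= 0" by (simp add: cross3_vec3 axis_def)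
 then have "cross3 (axis 1 (1/2)) (axis 2 (1/2)) ~= 0" by (metis zero_index)
 then have "(axis 1 (1/2), axis 2 (1/2)) \<in> Om2" by (simp add: Om2_def norm_eq_sqrt_inner inner_axis_axis real_sqrt_divide)
 then have "~ negligible Om2" using o open_not_negligible by blast
 then show "emeasure lborel Om2 ~= 0" using s by (simp add: negligible_iff_null_sets null_sets_def)
 have "Om2 \<subseteq> cball 0 1 \<times> cball 0 1" by (auto simp: Om2_def)
 then have "bounded Om2" by (rule bounded_subset[OF bounded_Times[OF bounded_cball bounded_cball]])
 then show "emeasure lborel Om2 ~= \<infinity>" using emeasure_bounded_finite by (simp add: less_top)
qed

lemma sets_hr[measurable_cong, simp]: "sets hr = sets borel" "space hr = UNIV" by (simp_all add: hr_def)

lemma hr_AE: "(!!y. y \<in> Om2 ==> P y) ==> AE y in hr. P y"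
 unfolding hr_def by (rule AE_uniform_measureI) auto

lemma emeasure_hr[simp]: "emeasure hr UNIV = 1"
 using emeasure_uniform_measure_1[OF Om2_emeasure] by (simp add: hr_def)

lemma measure_hr[simp]: "measure hr UNIV = 1" by (simp add: measure_def emeasure_hr)

interpretation hr: finite_measure hr by (rule finite_measureI) (simp add: emeasure_hr)


lemma Rt_orthogonal:
 assumes y: "y \<in> Om2" shows "orthogonal_transformation (Rt y)"
proof -
 have c: "cross3 (fst y) (snd y) ~= 0" using y by (simp add: Om2_def)
 then have y0: "fst y ~= 0" by auto
 define w where "w = snd y - (snd y \<bullet> fr1 y) *\<^sub>R fr1 y"
 have n1: "norm (fr1 y) = 1" using y0 by (simp add: fr1_def norm_sgn)
 have "w ~= 0"
 proof
  assume "w = 0"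
  then have "snd y = (snd y \<bullet> fr1 y) *\<^sub>R fr1 y" by (simp add: w_def)
  also have "fr1 y = (1 / norm (fst y)) *\<^sub>R fst y" by (simp add: fr1_def sgn_div_norm divide_inverse)
  finally have "EX c. snd y = c *\<^sub>R fst y" by (metis scaleR_scaleR)
  then obtain k where "snd y = k *\<^sub>R fst y" ..
  then have "cross3 (fst y) (snd y) = 0" by (simp add: cross_mult_right)
  then show False using c by simp
 qed
 then have n2: "norm (fr2 y) = 1" by (simp add: fr2_def w_def[symmetric] norm_sgn)
 have "w \<bullet> fr1 y = 0" using n1 by (simp add: w_def inner_diff_left dot_square_norm)
 then have o12: "fr2 y \<bullet> fr1 y = 0" by (simp add: fr2_def w_def[symmetric] sgn_div_norm)
 have o: "fr1 y \<bullet> fr3 y = 0" "fr2 y \<bullet> fr3 y = 0" by (simp_all add: fr3_def dot_cross_self)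
 have "(norm (fr3 y))^2 = 1" using norm_cross_dot[of "fr1 y" "fr2 y"] n1 n2 o12 by (simp add: fr3_def inner_commute)
 then have n3: "norm (fr3 y) = 1" by (simp add: power2_eq_1_iff) (metis abs_norm_cancel abs_one norm_ge_zero not_one_le_zero abs_minus)
 define A :: "real^3^3" where "A = (\<chi> i. if i = 1 then fr1 y else if i = 2 then fr2 y else fr3 y)"
 have rA: "row i A = (if i = 1 then fr1 y else if i = 2 then fr2 y else fr3 y)" for i by (simp add: row_def A_def vec_eq_iff)
 have "orthogonal_matrix A" unfolding orthogonal_matrix_orthonormal_rows rA
  using n1 n2 n3 o12 o by (simp add: forall_3 orthogonal_def inner_commute)
 moreover have "Rt y = (*v) A" by (auto simp: fun_eq_iff Rt_def vec_eq_iff forall_3 matrix_vector_mul_component A_def)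
 ultimately show ?thesis by (simp add: orthogonal_transformation_matrix)
qed

lemma Rt_iso: "y \<in> Om2 ==> iso (Rt y) (Rt y)" by (rule iso_orthogonal[OF Rt_orthogonal])

text \<open>The frame moves with the rotation and inner products are preserved, so the coordinates
  stay the same. The determinant is fixed because the cross product changes sign under improper
  orthogonal maps.\<close>

lemma Rt_equivariant:
 assumes f: "orthogonal_transformation f" "det (matrix f) = 1" shows "Rt (f (fst y), f (snd y)) (f x) = Rt y x"
proof -
 have l: "linear f" by (rule orthogonal_transformation_linear[OF f(1)])
 have i: "f v \<bullet> f w = v \<bullet> w" for v w using f(1) by (simp add: orthogonal_transformation_def)
 have s: "sgn (f v) = f (sgn v)" for v by (simp add: sgn_div_norm linear_scale[OF l] orthogonal_transformation_norm[OF f(1)])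
 have 1: "fr1 (f (fst y), f (snd y)) = f (fr1 y)" by (simp add: fr1_def s)
 have 2: "fr2 (f (fst y), f (snd y)) = f (fr2 y)"
  by (simp add: fr2_def 1 i s[symmetric] linear_diff[OF l] linear_scale[OF l])
 have 3: "fr3 (f (fst y), f (snd y)) = f (fr3 y)"
  using cross_orthogonal_transformation[OF f(1)] f(2) by (simp add: fr3_def 1 2)
 show ?thesis by (simp add: Rt_def 1 2 3 i)
qed

lemma hr_invariant:
 assumes f: "orthogonal_transformation f" "det (matrix f) = 1"
 shows "distr hr borel (%y. (f (fst y), f (snd y))) = hr"
proof -
 define F where "F y = (f (fst y), f (snd y))" for y :: "R3 \<times> R3"
 note [measurable] = orthogonal_measurable[OF f(1)]
 have Fm[measurable]: "BM F" unfolding F_def by measurable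
 have "lborel = (lborel :: R3 measure) \<Otimes>\<^sub>M (lborel :: R3 measure)" by (rule lborel_prod[symmetric])
 also have "... = distr lborel borel f \<Otimes>\<^sub>M distr lborel borel f" by (simp add: lborel_distr_orthogonal[OF f(1)])
 also have "... = distr lborel2 (borel2) (%(x, y). (f x, f y))"
  by (rule pair_measure_distr) (auto simp: lborel_distr_orthogonal[OF f(1)] lborel.sigma_finite_measure_axioms)
 also have "... = distr lborel borel F" by (simp add: lborel_prod borel_prod F_def[abs_def] case_prod_beta')
 finally have d: "distr lborel borel F = lborel" by simp
 have "y \<in> Om2 \<longleftrightarrow> F y \<in> Om2" for y
 proof -
  have "cross3 (f (fst y)) (f (snd y)) = f (cross3 (fst y) (snd y))" using cross_orthogonal_transformation[OF f(1)] f(2) by simp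
  then show ?thesis using orthogonal_transformation_norm[OF f(1)] norm_eq_zero
   by (simp add: Om2_def F_def) (metis norm_eq_zero)
 qed
 then have w: "indicator Om2 (F y) = (indicator Om2 y :: ennreal)" for y by (simp add: indicator_def)
 have "hr = density (distr lborel borel F) (%y. indicator Om2 y / emeasure lborel Om2)"
  unfolding d by (simp add: hr_def uniform_measure_def)
 also have "... = distr (density lborel (%y. indicator Om2 (F y) / emeasure lborel Om2)) borel F"
  by (rule density_distr) measurable
 also have "... = distr hr borel F" unfolding w by (simp add: hr_def uniform_measure_def)
 finally show ?thesis by (simp add: F_def[abs_def])
qed

text \<open>A rotation taking x to x', applied to the frame and to the point at once, leaves
  \<open>Rt\<close> unchanged, and its action on frames preserves \<open>hr\<close>.\<close>

lemma avg_rotation: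
 fixes h :: "R3 => real"
 assumes [measurable]: "BM h" and n: "norm x = norm x'" shows "(\<integral>y. h (Rt y x) \<partial>hr) = (\<integral>y. h (Rt y x') \<partial>hr)"
proof -
 obtain f where f: "orthogonal_transformation f" "det (matrix f) = 1" "f x = x'" using rotation_exists[OF _ n] by auto
 note [measurable] = orthogonal_measurable[OF f(1)]
 have "(\<integral>y. h (Rt y x') \<partial>hr) = (\<integral>y. h (Rt y x') \<partial>distr hr borel (%y. (f (fst y), f (snd y))))" by (simp only: hr_invariant[OF f(1,2)])
 also have "... = (\<integral>y. h (Rt (f (fst y), f (snd y)) (f x)) \<partial>hr)" unfolding f(3) by (rule integral_distr) measurable
 also have "... = (\<integral>y. h (Rt y x) \<partial>hr)" by (simp only: Rt_equivariant[OF f(1,2)])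
 finally show ?thesis by simp
qed

text \<open>Nonnegativity of the variance. If \<open>h\<close> is not integrable the average is 0 by
  convention, and if its square is not integrable the right-hand side is infinite.\<close>

lemma avg_Jensen:
 assumes [measurable]: "h \<in> borel_measurable hr" shows "ennreal ((\<integral>y. h y \<partial>hr)^2) <= (\<integral>\<^sup>+y. ennreal ((h y)^2) \<partial>hr)"
proof (cases "integrable hr (%y. (h y)^2)")
 case True
 show ?thesis
 proof (cases "integrable hr h")
  case i: True
  define c where "c = (\<integral>y. h y \<partial>hr)"
  have "0 <= (\<integral>y. (h y - c)^2 \<partial>hr)" by simp
  also have "... = (\<integral>y. (h y)^2 + ((-2 * c) * h y + c^2) \<partial>hr)" by (simp add: power2_diff algebra_simps)
  also have "... = (\<integral>y. (h y)^2 \<partial>hr) + ((-2 * c) * c + c^2)"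
   using True i by (simp add: c_def[symmetric] measure_def emeasure_hr)
  finally have "c^2 <= (\<integral>y. (h y)^2 \<partial>hr)" by (simp add: power2_eq_square)
  then show ?thesis using True by (simp add: nn_integral_eq_integral c_def ennreal_leI)
 qed (simp add: not_integrable_integral_eq)
next
 case False
 have "integrable hr (%y. (h y)^2)" if "(\<integral>\<^sup>+y. ennreal ((h y)^2) \<partial>hr) < \<infinity>" by (rule integrableI_nonneg[OF _ _ that]) auto
 then have "(\<integral>\<^sup>+y. ennreal ((h y)^2) \<partial>hr) = \<infinity>" using False by (metis top.not_eq_extremum infinity_ennreal_def)
 then show ?thesis by simp
qed

text \<open>The parameters \<open>b\<close> and \<open>pj\<close> serve integrals over points, with
  \<open>pj\<close> the identity, as well as those over pairs of points, with
  \<open>pj = fst\<close> and the kernel and the remaining factors put into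
  \<open>b\<close>.\<close>

lemma avg_integral:
 fixes F :: "R3 \<times> R3 => R3 => real"
 assumes M: "sigma_finite_measure M" and [measurable]: "case_prod F \<in> borel_measurable borel2" "b \<in> borel_measurable M" "pj \<in> M \<rightarrow>\<^sub>M borel"
  and C: "!!y. y \<in> Om2 ==> (\<integral>\<^sup>+z. ennreal \<bar>b z * F y (pj z)\<bar> \<partial>M) <= C" "C < top"
 shows "(\<integral>z. b z * (\<integral>y. F y (pj z) \<partial>hr) \<partial>M) = (\<integral>y. (\<integral>z. b z * F y (pj z) \<partial>M) \<partial>hr)"
proof -
 interpret pair_sigma_finite hr M using M by (intro pair_sigma_finite.intro hr.sigma_finite_measure_axioms)
 have i: "integrable (hr \<Otimes>\<^sub>M M) (%(y, z). b z * F y (pj z))"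
 proof (rule integrableI_bounded)
  have "(\<integral>\<^sup>+w. ennreal (norm (case w of (y, z) => b z * F y (pj z))) \<partial>(hr \<Otimes>\<^sub>M M)) = (\<integral>\<^sup>+y. \<integral>\<^sup>+z. ennreal \<bar>b z * F y (pj z)\<bar> \<partial>M \<partial>hr)"
   by (subst M2.nn_integral_fst[symmetric]) (auto intro!: nn_integral_cong simp: case_prod_beta)
  also have "... <= (\<integral>\<^sup>+y. C \<partial>hr)" by (intro nn_integral_mono_AE hr_AE C)
  also have "... < \<infinity>" using C(2) by simp
  finally show "(\<integral>\<^sup>+w. ennreal (norm (case w of (y, z) => b z * F y (pj z))) \<partial>(hr \<Otimes>\<^sub>M M)) < \<infinity>" .
 qed measurable
 have "(\<integral>z. b z * (\<integral>y. F y (pj z) \<partial>hr) \<partial>M) = (\<integral>z. (\<integral>y. b z * F y (pj z) \<partial>hr) \<partial>M)" by simp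
 also have "... = (\<integral>y. (\<integral>z. b z * F y (pj z) \<partial>M) \<partial>hr)" by (rule Fubini_integral[OF i])
 finally show ?thesis .
qed

lemma avg_integral_const:
 fixes F :: "R3 \<times> R3 => R3 => real"
 assumes "sigma_finite_measure M" "case_prod F \<in> borel_measurable borel2" "b \<in> borel_measurable M" "pj \<in> M \<rightarrow>\<^sub>M borel"
  "!!y. y \<in> Om2 ==> (\<integral>\<^sup>+z. ennreal \<bar>b z * F y (pj z)\<bar> \<partial>M) <= C" "C < top"
  and c: "!!y. y \<in> Om2 ==> (\<integral>z. b z * F y (pj z) \<partial>M) = c" shows "(\<integral>z. b z * (\<integral>y. F y (pj z) \<partial>hr) \<partial>M) = c"
proof -
 interpret M: sigma_finite_measure M by (rule assms(1))
 note [measurable] = assms(2-4)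
 have "(\<integral>z. b z * (\<integral>y. F y (pj z) \<partial>hr) \<partial>M) = (\<integral>y. (\<integral>z. b z * F y (pj z) \<partial>M) \<partial>hr)" by (rule avg_integral) fact+
 also have "... = (\<integral>y. c \<partial>hr)" by (intro integral_cong_AE hr_AE c) measurable
 finally show ?thesis by simp
qed

section \<open>Averages of functions and of their weak gradients\<close>

definition avg :: "(R3 => real) => R3 => real" where "avg v x = (\<integral>y. v (Rt y x) \<partial>hr)"
definition avgg :: "(R3 => R3) => R3 => R3" where "avgg h x = (\<chi> i. \<integral>y. pb (Rt y) (h (Rt y x)) $ i \<partial>hr)"

lemma vec_lambda_vec3: "(\<chi> i. F i) = vec3 (F 1) (F 2) (F 3)"
 by (simp add: vec_eq_iff forall_3)

lemma pb_Rt_measurable[measurable (raw)]: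
 assumes [measurable]: "f \<in> borel_measurable N" "g \<in> borel_measurable N"
 shows "(%w. pb (Rt (f w)) (g w)) \<in> borel_measurable N" unfolding pb_def vec_lambda_vec3 by measurable

lemma sq_comp_measurable[measurable (raw)]:
 assumes [measurable]: "BM v" "f \<in> borel_measurable N" shows "(%w. sq v (f w)) \<in> borel_measurable N"
 unfolding sq_def by measurable

lemma nsq_comp_measurable[measurable (raw)]:
 assumes [measurable]: "BM v" "f \<in> borel_measurable N" shows "(%w. nsq v (f w)) \<in> borel_measurable N"
 unfolding nsq_def by measurable

lemma avg_measurable[measurable (raw)]:
 assumes [measurable]: "BM v" shows "BM (avg v)" unfolding avg_def[abs_def] by measurable

lemma avgg_measurable[measurable (raw)]:
 assumes [measurable]: "BM h" shows "BM (avgg h)" unfolding avgg_def[abs_def] vec_lambda_vec3 by measurable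

text \<open>By Jensen the square of the average is at most the average \<open>S\<close> of the
  squares. Expanding \<open>W a S S\<close> gives a double average of interactions of rotated
  copies, and \<open>W_le_sum\<close> bounds all of these by the same number, since each copy has
  the self-interaction of \<open>v\<close>. The weak gradient is the average of the pulled-back
  ones, by Fubini in the defining identity.\<close>

lemma avg_X:
 assumes a: "a > 0" and v: "X a v h" shows "X a (avg v) (avgg h)"
proof -
 have [measurable]: "BM v" "BM h" using v by auto
 define S where "S x = (\<integral>\<^sup>+y. sq v (Rt y x) \<partial>hr)" for x
 have [measurable]: "BM S" unfolding S_def by measurable
 have sS: "sq (avg v) x <= S x" for x unfolding sq_def S_def avg_def by (rule avg_Jensen) measurable
 interpret P: pair_sigma_finite "lborel :: R3 measure" hr
  by (intro pair_sigma_finite.intro hr.sigma_finite_measure_axioms lborel.sigma_finite_measure_axioms)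
 have Wy: "W a S g = (\<integral>\<^sup>+y. W a (%x. sq v (Rt y x)) g \<partial>hr)" if [measurable]: "BM g" for g
 proof -
  have "W a S g = (NI x. NI z. \<integral>\<^sup>+y. ennreal (kernel a (x - z)) * (sq v (Rt y x) * g z) \<partial>hr)"
   unfolding W_def S_def by (simp add: nn_integral_cmult nn_integral_multc)
  also have "... = (NI x. \<integral>\<^sup>+y. (NI z. ennreal (kernel a (x - z)) * (sq v (Rt y x) * g z)) \<partial>hr)"
   by (intro nn_integral_cong P.Fubini'[symmetric]) measurable
  also have "... = (\<integral>\<^sup>+y. (NI x. NI z. ennreal (kernel a (x - z)) * (sq v (Rt y x) * g z)) \<partial>hr)"
   by (intro P.Fubini'[symmetric]) measurable
  finally show ?thesis unfolding W_def .
 qed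
 have Wc: "W a (%x. sq v (Rt y x)) (%x. sq v (Rt y x)) = W a (sq v) (sq v)" if "y \<in> Om2" for y
  by (rule W_isometry) (auto simp: iso_distr[OF Rt_iso[OF that]] iso_norm[OF Rt_iso[OF that]])
 define w where "w = CW * (W a (sq v) (sq v) + W a (sq v) (sq v))"
 have wt: "w < top" using v CW_finite by (simp add: w_def X_def ennreal_mult_less_top)
 have "W a (sq (avg v)) (sq (avg v)) <= W a S S" by (intro W_mono sS)
 also have "... = (\<integral>\<^sup>+y. W a (%x. sq v (Rt y x)) S \<partial>hr)" by (rule Wy) measurable
 also have "... <= (\<integral>\<^sup>+y. w \<partial>hr)"
 proof (intro nn_integral_mono_AE hr_AE)
  fix y assume y: "y \<in> Om2"
  have "W a (%x. sq v (Rt y x)) S = W a S (%x. sq v (Rt y x))" by (rule W_commute) (use a in measurable)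
  also have "... = (\<integral>\<^sup>+y'. W a (%x. sq v (Rt y' x)) (%x. sq v (Rt y x)) \<partial>hr)" by (rule Wy) measurable
  also have "... <= (\<integral>\<^sup>+y'. w \<partial>hr)"
  proof (intro nn_integral_mono_AE hr_AE)
   fix y' assume y': "y' \<in> Om2"
   have "W a (%x. sq v (Rt y' x)) (%x. sq v (Rt y x)) <= CW * (W a (%x. sq v (Rt y' x)) (%x. sq v (Rt y' x)) + W a (%x. sq v (Rt y x)) (%x. sq v (Rt y x)))"
    by (rule W_le_sum[OF a]) measurable
   then show "W a (%x. sq v (Rt y' x)) (%x. sq v (Rt y x)) <= w" unfolding Wc[OF y] Wc[OF y'] w_def .
  qed
  finally show "W a (%x. sq v (Rt y x)) S <= w" by simp
 qed
 finally have Wf: "W a (sq (avg v)) (sq (avg v)) < top" using wt by (auto intro: le_less_trans)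
 have lv: "loc2 v" using v by (auto simp: X_def wpair_loc2)
 have lS: "bm S 0 r = bm (sq v) 0 r" for r
 proof -
  have "bm S 0 r = (NI x. \<integral>\<^sup>+y. (if dist 0 x < r then sq v (Rt y x) else 0) \<partial>hr)"
   unfolding bm_def S_def by (intro nn_integral_cong) auto
  also have "... = (\<integral>\<^sup>+y. bm (%x. sq v (Rt y x)) 0 r \<partial>hr)" unfolding bm_def by (rule P.Fubini'[symmetric]) measurable
  also have "... = (\<integral>\<^sup>+y. bm (sq v) 0 r \<partial>hr)"
  proof (intro nn_integral_cong_AE hr_AE)
   fix y assume y: "y \<in> Om2"
   have "Rt y 0 = 0" by (simp add: linear_0[OF orthogonal_transformation_linear[OF Rt_orthogonal[OF y]]])
   then show "bm (%x. sq v (Rt y x)) 0 r = bm (sq v) 0 r" using bm_iso[OF Rt_iso[OF y], of "sq v" 0 r] by simp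
  qed
  finally show ?thesis by simp
 qed
 have l: "loc2 (avg v)" unfolding loc2_iff_bm
 proof (intro conjI allI)
  fix r
  have "bm (sq (avg v)) 0 r <= bm S 0 r" by (rule bm_mono) (auto intro: sS)
  then show "bm (sq (avg v)) 0 r < top" using lv unfolding lS loc2_iff_bm by (blast intro: le_less_trans)
 qed measurable
 have n: "(NE x. (norm (avgg h x))^2) < \<infinity>"
 proof -
  have "ennreal ((norm (avgg h x))^2) <= (\<integral>\<^sup>+y. nsq h (Rt y x) \<partial>hr)" for x
  proof -
   have "ennreal ((norm (avgg h x))^2) = (\<Sum>i\<in>UNIV. ennreal ((\<integral>y. pb (Rt y) (h (Rt y x)) $ i \<partial>hr)^2))"
    unfolding ennreal_norm_sq_vec by (simp add: avgg_def)
   also have "... <= (\<Sum>i\<in>UNIV. \<integral>\<^sup>+y. ennreal ((pb (Rt y) (h (Rt y x)) $ i)^2) \<partial>hr)" by (intro sum_mono avg_Jensen) measurable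
   also have "... = (\<integral>\<^sup>+y. ennreal ((norm (pb (Rt y) (h (Rt y x))))^2) \<partial>hr)"
    unfolding ennreal_norm_sq_vec by (rule nn_integral_sum[symmetric]) measurable
   also have "... = (\<integral>\<^sup>+y. nsq h (Rt y x) \<partial>hr)"
    by (intro nn_integral_cong_AE hr_AE) (simp add: nsq_def pb_orthogonal(2)[OF Rt_orthogonal])
   finally show ?thesis .
  qed
  then have "(NE x. (norm (avgg h x))^2) <= (NI x. \<integral>\<^sup>+y. nsq h (Rt y x) \<partial>hr)" by (intro nn_integral_mono)
  also have "... = (\<integral>\<^sup>+y. (NI x. nsq h (Rt y x)) \<partial>hr)" by (rule P.Fubini'[symmetric]) measurable
  also have "... = (\<integral>\<^sup>+y. (NI x. nsq h x) \<partial>hr)"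
   by (intro nn_integral_cong_AE hr_AE nn_integral_preserving iso_distr[OF Rt_iso]) measurable
  also have "... < \<infinity>" using L2v_nsq[OF X_L2v[OF v]] by simp
  finally show ?thesis .
 qed
 have loc_bound: "(NI x. ennreal \<bar>ps x * f x\<bar>) <= (NE x. (ps x)^2) + bm (sq f) 0 (r + 1)"
  if [measurable]: "BM ps" "BM f" and r: "!!x. norm x > r ==> ps x = 0" for ps f :: "R3 => real" and r
 proof -
  have "(NI x. ennreal \<bar>ps x * f x\<bar>) <= (NI x. ennreal ((ps x)^2) + (if dist 0 x < r + 1 then sq f x else 0))"
  proof (intro nn_integral_mono)
   show "ennreal \<bar>ps x * f x\<bar> <= ennreal ((ps x)^2) + (if dist 0 x < r + 1 then sq f x else 0)" for x
    using abs_mult_le_sq[of "ps x" "f x"] r[of x] by (cases "norm x > r") (auto simp: sq_def ennreal_leI simp flip: ennreal_plus)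
  qed
  then show ?thesis unfolding bm_def by (subst (asm) nn_integral_add) auto
 qed
 have "(LI x. avg v x * partial i vp x) = - (LI x. avgg h x $ i * vp x)" if vp: "test_fun vp" for vp i
 proof -
  obtain r B where r: "!!x. norm x > r ==> vp x = 0" "!!x i. norm x > r ==> partial i vp x = 0"
   using test_fun_support[OF vp] by metis
  note [measurable] = test_fun_measurable[OF vp]
  have fin: "(NE x. (ps x)^2) < top" if "test_fun ps" for ps :: "R3 => real"
   using loc2_test_integrable(1)[OF loc2_continuous[OF test_fun_continuous(1)[OF that]] that]
   by (simp add: nn_integral_eq_integral power2_eq_square)
  have "(LI x. partial i vp x * (\<integral>y. v (Rt y x) \<partial>hr)) = (\<integral>y. (LI x. partial i vp x * v (Rt y x)) \<partial>hr)"
  proof (rule avg_integral[where pj="%x. x" and C="(NE x. (partial i vp x)^2) + bm (sq v) 0 (r + 1)", OF lborel.sigma_finite_measure_axioms])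
   show "(NI x. ennreal \<bar>partial i vp x * v (Rt y x)\<bar>) <= (NE x. (partial i vp x)^2) + bm (sq v) 0 (r + 1)" if y: "y \<in> Om2" for y
   proof -
    have "Rt y 0 = 0" by (simp add: linear_0[OF orthogonal_transformation_linear[OF Rt_orthogonal[OF y]]])
    then show ?thesis using loc_bound[of "partial i vp" "%x. v (Rt y x)" r] r(2) bm_iso[OF Rt_iso[OF y], of "sq v" 0 "r + 1"]
     by (simp add: sq_def[abs_def])
   qed
   show "(NE x. (partial i vp x)^2) + bm (sq v) 0 (r + 1) < top"
    using fin[OF test_fun_partial[OF vp]] lv by (simp add: loc2_iff_bm)
  qed measurable
  moreover have "(LI x. vp x * (\<integral>y. pb (Rt y) (h (Rt y x)) $ i \<partial>hr)) = (\<integral>y. (LI x. vp x * pb (Rt y) (h (Rt y x)) $ i) \<partial>hr)"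
  proof (rule avg_integral[where pj="%x. x" and C="(NE x. (vp x)^2) + ennreal (N2 h)", OF lborel.sigma_finite_measure_axioms])
   show "(NI x. ennreal \<bar>vp x * pb (Rt y) (h (Rt y x)) $ i\<bar>) <= (NE x. (vp x)^2) + ennreal (N2 h)" if y: "y \<in> Om2" for y
   proof -
    have "(NI x. ennreal \<bar>vp x * pb (Rt y) (h (Rt y x)) $ i\<bar>) <= (NI x. ennreal ((vp x)^2) + nsq h (Rt y x))"
    proof (intro nn_integral_mono)
     fix x
     have "(pb (Rt y) (h (Rt y x)) $ i)^2 <= (norm (h (Rt y x)))^2"
      using component_le_norm_cart[of "pb (Rt y) (h (Rt y x))" i] pb_orthogonal(2)[OF Rt_orthogonal[OF y], of "h (Rt y x)"]
      by (simp add: abs_le_square_iff[symmetric])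
     then have "\<bar>vp x * pb (Rt y) (h (Rt y x)) $ i\<bar> <= (vp x)^2 + (norm (h (Rt y x)))^2"
      using abs_mult_le_sq[of "vp x" "pb (Rt y) (h (Rt y x)) $ i"] by linarith
     then show "ennreal \<bar>vp x * pb (Rt y) (h (Rt y x)) $ i\<bar> <= ennreal ((vp x)^2) + nsq h (Rt y x)"
      by (simp add: nsq_def ennreal_leI flip: ennreal_plus)
    qed
    also have "... = (NE x. (vp x)^2) + (NI x. nsq h (Rt y x))" by (rule nn_integral_add) measurable
    also have "(NI x. nsq h (Rt y x)) = (NI x. nsq h x)"
     by (intro nn_integral_preserving iso_distr[OF Rt_iso[OF y]]) measurable
    finally show ?thesis by (simp add: L2v_nsq[OF X_L2v[OF v]])
   qed
   show "(NE x. (vp x)^2) + ennreal (N2 h) < top" using fin[OF vp] by simp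
  qed measurable
  moreover have "(\<integral>y. (LI x. partial i vp x * v (Rt y x)) \<partial>hr) = (\<integral>y. - (LI x. vp x * pb (Rt y) (h (Rt y x)) $ i) \<partial>hr)"
  proof (intro integral_cong_AE hr_AE)
   fix y assume y: "y \<in> Om2"
   have "wpair (%x. v (Rt y x)) (%x. pb (Rt y) (h (Rt y x)))" by (rule iso_wpair[OF Rt_iso[OF y]]) (use v in \<open>simp add: X_def\<close>)
   then show "(LI x. partial i vp x * v (Rt y x)) = - (LI x. vp x * pb (Rt y) (h (Rt y x)) $ i)"
    using vp by (simp add: wpair_def mult.commute)
  qed measurable
  ultimately show ?thesis by (simp add: avg_def avgg_def mult.commute)
 qed
 then show ?thesis using l n Wf by (simp add: X_def wpair_def)
qed

lemma avg_radial: "BM v ==> radial (avg v)"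
 unfolding radial_AE by (rule exI[of _ "avg v"]) (auto simp: avg_def intro: avg_rotation)

text \<open>Averaging over rotations does not change the pairing with a radial function, so criticality
 among radial functions implies criticality.\<close>

lemma L2v_component:
 assumes f: "L2v f" and h: "L2v h"
 shows "integrable lborel (%x. f x $ i * h x $ i)" "\<bar>(LI x. f x $ i * h x $ i)\<bar> <= N2 f + N2 h"
  "(NI x. ennreal \<bar>f x $ i * h x $ i\<bar>) <= ennreal (N2 f + N2 h)"
proof -
 have [measurable]: "BM f" "BM h" using f h by auto
 have b: "\<bar>f x $ i * h x $ i\<bar> <= (norm (f x))^2 + (norm (h x))^2" for x
 proof -
  have "(f x $ i)^2 <= (norm (f x))^2" "(h x $ i)^2 <= (norm (h x))^2"
   using component_le_norm_cart[of "f x" i] component_le_norm_cart[of "h x" i] by (simp_all add: abs_le_square_iff[symmetric])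
  then show ?thesis using abs_mult_le_sq[of "f x $ i" "h x $ i"] by linarith
 qed
 have s: "integrable lborel (%x. (norm (f x))^2 + (norm (h x))^2)" using L2v_sq_integrable[OF f] L2v_sq_integrable[OF h] by simp
 show i: "integrable lborel (%x. f x $ i * h x $ i)"
  by (rule Bochner_Integration.integrable_bound[OF s]) (use b in auto)
 have "(LI x. \<bar>f x $ i * h x $ i\<bar>) <= N2 f + N2 h"
  using integral_mono[OF integrable_abs[OF i] s b] L2v_sq_integrable[OF f] L2v_sq_integrable[OF h] by (simp add: N2_def)
 then show "\<bar>(LI x. f x $ i * h x $ i)\<bar> <= N2 f + N2 h" "(NI x. ennreal \<bar>f x $ i * h x $ i\<bar>) <= ennreal (N2 f + N2 h)"
  using order_trans[OF integral_abs_bound[of lborel "%x. f x $ i * h x $ i"]] i by (simp_all add: nn_integral_eq_integral ennreal_leI)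
qed

lemma ip_avgg:
 assumes a: "a > 0" and U: "X a U G" "radial U" and v: "X a v h" shows "ip G (avgg h) = ip G h"
proof -
 have [measurable]: "BM G" "BM h" "BM U" using U v by auto
 have L: "L2v G" "L2v h" using U v X_L2v by auto
 define hy where "hy y x = pb (Rt y) (h (Rt y x))" for y x
 have [measurable]: "case_prod hy \<in> borel_measurable borel2" unfolding hy_def by measurable
 have Ly: "L2v (hy y)" "N2 (hy y) = N2 h" if y: "y \<in> Om2" for y
  using X_L2v[OF iso_X[OF Rt_iso[OF y] v]] iso_N2[OF Rt_iso[OF y], of h] by (simp_all add: hy_def[abs_def])
 define c where "c i y = (LI x. G x $ i * hy y x $ i)" for i y
 have [measurable]: "BM (c i)" for i unfolding c_def by measurable
 have "\<bar>c i y\<bar> <= N2 G + N2 h" if "y \<in> Om2" for i y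
  using L2v_component(2)[OF L(1) Ly(1)[OF that]] Ly(2)[OF that] by (simp add: c_def)
 then have ci: "integrable hr (c i)" for i by (intro hr.integrable_const_bound[of _ "N2 G + N2 h"] hr_AE) simp_all
 have "ip G (avgg h) = (LI x. (\<Sum>i\<in>UNIV. G x $ i * avgg h x $ i))" by (simp add: ip_def inner_vec_def)
 also have "... = (\<Sum>i\<in>UNIV. (LI x. G x $ i * avgg h x $ i))"
  by (intro Bochner_Integration.integral_sum L2v_component L X_L2v[OF avg_X[OF a v]])
 also have "... = (\<Sum>i\<in>UNIV. \<integral>y. c i y \<partial>hr)"
 proof (rule sum.cong)
  show "(LI x. G x $ i * avgg h x $ i) = (\<integral>y. c i y \<partial>hr)" for i
   unfolding avgg_def c_def hy_def[symmetric] vec_lambda_beta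
   by (rule avg_integral[where pj="%x. x" and F="%y x. hy y x $ i" and C="ennreal (N2 G + N2 h)", OF lborel.sigma_finite_measure_axioms])
    (measurable, use L2v_component(3)[OF L(1) Ly(1)] Ly(2) in simp_all)
 qed simp
 also have "... = (\<integral>y. (\<Sum>i\<in>UNIV. c i y) \<partial>hr)" by (rule Bochner_Integration.integral_sum[symmetric]) (rule ci)
 also have "... = (\<integral>y. ip G h \<partial>hr)"
 proof (intro integral_cong_AE hr_AE)
  fix y assume y: "y \<in> Om2"
  \<comment> \<open>A radial function agrees almost everywhere with its rotated copy, so uniqueness
    of weak gradients makes the gradient equivariant.\<close>
  have "AL x. pb (Rt y) (G (Rt y x)) = G x"
   using iso_X[OF Rt_iso[OF y] U(1)] U(1) radial_orthogonal[OF U(2) Rt_orthogonal[OF y]]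
   by (intro wpair_zero_grad_unique[of "%x. U (Rt y x)" _ U]) (auto simp: X_def)
  note ae = this
  have "(\<Sum>i\<in>UNIV. c i y) = (LI x. (\<Sum>i\<in>UNIV. G x $ i * hy y x $ i))"
   unfolding c_def by (intro Bochner_Integration.integral_sum[symmetric] L2v_component L Ly y)
  also have "... = (LI x. G x \<bullet> hy y x)" by (simp add: inner_vec_def)
  also have "... = (LI x. pb (Rt y) (G (Rt y x)) \<bullet> pb (Rt y) (h (Rt y x)))"
   unfolding hy_def using ae by (intro integral_cong_AE) auto
  also have "... = (LI x. G (Rt y x) \<bullet> h (Rt y x))" by (simp add: pb_orthogonal(3)[OF Rt_orthogonal[OF y]])
  also have "... = ip G h" unfolding ip_def by (rule iso_integral[OF Rt_iso[OF y], of "%x. G x \<bullet> h x"]) measurable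
  finally show "(\<Sum>i\<in>UNIV. c i y) = ip G h" .
 qed measurable
 finally show ?thesis by simp
qed

lemma Cp'_avg:
 assumes a: "a > 0" and p: "4 < p" "p < 6" and U: "X a U G" "radial U" and v: "X a v h"
 shows "Cp' p U (avg v) = Cp' p U v" unfolding Cp'_def avg_def
proof (rule avg_integral_const[where pj="%x. x" and C="ennreal (Cp p U) + ennreal (Cp p v)", OF lborel.sigma_finite_measure_axioms])
 have [measurable]: "BM U" "BM v" using U v by auto
 show "case_prod (%y x. v (Rt y x)) \<in> borel_measurable borel2" "(%x. \<bar>U x\<bar> powr (p - 2) * U x) \<in> borel_measurable lborel" by measurable
 fix y assume y: "y \<in> Om2"
 have "(NI x. ennreal \<bar>\<bar>U x\<bar> powr (p - 2) * U x * v (Rt y x)\<bar>) <= (NI x. ennreal (\<bar>U x\<bar> powr p) + ennreal (\<bar>v (Rt y x)\<bar> powr p))"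
  using Young_powr[of "\<bar>U _\<bar>" "\<bar>v (Rt y _)\<bar>" 1 p] p
  by (intro nn_integral_mono) (simp add: abs_powr_mult ennreal_leI flip: ennreal_plus)
 also have "... = (NE x. \<bar>U x\<bar> powr p) + (NE x. \<bar>v (Rt y x)\<bar> powr p)" by (rule nn_integral_add) measurable
 also have "(NE x. \<bar>v (Rt y x)\<bar> powr p) = (NE x. \<bar>v x\<bar> powr p)"
  by (rule nn_integral_preserving[where f="%x. ennreal (\<bar>v x\<bar> powr p)"]) (auto simp: iso_distr[OF Rt_iso[OF y]])
 finally show "(NI x. ennreal \<bar>\<bar>U x\<bar> powr (p - 2) * U x * v (Rt y x)\<bar>) <= ennreal (Cp p U) + ennreal (Cp p v)"
  by (simp add: X_Lp(2)[OF a p U(1)] X_Lp(2)[OF a p v])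
 have "(LI x. \<bar>U x\<bar> powr (p - 2) * U x * v (Rt y x)) = (LI x. \<bar>U (Rt y x)\<bar> powr (p - 2) * U (Rt y x) * v (Rt y x))"
  using radial_orthogonal[OF U(2) Rt_orthogonal[OF y]] by (intro integral_cong_AE) auto
 also have "... = (LI x. \<bar>U x\<bar> powr (p - 2) * U x * v x)"
  by (rule iso_integral[OF Rt_iso[OF y], of "%x. \<bar>U x\<bar> powr (p - 2) * U x * v x"]) measurable
 finally show "(LI x. \<bar>U x\<bar> powr (p - 2) * U x * v (Rt y x)) = (LI x. \<bar>U x\<bar> powr (p - 2) * U x * v x)" .
qed auto

lemma Dk_avg:
 assumes a: "a > 0" and U: "X a U G" "radial U" and v: "X a v h"
 shows "Dk a (%x. U x * avg v x) (%x. (U x)^2) = Dk a (%x. U x * v x) (%x. (U x)^2)"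
proof -
 have [measurable]: "BM U" "BM v" using U v by auto
 define C where "C = (1 + 2 * enn2real CW) * (Bf a U + Bf a v)"
 have sf: "sigma_finite_measure PP" unfolding PP_def by (rule lborel_pair.sigma_finite_measure_axioms)
 have "(\<integral>z. kernel a (fst z - snd z) * U (fst z) * (U (snd z))^2 * (\<integral>y. v (Rt y (fst z)) \<partial>hr) \<partial>PP) = Dk a (%x. U x * v x) (%x. (U x)^2)"
 proof (rule avg_integral_const[where pj=fst and C="ennreal C", OF sf])
  show "case_prod (%y x. v (Rt y x)) \<in> borel_measurable borel2"
   "(%z. kernel a (fst z - snd z) * U (fst z) * (U (snd z))^2) \<in> borel_measurable PP" "fst \<in> PP \<rightarrow>\<^sub>M borel" by measurable
  fix y assume y: "y \<in> Om2"
  define vy where "vy x = v (Rt y x)" for x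
  have Xy: "X a vy (%x. pb (Rt y) (h (Rt y x)))" unfolding vy_def by (rule iso_X[OF Rt_iso[OF y] v])
  have [measurable]: "BM vy" unfolding vy_def by measurable
  have e: "kernel a (fst z - snd z) * U (fst z) * (U (snd z))^2 * v (Rt y (fst z)) = kernel a (fst z - snd z) * ((U (fst z) * vy (fst z)) * (U (snd z))^2)" for z
   by (simp add: vy_def)
  have Bv: "Bf a vy = Bf a v" using iso_Dk[OF Rt_iso[OF y], of "%x. (v x)^2" "%x. (v x)^2" a] by (simp add: Bf_def vy_def[abs_def])
  define ab where "ab f = (%x. \<bar>f x\<bar>)" for f :: "R3 => real"
  have b: "\<bar>\<bar>U x * vy x\<bar>\<bar> <= (U x)^2 + (vy x)^2" "\<bar>(U x)^2\<bar> <= (U x)^2 + (vy x)^2" for x using abs_mult_le_sq[of "U x" "vy x"] by auto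
  have D: "Di a (%x. \<bar>U x * vy x\<bar>) (%x. (U x)^2)" "\<bar>Dk a (%x. \<bar>U x * vy x\<bar>) (%x. (U x)^2)\<bar> <= Dk a (%x. (U x)^2 + (vy x)^2) (%x. (U x)^2 + (vy x)^2)"
   by (rule Di_quad[OF a U(1) Xy _ _ b]; measurable)+
  have "(\<integral>\<^sup>+z. ennreal \<bar>kernel a (fst z - snd z) * U (fst z) * (U (snd z))^2 * v (Rt y (fst z))\<bar> \<partial>PP) = ennreal (Dk a (%x. \<bar>U x * vy x\<bar>) (%x. (U x)^2))"
   unfolding e Dk_def abs_mult abs_of_nonneg[OF kernel_bounds(1)[OF a]] using D(1)
   by (subst nn_integral_eq_integral[symmetric]) (auto simp: Di_def abs_mult kernel_bounds(1)[OF a])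
  also have "... <= ennreal C" using D(2) Dk_sum_bound[OF a U(1) Xy] by (intro ennreal_leI) (simp add: C_def Bv)
  finally show "(\<integral>\<^sup>+z. ennreal \<bar>kernel a (fst z - snd z) * U (fst z) * (U (snd z))^2 * v (Rt y (fst z))\<bar> \<partial>PP) <= ennreal C" .
  have "(\<integral>z. kernel a (fst z - snd z) * U (fst z) * (U (snd z))^2 * v (Rt y (fst z)) \<partial>PP) = Dk a (%x. U x * vy x) (%x. (U x)^2)"
   unfolding e Dk_def ..
  also have "... = Dk a (%x. U (Rt y x) * v (Rt y x)) (%x. (U (Rt y x))^2)" unfolding Dk_def
  proof (intro integral_cong_AE)
   show "AE z in PP. kernel a (fst z - snd z) * (U (fst z) * vy (fst z) * (U (snd z))^2)
     = kernel a (fst z - snd z) * (U (Rt y (fst z)) * v (Rt y (fst z)) * (U (Rt y (snd z)))^2)"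
    using AE_PP[OF radial_orthogonal[OF U(2) Rt_orthogonal[OF y]]] by eventually_elim (simp add: vy_def)
  qed measurable
  also have "... = Dk a (%x. U x * v x) (%x. (U x)^2)" by (rule iso_Dk[OF Rt_iso[OF y], of "%x. U x * v x" "%x. (U x)^2"]) measurable
  finally show "(\<integral>z. kernel a (fst z - snd z) * U (fst z) * (U (snd z))^2 * v (Rt y (fst z)) \<partial>PP) = Dk a (%x. U x * v x) (%x. (U x)^2)" .
 qed auto
 then show ?thesis by (simp add: Dk_def avg_def mult_ac)
qed

section \<open>Lebesgue measurable functions\<close>

lemma lebesgue_transfer:
 fixes f f' :: "R3 => real"
 assumes "f \<in> borel_measurable lebesgue" "BM f'" and ae: "AL x. f x = f' x"
 shows "integrable lebesgue f \<longleftrightarrow> integrable lborel f'" "(\<integral>x. f x \<partial>lebesgue) = (LI x. f' x)"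
proof -
 have m: "f' \<in> borel_measurable lborel" "f' \<in> borel_measurable lebesgue" using assms(2) by (simp_all add: measurable_completion)
 note ae' = AE_completion[OF ae]
 show "integrable lebesgue f \<longleftrightarrow> integrable lborel f'"
  using integrable_cong_AE[OF assms(1) m(2) ae'] integrable_completion[OF m(1)] by simp
 show "(\<integral>x. f x \<partial>lebesgue) = (LI x. f' x)"
  using integral_cong_AE[OF assms(1) m(2) ae'] integral_completion[OF m(1)] by simp
qed

lemma lebesgueI: "BM f ==> f \<in> borel_measurable lebesgue"
 by (rule measurable_completion) simp

text \<open>The notions of the theorem refer to the completed measure, while Fubini arguments are
  carried out with Borel functions; Borel representatives link the two.\<close>

definition rep :: "(R3 => 'b::real_normed_vector) => (R3 => 'b) => bool" where
 "rep u u' \<longleftrightarrow> u \<in> borel_measurable lebesgue & BM u' & (AL x. u x = u' x)"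

lemma rep_refl: "BM u ==> rep u u" by (simp add: rep_def lebesgueI)

lemma rep_measurable[measurable_dest]: "rep u u' ==> u \<in> borel_measurable lebesgue" "rep u u' ==> BM u'"
 by (simp_all add: rep_def)

lemma rep_AE: "rep u u' ==> AL x. u x = u' x" by (simp add: rep_def)

lemma rep_real: "(u :: R3 => real) \<in> borel_measurable lebesgue ==> EX u'. rep u u'"
 using completion_ex_borel_measurable_real[of u lborel] by (auto simp: rep_def)

lemma rep_vec:
 assumes "(g :: R3 => R3) \<in> borel_measurable lebesgue" shows "EX g'. rep g g'"
proof -
 have "(%x. g x $ i) \<in> borel_measurable lebesgue" for i using measurable_compose[OF assms vec_nth_measurable] by simp
 then have "EX c. rep (%x. g x $ i) c" for i by (rule rep_real)
 then obtain c where c: "!!i. rep (%x. g x $ i) (c i)" by metis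
 have [measurable]: "BM (c i)" for i using c[of i] by (rule rep_measurable)
 have "AL x. g x = vec3 (c 1 x) (c 2 x) (c 3 x)"
  using rep_AE[OF c[of 1]] rep_AE[OF c[of 2]] rep_AE[OF c[of 3]] by eventually_elim (simp add: vec_eq_iff forall_3)
 then show ?thesis using assms by (intro exI[of _ "%x. vec3 (c 1 x) (c 2 x) (c 3 x)"]) (simp add: rep_def)
qed

lemma weak_gradient_rep:
 assumes u: "rep u u'" and g: "rep g g'"
 shows "weak_gradient u g \<longleftrightarrow> (ALL vp. test_fun vp --> (ALL i. integrable lborel (%x. u' x * partial i vp x) &
  integrable lborel (%x. g' x $ i * vp x) & (LI x. u' x * partial i vp x) = - (LI x. g' x $ i * vp x)))"
proof -
 have "(integrable lebesgue (%x. u x * partial i vp x) \<longleftrightarrow> integrable lborel (%x. u' x * partial i vp x)) &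
  (integrable lebesgue (%x. g x $ i * vp x) \<longleftrightarrow> integrable lborel (%x. g' x $ i * vp x)) &
  (\<integral>x. u x * partial i vp x \<partial>lebesgue) = (LI x. u' x * partial i vp x) &
  (\<integral>x. g x $ i * vp x \<partial>lebesgue) = (LI x. g' x $ i * vp x)" if vp: "test_fun vp" for vp i
 proof -
  note [measurable] = test_fun_measurable[OF vp] test_fun_measurable[OF vp, THEN lebesgueI] rep_measurable[OF u] rep_measurable[OF g]
  have [measurable]: "(%x. g x $ i) \<in> borel_measurable lebesgue"
   using measurable_compose[OF rep_measurable(1)[OF g] vec_nth_measurable] by simp
  have a: "AL x. u x * partial i vp x = u' x * partial i vp x" "AL x. g x $ i * vp x = g' x $ i * vp x"
   using rep_AE[OF u] rep_AE[OF g] by (auto elim: eventually_mono)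
  have m: "BM (%x. u' x * partial i vp x)" "BM (%x. g' x $ i * vp x)"
   "(%x. u x * partial i vp x) \<in> borel_measurable lebesgue" "(%x. g x $ i * vp x) \<in> borel_measurable lebesgue" by measurable
  show ?thesis using lebesgue_transfer[OF m(3,1) a(1)] lebesgue_transfer[OF m(4,2) a(2)] by blast
 qed
 then show ?thesis unfolding weak_gradient_def using rep_measurable(1)[OF g] by simp
qed

text \<open>\<open>box_approx\<close> on the box enlarged by 1 in every direction has a positive
  minimum on the closed box, so integrability against this single test function gives integrability
  over the box.\<close>

lemma test_integrable_box:
 assumes [measurable]: "BM h" and h: "!!vp. test_fun vp ==> integrable lborel (%x. h x * vp x)"
 shows "integrable lborel (%x. h x * indicator (box a b) x :: real)"
proof (cases "cbox a b = {}")
 case True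
 then have "box a b = {}" using box_subset_cbox[of a b] by auto
 then show ?thesis by simp
next
 case False
 define vp where "vp = box_approx (a - (\<chi> i. 1)) (b + (\<chi> i. 1)) 1"
 have vp: "test_fun vp" unfolding vp_def by (rule test_fun_box_approx)
 have pos: "vp x > 0" if "x \<in> cbox a b" for x
 proof -
  have "a $ i <= x $ i" "x $ i <= b $ i" for i using that by (auto simp: mem_box_cart)
  then have "0 < flat 0 (x $ i + (1 - a $ i)) * flat 0 (- x $ i + (b $ i + 1))" for i
   by (intro mult_pos_pos) (auto simp: flat_def intro: add_nonneg_pos add_pos_nonneg, smt+)
  then show ?thesis unfolding vp_def box_approx_def tens_def by (intro prod_pos) (auto simp: algebra_simps)
 qed
 obtain x0 where x0: "x0 \<in> cbox a b" "!!x. x \<in> cbox a b ==> vp x0 <= vp x"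
  using continuous_attains_inf[OF compact_cbox False continuous_on_subset[OF test_fun_continuous(1)[OF vp]]] by auto
 show ?thesis
 proof (rule Bochner_Integration.integrable_bound[of _ "%x. (1 / vp x0) * (h x * vp x)"])
  show "integrable lborel (%x. (1 / vp x0) * (h x * vp x))" by (intro integrable_mult_right h vp)
  have "norm (h x * indicator (box a b) x) <= norm ((1 / vp x0) * (h x * vp x))" for x
  proof (cases "x \<in> box a b")
   case True
   then have x: "x \<in> cbox a b" using box_subset_cbox by auto
   have "\<bar>h x\<bar> * 1 <= \<bar>h x\<bar> * (vp x / vp x0)" using x0(2)[OF x] pos[OF x0(1)] by (intro mult_left_mono) auto
   then show ?thesis using True pos[OF x] pos[OF x0(1)] by (simp add: abs_mult mult_ac)
  qed simp
  then show "AL x. norm (h x * indicator (box a b) x) <= norm ((1 / vp x0) * (h x * vp x))" by simp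
 qed measurable
qed

text \<open>This makes the choice in \<open>grad\<close> harmless: any weak gradient at hand can
  replace it almost everywhere. The fields are only known to be integrable against test functions,
  hence the L^1 form of the fundamental lemma.\<close>

lemma weak_gradient_unique:
 assumes u: "u \<in> borel_measurable lebesgue" and g: "weak_gradient u g" and h: "weak_gradient u h"
 shows "AL x. g x = h x"
proof -
 have gh: "g \<in> borel_measurable lebesgue" "h \<in> borel_measurable lebesgue" using g h by (simp_all add: weak_gradient_def)
 obtain u' g' h' where r: "rep u u'" "rep g g'" "rep h h'" using rep_real[OF u] rep_vec gh by metis
 note wg = g[unfolded weak_gradient_rep[OF r(1,2)]] and wh = h[unfolded weak_gradient_rep[OF r(1,3)]]
 have [measurable]: "BM g'" "BM h'" using r by (simp_all add: rep_def)
 have "AL x. g' x $ i - h' x $ i = 0" for i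
 proof (rule fundamental_lemma_L1)
  have i: "integrable lborel (%x. (g' x $ i - h' x $ i) * vp x)" if "test_fun vp" for vp
   using wg wh that by (simp add: left_diff_distrib)
  then show "integrable lborel (%x. (g' x $ i - h' x $ i) * indicator (box a b) x)" for a b
   by (intro test_integrable_box) auto
  show "(LI x. (g' x $ i - h' x $ i) * vp x) = 0" if "test_fun vp" for vp
  proof -
   have "(LI x. u' x * partial i vp x) = - (LI x. g' x $ i * vp x)" "(LI x. u' x * partial i vp x) = - (LI x. h' x $ i * vp x)"
    using wg wh that by blast+
   then have "(LI x. g' x $ i * vp x) = (LI x. h' x $ i * vp x)" by linarith
   then show ?thesis using wg wh that by (simp add: left_diff_distrib)
  qed
 qed measurable
 then have "AL x. ALL i. g' x $ i - h' x $ i = 0" by (simp add: AE_all_countable)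
 then show ?thesis using rep_AE[OF r(2)] rep_AE[OF r(3)] by eventually_elim (simp add: vec_eq_iff)
qed

lemma wpair_weak_gradient:
 assumes "wpair u g" shows "weak_gradient u g"
proof -
 have "rep u u" "rep g g" using assms by (auto intro: rep_refl)
 then show ?thesis using assms loc2_test_integrable[OF wpair_loc2[OF assms]] loc2_test_integrable(1)[OF wpair_loc2_component[OF assms]]
  by (auto simp: weak_gradient_rep wpair_def)
qed

lemma Vnn_rep: "a > 0 ==> rep u u' ==> Vnn a (%x. (u x)^2) (%x. (u x)^2) = W a (sq u') (sq u')"
proof -
 assume a: "a > 0" and r: "rep u u'"
 have ae: "AL x. sq u x = sq u' x" using rep_AE[OF r] by eventually_elim (simp add: sq_def)
 have "Vnn a (%x. (u x)^2) (%x. (u x)^2) = W a (sq u) (sq u)" using a by (subst Vnn_eq_W) (auto simp: sq_def[abs_def])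
 then show ?thesis using W_cong_AE[OF ae ae] by simp
qed

section \<open>The energy space and its functionals in terms of Borel pairs\<close>

definition Erep :: "real => (R3 => real) => (R3 => real) => (R3 => R3) => bool" where
 "Erep a u u' g \<longleftrightarrow> u \<in> Espace a & X a u' g & rep u u' & rep (grad u) g"

lemma grad_rep:
 assumes u: "rep u u'" and g: "weak_gradient u g0" "rep g0 g" shows "rep (grad u) g"
proof -
 have w: "weak_gradient u (grad u)" unfolding grad_def by (rule someI[where P="weak_gradient u", OF g(1)])
 have "AL x. grad u x = g0 x" by (rule weak_gradient_unique[OF rep_measurable(1)[OF u] w g(1)])
 then have "AL x. grad u x = g x" using rep_AE[OF g(2)] by eventually_elim simp
 then show ?thesis using w g(2) by (simp add: rep_def weak_gradient_def)
qed

lemma X_Erep: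
 assumes a: "a > 0" and u: "X a u g" shows "Erep a u u g"
proof -
 have [measurable]: "BM u" "BM g" using u by auto
 have w: "weak_gradient u g" using u by (intro wpair_weak_gradient) (simp add: X_def)
 have r: "rep u u" "rep g g" by (auto intro: rep_refl)
 have "integrable lborel (%x. \<bar>u x\<bar> ^ 6)"
 proof (rule integrableI_nonneg)
  have "(NE x. \<bar>u x\<bar> ^ 6) <= Csob * (NI x. nsq g x)^3" using Sobolev_X[OF a u] by (simp add: power_even_abs)
  also have "... < \<infinity>" using Csob_finite L2v_nsq[OF X_L2v[OF u]] by (simp add: ennreal_mult_less_top ennreal_power N2_nonneg)
  finally show "(NE x. \<bar>u x\<bar> ^ 6) < \<infinity>" .
 qed auto
 moreover have "integrable lborel (%x. norm (g x) ^ 2)" by (rule L2v_sq_integrable[OF X_L2v[OF u]])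
 ultimately have "integrable lebesgue (%x. \<bar>u x\<bar> ^ 6)" "integrable lebesgue (%x. norm (g x) ^ 2)"
  by (subst integrable_completion; simp)+
 then have "u \<in> Espace a" using w Vnn_rep[OF a r(1)] u r(1) by (auto simp: Espace_def D12_def rep_def X_def)
 then show ?thesis using u r grad_rep[OF r(1) w r(2)] by (simp add: Erep_def)
qed

lemma Espace_Erep:
 assumes a: "a > 0" and u: "u \<in> Espace a"
 obtains u' g where "Erep a u u' g"
proof -
 obtain g0 where um: "u \<in> borel_measurable lebesgue" and u6: "integrable lebesgue (%x. \<bar>u x\<bar> ^ 6)"
  and w: "weak_gradient u g0" and g2: "integrable lebesgue (%x. norm (g0 x) ^ 2)"
  and V: "Vnn a (%x. (u x)^2) (%x. (u x)^2) < \<infinity>" using u by (auto simp: Espace_def D12_def)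
 have gm: "g0 \<in> borel_measurable lebesgue" using w by (simp add: weak_gradient_def)
 obtain u' g where r: "rep u u'" "rep g0 g" using rep_real[OF um] rep_vec[OF gm] by blast
 have [measurable]: "BM u'" "BM g" using r by (simp_all add: rep_def)
 have i6: "integrable lborel (%x. \<bar>u' x\<bar> ^ 6)"
  using u6 um rep_AE[OF r(1)] by (subst lebesgue_transfer(1)[symmetric, of "%x. \<bar>u x\<bar> ^ 6"]) (auto elim: eventually_mono)
 have ig: "integrable lborel (%x. (norm (g x))^2)"
  using g2 gm rep_AE[OF r(2)] by (subst lebesgue_transfer(1)[symmetric, of "%x. (norm (g0 x))^2"]) (auto elim: eventually_mono)
 have l: "loc2 u'" unfolding loc2_iff_bm
 proof (intro conjI allI)
  fix R
  \<comment> \<open>Local square integrability comes from the L^6 condition of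
    \<open>D12\<close>.\<close>
  have le: "y^2 <= 1 + \<bar>y\<bar> ^ 6" for y :: real
  proof (cases "\<bar>y\<bar> <= 1")
   case True
   then have "y^2 <= 1" by (simp add: abs_square_le_1)
   then show ?thesis by (simp add: add_increasing2)
  next
   case False
   then have "\<bar>y\<bar> ^ 2 <= \<bar>y\<bar> ^ 6" by (intro power_increasing) auto
   then show ?thesis by simp
  qed
  have "bm (sq u') 0 R <= (NI x. indicator (ball (0::R3) R) x + ennreal (\<bar>u' x\<bar> ^ 6))" unfolding bm_def
  proof (intro nn_integral_mono)
   show "(if dist 0 x < R then sq u' x else 0) <= indicator (ball 0 R) x + ennreal (\<bar>u' x\<bar> ^ 6)" for x
    using le[of "u' x"] ennreal_leI[OF le[of "u' x"]] by (auto simp: sq_def ennreal_plus indicator_def)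
  qed
  also have "... = emeasure lborel (ball (0::R3) R) + (NE x. \<bar>u' x\<bar> ^ 6)" by (subst nn_integral_add) auto
  also have "... < top" using i6 emeasure_lborel_ball_finite[of "0::R3" R] by (simp add: nn_integral_eq_integral)
  finally show "bm (sq u') 0 R < top" .
 qed measurable
 have "(NE x. (norm (g x))^2) < \<infinity>" using ig by (simp add: nn_integral_eq_integral)
 then have "wpair u' g" using l w[unfolded weak_gradient_rep[OF r]] by (simp add: wpair_def)
 then have "X a u' g" using V Vnn_rep[OF a r(1)] by (simp add: X_def)
 then show ?thesis using that u r grad_rep[OF r(1) w r(2)] by (auto simp: Erep_def)
qed

lemma energy_rep:
 assumes a: "a > 0" and u: "Erep a u u' g" shows "energy a q p u = N2 g / 2 + q^2 * Bf a u' / 4 - Cp p u' / p"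
proof -
 have r: "rep u u'" "rep (grad u) g" "X a u' g" using u by (auto simp: Erep_def)
 note [measurable] = rep_measurable[OF r(1)] rep_measurable[OF r(2)]
 have "(\<integral>x. norm (grad u x) ^ 2 \<partial>lebesgue) = N2 g" unfolding N2_def
  by (rule lebesgue_transfer(2)) (use rep_AE[OF r(2)] in \<open>auto elim: eventually_mono\<close>)
 moreover have "(\<integral>x. \<bar>u x\<bar> powr p \<partial>lebesgue) = Cp p u'" unfolding Cp_def
  by (rule lebesgue_transfer(2)) (use rep_AE[OF r(1)] in \<open>auto elim: eventually_mono\<close>)
 moreover have "V a (%x. (u x)^2) (%x. (u x)^2) = Bf a u'"
  unfolding V_def Vnn_rep[OF a r(1)] X_Bf(1)[OF a r(3)] using X_Bf(2)[OF a r(3)] by simp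
 ultimately show ?thesis unfolding energy_def by simp
qed

lemma phi_integral_rep:
 assumes a: "a > 0" and u: "Erep a u u' g" and v: "Erep a v v' h"
 shows "(\<integral>x. phi a u x * u x * v x \<partial>lebesgue) = Dk a (%x. u' x * v' x) (%x. (u' x)^2)"
proof -
 have r: "rep u u'" "rep v v'" and X: "X a u' g" "X a v' h" using u v by (auto simp: Erep_def)
 note [measurable] = rep_measurable[OF r(1)] rep_measurable[OF r(2)]
 define ph where "ph x = (LI y. kernel a (x - y) * (u' y)^2)" for x
 have [measurable]: "BM ph" unfolding ph_def by measurable
 have ph: "phi a u = ph"
 proof
  fix x
  have [measurable]: "(%y. kernel a (x - y)) \<in> borel_measurable lebesgue" by (rule lebesgueI) measurable
  show "phi a u x = ph x" unfolding phi_def ph_def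
   by (rule lebesgue_transfer(2)) (use rep_AE[OF r(1)] in \<open>auto elim: eventually_mono\<close>)
 qed
 have [measurable]: "ph \<in> borel_measurable lebesgue" by (rule lebesgueI) measurable
 have "(\<integral>x. phi a u x * u x * v x \<partial>lebesgue) = (LI x. ph x * u' x * v' x)" unfolding ph
 proof (rule lebesgue_transfer(2))
  show "AL x. ph x * u x * v x = ph x * u' x * v' x" using rep_AE[OF r(1)] rep_AE[OF r(2)] by eventually_elim simp
 qed measurable
 \<comment> \<open>The factor is moved under the inner integral unconditionally, since a divergent
   inner integral has the value 0 on both sides; integrability over pairs is used only for the next
   equality.\<close>
 also have "... = (LI x. LI y. kernel a (x - y) * (u' x * v' x * (u' y)^2))"
 proof (rule Bochner_Integration.integral_cong[OF refl])
  fix x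
  have "(LI y. kernel a (x - y) * (u' x * v' x * (u' y)^2)) = (LI y. (u' x * v' x) * (kernel a (x - y) * (u' y)^2))"
   by (simp add: mult_ac)
  then show "ph x * u' x * v' x = (LI y. kernel a (x - y) * (u' x * v' x * (u' y)^2))"
   unfolding ph_def by (simp add: mult_ac)
 qed
 also have "... = Dk a (%x. u' x * v' x) (%x. (u' x)^2)"
 proof -
  have "Di a (%x. u' x * v' x) (%x. (u' x)^2)" by (rule Di_quad(1)[OF a X]) (use abs_mult_le_sq in auto)
  then have "integrable lborel2 (%z. kernel a (fst z - snd z) * (u' (fst z) * v' (fst z) * (u' (snd z))^2))"
   by (simp add: Di_def PP_def)
  from lborel_pair.integral_fst'[OF this] show ?thesis by (simp add: Dk_def PP_def)
 qed
 finally show ?thesis .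
qed

lemma weak_solution_rep:
 assumes a: "a > 0" and u: "Erep a u u' g"
 shows "weak_solution a q p u \<longleftrightarrow> (ALL v h. X a v h --> ip g h + q^2 * Dk a (%x. u' x * v x) (%x. (u' x)^2) = Cp' p u' v)"
proof -
 have *: "(\<integral>x. grad u x \<bullet> grad v x \<partial>lebesgue) + q^2 * (\<integral>x. phi a u x * u x * v x \<partial>lebesgue) = (\<integral>x. \<bar>u x\<bar> powr (p - 2) * u x * v x \<partial>lebesgue)
  \<longleftrightarrow> ip g h + q^2 * Dk a (%x. u' x * v' x) (%x. (u' x)^2) = Cp' p u' v'" if v: "Erep a v v' h" for v v' h
 proof -
  have r: "rep u u'" "rep (grad u) g" "rep v v'" "rep (grad v) h" using u v by (auto simp: Erep_def)
  note [measurable] = rep_measurable[OF r(1)] rep_measurable[OF r(2)] rep_measurable[OF r(3)] rep_measurable[OF r(4)]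
  have "(\<integral>x. grad u x \<bullet> grad v x \<partial>lebesgue) = ip g h" unfolding ip_def
  proof (rule lebesgue_transfer(2))
   show "AL x. grad u x \<bullet> grad v x = g x \<bullet> h x" using rep_AE[OF r(2)] rep_AE[OF r(4)] by eventually_elim simp
  qed measurable
  moreover have "(\<integral>x. \<bar>u x\<bar> powr (p - 2) * u x * v x \<partial>lebesgue) = Cp' p u' v'" unfolding Cp'_def
  proof (rule lebesgue_transfer(2))
   show "AL x. \<bar>u x\<bar> powr (p - 2) * u x * v x = \<bar>u' x\<bar> powr (p - 2) * u' x * v' x"
    using rep_AE[OF r(1)] rep_AE[OF r(3)] by eventually_elim simp
  qed measurable
  ultimately show ?thesis by (simp add: phi_integral_rep[OF a u v])
 qed
 have uE: "u \<in> Espace a" using u by (simp add: Erep_def)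
 show ?thesis
 proof
  assume w: "weak_solution a q p u"
  show "ALL v h. X a v h --> ip g h + q^2 * Dk a (%x. u' x * v x) (%x. (u' x)^2) = Cp' p u' v"
  proof (intro allI impI)
   fix v h assume "X a v h"
   then have v: "Erep a v v h" by (rule X_Erep[OF a])
   then have "v \<in> Espace a" by (simp add: Erep_def)
   then show "ip g h + q^2 * Dk a (%x. u' x * v x) (%x. (u' x)^2) = Cp' p u' v" using w *[OF v] by (simp add: weak_solution_def)
  qed
 next
  assume c: "ALL v h. X a v h --> ip g h + q^2 * Dk a (%x. u' x * v x) (%x. (u' x)^2) = Cp' p u' v"
  show "weak_solution a q p u" unfolding weak_solution_def
  proof (intro conjI ballI uE)
   fix v assume "v \<in> Espace a"
   then obtain v' h where v: "Erep a v v' h" using Espace_Erep[OF a] by blast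
   then have "X a v' h" by (simp add: Erep_def)
   then show "(\<integral>x. grad u x \<bullet> grad v x \<partial>lebesgue) + q^2 * (\<integral>x. phi a u x * u x * v x \<partial>lebesgue) = (\<integral>x. \<bar>u x\<bar> powr (p - 2) * u x * v x \<partial>lebesgue)"
    using c *[OF v] by blast
  qed
 qed
qed

text \<open>\<open>P\<close> is either trivial or radiality, and \<open>lift\<close> extends
  criticality from directions with \<open>P\<close> to all directions. A competing weak solution
  satisfies the Nehari identity, by testing with itself, so minimality under that constraint gives
  minimality among solutions.\<close>

lemma ground_state_exists:
 assumes v: "variational a q p (%u g. X a u g & P u)" and P: "!!u u'. rep u u' ==> P u ==> P u'"
  and lift: "!!U G v h. X a U G ==> P U ==>
   (!!v h. X a v h ==> P v ==> ip G h + q^2 * Dk a (%x. U x * v x) (%x. (U x)^2) = Cp' p U v) ==>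
   X a v h ==> ip G h + q^2 * Dk a (%x. U x * v x) (%x. (U x)^2) = Cp' p U v"
 shows "EX u. ground_state_in {u \<in> Espace a. P u} a q p u"
proof -
 interpret variational a q p "%u g. X a u g & P u" by (rule v)
 obtain U G where U': "X a U G & P U" and nt: "~ (AL x. U x = 0)"
  and crit: "!!v h. X a v h & P v ==> ip G h + q^2 * Dk a (%x. U x * v x) (%x. (U x)^2) = Cp' p U v"
  and min: "!!u g. X a u g & P u ==> ~ (AL x. u x = 0) ==> N2 g + q^2 * Bf a u = Cp p u ==> E U G <= E u g"
  by (rule minimizer_exists) (rule that; assumption)
 have U: "X a U G" "P U" using U' by auto
 have EU: "Erep a U U G" by (rule X_Erep[OF a U(1)])
 have sol: "weak_solution a q p U" unfolding weak_solution_rep[OF a EU] using lift[OF U crit] by blast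
 have "energy a q p U <= energy a q p w"
  if w: "w \<in> Espace a" "P w" "nontrivial w" "weak_solution a q p w" for w
 proof -
  obtain w' h where Ew: "Erep a w w' h" using Espace_Erep[OF a w(1)] by blast
  then have r: "rep w w'" "X a w' h" by (auto simp: Erep_def)
  have "~ (AL x. w' x = 0)"
  proof
   assume "AL x. w' x = 0"
   then have "AL x. w x = 0" using rep_AE[OF r(1)] by eventually_elim simp
   then show False using w(3) by (simp add: nontrivial_def AE_completion_iff)
  qed
  moreover have "N2 h + q^2 * Bf a w' = Cp p w'"
   using w(4) r(2) unfolding weak_solution_rep[OF a Ew] by (auto simp: N2_ip Bf_def Cp'_self[symmetric] power2_eq_square)
  ultimately have "E U G <= E w' h" using r(2) P[OF r(1) w(2)] by (intro min) auto
  then show ?thesis unfolding energy_rep[OF a EU] energy_rep[OF a Ew] E_def .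
 qed
 moreover have "nontrivial U" using nt by (simp add: nontrivial_def AE_completion_iff)
 moreover have "U \<in> Espace a" using EU by (simp add: Erep_def)
 ultimately show ?thesis unfolding ground_state_in_def using U(2) sol by blast
qed

theorem theorem1p1:
  fixes a q p :: real
  assumes "a > 0" and "q \<noteq> 0" and "4 < p" and "p < 6"
  shows "(\<exists>u. ground_state_in (Espace a) a q p u) \<and> (\<exists>u. ground_state_in (Espace_r a) a q p u)"
proof
 have "EX u. ground_state_in {u \<in> Espace a. True} a q p u"
  using variational_X[OF assms] by (intro ground_state_exists) auto
 then show "EX u. ground_state_in (Espace a) a q p u" by simp
 have "EX u. ground_state_in {u \<in> Espace a. radial u} a q p u"
 proof (rule ground_state_exists[OF variational_radial[OF assms]])
  show "radial u'" if r: "rep u u'" "radial u" for u u'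
  proof -
   \<comment> \<open>Radiality passes to a function equal almost everywhere, as the limit of a
     constant sequence.\<close>
   have "AL x. (%n::nat. u x) ---> u' x" using rep_AE[OF r(1)] by eventually_elim simp
   then show ?thesis by (rule radial_limit[of "%_. u" u', OF r(2)])
  qed
  fix U G v h assume U: "X a U G" "radial U" and v: "X a v h"
   and c: "!!v h. X a v h ==> radial v ==> ip G h + q^2 * Dk a (%x. U x * v x) (%x. (U x)^2) = Cp' p U v"
  have "radial (avg v)" using v by (intro avg_radial) auto
  from c[OF avg_X[OF assms(1) v] this]
  show "ip G h + q^2 * Dk a (%x. U x * v x) (%x. (U x)^2) = Cp' p U v"
   by (simp add: ip_avgg[OF assms(1) U v] Dk_avg[OF assms(1) U v] Cp'_avg[OF assms(1,3,4) U v])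
 qed
 then show "EX u. ground_state_in (Espace_r a) a q p u" by (simp add: Espace_r_def)
qed

end
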